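(* Let $k$ be an algebraically closed field, let $A$ be a basic connected finite-dimensional $k$-algebra, let $X$ be a finitely generated left $A$-module, and let $B=A[X]$ be the one-point extension algebra of $A$ by $X$. Then $$|\mathrm{s}\tau\text{-}\mathrm{tilt}\,B|\;\geqslant\;2\,|\mathrm{s}\tau\text{-}\mathrm{tilt}\,A|,$$ where $\mathrm{s}\tau\text{-}\mathrm{tilt}\,\Lambda$ denotes the set of isomorphism classes of basic support $\tau$-tilting $\Lambda$-modules.
   Context: For an algebra $\Lambda$, modules are finitely generated left $\Lambda$-modules and $\tau$ is the Auslander–Reiten translation. All algebras considered (including $B$) are assumed basic and connected. For a set $J$, $|J|$ is its cardinality. For a module $M$, $|M|$ is the number of isomorphism classes of indecomposable direct summands of $M$. The one-point extension of $A$ by $X$ is the matrix algebra $B=A[X]=\begin{pmatrix}A&X\\0&k\end{pmatrix}$, with ordinary matrix addition and multiplication induced by the module structure of $X$. A $\Lambda$-module $M$ is $\tau$-rigid if $\operatorname{Hom}_\Lambda(M,\tau M)=0$; it is $\tau$-tilting if it is $\tau$-rigid and $|M|=|\Lambda|$; it is support $\tau$-tilting if it is a $\tau$-tilting $\Lambda/\langle e\rangle$-module for some idempotent $e$ of $\Lambda$ (the zero module is allowed, with $e=1$). *)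

theory Defs
  imports "HOL-Algebra.Algebra" "HOL-Algebra.Algebraic_Closure"
begin

unbundle cardinal_syntax

section \<open>Algebras and their left modules\<close>

text \<open>
  The library locales \<^locale>\<open>module\<close> and \<^locale>\<open>algebra\<close> are restricted to commutative
  rings. The record \<open>('k, 'a) module\<close> however carries exactly the signature of an algebra over a
  ring with elements in \<open>'k\<close>, and also that of a left module over an arbitrary ring; in the
  latter case the fields \<^const>\<open>monoid.mult\<close> and \<^const>\<open>monoid.one\<close> are ignored.
\<close>

locale left_module = R?: ring R + M?: abelian_group M
  for R :: "('a, 'y) ring_scheme" (structure) and M :: "('a, 'm) module" (structure) +
  assumes smult_closed:
      "\<lbrakk>a \<in> carrier R; x \<in> carrier M\<rbrakk> \<Longrightarrow> a \<odot>\<^bsub>M\<^esub> x \<in> carrier M"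
    and smult_l_distr:
      "\<lbrakk>a \<in> carrier R; b \<in> carrier R; x \<in> carrier M\<rbrakk> \<Longrightarrow>
        (a \<oplus> b) \<odot>\<^bsub>M\<^esub> x = a \<odot>\<^bsub>M\<^esub> x \<oplus>\<^bsub>M\<^esub> b \<odot>\<^bsub>M\<^esub> x"
    and smult_r_distr:
      "\<lbrakk>a \<in> carrier R; x \<in> carrier M; y \<in> carrier M\<rbrakk> \<Longrightarrow>
        a \<odot>\<^bsub>M\<^esub> (x \<oplus>\<^bsub>M\<^esub> y) = a \<odot>\<^bsub>M\<^esub> x \<oplus>\<^bsub>M\<^esub> a \<odot>\<^bsub>M\<^esub> y"
    and smult_assoc1:
      "\<lbrakk>a \<in> carrier R; b \<in> carrier R; x \<in> carrier M\<rbrakk> \<Longrightarrow>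
        (a \<otimes> b) \<odot>\<^bsub>M\<^esub> x = a \<odot>\<^bsub>M\<^esub> (b \<odot>\<^bsub>M\<^esub> x)"
    and smult_one:
      "x \<in> carrier M \<Longrightarrow> \<one> \<odot>\<^bsub>M\<^esub> x = x"

definition fin_gen :: "('a, 'y) ring_scheme \<Rightarrow> ('a, 'm) module \<Rightarrow> bool" where
  "fin_gen R M \<longleftrightarrow> (\<exists>S. finite S \<and> S \<subseteq> carrier M \<and>
     (\<forall>x\<in>carrier M. \<exists>c\<in>S \<rightarrow> carrier R. x = (\<Oplus>\<^bsub>M\<^esub>s\<in>S. c s \<odot>\<^bsub>M\<^esub> s)))"

definition fd_algebra :: "'k ring \<Rightarrow> ('k, 'a) module \<Rightarrow> bool" where
  "fd_algebra K L \<longleftrightarrow> field K \<and> module K L \<and> ring L \<and>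
     (\<forall>c\<in>carrier K. \<forall>x\<in>carrier L. \<forall>y\<in>carrier L.
        (c \<odot>\<^bsub>L\<^esub> x) \<otimes>\<^bsub>L\<^esub> y = c \<odot>\<^bsub>L\<^esub> (x \<otimes>\<^bsub>L\<^esub> y) \<and>
        x \<otimes>\<^bsub>L\<^esub> (c \<odot>\<^bsub>L\<^esub> y) = c \<odot>\<^bsub>L\<^esub> (x \<otimes>\<^bsub>L\<^esub> y)) \<and>
     fin_gen K L"

definition regular_module :: "('k, 'a) module \<Rightarrow> ('a, 'a) module" where
  "regular_module L = \<lparr>carrier = carrier L, monoid.mult = monoid.mult L, monoid.one = monoid.one L,
     ring.zero = ring.zero L, ring.add = ring.add L, smult = monoid.mult L\<rparr>"

definition quot_algebra :: "('k, 'a) module \<Rightarrow> 'a set \<Rightarrow> ('k, 'a set) module" where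
  "quot_algebra L I = ring.extend (L Quot I)
     (module.fields (\<lambda>c C. \<Union>x\<in>C. I +>\<^bsub>L\<^esub> (c \<odot>\<^bsub>L\<^esub> x)))"

text \<open>
  Homomorphisms are extensional, so that sets of homomorphisms can serve as carriers of modules.
\<close>

definition mod_hom :: "('a, 'y) ring_scheme \<Rightarrow> ('a, 'm) module \<Rightarrow> ('a, 'n) module \<Rightarrow> ('m \<Rightarrow> 'n) set"
  where "mod_hom R M N = {h \<in> carrier M \<rightarrow>\<^sub>E carrier N.
     (\<forall>x\<in>carrier M. \<forall>y\<in>carrier M. h (x \<oplus>\<^bsub>M\<^esub> y) = h x \<oplus>\<^bsub>N\<^esub> h y) \<and>
     (\<forall>a\<in>carrier R. \<forall>x\<in>carrier M. h (a \<odot>\<^bsub>M\<^esub> x) = a \<odot>\<^bsub>N\<^esub> h x)}"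

definition mod_iso :: "('a, 'y) ring_scheme \<Rightarrow> ('a, 'm) module \<Rightarrow> ('a, 'n) module \<Rightarrow> bool" where
  "mod_iso R M N \<longleftrightarrow> (\<exists>h\<in>mod_hom R M N. bij_betw h (carrier M) (carrier N))"

definition iso_classes :: "('a, 'y) ring_scheme \<Rightarrow> ('a, 'm) module set \<Rightarrow> ('a, 'm) module set set" where
  "iso_classes R S = S // {(M, N) \<in> S \<times> S. mod_iso R M N}"

definition quot_module :: "('a, 'm) module \<Rightarrow> 'm set \<Rightarrow> ('a, 'm set) module" where
  "quot_module M N = \<lparr>carrier = a_rcosets\<^bsub>M\<^esub> N, monoid.mult = \<lambda>_ _. undefined,
     monoid.one = undefined, ring.zero = N, ring.add = set_add M, smult = \<lambda>a C. \<Union>x\<in>C. N +>\<^bsub>M\<^esub> (a \<odot>\<^bsub>M\<^esub> x)\<rparr>"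


section \<open>Direct sum decompositions\<close>

definition complementary ::
    "('a, 'y) ring_scheme \<Rightarrow> ('a, 'm) module \<Rightarrow> 'm set \<Rightarrow> 'm set \<Rightarrow> bool" where
  "complementary R M N N' \<longleftrightarrow> submodule N R M \<and> submodule N' R M \<and>
     N \<inter> N' = {\<zero>\<^bsub>M\<^esub>} \<and> N <+>\<^bsub>M\<^esub> N' = carrier M"

definition indecomposable :: "('a, 'y) ring_scheme \<Rightarrow> ('a, 'm) module \<Rightarrow> bool" where
  "indecomposable R M \<longleftrightarrow> carrier M \<noteq> {\<zero>\<^bsub>M\<^esub>} \<and>
     (\<forall>N N'. complementary R M N N' \<longrightarrow> N = {\<zero>\<^bsub>M\<^esub>} \<or> N' = {\<zero>\<^bsub>M\<^esub>})"

text \<open>The number written \<open>|M|\<close>; in particular \<open>|L|\<close> refers to the regular module.\<close>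

definition num_summands :: "('a, 'y) ring_scheme \<Rightarrow> ('a, 'm) module \<Rightarrow> nat" where
  "num_summands R M = card (iso_classes R
     {M\<lparr>carrier := N\<rparr> | N. (\<exists>N'. complementary R M N N') \<and> indecomposable R (M\<lparr>carrier := N\<rparr>)})"

definition internal_direct_sum ::
    "('a, 'y) ring_scheme \<Rightarrow> ('a, 'm) module \<Rightarrow> 'm set set \<Rightarrow> bool" where
  "internal_direct_sum R M S \<longleftrightarrow> finite S \<and> (\<forall>N\<in>S. submodule N R M) \<and>
     (\<forall>x\<in>carrier M. \<exists>!c. c \<in> (\<Pi>\<^sub>E N\<in>S. N) \<and> x = (\<Oplus>\<^bsub>M\<^esub>N\<in>S. c N))"

definition basic_module :: "('a, 'y) ring_scheme \<Rightarrow> ('a, 'm) module \<Rightarrow> bool" where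
  "basic_module R M \<longleftrightarrow> (\<exists>S. internal_direct_sum R M S \<and>
     (\<forall>N\<in>S. indecomposable R (M\<lparr>carrier := N\<rparr>)) \<and>
     (\<forall>N\<in>S. \<forall>N'\<in>S. mod_iso R (M\<lparr>carrier := N\<rparr>) (M\<lparr>carrier := N'\<rparr>) \<longrightarrow> N = N'))"

definition basic_algebra :: "('k, 'a) module \<Rightarrow> bool" where
  "basic_algebra L \<longleftrightarrow> basic_module L (regular_module L)"

text \<open>
  Connected: nonzero and not a direct product of two nonzero algebras, the direct product being
  taken internally, as a direct sum of two-sided ideals.
\<close>

definition connected_algebra :: "('k, 'a) module \<Rightarrow> bool" where
  "connected_algebra L \<longleftrightarrow> carrier L \<noteq> {\<zero>\<^bsub>L\<^esub>} \<and>
     (\<forall>I J. ideal I L \<and> ideal J L \<and> I \<inter> J = {\<zero>\<^bsub>L\<^esub>} \<and> I <+>\<^bsub>L\<^esub> J = carrier L \<longrightarrow>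
        I = {\<zero>\<^bsub>L\<^esub>} \<or> J = {\<zero>\<^bsub>L\<^esub>})"


section \<open>The category of finitely generated modules\<close>

text \<open>
  A finitely generated module over a finite-dimensional algebra is finite-dimensional over the
  ground field, so up to isomorphism its elements are coordinate vectors. The type
  \<open>nat \<Rightarrow> 'k\<close> therefore contains the carrier of an isomorphic copy of every such module,
  and quantifying over modules with carrier in this type loses nothing.
\<close>

type_synonym ('k, 'a) fdmod = "('a, nat \<Rightarrow> 'k) module"

definition fgmod :: "('k, 'a) module \<Rightarrow> ('k, 'a) fdmod set" where
  "fgmod L = {M. left_module L M \<and> fin_gen L M}"

definition projective :: "('k, 'a) module \<Rightarrow> ('k, 'a) fdmod \<Rightarrow> bool" where
  "projective L P \<longleftrightarrow> P \<in> fgmod L \<and>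
     (\<forall>M\<in>fgmod L. \<forall>N\<in>fgmod L. \<forall>g\<in>mod_hom L M N. \<forall>f\<in>mod_hom L P N.
        g ` carrier M = carrier N \<longrightarrow> (\<exists>h\<in>mod_hom L P M. \<forall>x\<in>carrier P. g (h x) = f x))"

definition superfluous :: "('k, 'a) module \<Rightarrow> ('k, 'a) fdmod \<Rightarrow> (nat \<Rightarrow> 'k) set \<Rightarrow> bool" where
  "superfluous L M U \<longleftrightarrow> submodule U L M \<and>
     (\<forall>N. submodule N L M \<and> U <+>\<^bsub>M\<^esub> N = carrier M \<longrightarrow> N = carrier M)"

definition projective_cover ::
    "('k, 'a) module \<Rightarrow> ('k, 'a) fdmod \<Rightarrow> ((nat \<Rightarrow> 'k) \<Rightarrow> (nat \<Rightarrow> 'k)) \<Rightarrow> ('k, 'a) fdmod \<Rightarrow> bool" where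
  "projective_cover L P g M \<longleftrightarrow> projective L P \<and> g \<in> mod_hom L P M \<and>
     g ` carrier P = carrier M \<and> superfluous L P (a_kernel P M g)"

text \<open>Minimal projective presentations \<open>P1 \<rightarrow> P0 \<rightarrow> M \<rightarrow> 0\<close>, with maps \<open>f\<close> and \<open>g\<close>.\<close>

definition min_proj_presentation ::
    "('k, 'a) module \<Rightarrow> ('k, 'a) fdmod \<Rightarrow> ('k, 'a) fdmod \<Rightarrow> ((nat \<Rightarrow> 'k) \<Rightarrow> (nat \<Rightarrow> 'k)) \<Rightarrow>
     ('k, 'a) fdmod \<Rightarrow> ((nat \<Rightarrow> 'k) \<Rightarrow> (nat \<Rightarrow> 'k)) \<Rightarrow> bool" where
  "min_proj_presentation L M P1 f P0 g \<longleftrightarrow>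
     projective_cover L P0 g M \<and> projective_cover L P1 f (P0\<lparr>carrier := a_kernel P0 M g\<rparr>)"


section \<open>The Auslander--Reiten translation\<close>

text \<open>
  The right module \<open>Hom(P, L)\<close> of a left module \<open>P\<close>. For this right module, and for the transpose
  below, the field \<^const>\<open>smult\<close> is the right action: \<open>a \<odot> h\<close> stands for \<open>h a\<close>.
\<close>

definition hom_to_algebra :: "('k, 'a) module \<Rightarrow> ('a, 'm) module \<Rightarrow> ('a, 'm \<Rightarrow> 'a) module" where
  "hom_to_algebra L P = \<lparr>carrier = mod_hom L P (regular_module L),
     monoid.mult = \<lambda>_ _. undefined, monoid.one = undefined,
     ring.zero = (\<lambda>x\<in>carrier P. \<zero>\<^bsub>L\<^esub>),
     ring.add = \<lambda>h h'. \<lambda>x\<in>carrier P. h x \<oplus>\<^bsub>L\<^esub> h' x,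
     smult = \<lambda>a h. \<lambda>x\<in>carrier P. h x \<otimes>\<^bsub>L\<^esub> a\<rparr>"

text \<open>
  The transpose: the cokernel of \<open>Hom(f, L) : Hom(P0, L) \<rightarrow> Hom(P1, L)\<close>, a right module.
\<close>

definition transpose_of ::
    "('k, 'a) module \<Rightarrow> ('a, 'm) module \<Rightarrow> ('m \<Rightarrow> 'm) \<Rightarrow> ('a, 'm) module \<Rightarrow> ('a, ('m \<Rightarrow> 'a) set) module"
  where
  "transpose_of L P1 f P0 = quot_module (hom_to_algebra L P1)
     ((\<lambda>h. \<lambda>x\<in>carrier P1. h (f x)) ` carrier (hom_to_algebra L P0))"

text \<open>
  The standard duality \<open>Hom\<^sub>K(-, K)\<close>, from right to left \<open>L\<close>-modules. A scalar \<open>c\<close> of the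
  ground field acts on a module through \<open>c \<odot> \<one>\<close>.
\<close>

definition k_dual :: "'k ring \<Rightarrow> ('k, 'a) module \<Rightarrow> ('a, 'm) module \<Rightarrow> ('a, 'm \<Rightarrow> 'k) module" where
  "k_dual K L N = \<lparr>carrier = {\<phi> \<in> carrier N \<rightarrow>\<^sub>E carrier K.
       (\<forall>x\<in>carrier N. \<forall>y\<in>carrier N. \<phi> (x \<oplus>\<^bsub>N\<^esub> y) = \<phi> x \<oplus>\<^bsub>K\<^esub> \<phi> y) \<and>
       (\<forall>c\<in>carrier K. \<forall>x\<in>carrier N. \<phi> ((c \<odot>\<^bsub>L\<^esub> \<one>\<^bsub>L\<^esub>) \<odot>\<^bsub>N\<^esub> x) = c \<otimes>\<^bsub>K\<^esub> \<phi> x)},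
     monoid.mult = \<lambda>_ _. undefined, monoid.one = undefined,
     ring.zero = (\<lambda>x\<in>carrier N. \<zero>\<^bsub>K\<^esub>),
     ring.add = \<lambda>\<phi> \<psi>. \<lambda>x\<in>carrier N. \<phi> x \<oplus>\<^bsub>K\<^esub> \<psi> x,
     smult = \<lambda>a \<phi>. \<lambda>x\<in>carrier N. \<phi> (a \<odot>\<^bsub>N\<^esub> x)\<rparr>"

text \<open>
  The translate is defined only up to isomorphism, so any choice of a minimal projective
  presentation will do; one exists for each module in \<^const>\<open>fgmod\<close>.
\<close>

definition AR_translate ::
    "'k ring \<Rightarrow> ('k, 'a) module \<Rightarrow> ('k, 'a) fdmod \<Rightarrow> ('a, ((nat \<Rightarrow> 'k) \<Rightarrow> 'a) set \<Rightarrow> 'k) module" where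
  "AR_translate K L M =
     (case SOME (P1, f, P0). \<exists>g. min_proj_presentation L M P1 f P0 g of
        (P1, f, P0) \<Rightarrow> k_dual K L (transpose_of L P1 f P0))"


section \<open>Support \<open>\<tau>\<close>-tilting modules\<close>

definition tau_rigid :: "'k ring \<Rightarrow> ('k, 'a) module \<Rightarrow> ('k, 'a) fdmod \<Rightarrow> bool" where
  "tau_rigid K L M \<longleftrightarrow> M \<in> fgmod L \<and>
     mod_hom L M (AR_translate K L M) = {\<lambda>x\<in>carrier M. \<zero>\<^bsub>AR_translate K L M\<^esub>}"

definition tau_tilting :: "'k ring \<Rightarrow> ('k, 'a) module \<Rightarrow> ('k, 'a) fdmod \<Rightarrow> bool" where
  "tau_tilting K L M \<longleftrightarrow> tau_rigid K L M \<and> num_summands L M = num_summands L (regular_module L)"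

text \<open>Restriction of scalars along the projection from \<open>L\<close> to its quotient by \<open>I\<close>.\<close>

definition inflate :: "('k, 'a) module \<Rightarrow> 'a set \<Rightarrow> ('a set, 'm) module \<Rightarrow> ('a, 'm) module" where
  "inflate L I N = \<lparr>carrier = carrier N, monoid.mult = monoid.mult N, monoid.one = monoid.one N,
     ring.zero = ring.zero N, ring.add = ring.add N,
     smult = \<lambda>a x. (I +>\<^bsub>L\<^esub> a) \<odot>\<^bsub>N\<^esub> x\<rparr>"

definition support_tau_tilting :: "'k ring \<Rightarrow> ('k, 'a) module \<Rightarrow> ('k, 'a) fdmod \<Rightarrow> bool" where
  "support_tau_tilting K L M \<longleftrightarrow> M \<in> fgmod L \<and>
     (\<exists>e\<in>carrier L. e \<otimes>\<^bsub>L\<^esub> e = e \<and>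
        (\<exists>N. tau_tilting K (quot_algebra L (Idl\<^bsub>L\<^esub> {e})) N \<and>
             mod_iso L M (inflate L (Idl\<^bsub>L\<^esub> {e}) N)))"

definition stau_tilt :: "'k ring \<Rightarrow> ('k, 'a) module \<Rightarrow> ('k, 'a) fdmod set set" where
  "stau_tilt K L = iso_classes L {M. basic_module L M \<and> support_tau_tilting K L M}"


section \<open>One-point extensions\<close>

text \<open>
  The triple \<open>(a, x, c)\<close> stands for the matrix with rows \<open>(a, x)\<close> and \<open>(0, c)\<close>. In a product
  the upper right entry is \<open>a x' + x c'\<close>, where \<open>c'\<close> acts on \<open>M\<close> through \<open>c' \<odot> \<one>\<close>.
\<close>

definition one_point_extension ::
    "'k ring \<Rightarrow> ('k, 'a) module \<Rightarrow> ('a, 'm) module \<Rightarrow> ('k, 'a \<times> 'm \<times> 'k) module" where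
  "one_point_extension K A M = \<lparr>carrier = carrier A \<times> carrier M \<times> carrier K,
     monoid.mult = \<lambda>(a, x, c) (a', x', c').
       (a \<otimes>\<^bsub>A\<^esub> a', a \<odot>\<^bsub>M\<^esub> x' \<oplus>\<^bsub>M\<^esub> (c' \<odot>\<^bsub>A\<^esub> \<one>\<^bsub>A\<^esub>) \<odot>\<^bsub>M\<^esub> x, c \<otimes>\<^bsub>K\<^esub> c'),
     monoid.one = (\<one>\<^bsub>A\<^esub>, \<zero>\<^bsub>M\<^esub>, \<one>\<^bsub>K\<^esub>),
     ring.zero = (\<zero>\<^bsub>A\<^esub>, \<zero>\<^bsub>M\<^esub>, \<zero>\<^bsub>K\<^esub>),
     ring.add = \<lambda>(a, x, c) (a', x', c'). (a \<oplus>\<^bsub>A\<^esub> a', x \<oplus>\<^bsub>M\<^esub> x', c \<oplus>\<^bsub>K\<^esub> c'),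
     smult = \<lambda>t (a, x, c). (t \<odot>\<^bsub>A\<^esub> a, (t \<odot>\<^bsub>A\<^esub> \<one>\<^bsub>A\<^esub>) \<odot>\<^bsub>M\<^esub> x, t \<otimes>\<^bsub>K\<^esub> c)\<rparr>"

end

(*
  A module M is tau-rigid iff it is Ext-projective in Gen M: a map from M to a quotient Z of E
  lifts to E whenever the kernel of E -> Z is generated by M. This follows from the duality between
  Hom(M, D Tr M) and the cokernel of Hom(P0, M) -> Hom(P1, M), for a minimal projective presentation
  P1 -> P0 -> M. In this form tau-rigidity is easily compared along surjections of algebras.

  Let eps = (0, 0, 1) be the new idempotent of B and let T be support tau-tilting over A, a
  tau-tilting A/<e>-module. Then T is also tau-tilting over B/<(e, 0, 1)>, as A/<e> = B/<(e, 0, 1)>.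
  Over B/<(e, 0, 0)> there is one simple module more. The modules Q for which the submodule {q. eps q = 0} is in
  Gen T form a torsion class there. The projective at the new vertex maps to an Ext-projective object N of it:
  finitely many pushouts along universal maps into powers of T move the old part of the projective
  into the trace of T. An indecomposable summand N1 of N with eps N1 nonzero gives the
  tau-tilting B/<(e, 0, 0)>-module T + N1.

  The classes of T and T + N1 are distinct, since eps annihilates only the former, and N1 can be
  cancelled from an isomorphism between T + N1 and T' + N1' because eps acts as zero on T and T'.
*)
theory Submission
  imports Defs
begin

section \<open>Linear maps and submodules\<close>

text \<open>The obstacle is that \<open>AR_translate\<close> is built from a projective
  presentation, and projectives change with the ring. Lifting against short exact sequences mentions
  none, so one and the same test runs over A, over B and over their quotients.

  The pushouts imitate Bongartz completion. In the projective P at the new vertex the part killed by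
  eps need not lie in Gen T. Copies of T are glued to P along a single element, chosen so that every
  element of a trace of T is its image under some homomorphism. This puts one more element of P into
  the trace and keeps Ext-projectivity; finitely many generators suffice. The generator of P
  survives because eps kills whatever is divided out.

  The count works because eps B eps = k eps: the regular module of the quotient by (e, 0, 0) gains
  exactly one indecomposable summand, and an element of N killed by eps comes from an element of P
  killed by eps, up to the trace. Isomorphism classes of summands are counted through Krull-Schmidt
  exchange, which is derived from Fitting's lemma.

  The sets of classes may be infinite, so the bound is an injection of two copies of one set into
  the other.\<close>

definition lin :: "('a, 'y) ring_scheme \<Rightarrow> ('a, 'm) module \<Rightarrow> ('a, 'n) module \<Rightarrow> ('m \<Rightarrow> 'n) \<Rightarrow> bool" where
  "lin R M N f \<longleftrightarrow> f \<in> carrier M \<rightarrow> carrier N \<and>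
     (\<forall>x\<in>carrier M. \<forall>y\<in>carrier M. f (x \<oplus>\<^bsub>M\<^esub> y) = f x \<oplus>\<^bsub>N\<^esub> f y) \<and>
     (\<forall>a\<in>carrier R. \<forall>x\<in>carrier M. f (a \<odot>\<^bsub>M\<^esub> x) = a \<odot>\<^bsub>N\<^esub> f x)"

abbreviation lker :: "('a, 'm) module \<Rightarrow> ('a, 'n) module \<Rightarrow> ('m \<Rightarrow> 'n) \<Rightarrow> 'm set" where
  "lker M N f \<equiv> {x \<in> carrier M. f x = \<zero>\<^bsub>N\<^esub>}"

lemma linI:
  assumes "\<And>x. x \<in> carrier M \<Longrightarrow> f x \<in> carrier N"
    and "\<And>x y. x \<in> carrier M \<Longrightarrow> y \<in> carrier M \<Longrightarrow> f (x \<oplus>\<^bsub>M\<^esub> y) = f x \<oplus>\<^bsub>N\<^esub> f y"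
    and "\<And>a x. a \<in> carrier R \<Longrightarrow> x \<in> carrier M \<Longrightarrow> f (a \<odot>\<^bsub>M\<^esub> x) = a \<odot>\<^bsub>N\<^esub> f x"
  shows "lin R M N f"
  using assms by (auto simp: lin_def)

lemma lin_closed: "lin R M N f \<Longrightarrow> x \<in> carrier M \<Longrightarrow> f x \<in> carrier N"
  and lin_add: "lin R M N f \<Longrightarrow> x \<in> carrier M \<Longrightarrow> y \<in> carrier M \<Longrightarrow> f (x \<oplus>\<^bsub>M\<^esub> y) = f x \<oplus>\<^bsub>N\<^esub> f y"
  and lin_smult: "lin R M N f \<Longrightarrow> a \<in> carrier R \<Longrightarrow> x \<in> carrier M \<Longrightarrow> f (a \<odot>\<^bsub>M\<^esub> x) = a \<odot>\<^bsub>N\<^esub> f x"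
  by (auto simp: lin_def)

context left_module begin

declare smult_closed [simp, intro] smult_one [simp]

lemma smult_l_null [simp]:
  assumes "x \<in> carrier M" shows "\<zero> \<odot>\<^bsub>M\<^esub> x = \<zero>\<^bsub>M\<^esub>"
proof -
  have "\<zero> \<odot>\<^bsub>M\<^esub> x \<oplus>\<^bsub>M\<^esub> \<zero> \<odot>\<^bsub>M\<^esub> x = \<zero> \<odot>\<^bsub>M\<^esub> x"
    using smult_l_distr[of \<zero> \<zero> x] assms by simp
  then show ?thesis using assms by (metis M.add.l_cancel_one' R.zero_closed smult_closed)
qed

lemma smult_r_null [simp]:
  assumes "a \<in> carrier R" shows "a \<odot>\<^bsub>M\<^esub> \<zero>\<^bsub>M\<^esub> = \<zero>\<^bsub>M\<^esub>"
proof -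
  have "a \<odot>\<^bsub>M\<^esub> \<zero>\<^bsub>M\<^esub> \<oplus>\<^bsub>M\<^esub> a \<odot>\<^bsub>M\<^esub> \<zero>\<^bsub>M\<^esub> = a \<odot>\<^bsub>M\<^esub> \<zero>\<^bsub>M\<^esub>"
    using smult_r_distr[of a "\<zero>\<^bsub>M\<^esub>" "\<zero>\<^bsub>M\<^esub>"] assms by simp
  then show ?thesis using assms by (metis M.add.l_cancel_one' M.zero_closed smult_closed)
qed

lemma smult_l_minus:
  assumes "a \<in> carrier R" "x \<in> carrier M" shows "(\<ominus> a) \<odot>\<^bsub>M\<^esub> x = \<ominus>\<^bsub>M\<^esub> (a \<odot>\<^bsub>M\<^esub> x)"
proof -
  have "(\<ominus> a) \<odot>\<^bsub>M\<^esub> x \<oplus>\<^bsub>M\<^esub> a \<odot>\<^bsub>M\<^esub> x = \<zero>\<^bsub>M\<^esub>"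
    using smult_l_distr[of "\<ominus> a" a x] assms by (simp add: R.l_neg)
  then show ?thesis using assms by (metis M.minus_equality R.a_inv_closed smult_closed)
qed

lemma smult_r_minus:
  assumes "a \<in> carrier R" "x \<in> carrier M" shows "a \<odot>\<^bsub>M\<^esub> (\<ominus>\<^bsub>M\<^esub> x) = \<ominus>\<^bsub>M\<^esub> (a \<odot>\<^bsub>M\<^esub> x)"
proof -
  have "a \<odot>\<^bsub>M\<^esub> (\<ominus>\<^bsub>M\<^esub> x) \<oplus>\<^bsub>M\<^esub> a \<odot>\<^bsub>M\<^esub> x = \<zero>\<^bsub>M\<^esub>"
    using smult_r_distr[of a "\<ominus>\<^bsub>M\<^esub> x" x] assms by (simp add: M.l_neg)
  then show ?thesis using assms by (metis M.minus_equality M.a_inv_closed smult_closed)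
qed

lemma smult_r_diff:
  assumes "a \<in> carrier R" "x \<in> carrier M" "y \<in> carrier M"
  shows "a \<odot>\<^bsub>M\<^esub> (x \<ominus>\<^bsub>M\<^esub> y) = a \<odot>\<^bsub>M\<^esub> x \<ominus>\<^bsub>M\<^esub> a \<odot>\<^bsub>M\<^esub> y"
  using assms by (simp add: M.minus_eq smult_r_distr smult_r_minus)

lemma smult_l_diff:
  assumes "a \<in> carrier R" "b \<in> carrier R" "x \<in> carrier M"
  shows "(a \<ominus> b) \<odot>\<^bsub>M\<^esub> x = a \<odot>\<^bsub>M\<^esub> x \<ominus>\<^bsub>M\<^esub> b \<odot>\<^bsub>M\<^esub> x"
  using assms by (simp add: M.minus_eq R.minus_eq smult_l_distr smult_l_minus)

lemma diff_eq_iff: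
  assumes "x \<in> carrier M" "y \<in> carrier M" "z \<in> carrier M"
  shows "x \<ominus>\<^bsub>M\<^esub> y = z \<longleftrightarrow> x = z \<oplus>\<^bsub>M\<^esub> y"
  using assms by (metis M.a_assoc M.a_inv_closed M.l_neg M.minus_eq M.r_neg M.r_zero)

lemma diff_self [simp]: "x \<in> carrier M \<Longrightarrow> x \<ominus>\<^bsub>M\<^esub> x = \<zero>\<^bsub>M\<^esub>"
  and diff_zero_iff [simp]: "x \<in> carrier M \<Longrightarrow> y \<in> carrier M \<Longrightarrow> x \<ominus>\<^bsub>M\<^esub> y = \<zero>\<^bsub>M\<^esub> \<longleftrightarrow> x = y"
  and diff_add_cancel [simp]: "x \<in> carrier M \<Longrightarrow> y \<in> carrier M \<Longrightarrow> x \<ominus>\<^bsub>M\<^esub> y \<oplus>\<^bsub>M\<^esub> y = x"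
  and add_diff_cancel [simp]: "x \<in> carrier M \<Longrightarrow> y \<in> carrier M \<Longrightarrow> x \<oplus>\<^bsub>M\<^esub> y \<ominus>\<^bsub>M\<^esub> y = x"
  and diff_zero [simp]: "x \<in> carrier M \<Longrightarrow> x \<ominus>\<^bsub>M\<^esub> \<zero>\<^bsub>M\<^esub> = x"
  and add_diff_same [simp]: "x \<in> carrier M \<Longrightarrow> y \<in> carrier M \<Longrightarrow> y \<oplus>\<^bsub>M\<^esub> (x \<ominus>\<^bsub>M\<^esub> y) = x"
proof -
  show "x \<in> carrier M \<Longrightarrow> x \<ominus>\<^bsub>M\<^esub> x = \<zero>\<^bsub>M\<^esub>" by (simp add: M.minus_eq M.r_neg)
  show "x \<in> carrier M \<Longrightarrow> y \<in> carrier M \<Longrightarrow> x \<ominus>\<^bsub>M\<^esub> y = \<zero>\<^bsub>M\<^esub> \<longleftrightarrow> x = y" by (simp add: diff_eq_iff)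
  show "x \<in> carrier M \<Longrightarrow> y \<in> carrier M \<Longrightarrow> x \<ominus>\<^bsub>M\<^esub> y \<oplus>\<^bsub>M\<^esub> y = x"
    using diff_eq_iff[of x y "x \<ominus>\<^bsub>M\<^esub> y"] by simp
  then show "x \<in> carrier M \<Longrightarrow> y \<in> carrier M \<Longrightarrow> y \<oplus>\<^bsub>M\<^esub> (x \<ominus>\<^bsub>M\<^esub> y) = x" by (simp add: M.a_comm)
  show "x \<in> carrier M \<Longrightarrow> y \<in> carrier M \<Longrightarrow> x \<oplus>\<^bsub>M\<^esub> y \<ominus>\<^bsub>M\<^esub> y = x" by (simp add: diff_eq_iff)
  show "x \<in> carrier M \<Longrightarrow> x \<ominus>\<^bsub>M\<^esub> \<zero>\<^bsub>M\<^esub> = x" by (simp add: diff_eq_iff)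
qed

lemma diff_add_diff:
  assumes "x \<in> carrier M" "y \<in> carrier M" "z \<in> carrier M"
  shows "(x \<ominus>\<^bsub>M\<^esub> y) \<oplus>\<^bsub>M\<^esub> (y \<ominus>\<^bsub>M\<^esub> z) = x \<ominus>\<^bsub>M\<^esub> z"
proof -
  have "(x \<ominus>\<^bsub>M\<^esub> y) \<oplus>\<^bsub>M\<^esub> (y \<ominus>\<^bsub>M\<^esub> z) = (x \<ominus>\<^bsub>M\<^esub> y \<oplus>\<^bsub>M\<^esub> y) \<ominus>\<^bsub>M\<^esub> z"
    using assms by (simp add: M.minus_eq M.a_assoc)
  then show ?thesis using assms by simp
qed

lemma diff_diff_left:
  assumes "x \<in> carrier M" "y \<in> carrier M" "z \<in> carrier M"
  shows "(x \<ominus>\<^bsub>M\<^esub> y) \<ominus>\<^bsub>M\<^esub> (x \<ominus>\<^bsub>M\<^esub> z) = z \<ominus>\<^bsub>M\<^esub> y"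
  using diff_add_diff[of x z y] assms M.a_comm[of "x \<ominus>\<^bsub>M\<^esub> z" "z \<ominus>\<^bsub>M\<^esub> y"] diff_eq_iff[of "x \<ominus>\<^bsub>M\<^esub> y"] by simp

lemma diff_diff_right:
  assumes "x \<in> carrier M" "y \<in> carrier M" "z \<in> carrier M"
  shows "(x \<ominus>\<^bsub>M\<^esub> z) \<ominus>\<^bsub>M\<^esub> (y \<ominus>\<^bsub>M\<^esub> z) = x \<ominus>\<^bsub>M\<^esub> y"
  using diff_add_diff[of x y z] assms by (simp add: diff_eq_iff)

lemma neg_eq_smult: "x \<in> carrier M \<Longrightarrow> \<ominus>\<^bsub>M\<^esub> x = (\<ominus> \<one>) \<odot>\<^bsub>M\<^esub> x"
  by (simp add: smult_l_minus)

lemma submoduleI: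
  assumes "H \<subseteq> carrier M" "\<zero>\<^bsub>M\<^esub> \<in> H" "\<And>x y. x \<in> H \<Longrightarrow> y \<in> H \<Longrightarrow> x \<oplus>\<^bsub>M\<^esub> y \<in> H"
    and "\<And>a x. a \<in> carrier R \<Longrightarrow> x \<in> H \<Longrightarrow> a \<odot>\<^bsub>M\<^esub> x \<in> H"
  shows "submodule H R M"
proof -
  have "subgroup H (add_monoid M)"
  proof (rule subgroup.intro)
    fix x assume "x \<in> H"
    then have "\<ominus>\<^bsub>M\<^esub> x \<in> H" using assms neg_eq_smult[of x] by (auto simp: subset_iff)
    then show "inv\<^bsub>add_monoid M\<^esub> x \<in> H" by (simp add: a_inv_def)
  qed (use assms in auto)
  then show ?thesis using assms(4) by (simp add: submodule_def submodule_axioms_def)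
qed

lemma sub_subset: "submodule H R M \<Longrightarrow> H \<subseteq> carrier M"
  and sub_mem: "submodule H R M \<Longrightarrow> x \<in> H \<Longrightarrow> x \<in> carrier M"
  and sub_zero: "submodule H R M \<Longrightarrow> \<zero>\<^bsub>M\<^esub> \<in> H"
  and sub_add: "submodule H R M \<Longrightarrow> x \<in> H \<Longrightarrow> y \<in> H \<Longrightarrow> x \<oplus>\<^bsub>M\<^esub> y \<in> H"
  and sub_neg: "submodule H R M \<Longrightarrow> x \<in> H \<Longrightarrow> \<ominus>\<^bsub>M\<^esub> x \<in> H"
  and sub_smult: "submodule H R M \<Longrightarrow> a \<in> carrier R \<Longrightarrow> x \<in> H \<Longrightarrow> a \<odot>\<^bsub>M\<^esub> x \<in> H"
proof -
  assume H: "submodule H R M"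
  then have s: "subgroup H (add_monoid M)" by (simp add: submodule_def)
  show sub: "H \<subseteq> carrier M" using subgroup.subset[OF s] by simp
  show "x \<in> H \<Longrightarrow> x \<in> carrier M" using sub by auto
  show "\<zero>\<^bsub>M\<^esub> \<in> H" using subgroup.one_closed[OF s] by simp
  show "x \<in> H \<Longrightarrow> y \<in> H \<Longrightarrow> x \<oplus>\<^bsub>M\<^esub> y \<in> H" using subgroup.m_closed[OF s] by simp
  show "x \<in> H \<Longrightarrow> \<ominus>\<^bsub>M\<^esub> x \<in> H" using subgroup.m_inv_closed[OF s] by (simp add: a_inv_def)
  show "a \<in> carrier R \<Longrightarrow> x \<in> H \<Longrightarrow> a \<odot>\<^bsub>M\<^esub> x \<in> H" using submodule.smult_closed[OF H] .
qed

lemma sub_diff: "submodule H R M \<Longrightarrow> x \<in> H \<Longrightarrow> y \<in> H \<Longrightarrow> x \<ominus>\<^bsub>M\<^esub> y \<in> H"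
  by (simp add: M.minus_eq sub_add sub_neg)

lemma sub_module:
  assumes "submodule H R M" shows "left_module R (M\<lparr>carrier := H\<rparr>)"
proof -
  note s = sub_subset[OF assms] and mem = sub_mem[OF assms]
  have "abelian_group (M\<lparr>carrier := H\<rparr>)"
  proof (rule abelian_groupI)
    fix x assume "x \<in> carrier (M\<lparr>carrier := H\<rparr>)"
    then show "\<exists>y\<in>carrier (M\<lparr>carrier := H\<rparr>). y \<oplus>\<^bsub>M\<lparr>carrier := H\<rparr>\<^esub> x = \<zero>\<^bsub>M\<lparr>carrier := H\<rparr>\<^esub>"
      using assms mem by (auto intro!: bexI[of _ "\<ominus>\<^bsub>M\<^esub> x"] sub_neg simp: M.l_neg)
  qed (use assms in \<open>auto simp: sub_zero sub_add mem M.a_ac\<close>)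
  then show ?thesis
    by (intro left_module.intro left_module_axioms.intro R.ring_axioms)
      (use assms in \<open>auto intro: sub_smult smult_l_distr smult_r_distr smult_assoc1 mem smult_one\<close>)
qed

lemma carrier_submodule: "submodule (carrier M) R M"
  by (rule submoduleI) auto

lemma zero_submodule: "submodule {\<zero>\<^bsub>M\<^esub>} R M"
  by (rule submoduleI) auto

lemma inter_submodule: "submodule H R M \<Longrightarrow> submodule H' R M \<Longrightarrow> submodule (H \<inter> H') R M"
  by (rule submoduleI) (auto intro: sub_mem sub_zero sub_add sub_smult)

lemma sum_submodule:
  assumes "submodule H R M" "submodule H' R M"
  shows "submodule {x \<oplus>\<^bsub>M\<^esub> y | x y. x \<in> H \<and> y \<in> H'} R M"
proof (rule submoduleI)
  note mem = sub_mem[OF assms(1)] sub_mem[OF assms(2)]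
  show "{x \<oplus>\<^bsub>M\<^esub> y | x y. x \<in> H \<and> y \<in> H'} \<subseteq> carrier M" by (auto intro: mem)
  show "\<zero>\<^bsub>M\<^esub> \<in> {x \<oplus>\<^bsub>M\<^esub> y | x y. x \<in> H \<and> y \<in> H'}"
    using assms by (auto intro!: exI[of _ "\<zero>\<^bsub>M\<^esub>"] sub_zero)
  fix u v assume "u \<in> {x \<oplus>\<^bsub>M\<^esub> y | x y. x \<in> H \<and> y \<in> H'}" "v \<in> {x \<oplus>\<^bsub>M\<^esub> y | x y. x \<in> H \<and> y \<in> H'}"
  then obtain x y x' y' where *: "u = x \<oplus>\<^bsub>M\<^esub> y" "v = x' \<oplus>\<^bsub>M\<^esub> y'" "x \<in> H" "x' \<in> H" "y \<in> H'" "y' \<in> H'" by auto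
  have "u \<oplus>\<^bsub>M\<^esub> v = (x \<oplus>\<^bsub>M\<^esub> x') \<oplus>\<^bsub>M\<^esub> (y \<oplus>\<^bsub>M\<^esub> y')" using * mem by (simp add: M.a_ac)
  then show "u \<oplus>\<^bsub>M\<^esub> v \<in> {x \<oplus>\<^bsub>M\<^esub> y | x y. x \<in> H \<and> y \<in> H'}"
    using * assms by (blast intro: sub_add)
next
  fix a u assume "a \<in> carrier R" "u \<in> {x \<oplus>\<^bsub>M\<^esub> y | x y. x \<in> H \<and> y \<in> H'}"
  then show "a \<odot>\<^bsub>M\<^esub> u \<in> {x \<oplus>\<^bsub>M\<^esub> y | x y. x \<in> H \<and> y \<in> H'}"
    using assms by (force simp: smult_r_distr sub_mem intro: sub_smult)
qed

lemma sub_sub: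
  assumes "submodule H R M"
  shows "submodule U R (M\<lparr>carrier := H\<rparr>) \<longleftrightarrow> U \<subseteq> H \<and> submodule U R M"
proof -
  interpret H: left_module R "M\<lparr>carrier := H\<rparr>" by (rule sub_module[OF assms])
  show ?thesis
  proof safe
    assume U: "submodule U R (M\<lparr>carrier := H\<rparr>)"
    show "submodule U R M"
      by (rule submoduleI) (use U assms H.sub_zero[OF U] H.sub_add[OF U] H.sub_smult[OF U]
          H.sub_subset[OF U] sub_subset[OF assms] in auto)
    show "\<And>x. x \<in> U \<Longrightarrow> x \<in> H" using H.sub_subset[OF U] by auto
  next
    assume U: "submodule U R M" "U \<subseteq> H"
    show "submodule U R (M\<lparr>carrier := H\<rparr>)"
      by (rule H.submoduleI) (use U sub_zero sub_add sub_smult in auto)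
  qed
qed

end

lemma lin_zero: 
  assumes "left_module R M" "left_module R N" "lin R M N f" shows "f \<zero>\<^bsub>M\<^esub> = \<zero>\<^bsub>N\<^esub>"
proof -
  interpret M: left_module R M by fact
  interpret N: left_module R N by fact
  have "f (\<zero>\<^bsub>R\<^esub> \<odot>\<^bsub>M\<^esub> \<zero>\<^bsub>M\<^esub>) = \<zero>\<^bsub>R\<^esub> \<odot>\<^bsub>N\<^esub> f \<zero>\<^bsub>M\<^esub>" using assms(3) by (intro lin_smult) auto
  then show ?thesis using lin_closed[OF assms(3), of "\<zero>\<^bsub>M\<^esub>"] by simp
qed

lemma lin_neg:
  assumes "left_module R M" "left_module R N" "lin R M N f" "x \<in> carrier M"
  shows "f (\<ominus>\<^bsub>M\<^esub> x) = \<ominus>\<^bsub>N\<^esub> f x"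
proof -
  interpret M: left_module R M by fact
  interpret N: left_module R N by fact
  show ?thesis using lin_smult[OF assms(3), of "\<ominus>\<^bsub>R\<^esub> \<one>\<^bsub>R\<^esub>" x] lin_closed[OF assms(3), of x] assms(4)
    by (simp add: M.neg_eq_smult N.neg_eq_smult)
qed

lemma lin_minus:
  assumes "left_module R M" "left_module R N" "lin R M N f" "x \<in> carrier M" "y \<in> carrier M"
  shows "f (x \<ominus>\<^bsub>M\<^esub> y) = f x \<ominus>\<^bsub>N\<^esub> f y"
proof -
  interpret M: left_module R M by fact
  interpret N: left_module R N by fact
  show ?thesis using assms lin_add[OF assms(3), of x "\<ominus>\<^bsub>M\<^esub> y"] lin_neg[OF assms(1-3), of y]
    by (simp add: M.M.minus_eq N.M.minus_eq)
qed

lemma lin_comp: "lin R M N f \<Longrightarrow> lin R N P g \<Longrightarrow> lin R M P (\<lambda>x. g (f x))"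
  by (auto simp: lin_def Pi_iff)

lemma lin_id: "lin R M M (\<lambda>x. x)"
  by (auto simp: lin_def)

lemma lin_incl: "H \<subseteq> carrier M \<Longrightarrow> lin R (M\<lparr>carrier := H\<rparr>) M (\<lambda>x. x)"
  by (auto simp: lin_def)

lemma lin_cong: "lin R M N f \<Longrightarrow> (\<And>x. x \<in> carrier M \<Longrightarrow> f x = g x) \<Longrightarrow> left_module R M \<Longrightarrow> lin R M N g"
proof -
  assume a: "lin R M N f" "\<And>x. x \<in> carrier M \<Longrightarrow> f x = g x" "left_module R M"
  interpret M: left_module R M by fact
  show ?thesis using a(1) a(2)[symmetric] by (intro linI) (auto simp: lin_def Pi_iff)
qed

lemma lin_const0: "left_module R N \<Longrightarrow> lin R M N (\<lambda>x. \<zero>\<^bsub>N\<^esub>)"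
proof -
  assume "left_module R N"
  then interpret N: left_module R N .
  show ?thesis by (auto simp: lin_def)
qed

lemma lin_sum:
  assumes "left_module R N" "lin R M N f" "lin R M N g"
  shows "lin R M N (\<lambda>x. f x \<oplus>\<^bsub>N\<^esub> g x)"
proof -
  interpret N: left_module R N by fact
  note c = lin_closed[OF assms(2)] lin_closed[OF assms(3)]
  show ?thesis
    by (rule linI) (use c lin_add[OF assms(2)] lin_add[OF assms(3)] lin_smult[OF assms(2)]
        lin_smult[OF assms(3)] in \<open>auto simp: N.M.a_ac N.smult_r_distr\<close>)
qed

lemma lin_uminus:
  assumes "left_module R N" "lin R M N f"
  shows "lin R M N (\<lambda>x. \<ominus>\<^bsub>N\<^esub> f x)"
proof -
  interpret N: left_module R N by fact
  note c = lin_closed[OF assms(2)]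
  show ?thesis
    by (rule linI) (use c lin_add[OF assms(2)] lin_smult[OF assms(2)] 
       in \<open>auto simp: N.M.minus_add N.smult_r_minus\<close>)
qed

lemma lin_diff:
  assumes "left_module R N" "lin R M N f" "lin R M N g"
  shows "lin R M N (\<lambda>x. f x \<ominus>\<^bsub>N\<^esub> g x)"
  using lin_sum[OF assms(1,2) lin_uminus[OF assms(1,3)]] by (simp add: a_minus_def)

lemma lin_corestrict:
  "lin R M N f \<Longrightarrow> (\<And>x. x \<in> carrier M \<Longrightarrow> f x \<in> H) \<Longrightarrow> lin R M (N\<lparr>carrier := H\<rparr>) f"
  by (auto simp: lin_def)

lemma lin_decorestrict:
  "lin R M (N\<lparr>carrier := H\<rparr>) f \<Longrightarrow> H \<subseteq> carrier N \<Longrightarrow> lin R M N f"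
  by (auto simp: lin_def)

lemma lin_restrict:
  "lin R M N f \<Longrightarrow> H \<subseteq> carrier M \<Longrightarrow> lin R (M\<lparr>carrier := H\<rparr>) N f"
  by (auto simp: lin_def subset_iff)

lemma ker_submodule:
  assumes "left_module R M" "left_module R N" "lin R M N f"
  shows "submodule (lker M N f) R M"
proof -
  interpret M: left_module R M by fact
  interpret N: left_module R N by fact
  show ?thesis
    by (rule M.submoduleI) (auto simp: lin_zero[OF assms] lin_add[OF assms(3)] lin_smult[OF assms(3)])
qed

lemma image_submodule:
  assumes "left_module R M" "left_module R N" "lin R M N f" "submodule H R M"
  shows "submodule (f ` H) R N"
proof -
  interpret M: left_module R M by fact
  interpret N: left_module R N by fact
  note mem = M.sub_mem[OF assms(4)]
  show ?thesis
  proof (rule N.submoduleI)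
    show "f ` H \<subseteq> carrier N" using mem lin_closed[OF assms(3)] by auto
    show "\<zero>\<^bsub>N\<^esub> \<in> f ` H" using lin_zero[OF assms(1-3)] M.sub_zero[OF assms(4)] by (metis imageI)
    show "\<And>x y. x \<in> f ` H \<Longrightarrow> y \<in> f ` H \<Longrightarrow> x \<oplus>\<^bsub>N\<^esub> y \<in> f ` H"
      using M.sub_add[OF assms(4)] mem lin_add[OF assms(3), symmetric] by auto
    show "\<And>a x. a \<in> carrier R \<Longrightarrow> x \<in> f ` H \<Longrightarrow> a \<odot>\<^bsub>N\<^esub> x \<in> f ` H"
      using M.sub_smult[OF assms(4)] mem lin_smult[OF assms(3), symmetric] by auto
  qed
qed

lemma vimage_submodule:
  assumes "left_module R M" "left_module R N" "lin R M N f" "submodule H R N"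
  shows "submodule {x \<in> carrier M. f x \<in> H} R M"
proof -
  interpret M: left_module R M by fact
  interpret N: left_module R N by fact
  show ?thesis
    by (rule M.submoduleI) (auto simp: lin_zero[OF assms(1-3)] lin_add[OF assms(3)] lin_smult[OF assms(3)] 
        N.sub_zero[OF assms(4)] N.sub_add[OF assms(4)] N.sub_smult[OF assms(4)])
qed

text \<open>Any set-theoretic section of \<open>p\<close> can be used to define \<open>g\<close>,
  since \<open>ker\<close> makes \<open>f\<close> constant on the fibres of \<open>p\<close>. This
  is how maps out of quotient modules are constructed below.\<close>

lemma lin_factor:
  assumes "left_module R M" "left_module R Q" "left_module R Z" "lin R M Q p" "lin R M Z f"
    and surj: "p ` carrier M = carrier Q" and ker: "\<And>x. x \<in> carrier M \<Longrightarrow> p x = \<zero>\<^bsub>Q\<^esub> \<Longrightarrow> f x = \<zero>\<^bsub>Z\<^esub>"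
  shows "\<exists>g. lin R Q Z g \<and> (\<forall>x\<in>carrier M. g (p x) = f x)"
proof -
  interpret M: left_module R M by fact
  interpret Q: left_module R Q by fact
  interpret Z: left_module R Z by fact
  note lp = lin_closed[OF assms(4)] lin_add[OF assms(4)] lin_smult[OF assms(4)]
  note lf = lin_closed[OF assms(5)] lin_add[OF assms(5)] lin_smult[OF assms(5)]
  define g where "g q = f (inv_into (carrier M) p q)" for q
  have eq: "f x = f y" if "x \<in> carrier M" "y \<in> carrier M" "p x = p y" for x y
  proof -
    have "p (x \<ominus>\<^bsub>M\<^esub> y) = \<zero>\<^bsub>Q\<^esub>" using lin_minus[OF assms(1,2,4)] that lp(1) by simp
    then have "f x \<ominus>\<^bsub>Z\<^esub> f y = \<zero>\<^bsub>Z\<^esub>" using lin_minus[OF assms(1,3,5)] ker[of "x \<ominus>\<^bsub>M\<^esub> y"] that by simp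
    then show ?thesis using that lf(1) by simp
  qed
  have i: "inv_into (carrier M) p q \<in> carrier M" "p (inv_into (carrier M) p q) = q" if "q \<in> carrier Q" for q
    using that surj by (auto intro: inv_into_into f_inv_into_f)
  have gp: "g (p x) = f x" if "x \<in> carrier M" for x
    unfolding g_def using that i lp by (intro eq) auto
  have "lin R Q Z g"
  proof (rule linI)
    fix x assume "x \<in> carrier Q" then show "g x \<in> carrier Z" using i lf by (auto simp: g_def)
    fix y assume "x \<in> carrier Q" "y \<in> carrier Q"
    then obtain u v where "x = p u" "y = p v" "u \<in> carrier M" "v \<in> carrier M" using surj by (metis imageE)
    then show "g (x \<oplus>\<^bsub>Q\<^esub> y) = g x \<oplus>\<^bsub>Z\<^esub> g y" using lp lf gp gp[of "u \<oplus>\<^bsub>M\<^esub> v"] by simp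
  next
    fix a x assume "x \<in> carrier Q" "a \<in> carrier R"
    moreover then obtain u where "x = p u" "u \<in> carrier M" using surj by auto
    ultimately show "g (a \<odot>\<^bsub>Q\<^esub> x) = a \<odot>\<^bsub>Z\<^esub> g x" using lp lf gp gp[of "a \<odot>\<^bsub>M\<^esub> u"] by simp
  qed
  then show ?thesis using gp by blast
qed

lemma lin_inj_iff:
  assumes "left_module R M" "left_module R N" "lin R M N f"
  shows "inj_on f (carrier M) \<longleftrightarrow> (\<forall>x\<in>carrier M. f x = \<zero>\<^bsub>N\<^esub> \<longrightarrow> x = \<zero>\<^bsub>M\<^esub>)"
proof -
  interpret M: left_module R M by fact
  interpret N: left_module R N by fact
  show ?thesis
  proof safe
    fix x assume "inj_on f (carrier M)" "x \<in> carrier M" "f x = \<zero>\<^bsub>N\<^esub>"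
    then show "x = \<zero>\<^bsub>M\<^esub>" using lin_zero[OF assms] by (metis M.M.zero_closed inj_onD)
  next
    assume *: "\<forall>x\<in>carrier M. f x = \<zero>\<^bsub>N\<^esub> \<longrightarrow> x = \<zero>\<^bsub>M\<^esub>"
    show "inj_on f (carrier M)"
    proof (rule inj_onI)
      fix x y assume xy: "x \<in> carrier M" "y \<in> carrier M" "f x = f y"
      then have "f (x \<ominus>\<^bsub>M\<^esub> y) = \<zero>\<^bsub>N\<^esub>" using lin_minus[OF assms xy(1,2)] lin_closed[OF assms(3)] by simp
      then show "x = y" using * xy by (metis M.diff_zero_iff M.M.minus_closed)
    qed
  qed
qed

lemma lin_inverse:
  assumes "left_module R M" "lin R M N f" "bij_betw f (carrier M) (carrier N)"
  shows "\<exists>g. lin R N M g \<and> (\<forall>x\<in>carrier M. g (f x) = x) \<and> (\<forall>y\<in>carrier N. f (g y) = y) \<and>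
     bij_betw g (carrier N) (carrier M)"
proof -
  interpret M: left_module R M by fact
  define g where "g = inv_into (carrier M) f"
  have gf: "g (f x) = x" if "x \<in> carrier M" for x
    using that assms(3) by (simp add: g_def bij_betw_def inv_into_f_f)
  have fg: "f (g y) = y" "g y \<in> carrier M" if "y \<in> carrier N" for y
    using that assms(3) by (auto simp: g_def bij_betw_def f_inv_into_f inv_into_into)
  have "lin R N M g"
  proof (rule linI)
    fix x assume x: "x \<in> carrier N" then show "g x \<in> carrier M" by (rule fg)
    fix y assume y: "y \<in> carrier N"
    have "f (g x \<oplus>\<^bsub>M\<^esub> g y) = x \<oplus>\<^bsub>N\<^esub> y" using lin_add[OF assms(2)] fg x y by simp
    then show "g (x \<oplus>\<^bsub>N\<^esub> y) = g x \<oplus>\<^bsub>M\<^esub> g y" using gf fg x y by (metis M.M.a_closed)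
  next
    fix a x assume *: "x \<in> carrier N" "a \<in> carrier R"
    then have "f (a \<odot>\<^bsub>M\<^esub> g x) = a \<odot>\<^bsub>N\<^esub> x" using lin_smult[OF assms(2)] fg by simp
    then show "g (a \<odot>\<^bsub>N\<^esub> x) = a \<odot>\<^bsub>M\<^esub> g x" using gf fg * by (metis M.smult_closed)
  qed
  moreover have "bij_betw g (carrier N) (carrier M)" using assms(3) by (simp add: g_def bij_betw_inv_into)
  ultimately show ?thesis using gf fg by blast
qed

lemma bij_of_inverse:
  assumes "lin R M N f" "lin R N M g" "\<And>x. x \<in> carrier M \<Longrightarrow> g (f x) = x" "\<And>y. y \<in> carrier N \<Longrightarrow> f (g y) = y"
  shows "bij_betw f (carrier M) (carrier N)"
  by (rule bij_betw_byWitness[of _ g]) (use assms lin_closed in fast)+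

section \<open>Extensional homomorphisms and isomorphisms of modules\<close>

lemma mod_hom_iff: 
  assumes "left_module R M"
  shows "h \<in> mod_hom R M N \<longleftrightarrow> lin R M N h \<and> h \<in> extensional (carrier M)"
  by (auto simp: mod_hom_def lin_def PiE_def)

lemma mod_hom_lin: "h \<in> mod_hom R M N \<Longrightarrow> lin R M N h"
  by (auto simp: mod_hom_def lin_def)

text \<open>Elements of \<open>mod_hom\<close> are extensional, while \<open>lin\<close> constrains
  a map on the carrier only, so that composites, sums and inclusions need no restriction. This is
  the way back to the sets of homomorphisms.\<close>

lemma restrict_mod_hom:
  assumes "left_module R M" "lin R M N f" shows "restrict f (carrier M) \<in> mod_hom R M N"
proof -
  interpret M: left_module R M by fact
  have "lin R M N (restrict f (carrier M))" by (rule lin_cong[OF assms(2)]) (auto simp: assms(1))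
  then show ?thesis by (simp add: mod_hom_iff[OF assms(1)])
qed

lemma mod_iso_iff:
  assumes "left_module R M"
  shows "mod_iso R M N \<longleftrightarrow> (\<exists>h. lin R M N h \<and> bij_betw h (carrier M) (carrier N))"
proof
  assume "mod_iso R M N" then show "\<exists>h. lin R M N h \<and> bij_betw h (carrier M) (carrier N)"
    by (auto simp: mod_iso_def dest: mod_hom_lin)
next
  assume "\<exists>h. lin R M N h \<and> bij_betw h (carrier M) (carrier N)"
  then obtain h where h: "lin R M N h" "bij_betw h (carrier M) (carrier N)" by blast
  have "bij_betw (restrict h (carrier M)) (carrier M) (carrier N)"
    using h(2) by (simp add: bij_betw_cong[of "carrier M" "restrict h (carrier M)" h])
  then show "mod_iso R M N" unfolding mod_iso_def using restrict_mod_hom[OF assms h(1)] by blast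
qed

lemma mod_isoI:
  "left_module R M \<Longrightarrow> lin R M N h \<Longrightarrow> bij_betw h (carrier M) (carrier N) \<Longrightarrow> mod_iso R M N"
  using mod_iso_iff by blast

lemma mod_iso_refl: "left_module R M \<Longrightarrow> mod_iso R M M"
  by (rule mod_isoI[OF _ lin_id]) (auto simp: bij_betw_def)

lemma mod_iso_sym: "left_module R M \<Longrightarrow> left_module R N \<Longrightarrow> mod_iso R M N \<Longrightarrow> mod_iso R N M"
  using lin_inverse[of R M N] by (simp add: mod_iso_iff) blast

lemma mod_iso_trans:
  assumes "left_module R M" "left_module R N" "mod_iso R M N" "mod_iso R N P"
  shows "mod_iso R M P"
proof -
  obtain f g where f: "lin R M N f" "bij_betw f (carrier M) (carrier N)"
    and g: "lin R N P g" "bij_betw g (carrier N) (carrier P)"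
    using assms by (auto simp: mod_iso_iff)
  have "bij_betw (\<lambda>x. g (f x)) (carrier M) (carrier P)"
    using bij_betw_trans[OF f(2) g(2)] by (simp add: comp_def)
  then show ?thesis using mod_isoI[OF assms(1) lin_comp[OF f(1) g(1)]] by blast
qed

section \<open>Quotients, direct sums and finite generation\<close>

text \<open>The module axioms are equations and existence statements, which pass along a surjection
  compatible with the operations. Nothing is presupposed about \<open>N\<close>, so the structure on
  quotients and on the one-point extension can be obtained from here.\<close>

lemma left_module_surj:
  assumes "left_module R M" "f ` carrier M = carrier N" "f \<zero>\<^bsub>M\<^esub> = \<zero>\<^bsub>N\<^esub>"
    and add: "\<And>x y. x \<in> carrier M \<Longrightarrow> y \<in> carrier M \<Longrightarrow> f (x \<oplus>\<^bsub>M\<^esub> y) = f x \<oplus>\<^bsub>N\<^esub> f y"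
    and smult: "\<And>a x. a \<in> carrier R \<Longrightarrow> x \<in> carrier M \<Longrightarrow> f (a \<odot>\<^bsub>M\<^esub> x) = a \<odot>\<^bsub>N\<^esub> f x"
  shows "left_module R N"
proof -
  interpret M: left_module R M by fact
  have ex: "\<exists>u\<in>carrier M. x = f u" if "x \<in> carrier N" for x using that assms(2) by auto
  have cl: "f x \<in> carrier N" if "x \<in> carrier M" for x using that assms(2) by auto
  have "abelian_group N"
  proof (rule abelian_groupI)
    show "\<zero>\<^bsub>N\<^esub> \<in> carrier N" using cl assms(3) by (metis M.M.zero_closed)
  next
    fix x y assume "x \<in> carrier N" "y \<in> carrier N"
    then obtain u v where *: "x = f u" "y = f v" "u \<in> carrier M" "v \<in> carrier M" using ex by metis
    then show "x \<oplus>\<^bsub>N\<^esub> y \<in> carrier N" by (simp add: add[symmetric] cl)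
    show "x \<oplus>\<^bsub>N\<^esub> y = y \<oplus>\<^bsub>N\<^esub> x" using * by (simp add: add[symmetric] M.M.a_comm)
    fix z assume "z \<in> carrier N"
    then obtain w where "z = f w" "w \<in> carrier M" using ex by metis
    then show "x \<oplus>\<^bsub>N\<^esub> y \<oplus>\<^bsub>N\<^esub> z = x \<oplus>\<^bsub>N\<^esub> (y \<oplus>\<^bsub>N\<^esub> z)" using * by (simp add: add[symmetric] M.M.a_assoc)
  next
    fix x assume "x \<in> carrier N"
    then obtain u where *: "x = f u" "u \<in> carrier M" using ex by metis
    then show "\<zero>\<^bsub>N\<^esub> \<oplus>\<^bsub>N\<^esub> x = x" using add[of "\<zero>\<^bsub>M\<^esub>" u] assms(3) by simp
    show "\<exists>y\<in>carrier N. y \<oplus>\<^bsub>N\<^esub> x = \<zero>\<^bsub>N\<^esub>"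
      by (rule bexI[of _ "f (\<ominus>\<^bsub>M\<^esub> u)"]) (use * cl add[of "\<ominus>\<^bsub>M\<^esub> u" u] assms(3) in \<open>auto simp: M.M.l_neg\<close>)
  qed
  moreover have "left_module_axioms R N"
  proof
    fix a x assume a: "a \<in> carrier R" and x: "x \<in> carrier N"
    from x obtain u where u: "x = f u" "u \<in> carrier M" using ex by metis
    show "a \<odot>\<^bsub>N\<^esub> x \<in> carrier N" using a u by (simp add: smult[symmetric] cl)
    { fix b assume b: "b \<in> carrier R"
      show "(a \<oplus>\<^bsub>R\<^esub> b) \<odot>\<^bsub>N\<^esub> x = a \<odot>\<^bsub>N\<^esub> x \<oplus>\<^bsub>N\<^esub> b \<odot>\<^bsub>N\<^esub> x" using a b u
        by (simp add: smult[symmetric] add[symmetric] M.smult_l_distr)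
      show "(a \<otimes>\<^bsub>R\<^esub> b) \<odot>\<^bsub>N\<^esub> x = a \<odot>\<^bsub>N\<^esub> (b \<odot>\<^bsub>N\<^esub> x)" using a b u
        by (simp add: smult[symmetric] M.smult_assoc1) }
    fix y assume "y \<in> carrier N"
    then obtain v where v: "y = f v" "v \<in> carrier M" using ex by metis
    show "a \<odot>\<^bsub>N\<^esub> (x \<oplus>\<^bsub>N\<^esub> y) = a \<odot>\<^bsub>N\<^esub> x \<oplus>\<^bsub>N\<^esub> a \<odot>\<^bsub>N\<^esub> y" using a u v
      by (simp add: smult[symmetric] add[symmetric] M.smult_r_distr)
  next
    fix x assume x: "x \<in> carrier N"
    from x obtain u where u: "x = f u" "u \<in> carrier M" using ex by metis
    show "\<one>\<^bsub>R\<^esub> \<odot>\<^bsub>N\<^esub> x = x" using u by (simp add: smult[symmetric])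
  qed
  ultimately show ?thesis by (intro left_module.intro M.R.ring_axioms)
qed

text \<open>Transport of structure to the image of \<open>f\<close>, with chosen preimages. If
  \<open>f\<close> identifies exactly the elements congruent modulo a submodule, the result is the
  quotient module. Unlike \<open>quot_module\<close>, whose elements are cosets, it has its elements
  in whatever type \<open>f\<close> maps to.\<close>

definition push :: "('a, 'm) module \<Rightarrow> ('m \<Rightarrow> 'n) \<Rightarrow> ('a, 'n) module" where
  "push M f = \<lparr>carrier = f ` carrier M, monoid.mult = \<lambda>_ _. undefined, monoid.one = undefined,
     ring.zero = f \<zero>\<^bsub>M\<^esub>,
     ring.add = \<lambda>u v. f (inv_into (carrier M) f u \<oplus>\<^bsub>M\<^esub> inv_into (carrier M) f v),
     smult = \<lambda>a u. f (a \<odot>\<^bsub>M\<^esub> inv_into (carrier M) f u)\<rparr>"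

lemma push_quotient:
  assumes "left_module R M" "submodule U R M"
    and f: "\<And>x y. x \<in> carrier M \<Longrightarrow> y \<in> carrier M \<Longrightarrow> f x = f y \<longleftrightarrow> x \<ominus>\<^bsub>M\<^esub> y \<in> U"
  shows "left_module R (push M f)" "lin R M (push M f) f" "lker M (push M f) f = U"
    "f ` carrier M = carrier (push M f)"
proof -
  interpret M: left_module R M by fact
  let ?g = "inv_into (carrier M) f"
  have g: "?g (f x) \<in> carrier M" "f (?g (f x)) = f x" if "x \<in> carrier M" for x
    using that by (auto intro: inv_into_into f_inv_into_f)
  then have gU: "x \<ominus>\<^bsub>M\<^esub> ?g (f x) \<in> U" if "x \<in> carrier M" for x using that f by metis
  note mem = M.sub_mem[OF assms(2)]
  have add: "f (x \<oplus>\<^bsub>M\<^esub> y) = f x \<oplus>\<^bsub>push M f\<^esub> f y" if xy: "x \<in> carrier M" "y \<in> carrier M" for x y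
  proof -
    have "(x \<oplus>\<^bsub>M\<^esub> y) \<ominus>\<^bsub>M\<^esub> (?g (f x) \<oplus>\<^bsub>M\<^esub> ?g (f y)) = (x \<ominus>\<^bsub>M\<^esub> ?g (f x)) \<oplus>\<^bsub>M\<^esub> (y \<ominus>\<^bsub>M\<^esub> ?g (f y))"
      using xy g by (simp add: M.M.minus_eq M.M.minus_add M.M.a_ac)
    also have "\<dots> \<in> U" using xy gU by (intro M.sub_add[OF assms(2)]) auto
    finally show ?thesis using xy g f by (simp add: push_def)
  qed
  have smult: "f (a \<odot>\<^bsub>M\<^esub> x) = a \<odot>\<^bsub>push M f\<^esub> f x" if "a \<in> carrier R" "x \<in> carrier M" for a x
  proof -
    have "a \<odot>\<^bsub>M\<^esub> x \<ominus>\<^bsub>M\<^esub> a \<odot>\<^bsub>M\<^esub> ?g (f x) = a \<odot>\<^bsub>M\<^esub> (x \<ominus>\<^bsub>M\<^esub> ?g (f x))" using that g by (simp add: M.smult_r_diff)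
    also have "\<dots> \<in> U" using that gU by (intro M.sub_smult[OF assms(2)]) auto
    finally show ?thesis using that g f by (simp add: push_def)
  qed
  show c: "f ` carrier M = carrier (push M f)" by (simp add: push_def)
  have z: "f \<zero>\<^bsub>M\<^esub> = \<zero>\<^bsub>push M f\<^esub>" by (simp add: push_def)
  show "left_module R (push M f)" by (rule left_module_surj[OF assms(1) c z add smult])
  show "lin R M (push M f) f" using c by (intro linI add smult) auto
  show "lker M (push M f) f = U" using f[of _ "\<zero>\<^bsub>M\<^esub>"] mem by (auto simp: z[symmetric])
qed

definition dsum :: "('a, 'm) module \<Rightarrow> ('a, 'n) module \<Rightarrow> ('a, 'm \<times> 'n) module" where
  "dsum M N = \<lparr>carrier = carrier M \<times> carrier N, monoid.mult = \<lambda>_ _. undefined, monoid.one = undefined,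
     ring.zero = (\<zero>\<^bsub>M\<^esub>, \<zero>\<^bsub>N\<^esub>), ring.add = \<lambda>(x, y) (x', y'). (x \<oplus>\<^bsub>M\<^esub> x', y \<oplus>\<^bsub>N\<^esub> y'),
     smult = \<lambda>a (x, y). (a \<odot>\<^bsub>M\<^esub> x, a \<odot>\<^bsub>N\<^esub> y)\<rparr>"

lemma dsum_module:
  assumes "left_module R M" "left_module R N" shows "left_module R (dsum M N)"
proof -
  interpret M: left_module R M by fact
  interpret N: left_module R N by fact
  have "abelian_group (dsum M N)"
  proof (rule abelian_groupI)
    fix x assume "x \<in> carrier (dsum M N)"
    then show "\<exists>y\<in>carrier (dsum M N). y \<oplus>\<^bsub>dsum M N\<^esub> x = \<zero>\<^bsub>dsum M N\<^esub>"
      by (auto simp: dsum_def M.M.l_neg N.M.l_neg intro!: bexI[of _ "(\<ominus>\<^bsub>M\<^esub> (fst x), \<ominus>\<^bsub>N\<^esub> (snd x))"])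
  qed (auto simp: dsum_def M.M.a_ac N.M.a_ac)
  then show ?thesis
    by (intro left_module.intro M.R.ring_axioms left_module_axioms.intro)
      (auto simp: dsum_def M.smult_l_distr M.smult_r_distr M.smult_assoc1
        N.smult_l_distr N.smult_r_distr N.smult_assoc1)
qed

text \<open>Sums are described by injections and projections instead of pairs: a sum has to be
  replaced by a copy with carrier in \<open>nat \<Rightarrow> 'k\<close>, and a given module should
  be recognisable as the sum of two of its submodules.\<close>

definition biproduct where
  "biproduct R S M N i1 i2 p1 p2 \<longleftrightarrow> lin R M S i1 \<and> lin R N S i2 \<and> lin R S M p1 \<and> lin R S N p2 \<and>
     (\<forall>x\<in>carrier M. p1 (i1 x) = x \<and> p2 (i1 x) = \<zero>\<^bsub>N\<^esub>) \<and>
     (\<forall>y\<in>carrier N. p2 (i2 y) = y \<and> p1 (i2 y) = \<zero>\<^bsub>M\<^esub>) \<and>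
     (\<forall>z\<in>carrier S. i1 (p1 z) \<oplus>\<^bsub>S\<^esub> i2 (p2 z) = z)"

lemma dsum_biproduct:
  assumes "left_module R M" "left_module R N"
  shows "biproduct R (dsum M N) M N (\<lambda>x. (x, \<zero>\<^bsub>N\<^esub>)) (\<lambda>y. (\<zero>\<^bsub>M\<^esub>, y)) fst snd"
proof -
  interpret M: left_module R M by fact
  interpret N: left_module R N by fact
  show ?thesis by (auto simp: biproduct_def dsum_def lin_def)
qed

subsection \<open>Generation\<close>

definition mspan :: "('a, 'y) ring_scheme \<Rightarrow> ('a, 'm) module \<Rightarrow> 'm set \<Rightarrow> 'm set" where
  "mspan R M S = \<Inter>{N. submodule N R M \<and> S \<subseteq> N}"

context left_module begin

lemma mspan_submodule:
  assumes "S \<subseteq> carrier M" shows "submodule (mspan R M S) R M"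
proof (rule submoduleI)
  show "mspan R M S \<subseteq> carrier M" using assms carrier_submodule by (auto simp: mspan_def)
qed (auto simp: mspan_def sub_zero sub_add sub_smult)

lemma mspan_superset: "S \<subseteq> mspan R M S" by (auto simp: mspan_def)

lemma mspan_least: "submodule N R M \<Longrightarrow> S \<subseteq> N \<Longrightarrow> mspan R M S \<subseteq> N" by (auto simp: mspan_def)

lemma finsum_in_sub:
  assumes "submodule N R M" "finite S" "f \<in> S \<rightarrow> N" shows "(\<Oplus>\<^bsub>M\<^esub>s\<in>S. f s) \<in> N"
  using assms(2,3)
proof (induction S rule: finite_induct)
  case empty then show ?case using sub_zero[OF assms(1)] by simp
next
  case (insert s S)
  then have "f \<in> S \<rightarrow> carrier M" "f s \<in> carrier M" using sub_mem[OF assms(1)] by auto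
  then show ?case using insert by (simp add: sub_add[OF assms(1)])
qed

lemma finsum_smult:
  assumes "finite S" "f \<in> S \<rightarrow> carrier M" "a \<in> carrier R"
  shows "a \<odot>\<^bsub>M\<^esub> (\<Oplus>\<^bsub>M\<^esub>s\<in>S. f s) = (\<Oplus>\<^bsub>M\<^esub>s\<in>S. a \<odot>\<^bsub>M\<^esub> f s)"
  using assms(1,2)
proof (induction S rule: finite_induct)
  case (insert s S)
  then have "f \<in> S \<rightarrow> carrier M" "f s \<in> carrier M" "(\<lambda>s. a \<odot>\<^bsub>M\<^esub> f s) \<in> S \<rightarrow> carrier M" using assms(3) by auto
  then show ?case using insert assms(3) by (simp add: smult_r_distr)
qed (use assms(3) in auto)

lemma combos_submodule:
  assumes "finite S" "S \<subseteq> carrier M"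
  shows "submodule {\<Oplus>\<^bsub>M\<^esub>s\<in>S. c s \<odot>\<^bsub>M\<^esub> s | c. c \<in> S \<rightarrow> carrier R} R M"
    "S \<subseteq> {\<Oplus>\<^bsub>M\<^esub>s\<in>S. c s \<odot>\<^bsub>M\<^esub> s | c. c \<in> S \<rightarrow> carrier R}"
proof -
  let ?C = "{\<Oplus>\<^bsub>M\<^esub>s\<in>S. c s \<odot>\<^bsub>M\<^esub> s | c. c \<in> S \<rightarrow> carrier R}"
  have cl: "(\<lambda>s. c s \<odot>\<^bsub>M\<^esub> s) \<in> S \<rightarrow> carrier M" if "c \<in> S \<rightarrow> carrier R" for c using that assms by auto
  show "submodule ?C R M"
  proof (rule submoduleI)
    show "?C \<subseteq> carrier M" using cl by (auto intro!: M.finsum_closed)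
    have "(\<Oplus>\<^bsub>M\<^esub>s\<in>S. \<zero> \<odot>\<^bsub>M\<^esub> s) = \<zero>\<^bsub>M\<^esub>" using assms by (intro M.add.finprod_one_eqI) auto
    then show "\<zero>\<^bsub>M\<^esub> \<in> ?C" by (auto intro!: exI[of _ "\<lambda>_. \<zero>"])
    fix x y assume "x \<in> ?C" "y \<in> ?C"
    then obtain c d where *: "c \<in> S \<rightarrow> carrier R" "d \<in> S \<rightarrow> carrier R" "x = (\<Oplus>\<^bsub>M\<^esub>s\<in>S. c s \<odot>\<^bsub>M\<^esub> s)" "y = (\<Oplus>\<^bsub>M\<^esub>s\<in>S. d s \<odot>\<^bsub>M\<^esub> s)" by auto
    have "(\<Oplus>\<^bsub>M\<^esub>s\<in>S. (c s \<oplus> d s) \<odot>\<^bsub>M\<^esub> s) = (\<Oplus>\<^bsub>M\<^esub>s\<in>S. c s \<odot>\<^bsub>M\<^esub> s \<oplus>\<^bsub>M\<^esub> d s \<odot>\<^bsub>M\<^esub> s)"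
      by (rule M.add.finprod_cong') (use * assms in \<open>auto simp: Pi_iff subset_iff intro!: smult_l_distr\<close>)
    also have "\<dots> = x \<oplus>\<^bsub>M\<^esub> y" using * cl by (simp add: M.finsum_addf)
    finally show "x \<oplus>\<^bsub>M\<^esub> y \<in> ?C" using * by (intro CollectI exI[of _ "\<lambda>s. c s \<oplus> d s"]) auto
  next
    fix a x assume a: "a \<in> carrier R" and "x \<in> ?C"
    then obtain c where *: "c \<in> S \<rightarrow> carrier R" "x = (\<Oplus>\<^bsub>M\<^esub>s\<in>S. c s \<odot>\<^bsub>M\<^esub> s)" by auto
    have "a \<odot>\<^bsub>M\<^esub> x = (\<Oplus>\<^bsub>M\<^esub>s\<in>S. a \<odot>\<^bsub>M\<^esub> (c s \<odot>\<^bsub>M\<^esub> s))" using * cl a assms by (simp add: finsum_smult)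
    also have "\<dots> = (\<Oplus>\<^bsub>M\<^esub>s\<in>S. (a \<otimes> c s) \<odot>\<^bsub>M\<^esub> s)"
      by (rule M.add.finprod_cong') (use * assms a in \<open>auto simp: Pi_iff subset_iff intro!: smult_assoc1[symmetric]\<close>)
    finally show "a \<odot>\<^bsub>M\<^esub> x \<in> ?C" using * a by (intro CollectI exI[of _ "\<lambda>s. a \<otimes> c s"]) auto
  qed
  show "S \<subseteq> ?C"
  proof
    fix t assume t: "t \<in> S"
    have "(\<Oplus>\<^bsub>M\<^esub>s\<in>S. (if s = t then \<one> else \<zero>) \<odot>\<^bsub>M\<^esub> s) = (\<Oplus>\<^bsub>M\<^esub>s\<in>S. if t = s then s else \<zero>\<^bsub>M\<^esub>)"
      by (rule M.add.finprod_cong') (use assms in auto)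
    also have "\<dots> = t" using M.add.finprod_singleton[OF t assms(1), of "\<lambda>s. s"] assms(2) by auto
    finally show "t \<in> ?C" by (intro CollectI exI[of _ "\<lambda>s. if s = t then \<one> else \<zero>"]) auto
  qed
qed

lemma mspan_combos:
  assumes "finite S" "S \<subseteq> carrier M"
  shows "mspan R M S = {\<Oplus>\<^bsub>M\<^esub>s\<in>S. c s \<odot>\<^bsub>M\<^esub> s | c. c \<in> S \<rightarrow> carrier R}"
proof
  show "mspan R M S \<subseteq> {\<Oplus>\<^bsub>M\<^esub>s\<in>S. c s \<odot>\<^bsub>M\<^esub> s | c. c \<in> S \<rightarrow> carrier R}"
    using combos_submodule[OF assms] by (rule mspan_least)
  show "{\<Oplus>\<^bsub>M\<^esub>s\<in>S. c s \<odot>\<^bsub>M\<^esub> s | c. c \<in> S \<rightarrow> carrier R} \<subseteq> mspan R M S"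
    using mspan_submodule[OF assms(2)] mspan_superset assms(1)
    by (auto intro!: finsum_in_sub sub_smult)
qed

lemma fin_gen_iff: "fin_gen R M \<longleftrightarrow> (\<exists>S. finite S \<and> S \<subseteq> carrier M \<and> mspan R M S = carrier M)"
proof -
  have "(\<forall>x\<in>carrier M. \<exists>c\<in>S \<rightarrow> carrier R. x = (\<Oplus>\<^bsub>M\<^esub>s\<in>S. c s \<odot>\<^bsub>M\<^esub> s)) \<longleftrightarrow> mspan R M S = carrier M"
    if "finite S" "S \<subseteq> carrier M" for S
  proof -
    have "(\<forall>x\<in>carrier M. \<exists>c\<in>S \<rightarrow> carrier R. x = (\<Oplus>\<^bsub>M\<^esub>s\<in>S. c s \<odot>\<^bsub>M\<^esub> s)) \<longleftrightarrow> carrier M \<subseteq> mspan R M S"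
      unfolding mspan_combos[OF that] by blast
    then show ?thesis using sub_subset[OF mspan_submodule[OF that(2)]] by blast
  qed
  then show ?thesis unfolding fin_gen_def by (intro iff_exI) blast
qed

lemma mspan_insert:
  assumes "S \<subseteq> carrier M" "s \<in> carrier M" "x \<in> mspan R M (insert s S)"
  shows "\<exists>a\<in>carrier R. \<exists>v\<in>mspan R M S. x = a \<odot>\<^bsub>M\<^esub> s \<oplus>\<^bsub>M\<^esub> v"
proof -
  note S = mspan_submodule[OF assms(1)]
  have "submodule {a \<odot>\<^bsub>M\<^esub> s \<oplus>\<^bsub>M\<^esub> v | a v. a \<in> carrier R \<and> v \<in> mspan R M S} R M" (is "submodule ?U R M")
  proof (rule submoduleI)
    show "?U \<subseteq> carrier M" using S assms sub_mem by auto
    show "\<zero>\<^bsub>M\<^esub> \<in> ?U" using S assms by (auto intro!: exI[of _ \<zero>] exI[of _ "\<zero>\<^bsub>M\<^esub>"] sub_zero)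
    fix x y assume "x \<in> ?U" "y \<in> ?U"
    then obtain a b v w where *: "a \<in> carrier R" "b \<in> carrier R" "v \<in> mspan R M S" "w \<in> mspan R M S"
      "x = a \<odot>\<^bsub>M\<^esub> s \<oplus>\<^bsub>M\<^esub> v" "y = b \<odot>\<^bsub>M\<^esub> s \<oplus>\<^bsub>M\<^esub> w" by auto
    then have "x \<oplus>\<^bsub>M\<^esub> y = (a \<oplus> b) \<odot>\<^bsub>M\<^esub> s \<oplus>\<^bsub>M\<^esub> (v \<oplus>\<^bsub>M\<^esub> w)"
      using assms sub_mem[OF S] by (simp add: smult_l_distr M.a_ac)
    then show "x \<oplus>\<^bsub>M\<^esub> y \<in> ?U" using * sub_add[OF S] by blast
  next
    fix a x assume a: "a \<in> carrier R" and "x \<in> ?U"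
    then obtain b v where *: "b \<in> carrier R" "v \<in> mspan R M S" "x = b \<odot>\<^bsub>M\<^esub> s \<oplus>\<^bsub>M\<^esub> v" by auto
    then have "a \<odot>\<^bsub>M\<^esub> x = (a \<otimes> b) \<odot>\<^bsub>M\<^esub> s \<oplus>\<^bsub>M\<^esub> a \<odot>\<^bsub>M\<^esub> v"
      using assms sub_mem[OF S] a by (simp add: smult_r_distr smult_assoc1)
    then show "a \<odot>\<^bsub>M\<^esub> x \<in> ?U" using * a sub_smult[OF S] by blast
  qed
  moreover have "insert s S \<subseteq> ?U"
  proof
    fix t assume "t \<in> insert s S"
    then consider "t = s" | "t \<in> S" by auto
    then show "t \<in> ?U"
    proof cases
      case 1 then show ?thesis using assms sub_zero[OF S]
        by (auto intro!: exI[of _ \<one>] exI[of _ "\<zero>\<^bsub>M\<^esub>"])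
    next
      case 2 then show ?thesis using assms mspan_superset
        by (auto intro!: exI[of _ \<zero>] exI[of _ t] simp: subset_iff)
    qed
  qed
  ultimately have "mspan R M (insert s S) \<subseteq> ?U" by (rule mspan_least)
  then show ?thesis using assms(3) by blast
qed

end

text \<open>\<open>fgmod\<close> with an arbitrary carrier type, so that it applies to pairs, to the
  regular module and to quotients before they are copied into the coordinate type.\<close>

definition fgm :: "('a, 'y) ring_scheme \<Rightarrow> ('a, 'm) module \<Rightarrow> bool" where
  "fgm R M \<longleftrightarrow> left_module R M \<and> fin_gen R M"

lemma fgmod_iff: "M \<in> fgmod L \<longleftrightarrow> fgm L M" by (simp add: fgmod_def fgm_def)

lemma fgm_module: "fgm R M \<Longrightarrow> left_module R M" by (simp add: fgm_def)

lemma fgm_surj: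
  assumes "fgm R M" "left_module R N" "lin R M N f" "f ` carrier M = carrier N"
  shows "fgm R N"
proof -
  interpret M: left_module R M using assms by (simp add: fgm_def)
  interpret N: left_module R N by fact
  obtain S where S: "finite S" "S \<subseteq> carrier M" "mspan R M S = carrier M"
    using assms(1) M.fin_gen_iff by (auto simp: fgm_def)
  have fS: "f ` S \<subseteq> carrier N" using S assms(4) by auto
  have "S \<subseteq> {x \<in> carrier M. f x \<in> mspan R N (f ` S)}" using S N.mspan_superset[of "f ` S"] by auto
  then have "mspan R M S \<subseteq> {x \<in> carrier M. f x \<in> mspan R N (f ` S)}"
    by (rule M.mspan_least[OF vimage_submodule[OF M.left_module_axioms assms(2,3) N.mspan_submodule[OF fS]]])
  then have "\<forall>x\<in>carrier M. f x \<in> mspan R N (f ` S)" using S(3) by auto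
  then have "carrier N \<subseteq> mspan R N (f ` S)" unfolding assms(4)[symmetric] by blast
  then have "mspan R N (f ` S) = carrier N" using N.sub_subset[OF N.mspan_submodule[OF fS]] by auto
  then show ?thesis using N.fin_gen_iff S(1) fS assms(2) by (auto simp: fgm_def)
qed

lemma fgm_dsum:
  assumes "fgm R M" "fgm R N" shows "fgm R (dsum M N)"
proof -
  interpret M: left_module R M using assms by (simp add: fgm_def)
  interpret N: left_module R N using assms by (simp add: fgm_def)
  interpret D: left_module R "dsum M N" by (rule dsum_module[OF M.left_module_axioms N.left_module_axioms])
  have b: "biproduct R (dsum M N) M N (\<lambda>x. (x, \<zero>\<^bsub>N\<^esub>)) (\<lambda>y. (\<zero>\<^bsub>M\<^esub>, y)) fst snd"
    by (rule dsum_biproduct[OF M.left_module_axioms N.left_module_axioms])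
  obtain S where S: "finite S" "S \<subseteq> carrier M" "mspan R M S = carrier M"
    using assms(1) M.fin_gen_iff by (auto simp: fgm_def)
  obtain S' where S': "finite S'" "S' \<subseteq> carrier N" "mspan R N S' = carrier N"
    using assms(2) N.fin_gen_iff by (auto simp: fgm_def)
  define G where "G = (\<lambda>x. (x, \<zero>\<^bsub>N\<^esub>)) ` S \<union> (\<lambda>y. (\<zero>\<^bsub>M\<^esub>, y)) ` S'"
  have G: "finite G" "G \<subseteq> carrier (dsum M N)" using S S' by (auto simp: G_def dsum_def)
  note W = D.mspan_submodule[OF G(2)]
  have "mspan R M S \<subseteq> {x \<in> carrier M. (x, \<zero>\<^bsub>N\<^esub>) \<in> mspan R (dsum M N) G}"
    by (rule M.mspan_least, rule vimage_submodule[OF M.left_module_axioms D.left_module_axioms _ W])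
      (use b S(2) D.mspan_superset[of G] in \<open>auto simp: biproduct_def G_def\<close>)
  moreover have "mspan R N S' \<subseteq> {x \<in> carrier N. (\<zero>\<^bsub>M\<^esub>, x) \<in> mspan R (dsum M N) G}"
    by (rule N.mspan_least, rule vimage_submodule[OF N.left_module_axioms D.left_module_axioms _ W])
      (use b S'(2) D.mspan_superset[of G] in \<open>auto simp: biproduct_def G_def\<close>)
  ultimately have "carrier (dsum M N) \<subseteq> mspan R (dsum M N) G"
    using D.sub_add[OF W] S(3) S'(3) by (force simp: dsum_def)
  then have "mspan R (dsum M N) G = carrier (dsum M N)" using D.sub_subset[OF W] by auto
  then show ?thesis using D.fin_gen_iff G D.left_module_axioms by (auto simp: fgm_def)
qed

section \<open>Finite length\<close>

text \<open>A strictly monotone map into the natural numbers stands in for composition length. It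
  yields both chain conditions, and the same function serves for submodules and after restriction of
  scalars.\<close>

definition fin_len :: "('a, 'y) ring_scheme \<Rightarrow> ('a, 'm) module \<Rightarrow> bool" where
  "fin_len R M \<longleftrightarrow> (\<exists>len::'m set \<Rightarrow> nat. \<forall>N N'. submodule N R M \<longrightarrow> submodule N' R M \<longrightarrow> N \<subset> N' \<longrightarrow> len N < len N')"

text \<open>Induction on a spanning set. One more vector raises the dimension by at most one, and a
  subspace shows this by leaving the span \<open>?W\<close> of the other vectors.\<close>

lemma fin_len_field:
  fixes V :: "('k, 'v) module"
  assumes "field K" "left_module K V" "fin_gen K V"
  shows "fin_len K V"
proof -
  interpret K: field K by fact
  interpret V: left_module K V by fact
  have "\<exists>len::'v set \<Rightarrow> nat. \<forall>N N'. submodule N K V \<longrightarrow> submodule N' K V \<longrightarrow> N \<subset> N' \<longrightarrow> N' \<subseteq> mspan K V S \<longrightarrow> len N < len N'"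
    if "finite S" "S \<subseteq> carrier V" for S
    using that
  proof (induction S rule: finite_induct)
    case empty
    have "mspan K V {} = {\<zero>\<^bsub>V\<^esub>}"
      using V.mspan_least[OF V.zero_submodule, of "{}"] V.sub_zero[OF V.mspan_submodule[of "{}"]] by auto
    then show ?case using V.sub_zero by (auto 0 4)
  next
    case (insert s S)
    then obtain len :: "'v set \<Rightarrow> nat" where "\<forall>N N'. submodule N K V \<longrightarrow> submodule N' K V \<longrightarrow> N \<subset> N' \<longrightarrow> N' \<subseteq> mspan K V S \<longrightarrow> len N < len N'"
      by auto
    note len = this[rule_format]
    let ?W = "mspan K V S"
    have W: "submodule ?W K V" using insert by (intro V.mspan_submodule) auto
    \<comment> \<open>The extra 1 decides the case in which both subspaces meet \<open>?W\<close> in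
      the same set; then only the larger one can leave \<open>?W\<close>.\<close>
    define len' where "len' N = len (N \<inter> ?W) + (if N \<subseteq> ?W then 0 else 1)" for N
    have "len' N < len' N'" if N: "submodule N K V" "submodule N' K V" "N \<subset> N'" "N' \<subseteq> mspan K V (insert s S)" for N N'
    proof (cases "N \<inter> ?W = N' \<inter> ?W")
      case False
      then have "len (N \<inter> ?W) < len (N' \<inter> ?W)" using N by (intro len V.inter_submodule W) auto
      then show ?thesis using N(3) by (auto simp: len'_def)
    next
      case eq: True
      have "N \<subseteq> ?W"
      proof (rule ccontr)
        assume "\<not> N \<subseteq> ?W"
        then obtain u where u: "u \<in> N" "u \<notin> ?W" by auto
        then have "u \<in> mspan K V (insert s S)" using N by auto
        then obtain d v where v: "d \<in> carrier K" "v \<in> ?W" "u = d \<odot>\<^bsub>V\<^esub> s \<oplus>\<^bsub>V\<^esub> v"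
          using V.mspan_insert[of S s u] insert.prems by auto
        note mem = V.sub_mem[OF W] and s = insert.prems
        \<comment> \<open>The coefficient of \<open>s\<close> in \<open>u\<close> is thus
          invertible, and a multiple of \<open>u\<close> can be subtracted from any element of
          \<open>N'\<close> to land in \<open>?W\<close>, where \<open>N\<close> and
          \<open>N'\<close> agree.\<close>
        have d: "d \<noteq> \<zero>\<^bsub>K\<^esub>" using u v mem s by auto
        have "N' \<subseteq> N"
        proof
          fix u' assume u': "u' \<in> N'"
          then have "u' \<in> mspan K V (insert s S)" using N by auto
          then obtain c v' where v': "c \<in> carrier K" "v' \<in> ?W" "u' = c \<odot>\<^bsub>V\<^esub> s \<oplus>\<^bsub>V\<^esub> v'"
            using V.mspan_insert[of S s u'] insert.prems by auto
          define q where "q = c \<otimes>\<^bsub>K\<^esub> inv\<^bsub>K\<^esub> d"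
          have q: "q \<in> carrier K" "q \<otimes>\<^bsub>K\<^esub> d = c"
            using d v(1) v'(1) by (auto simp: q_def K.m_assoc K.field_Units)
          have "u' \<ominus>\<^bsub>V\<^esub> q \<odot>\<^bsub>V\<^esub> u = v' \<ominus>\<^bsub>V\<^esub> q \<odot>\<^bsub>V\<^esub> v"
          proof -
            have "q \<odot>\<^bsub>V\<^esub> u = c \<odot>\<^bsub>V\<^esub> s \<oplus>\<^bsub>V\<^esub> q \<odot>\<^bsub>V\<^esub> v"
              using q v v' mem s by (simp add: V.smult_r_distr V.smult_assoc1[symmetric])
            then have "(v' \<ominus>\<^bsub>V\<^esub> q \<odot>\<^bsub>V\<^esub> v) \<oplus>\<^bsub>V\<^esub> q \<odot>\<^bsub>V\<^esub> u = c \<odot>\<^bsub>V\<^esub> s \<oplus>\<^bsub>V\<^esub> (v' \<ominus>\<^bsub>V\<^esub> q \<odot>\<^bsub>V\<^esub> v \<oplus>\<^bsub>V\<^esub> q \<odot>\<^bsub>V\<^esub> v)"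
              using q v v' mem s by (simp del: V.diff_add_cancel add: V.M.a_ac)
            also have "\<dots> = u'" using q v v' mem s by simp
            finally show ?thesis using q v v' mem s N u u' V.sub_mem by (simp add: V.diff_eq_iff)
          qed
          moreover have "\<dots> \<in> ?W" using v v' q by (intro V.sub_diff[OF W] V.sub_smult[OF W]) auto
          moreover have "u' \<ominus>\<^bsub>V\<^esub> q \<odot>\<^bsub>V\<^esub> u \<in> N'" using u u' q N by (intro V.sub_diff V.sub_smult) auto
          ultimately have "u' \<ominus>\<^bsub>V\<^esub> q \<odot>\<^bsub>V\<^esub> u \<in> N" using eq by auto
          then have "u' \<ominus>\<^bsub>V\<^esub> q \<odot>\<^bsub>V\<^esub> u \<oplus>\<^bsub>V\<^esub> q \<odot>\<^bsub>V\<^esub> u \<in> N" using u q N by (intro V.sub_add V.sub_smult) auto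
          then show "u' \<in> N" using u u' q N V.sub_mem by simp
        qed
        then show False using N by auto
      qed
      then have "\<not> N' \<subseteq> ?W" using N eq by auto
      then show ?thesis using \<open>N \<subseteq> ?W\<close> eq by (simp add: len'_def)
    qed
    then show ?case by blast
  qed
  moreover obtain S where "finite S" "S \<subseteq> carrier V" "mspan K V S = carrier V"
    using assms(3) V.fin_gen_iff by auto
  ultimately show ?thesis using V.sub_subset unfolding fin_len_def by metis
qed

lemma fin_len_sub:
  assumes "left_module R M" "fin_len R M" "submodule H R M"
  shows "fin_len R (M\<lparr>carrier := H\<rparr>)"
proof -
  interpret M: left_module R M by fact
  obtain len :: "'c set \<Rightarrow> nat" where "\<forall>N N'. submodule N R M \<longrightarrow> submodule N' R M \<longrightarrow> N \<subset> N' \<longrightarrow> len N < len N'"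
    using assms(2) unfolding fin_len_def by blast
  then show ?thesis unfolding fin_len_def by (intro exI[of _ len]) (simp add: M.sub_sub[OF assms(3)])
qed

lemma fin_len_max:
  assumes "left_module R M" "fin_len R M" "P N" "submodule N R M"
  shows "\<exists>N. submodule N R M \<and> P N \<and> (\<forall>N'. submodule N' R M \<longrightarrow> N \<subset> N' \<longrightarrow> \<not> P N')"
proof -
  interpret M: left_module R M by fact
  obtain len :: "'c set \<Rightarrow> nat" where len: "\<And>N N'. submodule N R M \<Longrightarrow> submodule N' R M \<Longrightarrow> N \<subset> N' \<Longrightarrow> len N < len N'"
    using assms(2) unfolding fin_len_def by blast
  have "len N' \<le> len (carrier M)" if "submodule N' R M" for N'
    using len[OF that M.carrier_submodule] M.sub_subset[OF that] by (metis less_imp_le order_refl psubsetI)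
  then have "\<exists>N. (submodule N R M \<and> P N) \<and> (\<forall>N'. (submodule N' R M \<and> P N') \<longrightarrow> len N' \<le> len N)"
    using assms(3,4) by (intro ex_has_greatest_nat[of _ N _ "Suc (len (carrier M))"]) (auto simp: less_Suc_eq_le)
  then show ?thesis using len by (meson linorder_not_le)
qed

lemma fin_len_min:
  assumes "fin_len R M" "P N" "submodule N R M"
  shows "\<exists>N. submodule N R M \<and> P N \<and> (\<forall>N'. submodule N' R M \<longrightarrow> N' \<subset> N \<longrightarrow> \<not> P N')"
proof -
  obtain len :: "'c set \<Rightarrow> nat" where len: "\<And>N N'. submodule N R M \<Longrightarrow> submodule N' R M \<Longrightarrow> N \<subset> N' \<Longrightarrow> len N < len N'"
    using assms(1) unfolding fin_len_def by blast
  have "\<exists>N. (submodule N R M \<and> P N) \<and> (\<forall>N'. (submodule N' R M \<and> P N') \<longrightarrow> len N \<le> len N')"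
    using assms(2,3) by (intro ex_has_least_nat[of _ N]) auto
  then show ?thesis using len by (meson linorder_not_le)
qed

text \<open>A maximal finitely generated submodule contains every element, as adjoining one keeps it
  finitely generated. Submodules of finitely generated modules are finitely generated for this
  reason.\<close>

lemma fin_len_fin_gen:
  assumes "left_module R M" "fin_len R M" shows "fin_gen R M"
proof -
  interpret M: left_module R M by fact
  let ?P = "\<lambda>N. \<exists>S. finite S \<and> S \<subseteq> carrier M \<and> N = mspan R M S"
  have "?P (mspan R M {})" by blast
  then obtain N where N: "submodule N R M" "?P N" "\<forall>N'. submodule N' R M \<longrightarrow> N \<subset> N' \<longrightarrow> \<not> ?P N'"
    using fin_len_max[OF assms, of ?P "mspan R M {}"] M.mspan_submodule[of "{}"] by auto
  then obtain S where S: "finite S" "S \<subseteq> carrier M" "N = mspan R M S" by auto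
  have "x \<in> N" if x: "x \<in> carrier M" for x
  proof (rule ccontr)
    assume "x \<notin> N"
    moreover have "insert x S \<subseteq> mspan R M (insert x S)" by (rule M.mspan_superset)
    moreover have sub: "submodule (mspan R M (insert x S)) R M" using x S by (intro M.mspan_submodule) auto
    ultimately have "N \<subset> mspan R M (insert x S)" using S(3) M.mspan_least[of "mspan R M (insert x S)" S] by auto
    then show False using N(3) sub S x by blast
  qed
  then have "mspan R M S = carrier M" using S M.sub_subset[OF N(1)] by auto
  then show ?thesis using M.fin_gen_iff S by auto
qed

section \<open>Finite-dimensional algebras\<close>

lemma module_left_module: "module R M \<Longrightarrow> left_module R M"
  by (intro left_module.intro left_module_axioms.intro) (simp_all add: module_def module_axioms_def cring_def)

locale fdalg =
  fixes K :: "'k ring" and L :: "('k, 'a) module"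
  assumes fd: "fd_algebra K L"

sublocale fdalg \<subseteq> K: field K using fd by (simp add: fd_algebra_def)
sublocale fdalg \<subseteq> R: ring L using fd by (simp add: fd_algebra_def)
sublocale fdalg \<subseteq> KL: left_module K L using fd by (simp add: fd_algebra_def module_left_module)

definition rsc :: "('k, 'a) module \<Rightarrow> ('a, 'm) module \<Rightarrow> ('k, 'm) module" where
  "rsc L M = \<lparr>carrier = carrier M, monoid.mult = monoid.mult M, monoid.one = monoid.one M,
     ring.zero = ring.zero M, ring.add = ring.add M, smult = \<lambda>c x. (c \<odot>\<^bsub>L\<^esub> \<one>\<^bsub>L\<^esub>) \<odot>\<^bsub>M\<^esub> x\<rparr>"

lemma rsc_simps [simp]: "carrier (rsc L M) = carrier M" "\<zero>\<^bsub>rsc L M\<^esub> = \<zero>\<^bsub>M\<^esub>"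
  "ring.add (rsc L M) = ring.add M" "c \<odot>\<^bsub>rsc L M\<^esub> x = (c \<odot>\<^bsub>L\<^esub> \<one>\<^bsub>L\<^esub>) \<odot>\<^bsub>M\<^esub> x"
  by (simp_all add: rsc_def)

context fdalg begin

abbreviation sc where "sc c \<equiv> c \<odot>\<^bsub>L\<^esub> \<one>\<^bsub>L\<^esub>"

lemma smult_mult: "c \<in> carrier K \<Longrightarrow> x \<in> carrier L \<Longrightarrow> y \<in> carrier L \<Longrightarrow> (c \<odot>\<^bsub>L\<^esub> x) \<otimes>\<^bsub>L\<^esub> y = c \<odot>\<^bsub>L\<^esub> (x \<otimes>\<^bsub>L\<^esub> y)"
  and mult_smult: "c \<in> carrier K \<Longrightarrow> x \<in> carrier L \<Longrightarrow> y \<in> carrier L \<Longrightarrow> x \<otimes>\<^bsub>L\<^esub> (c \<odot>\<^bsub>L\<^esub> y) = c \<odot>\<^bsub>L\<^esub> (x \<otimes>\<^bsub>L\<^esub> y)"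
  using fd by (auto simp: fd_algebra_def)

lemma sc_closed [simp, intro]: "c \<in> carrier K \<Longrightarrow> sc c \<in> carrier L" by simp

lemma sc_mult [simp]: "c \<in> carrier K \<Longrightarrow> a \<in> carrier L \<Longrightarrow> sc c \<otimes>\<^bsub>L\<^esub> a = c \<odot>\<^bsub>L\<^esub> a"
  and mult_sc [simp]: "c \<in> carrier K \<Longrightarrow> a \<in> carrier L \<Longrightarrow> a \<otimes>\<^bsub>L\<^esub> sc c = c \<odot>\<^bsub>L\<^esub> a"
  by (simp_all add: smult_mult mult_smult)

lemma rsc_module: assumes "left_module L M" shows "left_module K (rsc L M)"
proof -
  interpret M: left_module L M by fact
  have "abelian_group (rsc L M)"
  proof (rule abelian_groupI)
    fix x assume "x \<in> carrier (rsc L M)"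
    then show "\<exists>y\<in>carrier (rsc L M). y \<oplus>\<^bsub>rsc L M\<^esub> x = \<zero>\<^bsub>rsc L M\<^esub>"
      by (auto simp: M.M.l_neg intro!: bexI[of _ "\<ominus>\<^bsub>M\<^esub> x"])
  qed (auto simp: M.M.a_ac)
  then show ?thesis
    by (intro left_module.intro K.ring_axioms left_module_axioms.intro)
      (auto simp: KL.smult_l_distr M.smult_l_distr M.smult_r_distr M.smult_assoc1[symmetric] KL.smult_assoc1 simp del: mult_sc)
qed

lemma lin_sc:
  assumes "left_module L M" "c \<in> carrier K"
  shows "lin L M M (\<lambda>x. sc c \<odot>\<^bsub>M\<^esub> x)"
proof -
  interpret M: left_module L M by fact
  show ?thesis
    by (rule linI) (use assms in \<open>auto simp: M.smult_r_distr M.smult_assoc1[symmetric]\<close>)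
qed

lemma submodule_rsc:
  assumes "left_module L M" "submodule U L M" shows "submodule U K (rsc L M)"
proof -
  interpret M: left_module L M by fact
  interpret V: left_module K "rsc L M" using rsc_module assms by blast
  show ?thesis
    by (rule V.submoduleI) (use assms in \<open>auto intro: M.sub_mem M.sub_zero M.sub_add M.sub_smult\<close>)
qed

text \<open>The products of generators of \<open>L\<close> over \<open>K\<close> with generators of
  \<open>M\<close> over \<open>L\<close> span \<open>M\<close> over \<open>K\<close>.\<close>

lemma fgm_rsc: assumes "fgm L M" shows "fgm K (rsc L M)"
proof -
  interpret M: left_module L M using assms by (simp add: fgm_def)
  interpret V: left_module K "rsc L M" by (rule rsc_module) unfold_locales
  obtain S where S: "finite S" "S \<subseteq> carrier M" "mspan L M S = carrier M"
    using assms M.fin_gen_iff by (auto simp: fgm_def)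
  obtain B where B: "finite B" "B \<subseteq> carrier L" "mspan K L B = carrier L"
    using fd KL.fin_gen_iff by (auto simp: fd_algebra_def)
  define T where "T = (\<lambda>(b, s). b \<odot>\<^bsub>M\<^esub> s) ` (B \<times> S)"
  have T: "finite T" "T \<subseteq> carrier (rsc L M)" using S B by (auto simp: T_def)
  let ?W = "mspan K (rsc L M) T"
  have W: "submodule ?W K (rsc L M)" by (rule V.mspan_submodule[OF T(2)])
  have 1: "l \<odot>\<^bsub>M\<^esub> s \<in> ?W" if "l \<in> carrier L" "s \<in> S" for l s
  proof -
    have "submodule {l \<in> carrier L. l \<odot>\<^bsub>M\<^esub> s \<in> ?W} K L"
    proof (rule vimage_submodule[OF KL.left_module_axioms V.left_module_axioms _ W])
      show "lin K L (rsc L M) (\<lambda>l. l \<odot>\<^bsub>M\<^esub> s)"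
        using S that by (intro linI) (auto simp: M.smult_l_distr M.smult_assoc1[symmetric] subset_iff)
    qed
    moreover have "B \<subseteq> {l \<in> carrier L. l \<odot>\<^bsub>M\<^esub> s \<in> ?W}"
      using B that V.mspan_superset[of T] by (auto simp: T_def)
    ultimately have "mspan K L B \<subseteq> {l \<in> carrier L. l \<odot>\<^bsub>M\<^esub> s \<in> ?W}" by (rule KL.mspan_least)
    then show ?thesis using that B by auto
  qed
  \<comment> \<open>Since \<open>?W\<close> is only known to be a subspace, the elements all of
    whose \<open>L\<close>-multiples lie in \<open>?W\<close> are considered; these form an
    \<open>L\<close>-submodule.\<close>
  have "submodule {x \<in> carrier M. \<forall>l\<in>carrier L. l \<odot>\<^bsub>M\<^esub> x \<in> ?W} L M"
  proof (rule M.submoduleI)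
    fix a x assume "a \<in> carrier L" "x \<in> {x \<in> carrier M. \<forall>l\<in>carrier L. l \<odot>\<^bsub>M\<^esub> x \<in> ?W}"
    then show "a \<odot>\<^bsub>M\<^esub> x \<in> {x \<in> carrier M. \<forall>l\<in>carrier L. l \<odot>\<^bsub>M\<^esub> x \<in> ?W}"
      by (auto simp: M.smult_assoc1[symmetric])
  qed (use V.sub_zero[OF W] V.sub_add[OF W] in \<open>auto simp: M.smult_r_distr\<close>)
  moreover have "S \<subseteq> {x \<in> carrier M. \<forall>l\<in>carrier L. l \<odot>\<^bsub>M\<^esub> x \<in> ?W}" using S 1 by auto
  ultimately have "mspan L M S \<subseteq> {x \<in> carrier M. \<forall>l\<in>carrier L. l \<odot>\<^bsub>M\<^esub> x \<in> ?W}" by (rule M.mspan_least)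
  then have "\<forall>x\<in>carrier M. \<one>\<^bsub>L\<^esub> \<odot>\<^bsub>M\<^esub> x \<in> ?W" unfolding S(3) by blast
  then have "carrier (rsc L M) \<subseteq> ?W" by auto
  then have "?W = carrier (rsc L M)" using V.sub_subset[OF W] by auto
  then show ?thesis using V.fin_gen_iff T V.left_module_axioms by (auto simp: fgm_def)
qed

lemma fgm_fin_len: assumes "fgm L M" shows "fin_len L M"
proof -
  have "fgm K (rsc L M)" by (rule fgm_rsc[OF assms])
  then have "fin_len K (rsc L M)" by (intro fin_len_field K.field_axioms) (auto simp: fgm_def)
  then obtain len :: "'b set \<Rightarrow> nat" where
    "\<forall>N N'. submodule N K (rsc L M) \<longrightarrow> submodule N' K (rsc L M) \<longrightarrow> N \<subset> N' \<longrightarrow> len N < len N'"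
    unfolding fin_len_def by blast
  then show ?thesis unfolding fin_len_def
    by (intro exI[of _ len]) (simp add: submodule_rsc[OF fgm_module[OF assms]])
qed

lemma fgm_sub: assumes "fgm L M" "submodule U L M" shows "fgm L (M\<lparr>carrier := U\<rparr>)"
proof -
  interpret M: left_module L M using assms by (simp add: fgm_def)
  have "fin_len L (M\<lparr>carrier := U\<rparr>)" "left_module L (M\<lparr>carrier := U\<rparr>)"
    using fin_len_sub[OF _ fgm_fin_len] assms M.sub_module by (auto simp: fgm_def)
  then show ?thesis using fin_len_fin_gen by (auto simp: fgm_def)
qed

text \<open>Coordinates with respect to a finite spanning set are chosen and need not be unique;
  injectivity only requires that an element can be recovered from them. Numbering the spanning set
  turns coordinate families into functions on \<open>nat\<close>.\<close>

lemma ex_embed: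
  fixes M :: "('a, 'm) module"
  assumes "fgm L M" shows "\<exists>j :: 'm \<Rightarrow> nat \<Rightarrow> 'k. inj_on j (carrier M)"
proof -
  interpret V: left_module K "rsc L M" using fgm_rsc[OF assms] by (simp add: fgm_def)
  obtain S where S: "finite S" "S \<subseteq> carrier (rsc L M)"
    "\<forall>x\<in>carrier (rsc L M). \<exists>c\<in>S \<rightarrow> carrier K. x = (\<Oplus>\<^bsub>rsc L M\<^esub>s\<in>S. c s \<odot>\<^bsub>rsc L M\<^esub> s)"
    using fgm_rsc[OF assms] by (auto simp: fgm_def fin_gen_def)
  then obtain c where c: "\<forall>x\<in>carrier M. c x \<in> S \<rightarrow> carrier K \<and> x = (\<Oplus>\<^bsub>rsc L M\<^esub>s\<in>S. c x s \<odot>\<^bsub>rsc L M\<^esub> s)"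
    using bchoice[of "carrier M" "\<lambda>x c. c \<in> S \<rightarrow> carrier K \<and> x = (\<Oplus>\<^bsub>rsc L M\<^esub>s\<in>S. c s \<odot>\<^bsub>rsc L M\<^esub> s)"]
    unfolding rsc_simps(1) Bex_def by blast
  obtain h :: "'m \<Rightarrow> nat" where h: "inj_on h S" using finite_imp_inj_to_nat_seg[OF S(1)] by auto
  have "inj_on (\<lambda>x n. c x (inv_into S h n)) (carrier M)"
  proof (rule inj_onI)
    fix x y assume x: "x \<in> carrier M" and y: "y \<in> carrier M" and "(\<lambda>n. c x (inv_into S h n)) = (\<lambda>n. c y (inv_into S h n))"
    then have "c x s = c y s" if "s \<in> S" for s using that h by (metis inv_into_f_f)
    then have "(\<Oplus>\<^bsub>rsc L M\<^esub>s\<in>S. c x s \<odot>\<^bsub>rsc L M\<^esub> s) = (\<Oplus>\<^bsub>rsc L M\<^esub>s\<in>S. c y s \<odot>\<^bsub>rsc L M\<^esub> s)"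
      using y c S by (intro V.M.add.finprod_cong') (auto intro!: V.smult_closed[simplified])
    then show "x = y" using c x y by metis
  qed
  then show ?thesis by blast
qed

text \<open>Cosets cannot serve as elements, because the quotient must have its carrier in
  \<open>nat \<Rightarrow> 'k\<close>. A representative is picked in each coset and embedded by
  \<open>j\<close>.\<close>

lemma ex_quotient:
  fixes M :: "('a, 'm) module"
  assumes "fgm L M" "submodule U L M"
  obtains Q :: "('k, 'a) fdmod" and p where "Q \<in> fgmod L" "lin L M Q p"
    "p ` carrier M = carrier Q" "lker M Q p = U"
proof -
  interpret M: left_module L M using assms by (simp add: fgm_def)
  obtain j :: "'m \<Rightarrow> nat \<Rightarrow> 'k" where j: "inj_on j (carrier M)" using ex_embed[OF assms(1)] by blast
  \<comment> \<open>The predicate under the choice operator depends on \<open>x\<close> only through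
    its coset, so congruent elements receive the same representative.\<close>
  define rep where "rep x = (SOME y. y \<in> carrier M \<and> x \<ominus>\<^bsub>M\<^esub> y \<in> U)" for x
  have rep: "rep x \<in> carrier M" "x \<ominus>\<^bsub>M\<^esub> rep x \<in> U" if "x \<in> carrier M" for x
    using someI[of "\<lambda>y. y \<in> carrier M \<and> x \<ominus>\<^bsub>M\<^esub> y \<in> U" x] that M.sub_zero[OF assms(2)] by (auto simp: rep_def)
  have "rep x = rep y \<longleftrightarrow> x \<ominus>\<^bsub>M\<^esub> y \<in> U" if xy: "x \<in> carrier M" "y \<in> carrier M" for x y
  proof
    assume "rep x = rep y"
    then have "x \<ominus>\<^bsub>M\<^esub> rep x \<in> U" "y \<ominus>\<^bsub>M\<^esub> rep x \<in> U" using rep(2)[OF xy(1)] rep(2)[OF xy(2)] by simp_all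
    then have "(x \<ominus>\<^bsub>M\<^esub> rep x) \<ominus>\<^bsub>M\<^esub> (y \<ominus>\<^bsub>M\<^esub> rep x) \<in> U" by (rule M.sub_diff[OF assms(2)])
    also have "(x \<ominus>\<^bsub>M\<^esub> rep x) \<ominus>\<^bsub>M\<^esub> (y \<ominus>\<^bsub>M\<^esub> rep x) = x \<ominus>\<^bsub>M\<^esub> y"
      using xy rep by (simp add: M.diff_diff_right)
    finally show "x \<ominus>\<^bsub>M\<^esub> y \<in> U" .
  next
    assume u: "x \<ominus>\<^bsub>M\<^esub> y \<in> U"
    have "x \<ominus>\<^bsub>M\<^esub> z \<in> U \<longleftrightarrow> y \<ominus>\<^bsub>M\<^esub> z \<in> U" if z: "z \<in> carrier M" for z
    proof
      assume "x \<ominus>\<^bsub>M\<^esub> z \<in> U"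
      then have "(x \<ominus>\<^bsub>M\<^esub> z) \<ominus>\<^bsub>M\<^esub> (x \<ominus>\<^bsub>M\<^esub> y) \<in> U" using u by (rule M.sub_diff[OF assms(2)])
      also have "(x \<ominus>\<^bsub>M\<^esub> z) \<ominus>\<^bsub>M\<^esub> (x \<ominus>\<^bsub>M\<^esub> y) = y \<ominus>\<^bsub>M\<^esub> z"
        using xy z by (simp add: M.diff_diff_left)
      finally show "y \<ominus>\<^bsub>M\<^esub> z \<in> U" .
    next
      assume "y \<ominus>\<^bsub>M\<^esub> z \<in> U"
      then have "(x \<ominus>\<^bsub>M\<^esub> y) \<oplus>\<^bsub>M\<^esub> (y \<ominus>\<^bsub>M\<^esub> z) \<in> U" using u M.sub_add[OF assms(2)] by auto
      also have "(x \<ominus>\<^bsub>M\<^esub> y) \<oplus>\<^bsub>M\<^esub> (y \<ominus>\<^bsub>M\<^esub> z) = x \<ominus>\<^bsub>M\<^esub> z"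
        using xy z by (simp add: M.diff_add_diff)
      finally show "x \<ominus>\<^bsub>M\<^esub> z \<in> U" .
    qed
    then have "(\<lambda>z. z \<in> carrier M \<and> x \<ominus>\<^bsub>M\<^esub> z \<in> U) = (\<lambda>z. z \<in> carrier M \<and> y \<ominus>\<^bsub>M\<^esub> z \<in> U)" by auto
    then show "rep x = rep y" unfolding rep_def by (rule arg_cong)
  qed
  moreover have "j (rep x) = j (rep y) \<longleftrightarrow> rep x = rep y" if "x \<in> carrier M" "y \<in> carrier M" for x y
    using inj_on_eq_iff[OF j rep(1)[OF that(1)] rep(1)[OF that(2)]] .
  ultimately have f: "\<And>x y. x \<in> carrier M \<Longrightarrow> y \<in> carrier M \<Longrightarrow> j (rep x) = j (rep y) \<longleftrightarrow> x \<ominus>\<^bsub>M\<^esub> y \<in> U" by simp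
  note q = push_quotient[OF M.left_module_axioms assms(2), of "\<lambda>x. j (rep x)", OF f]
  have "push M (\<lambda>x. j (rep x)) \<in> fgmod L"
    using fgm_surj[OF assms(1) q(1,2,4)] by (simp add: fgmod_iff)
  then show ?thesis using that q(2,3,4) by blast
qed

lemma ex_copy:
  fixes M :: "('a, 'm) module"
  assumes "fgm L M"
  obtains Q :: "('k, 'a) fdmod" and f where "Q \<in> fgmod L" "lin L M Q f" "bij_betw f (carrier M) (carrier Q)"
proof -
  interpret M: left_module L M using assms by (simp add: fgm_def)
  obtain Q :: "('k, 'a) fdmod" and p where Q: "Q \<in> fgmod L" "lin L M Q p"
    "p ` carrier M = carrier Q" "lker M Q p = {\<zero>\<^bsub>M\<^esub>}"
    using ex_quotient[OF assms M.zero_submodule] by blast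
  have "left_module L Q" using Q(1) by (simp add: fgmod_def)
  then have "inj_on p (carrier M)" using Q(4) lin_inj_iff[OF M.left_module_axioms _ Q(2)] by blast
  then show ?thesis using that Q by (auto simp: bij_betw_def)
qed

lemma ex_biproduct:
  assumes "fgm L M" "fgm L N"
  obtains S :: "('k, 'a) fdmod" and i1 i2 p1 p2 where "S \<in> fgmod L" "biproduct L S M N i1 i2 p1 p2"
proof -
  interpret M: left_module L M using assms by (simp add: fgm_def)
  interpret N: left_module L N using assms by (simp add: fgm_def)
  interpret D: left_module L "dsum M N" by (rule dsum_module[OF M.left_module_axioms N.left_module_axioms])
  obtain S :: "('k, 'a) fdmod" and f where S: "S \<in> fgmod L" "lin L (dsum M N) S f"
    "bij_betw f (carrier (dsum M N)) (carrier S)" using ex_copy[OF fgm_dsum[OF assms]] by blast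
  obtain g where g: "lin L S (dsum M N) g" "\<forall>x\<in>carrier (dsum M N). g (f x) = x" "\<forall>y\<in>carrier S. f (g y) = y"
    using lin_inverse[OF D.left_module_axioms S(2,3)] by blast
  have b: "biproduct L (dsum M N) M N (\<lambda>x. (x, \<zero>\<^bsub>N\<^esub>)) (\<lambda>y. (\<zero>\<^bsub>M\<^esub>, y)) fst snd"
    by (rule dsum_biproduct[OF M.left_module_axioms N.left_module_axioms])
  then have l: "lin L M (dsum M N) (\<lambda>x. (x, \<zero>\<^bsub>N\<^esub>))" "lin L N (dsum M N) (\<lambda>y. (\<zero>\<^bsub>M\<^esub>, y))"
    "lin L (dsum M N) M fst" "lin L (dsum M N) N snd" by (auto simp: biproduct_def)
  note l' = l[THEN lin_closed]
  have "biproduct L S M N (\<lambda>x. f (x, \<zero>\<^bsub>N\<^esub>)) (\<lambda>y. f (\<zero>\<^bsub>M\<^esub>, y)) (\<lambda>z. fst (g z)) (\<lambda>z. snd (g z))"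
    unfolding biproduct_def
  proof (intro conjI ballI)
    fix z assume z: "z \<in> carrier S"
    then have gz: "g z \<in> carrier (dsum M N)" by (rule lin_closed[OF g(1)])
    then have "f (fst (g z), \<zero>\<^bsub>N\<^esub>) \<oplus>\<^bsub>S\<^esub> f (\<zero>\<^bsub>M\<^esub>, snd (g z)) =
        f ((fst (g z), \<zero>\<^bsub>N\<^esub>) \<oplus>\<^bsub>dsum M N\<^esub> (\<zero>\<^bsub>M\<^esub>, snd (g z)))"
      using l' by (simp add: lin_add[OF S(2)])
    also have "\<dots> = z" using b gz z g(3) by (simp add: biproduct_def)
    finally show "f (fst (g z), \<zero>\<^bsub>N\<^esub>) \<oplus>\<^bsub>S\<^esub> f (\<zero>\<^bsub>M\<^esub>, snd (g z)) = z" .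
  qed (use lin_comp[OF l(1) S(2)] lin_comp[OF l(2) S(2)] lin_comp[OF g(1) l(3)] lin_comp[OF g(1) l(4)]
      g(2) l' in auto)
  then show ?thesis using that S(1) by blast
qed

end

section \<open>Direct summands and Fitting's lemma\<close>

lemma complementary_iff:
  assumes "left_module R M"
  shows "complementary R M N N' \<longleftrightarrow> submodule N R M \<and> submodule N' R M \<and> N \<inter> N' = {\<zero>\<^bsub>M\<^esub>} \<and>
    (\<forall>x\<in>carrier M. \<exists>n\<in>N. \<exists>n'\<in>N'. x = n \<oplus>\<^bsub>M\<^esub> n')"
proof -
  interpret M: left_module R M by fact
  have "N <+>\<^bsub>M\<^esub> N' = carrier M \<longleftrightarrow> (\<forall>x\<in>carrier M. \<exists>n\<in>N. \<exists>n'\<in>N'. x = n \<oplus>\<^bsub>M\<^esub> n')"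
    if "submodule N R M" "submodule N' R M"
  proof -
    have "N <+>\<^bsub>M\<^esub> N' \<subseteq> carrier M"
      using M.sub_mem[OF that(1)] M.sub_mem[OF that(2)] by (auto simp: set_add_def')
    then have "N <+>\<^bsub>M\<^esub> N' = carrier M \<longleftrightarrow> carrier M \<subseteq> N <+>\<^bsub>M\<^esub> N'" by blast
    also have "\<dots> \<longleftrightarrow> (\<forall>x\<in>carrier M. \<exists>n\<in>N. \<exists>n'\<in>N'. x = n \<oplus>\<^bsub>M\<^esub> n')" unfolding set_add_def' by blast
    finally show ?thesis .
  qed
  then show ?thesis unfolding complementary_def by blast
qed

lemma complementary_sym:
  assumes "left_module R M" "complementary R M N N'" shows "complementary R M N' N"
proof -
  interpret M: left_module R M by fact
  have s: "submodule N R M" "submodule N' R M" and i: "N \<inter> N' = {\<zero>\<^bsub>M\<^esub>}"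
    and ex: "\<forall>x\<in>carrier M. \<exists>n\<in>N. \<exists>n'\<in>N'. x = n \<oplus>\<^bsub>M\<^esub> n'" using assms(2) by (auto simp: complementary_iff[OF assms(1)])
  have "\<exists>n'\<in>N'. \<exists>n\<in>N. x = n' \<oplus>\<^bsub>M\<^esub> n" if x: "x \<in> carrier M" for x
  proof -
    obtain n n' where n: "n \<in> N" "n' \<in> N'" "x = n \<oplus>\<^bsub>M\<^esub> n'" using ex x by blast
    then have "x = n' \<oplus>\<^bsub>M\<^esub> n" using M.sub_mem[OF s(1)] M.sub_mem[OF s(2)] M.M.a_comm by simp
    then show ?thesis using n by blast
  qed
  then show ?thesis using s i by (auto simp: complementary_iff[OF assms(1)])
qed

lemma complementary_projection:
  assumes "left_module R M" "complementary R M N N'"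
  obtains \<pi> where "lin R M M \<pi>" "\<And>x. x \<in> carrier M \<Longrightarrow> \<pi> x \<in> N" "\<And>x. x \<in> carrier M \<Longrightarrow> x \<ominus>\<^bsub>M\<^esub> \<pi> x \<in> N'"
    "\<And>x. x \<in> N \<Longrightarrow> \<pi> x = x" "\<And>x. x \<in> N' \<Longrightarrow> \<pi> x = \<zero>\<^bsub>M\<^esub>"
proof -
  interpret M: left_module R M by fact
  have s: "submodule N R M" "submodule N' R M" and i: "N \<inter> N' = {\<zero>\<^bsub>M\<^esub>}"
    and ex: "\<forall>x\<in>carrier M. \<exists>n\<in>N. \<exists>n'\<in>N'. x = n \<oplus>\<^bsub>M\<^esub> n'" using assms(2) by (auto simp: complementary_iff[OF assms(1)])
  note mem = M.sub_mem[OF s(1)] M.sub_mem[OF s(2)]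
  have "\<exists>n. n \<in> N \<and> x \<ominus>\<^bsub>M\<^esub> n \<in> N'" if "x \<in> carrier M" for x
  proof -
    obtain n n' where n: "n \<in> N" "n' \<in> N'" "x = n \<oplus>\<^bsub>M\<^esub> n'" using ex \<open>x \<in> carrier M\<close> by blast
    then have "x \<ominus>\<^bsub>M\<^esub> n = n'" using mem by (simp add: M.M.a_comm[of n n'])
    then show ?thesis using n by blast
  qed
  then obtain \<pi> where \<pi>: "\<And>x. x \<in> carrier M \<Longrightarrow> \<pi> x \<in> N \<and> x \<ominus>\<^bsub>M\<^esub> \<pi> x \<in> N'" by metis
  have uniq: "\<pi> x = n" if "x \<in> carrier M" "n \<in> N" "x \<ominus>\<^bsub>M\<^esub> n \<in> N'" for x n
  proof -
    have "(x \<ominus>\<^bsub>M\<^esub> n) \<ominus>\<^bsub>M\<^esub> (x \<ominus>\<^bsub>M\<^esub> \<pi> x) = \<pi> x \<ominus>\<^bsub>M\<^esub> n"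
      using that \<pi>[of x] mem by (simp add: M.diff_diff_left)
    then have "\<pi> x \<ominus>\<^bsub>M\<^esub> n \<in> N \<inter> N'" using that \<pi> M.sub_diff s by (metis IntI)
    then show ?thesis using i that \<pi> mem by auto
  qed
  have "lin R M M \<pi>"
  proof (rule linI)
    fix x assume x: "x \<in> carrier M" then show "\<pi> x \<in> carrier M" using \<pi> mem by blast
    fix y assume y: "y \<in> carrier M"
    have "(x \<oplus>\<^bsub>M\<^esub> y) \<ominus>\<^bsub>M\<^esub> (\<pi> x \<oplus>\<^bsub>M\<^esub> \<pi> y) = (x \<ominus>\<^bsub>M\<^esub> \<pi> x) \<oplus>\<^bsub>M\<^esub> (y \<ominus>\<^bsub>M\<^esub> \<pi> y)"
      using x y \<pi> mem by (simp add: M.M.minus_eq M.M.minus_add M.M.a_ac)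
    then show "\<pi> (x \<oplus>\<^bsub>M\<^esub> y) = \<pi> x \<oplus>\<^bsub>M\<^esub> \<pi> y" using x y \<pi> s M.sub_add by (intro uniq) auto
  next
    fix a x assume a: "a \<in> carrier R" "x \<in> carrier M"
    then have "a \<odot>\<^bsub>M\<^esub> x \<ominus>\<^bsub>M\<^esub> a \<odot>\<^bsub>M\<^esub> \<pi> x = a \<odot>\<^bsub>M\<^esub> (x \<ominus>\<^bsub>M\<^esub> \<pi> x)" using \<pi> mem by (simp add: M.smult_r_diff)
    then show "\<pi> (a \<odot>\<^bsub>M\<^esub> x) = a \<odot>\<^bsub>M\<^esub> \<pi> x" using a \<pi> s M.sub_smult by (intro uniq) auto
  qed
  moreover have "\<pi> x = x" if "x \<in> N" for x using that mem M.sub_zero[OF s(2)] by (intro uniq) auto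
  moreover have "\<pi> x = \<zero>\<^bsub>M\<^esub>" if "x \<in> N'" for x using that mem M.sub_zero[OF s(1)] by (intro uniq) auto
  ultimately show ?thesis using that[of \<pi>] \<pi> by blast
qed

text \<open>For a splitting it is enough that \<open>r\<close> after \<open>s\<close> is an
  automorphism instead of the identity. Local endomorphism rings supply splittings in precisely this
  form.\<close>

lemma complementary_retract:
  assumes "left_module R Y" "left_module R M" "lin R Y M s" "lin R M Y r"
    and bij: "bij_betw (\<lambda>y. r (s y)) (carrier Y) (carrier Y)"
  shows "complementary R M (s ` carrier Y) (lker M Y r)"
    "lin R Y (M\<lparr>carrier := s ` carrier Y\<rparr>) s" "bij_betw s (carrier Y) (s ` carrier Y)"
proof -
  interpret Y: left_module R Y by fact
  interpret M: left_module R M by fact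
  have inj: "inj_on (\<lambda>y. r (s y)) (carrier Y)" and surj: "(\<lambda>y. r (s y)) ` carrier Y = carrier Y"
    using bij by (auto simp: bij_betw_def)
  have "submodule (s ` carrier Y) R M" using image_submodule assms(1-3) Y.carrier_submodule by blast
  moreover have "submodule (lker M Y r) R M" using ker_submodule assms by blast
  moreover have "s ` carrier Y \<inter> lker M Y r = {\<zero>\<^bsub>M\<^esub>}"
  proof -
    have z: "s \<zero>\<^bsub>Y\<^esub> = \<zero>\<^bsub>M\<^esub>" "r \<zero>\<^bsub>M\<^esub> = \<zero>\<^bsub>Y\<^esub>" using lin_zero assms by blast+
    then have "y = \<zero>\<^bsub>Y\<^esub>" if "y \<in> carrier Y" "r (s y) = \<zero>\<^bsub>Y\<^esub>" for y
      using inj_onD[OF inj, of y "\<zero>\<^bsub>Y\<^esub>"] that by simp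
    then show ?thesis using z by (auto intro!: image_eqI[of _ s "\<zero>\<^bsub>Y\<^esub>"])
  qed
  moreover have "\<exists>n\<in>s ` carrier Y. \<exists>n'\<in>lker M Y r. x = n \<oplus>\<^bsub>M\<^esub> n'" if x: "x \<in> carrier M" for x
  proof -
    obtain y where y: "y \<in> carrier Y" "r (s y) = r x" using surj lin_closed[OF assms(4) x] by (metis imageE)
    have sy: "s y \<in> carrier M" using y lin_closed[OF assms(3)] by blast
    then have "r (x \<ominus>\<^bsub>M\<^esub> s y) = \<zero>\<^bsub>Y\<^esub>" using y x lin_minus[OF assms(2,1,4)] lin_closed[OF assms(4)] by simp
    then show ?thesis using y x sy
      by (intro bexI[of _ "s y"] bexI[of _ "x \<ominus>\<^bsub>M\<^esub> s y"]) auto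
  qed
  ultimately show "complementary R M (s ` carrier Y) (lker M Y r)" by (simp add: complementary_iff[OF assms(2)])
  show "lin R Y (M\<lparr>carrier := s ` carrier Y\<rparr>) s" using assms(3) by (rule lin_corestrict) auto
  show "bij_betw s (carrier Y) (s ` carrier Y)" using inj by (auto simp: bij_betw_def inj_on_def)
qed

lemma complementary_trans:
  assumes "left_module R M" "complementary R M N N'" "complementary R (M\<lparr>carrier := N\<rparr>) Y Y'"
  shows "\<exists>Z. complementary R M Y Z"
proof -
  interpret M: left_module R M by fact
  have N: "submodule N R M" using assms by (simp add: complementary_def)
  interpret N: left_module R "M\<lparr>carrier := N\<rparr>" by (rule M.sub_module[OF N])
  have Y: "submodule Y R (M\<lparr>carrier := N\<rparr>)" using assms by (simp add: complementary_def)
  then have Y': "submodule Y R M" "Y \<subseteq> N" by (auto simp: M.sub_sub[OF N])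
  interpret Y: left_module R "M\<lparr>carrier := Y\<rparr>" by (rule M.sub_module[OF Y'(1)])
  obtain \<pi> where \<pi>: "lin R M M \<pi>" "\<And>x. x \<in> carrier M \<Longrightarrow> \<pi> x \<in> N" "\<And>x. x \<in> N \<Longrightarrow> \<pi> x = x"
    using complementary_projection[OF assms(1,2)] by metis
  obtain \<rho> where \<rho>: "lin R (M\<lparr>carrier := N\<rparr>) (M\<lparr>carrier := N\<rparr>) \<rho>" "\<And>x. x \<in> N \<Longrightarrow> \<rho> x \<in> Y" "\<And>x. x \<in> Y \<Longrightarrow> \<rho> x = x"
    by (rule complementary_projection[OF N.left_module_axioms assms(3)], rule that, assumption) simp_all
  have "lin R M (M\<lparr>carrier := N\<rparr>) \<pi>" using \<pi> by (intro lin_corestrict)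
  moreover have "lin R (M\<lparr>carrier := N\<rparr>) (M\<lparr>carrier := Y\<rparr>) \<rho>"
    using \<rho>(1,2) lin_corestrict[OF \<rho>(1), of Y] by simp
  ultimately have "lin R M (M\<lparr>carrier := Y\<rparr>) (\<lambda>x. \<rho> (\<pi> x))" by (rule lin_comp)
  moreover have "bij_betw (\<lambda>y. \<rho> (\<pi> y)) Y Y"
    using \<pi> \<rho> Y'(2) by (subst bij_betw_cong[of _ _ "\<lambda>x. x"]) (auto simp: bij_betw_def)
  ultimately have "complementary R M ((\<lambda>x. x) ` Y) (lker M (M\<lparr>carrier := Y\<rparr>) (\<lambda>x. \<rho> (\<pi> x)))"
    using complementary_retract(1)[OF Y.left_module_axioms assms(1) lin_incl, of "\<lambda>x. \<rho> (\<pi> x)"]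
      M.sub_subset[OF Y'(1)] by simp
  then show ?thesis by auto
qed

section \<open>Fitting's lemma and endomorphisms of indecomposable modules\<close>

lemma lin_funpow: "lin R M M a \<Longrightarrow> lin R M M (a ^^ n)"
  by (induction n) (auto simp: id_def lin_id comp_def intro: lin_comp)

text \<open>The images of the powers form a descending chain, the kernels an ascending one, and both
  become stationary. The exponent is required to be positive so that later a factor \<open>a\<close>
  can be split off from the power.\<close>

lemma fitting:
  assumes "left_module R M" "fin_len R M" "lin R M M a"
  obtains n where "n > 0" "complementary R M ((a ^^ n) ` carrier M) (lker M M (a ^^ n))"
proof -
  interpret M: left_module R M by fact
  have im: "submodule ((a ^^ n) ` carrier M) R M" for n
    using image_submodule[OF assms(1,1) lin_funpow[OF assms(3)] M.carrier_submodule] .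
  have ker: "submodule (lker M M (a ^^ n)) R M" for n
    using ker_submodule[OF assms(1,1) lin_funpow[OF assms(3)]] .
  note cl = lin_closed[OF lin_funpow[OF assms(3)]]
  have "\<exists>N. submodule N R M \<and> (\<exists>n. N = (a ^^ n) ` carrier M) \<and>
      (\<forall>N'. submodule N' R M \<longrightarrow> N' \<subset> N \<longrightarrow> \<not> (\<exists>n. N' = (a ^^ n) ` carrier M))"
    by (rule fin_len_min[OF assms(2) _ im[of 0]]) blast
  then obtain i where "\<forall>N'. submodule N' R M \<longrightarrow> N' \<subset> (a ^^ i) ` carrier M \<longrightarrow> \<not> (\<exists>n. N' = (a ^^ n) ` carrier M)"
    by auto
  then have i: "\<not> (a ^^ m) ` carrier M \<subset> (a ^^ i) ` carrier M" for m using im[of m] by blast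
  have "\<exists>N. submodule N R M \<and> (\<exists>n. N = lker M M (a ^^ n)) \<and>
      (\<forall>N'. submodule N' R M \<longrightarrow> N \<subset> N' \<longrightarrow> \<not> (\<exists>n. N' = lker M M (a ^^ n)))"
    by (rule fin_len_max[OF assms(1,2) _ ker[of 0]]) blast
  then obtain j where "\<forall>N'. submodule N' R M \<longrightarrow> lker M M (a ^^ j) \<subset> N' \<longrightarrow> \<not> (\<exists>n. N' = lker M M (a ^^ n))"
    by auto
  then have j: "\<not> lker M M (a ^^ j) \<subset> lker M M (a ^^ m)" for m using ker[of m] by blast
  have imle: "(a ^^ (m + l)) ` carrier M \<subseteq> (a ^^ m) ` carrier M" for m l
    using cl by (auto simp: funpow_add)
  have kerle: "lker M M (a ^^ m) \<subseteq> lker M M (a ^^ (l + m))" for m l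
    using lin_zero[OF assms(1,1) lin_funpow[OF assms(3)]] by (auto simp: funpow_add)
  have im_eq: "(a ^^ m) ` carrier M = (a ^^ i) ` carrier M" if "m \<ge> i" for m
    using imle[of i "m - i"] i[of m] that by (simp add: psubset_eq)
  have ker_eq: "lker M M (a ^^ m) = lker M M (a ^^ j)" if "m \<ge> j" for m
    using kerle[of j "m - j"] j[of m] that by (simp add: psubset_eq)
  \<comment> \<open>The chains are stationary from \<open>i\<close> and from \<open>j\<close> on;
    the successor makes \<open>n\<close> positive.\<close>
  define n where "n = Suc (i + j)"
  have "(a ^^ n) ` carrier M \<inter> lker M M (a ^^ n) = {\<zero>\<^bsub>M\<^esub>}"
  proof safe
    fix x assume x: "x \<in> carrier M" "(a ^^ n) ((a ^^ n) x) = \<zero>\<^bsub>M\<^esub>"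
    then have "x \<in> lker M M (a ^^ (n + n))" by (auto simp: funpow_add)
    also have "\<dots> = lker M M (a ^^ n)" using ker_eq[of n] ker_eq[of "n + n"] by (simp add: n_def)
    finally show "(a ^^ n) x = \<zero>\<^bsub>M\<^esub>" by simp
  qed (use M.sub_zero[OF im] M.sub_zero[OF ker] in auto)
  moreover have "\<exists>u\<in>(a ^^ n) ` carrier M. \<exists>v\<in>lker M M (a ^^ n). x = u \<oplus>\<^bsub>M\<^esub> v" if x: "x \<in> carrier M" for x
  proof -
    have "(a ^^ n) x \<in> (a ^^ (n + n)) ` carrier M" 
      using im_eq[of n] im_eq[of "n + n"] x by (auto simp: n_def)
    then obtain y where y: "y \<in> carrier M" "(a ^^ n) x = (a ^^ n) ((a ^^ n) y)" by (auto simp: funpow_add)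
    then have "x \<ominus>\<^bsub>M\<^esub> (a ^^ n) y \<in> lker M M (a ^^ n)"
      using x cl lin_minus[OF assms(1,1) lin_funpow[OF assms(3)]] by simp
    then show ?thesis using x y cl
      by (intro bexI[of _ "(a ^^ n) y"] bexI[of _ "x \<ominus>\<^bsub>M\<^esub> (a ^^ n) y"]) auto
  qed
  ultimately have "complementary R M ((a ^^ n) ` carrier M) (lker M M (a ^^ n))"
    using im ker by (simp add: complementary_iff[OF assms(1)])
  then show ?thesis using that[of n] by (simp add: n_def)
qed

lemma indecomposable_endo:
  assumes "left_module R M" "fin_len R M" "lin R M M a" "indecomposable R M"
  shows "bij_betw a (carrier M) (carrier M) \<or> (\<exists>n. \<forall>x\<in>carrier M. (a ^^ n) x = \<zero>\<^bsub>M\<^esub>)"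
proof -
  interpret M: left_module R M by fact
  obtain n where n: "n > 0" "complementary R M ((a ^^ n) ` carrier M) (lker M M (a ^^ n))"
    using fitting[OF assms(1-3)] by blast
  then obtain m where m: "n = Suc m" by (cases n) auto
  note cl = lin_closed[OF assms(3)] lin_closed[OF lin_funpow[OF assms(3)]]
  consider "(a ^^ n) ` carrier M = {\<zero>\<^bsub>M\<^esub>}" | "lker M M (a ^^ n) = {\<zero>\<^bsub>M\<^esub>}"
    using assms(4) n(2) by (auto simp: indecomposable_def)
  then show ?thesis
  proof cases
    case 1 then show ?thesis by auto
  next
    case 2
    have "inj_on a (carrier M)"
    proof (subst lin_inj_iff[OF assms(1,1,3)], safe)
      fix x assume x: "x \<in> carrier M" "a x = \<zero>\<^bsub>M\<^esub>"
      then have "(a ^^ n) x = \<zero>\<^bsub>M\<^esub>"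
        using lin_zero[OF assms(1,1) lin_funpow[OF assms(3)]] by (simp add: m funpow_Suc_right del: funpow.simps)
      then show "x = \<zero>\<^bsub>M\<^esub>" using 2 x by auto
    qed
    moreover have "x \<in> a ` carrier M" if x: "x \<in> carrier M" for x
    proof -
      obtain y where "y \<in> carrier M" "x = (a ^^ n) y \<oplus>\<^bsub>M\<^esub> \<zero>\<^bsub>M\<^esub>"
        using n(2) x unfolding complementary_iff[OF assms(1)] 2 by auto
      then have "x = a ((a ^^ m) y)" "(a ^^ m) y \<in> carrier M" using cl by (auto simp: m)
      then show ?thesis by blast
    qed
    ultimately show ?thesis using cl by (auto simp: bij_betw_def)
  qed
qed

text \<open>After composition with the inverse \<open>g\<close> of the sum, two endomorphisms add up
  to the identity. If neither were invertible, both would be nilpotent by Fitting's lemma.\<close>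

lemma indecomposable_local:
  assumes "left_module R M" "fin_len R M" "indecomposable R M" "lin R M M a" "lin R M M b"
    and bij: "bij_betw (\<lambda>x. a x \<oplus>\<^bsub>M\<^esub> b x) (carrier M) (carrier M)"
  shows "bij_betw a (carrier M) (carrier M) \<or> bij_betw b (carrier M) (carrier M)"
proof -
  interpret M: left_module R M by fact
  obtain g where g: "lin R M M g" "\<forall>x\<in>carrier M. g (a x \<oplus>\<^bsub>M\<^esub> b x) = x" "\<forall>y\<in>carrier M. a (g y) \<oplus>\<^bsub>M\<^esub> b (g y) = y"
    "bij_betw g (carrier M) (carrier M)"
    using lin_inverse[OF assms(1) lin_sum[OF assms(1,4,5)] bij] by blast
  note cl = lin_closed[OF assms(4)] lin_closed[OF assms(5)] lin_closed[OF g(1)]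
  have eq: "g (a x) \<oplus>\<^bsub>M\<^esub> g (b x) = x" if "x \<in> carrier M" for x
    using g(2) that cl lin_add[OF g(1)] by auto
  have cancel: "bij_betw c (carrier M) (carrier M)" if "bij_betw (\<lambda>x. g (c x)) (carrier M) (carrier M)" "lin R M M c" for c
  proof -
    have "bij_betw (\<lambda>x. (a (g (c x)) \<oplus>\<^bsub>M\<^esub> b (g (c x)))) (carrier M) (carrier M)"
      using bij_betw_trans[OF that(1) bij] by (simp add: comp_def)
    moreover have "a (g (c x)) \<oplus>\<^bsub>M\<^esub> b (g (c x)) = c x" if "x \<in> carrier M" for x
      using g(3) lin_closed[OF \<open>lin R M M c\<close> that] by blast
    ultimately show ?thesis using bij_betw_cong[of "carrier M" "\<lambda>x. a (g (c x)) \<oplus>\<^bsub>M\<^esub> b (g (c x))" c] by simp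
  qed
  have ga: "lin R M M (\<lambda>x. g (a x))" and gb: "lin R M M (\<lambda>x. g (b x))"
    using lin_comp assms g(1) by blast+
  show ?thesis
  proof (rule ccontr)
    assume "\<not> ?thesis"
    then have nb: "\<not> bij_betw (\<lambda>x. g (a x)) (carrier M) (carrier M)" "\<not> bij_betw (\<lambda>x. g (b x)) (carrier M) (carrier M)"
      using cancel assms by blast+
    obtain n where n: "\<forall>x\<in>carrier M. ((\<lambda>x. g (a x)) ^^ n) x = \<zero>\<^bsub>M\<^esub>"
      using indecomposable_endo[OF assms(1,2) ga assms(3)] nb by blast
    obtain m where m: "\<forall>x\<in>carrier M. ((\<lambda>x. g (b x)) ^^ m) x = \<zero>\<^bsub>M\<^esub>"
      using indecomposable_endo[OF assms(1,2) gb assms(3)] nb by blast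
    \<comment> \<open>What \<open>g b\<close> kills is fixed by \<open>g a\<close> and by all its
      powers, one of which is zero. So \<open>g b\<close> is injective as well as nilpotent, which
      leaves only the zero module.\<close>
    have inj: "x = \<zero>\<^bsub>M\<^esub>" if x: "x \<in> carrier M" "g (b x) = \<zero>\<^bsub>M\<^esub>" for x
    proof -
      have "g (a x) = x" using eq[OF x(1)] x cl by simp
      then have "((\<lambda>x. g (a x)) ^^ k) x = x" for k by (induction k) auto
      then show ?thesis using n x by metis
    qed
    have "x = \<zero>\<^bsub>M\<^esub>" if "x \<in> carrier M" "((\<lambda>x. g (b x)) ^^ k) x = \<zero>\<^bsub>M\<^esub>" for x k
      using that by (induction k) (use inj lin_closed[OF lin_funpow[OF gb]] in auto)
    then have "carrier M = {\<zero>\<^bsub>M\<^esub>}" using m by auto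
    then show False using assms(3) by (simp add: indecomposable_def)
  qed
qed

section \<open>Projective covers\<close>

text \<open>Recursion over an initial segment of \<open>nat\<close> unfolds without the closure
  conditions of \<open>finsum\<close>, which suits expansions in indexed dual bases.\<close>

primrec lsum :: "('m, 'y) ring_scheme \<Rightarrow> (nat \<Rightarrow> 'm) \<Rightarrow> nat \<Rightarrow> 'm" where
  "lsum M f 0 = \<zero>\<^bsub>M\<^esub>"
| "lsum M f (Suc n) = lsum M f n \<oplus>\<^bsub>M\<^esub> f n"

lemma lsum_closed:
  assumes "left_module R M" "\<And>i. i < n \<Longrightarrow> f i \<in> carrier M" shows "lsum M f n \<in> carrier M"
proof -
  interpret M: left_module R M by fact
  show ?thesis using assms(2) by (induction n) auto
qed

lemma lsum_cong: "(\<And>i. i < n \<Longrightarrow> f i = g i) \<Longrightarrow> lsum M f n = lsum M g n"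
  by (induction n) auto

lemma lin_lsum:
  assumes "left_module R M" "left_module R N" "lin R M N h" "\<And>i. i < n \<Longrightarrow> f i \<in> carrier M"
  shows "h (lsum M f n) = lsum N (\<lambda>i. h (f i)) n"
  using assms(4)
  by (induction n) (auto simp: lin_zero[OF assms(1-3)] lin_add[OF assms(3) lsum_closed[OF assms(1)]])

lemma lsum_add:
  assumes "left_module R M" "\<And>i. i < n \<Longrightarrow> f i \<in> carrier M" "\<And>i. i < n \<Longrightarrow> g i \<in> carrier M"
  shows "lsum M (\<lambda>i. f i \<oplus>\<^bsub>M\<^esub> g i) n = lsum M f n \<oplus>\<^bsub>M\<^esub> lsum M g n"
proof -
  interpret M: left_module R M by fact
  show ?thesis using assms(2,3)
    by (induction n) (simp_all add: M.M.a_ac lsum_closed[OF assms(1)])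
qed

lemma lsum_smult:
  assumes "left_module R M" "\<And>i. i < n \<Longrightarrow> f i \<in> carrier M" "a \<in> carrier R"
  shows "a \<odot>\<^bsub>M\<^esub> lsum M f n = lsum M (\<lambda>i. a \<odot>\<^bsub>M\<^esub> f i) n"
proof -
  interpret M: left_module R M by fact
  show ?thesis using assms(2,3)
    by (induction n) (simp_all add: M.smult_r_distr lsum_closed[OF assms(1)])
qed

lemma lsum_zero:
  assumes "left_module R M" "\<And>i. i < n \<Longrightarrow> f i = \<zero>\<^bsub>M\<^esub>" shows "lsum M f n = \<zero>\<^bsub>M\<^esub>"
proof -
  interpret M: left_module R M by fact
  show ?thesis using assms(2) by (induction n) auto
qed

lemma regular_simps [simp]: "carrier (regular_module L) = carrier L" "\<zero>\<^bsub>regular_module L\<^esub> = \<zero>\<^bsub>L\<^esub>"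
  "ring.add (regular_module L) = ring.add L" "a \<odot>\<^bsub>regular_module L\<^esub> x = a \<otimes>\<^bsub>L\<^esub> x"
  by (simp_all add: regular_module_def)

text \<open>The dual basis lemma: the projectives in \<open>fgmod\<close> are exactly the modules
  with such a system, by \<open>dual_basis_projective\<close> and
  \<open>projective_dual_basis\<close>. It replaces free modules and tensor products in all
  computations below.\<close>

definition dual_basis where
  "dual_basis L P n p c \<longleftrightarrow> (\<forall>i<n. p i \<in> carrier P \<and> lin L P (regular_module L) (c i)) \<and>
     (\<forall>x\<in>carrier P. lsum P (\<lambda>i. c i x \<odot>\<^bsub>P\<^esub> p i) n = x)"

lemma a_kernel_eq: "a_kernel M N f = lker M N f"
  by (simp add: a_kernel_def')

lemma projective_lift:
  assumes "projective L P" "M \<in> fgmod L" "N \<in> fgmod L" "lin L M N g" "g ` carrier M = carrier N" "lin L P N f"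
  shows "\<exists>h. lin L P M h \<and> (\<forall>x\<in>carrier P. g (h x) = f x)"
proof -
  have lm: "left_module L P" "left_module L M" using assms by (auto simp: projective_def fgmod_def)
  have "restrict g (carrier M) \<in> mod_hom L M N" "restrict f (carrier P) \<in> mod_hom L P N"
    using assms lm restrict_mod_hom by blast+
  moreover have "restrict g (carrier M) ` carrier M = carrier N" using assms(5) by auto
  ultimately obtain h where h: "h \<in> mod_hom L P M"
    "\<forall>x\<in>carrier P. restrict g (carrier M) (h x) = restrict f (carrier P) x"
    using assms(1-3) unfolding projective_def by blast
  then have "lin L P M h" by (blast dest: mod_hom_lin)
  then show ?thesis using h(2) lin_closed[of L P M h] by auto
qed

lemma projectiveI:
  assumes "P \<in> fgmod L"
    and "\<And>M N g f. M \<in> fgmod L \<Longrightarrow> N \<in> fgmod L \<Longrightarrow> lin L M N g \<Longrightarrow> g ` carrier M = carrier N \<Longrightarrow> lin L P N f \<Longrightarrow>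
      \<exists>h. lin L P M h \<and> (\<forall>x\<in>carrier P. g (h x) = f x)"
  shows "projective L P"
  unfolding projective_def
proof (intro conjI ballI impI assms(1))
  fix M N g f assume *: "M \<in> fgmod L" "N \<in> fgmod L" "g \<in> mod_hom L M N" "f \<in> mod_hom L P N" "g ` carrier M = carrier N"
  then obtain h where h: "lin L P M h" "\<forall>x\<in>carrier P. g (h x) = f x" using assms(2) mod_hom_lin by metis
  have "restrict h (carrier P) \<in> mod_hom L P M"
    using assms(1) h by (intro restrict_mod_hom) (auto simp: fgmod_def)
  then show "\<exists>h\<in>mod_hom L P M. \<forall>x\<in>carrier P. g (h x) = f x" using h(2) by (intro bexI) auto
qed

lemma projective_retract:
  assumes "projective L P" "Y \<in> fgmod L" "lin L Y P s" "lin L P Y r" "\<And>y. y \<in> carrier Y \<Longrightarrow> r (s y) = y"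
  shows "projective L Y"
proof (rule projectiveI[OF assms(2)])
  fix M N g f assume *: "M \<in> fgmod L" "N \<in> fgmod L" "lin L M N g" "g ` carrier M = carrier N" "lin L Y N f"
  obtain h where h: "lin L P M h" "\<forall>x\<in>carrier P. g (h x) = f (r x)"
    using projective_lift[OF assms(1) *(1-4) lin_comp[OF assms(4) *(5)]] by blast
  then have "lin L Y M (\<lambda>y. h (s y))" "\<forall>x\<in>carrier Y. g (h (s x)) = f x"
    using lin_comp[OF assms(3)] lin_closed[OF assms(3)] assms(5) by auto
  then show "\<exists>h. lin L Y M h \<and> (\<forall>x\<in>carrier Y. g (h x) = f x)" by blast
qed

lemma dual_basis_lin:
  assumes "left_module L P" "left_module L M" "dual_basis L P n p c" "\<And>i. i < n \<Longrightarrow> m i \<in> carrier M"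
  shows "lin L P M (\<lambda>x. lsum M (\<lambda>i. c i x \<odot>\<^bsub>M\<^esub> m i) n)"
proof -
  interpret P: left_module L P by fact
  interpret M: left_module L M by fact
  have c: "lin L P (regular_module L) (c i)" if "i < n" for i using assms(3) that by (auto simp: dual_basis_def)
  note c' = c[THEN lin_closed, simplified] c[THEN lin_add, simplified] c[THEN lin_smult, simplified]
  show ?thesis
  proof (rule linI)
    fix x assume x: "x \<in> carrier P"
    show "lsum M (\<lambda>i. c i x \<odot>\<^bsub>M\<^esub> m i) n \<in> carrier M"
      using x c' assms(4) by (intro lsum_closed[OF assms(2)]) auto
    fix y assume y: "y \<in> carrier P"
    have "lsum M (\<lambda>i. c i (x \<oplus>\<^bsub>P\<^esub> y) \<odot>\<^bsub>M\<^esub> m i) n = lsum M (\<lambda>i. c i x \<odot>\<^bsub>M\<^esub> m i \<oplus>\<^bsub>M\<^esub> c i y \<odot>\<^bsub>M\<^esub> m i) n"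
      using x y c' assms(4) by (intro lsum_cong) (simp add: M.smult_l_distr)
    also have "\<dots> = lsum M (\<lambda>i. c i x \<odot>\<^bsub>M\<^esub> m i) n \<oplus>\<^bsub>M\<^esub> lsum M (\<lambda>i. c i y \<odot>\<^bsub>M\<^esub> m i) n"
      using x y c' assms(4) by (intro lsum_add[OF assms(2)]) auto
    finally show "lsum M (\<lambda>i. c i (x \<oplus>\<^bsub>P\<^esub> y) \<odot>\<^bsub>M\<^esub> m i) n = lsum M (\<lambda>i. c i x \<odot>\<^bsub>M\<^esub> m i) n \<oplus>\<^bsub>M\<^esub> lsum M (\<lambda>i. c i y \<odot>\<^bsub>M\<^esub> m i) n" .
  next
    fix a x assume ax: "a \<in> carrier L" "x \<in> carrier P"
    have "lsum M (\<lambda>i. c i (a \<odot>\<^bsub>P\<^esub> x) \<odot>\<^bsub>M\<^esub> m i) n = lsum M (\<lambda>i. a \<odot>\<^bsub>M\<^esub> (c i x \<odot>\<^bsub>M\<^esub> m i)) n"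
      using ax c' assms(4) by (intro lsum_cong) (simp add: M.smult_assoc1)
    also have "\<dots> = a \<odot>\<^bsub>M\<^esub> lsum M (\<lambda>i. c i x \<odot>\<^bsub>M\<^esub> m i) n"
      using ax c' assms(4) by (intro lsum_smult[OF assms(2), symmetric]) auto
    finally show "lsum M (\<lambda>i. c i (a \<odot>\<^bsub>P\<^esub> x) \<odot>\<^bsub>M\<^esub> m i) n = a \<odot>\<^bsub>M\<^esub> lsum M (\<lambda>i. c i x \<odot>\<^bsub>M\<^esub> m i) n" .
  qed
qed

lemma dual_basis_expand:
  assumes "left_module L P" "left_module L M" "dual_basis L P n p c" "lin L P M f" "x \<in> carrier P"
  shows "f x = lsum M (\<lambda>i. c i x \<odot>\<^bsub>M\<^esub> f (p i)) n"
proof -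
  interpret P: left_module L P by fact
  have c: "p i \<in> carrier P" "c i x \<in> carrier L" if "i < n" for i
    using assms(3,5) that lin_closed[of L P "regular_module L" "c i" x] by (auto simp: dual_basis_def)
  have "f x = f (lsum P (\<lambda>i. c i x \<odot>\<^bsub>P\<^esub> p i) n)" using assms by (simp add: dual_basis_def)
  also have "\<dots> = lsum M (\<lambda>i. f (c i x \<odot>\<^bsub>P\<^esub> p i)) n" using c by (intro lin_lsum[OF assms(1,2,4)]) auto
  also have "\<dots> = lsum M (\<lambda>i. c i x \<odot>\<^bsub>M\<^esub> f (p i)) n" using c by (intro lsum_cong lin_smult[OF assms(4)]) auto
  finally show ?thesis .
qed

lemma dual_basis_projective:
  assumes "P \<in> fgmod L" "dual_basis L P n p c" shows "projective L P"
proof (rule projectiveI[OF assms(1)])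
  fix M N g f assume *: "M \<in> fgmod L" "N \<in> fgmod L" "lin L M N g" "g ` carrier M = carrier N" "lin L P N f"
  have lm: "left_module L P" "left_module L M" "left_module L N" using assms * by (auto simp: fgmod_def)
  have "\<exists>m. m \<in> carrier M \<and> g m = f (p i)" if "i < n" for i
  proof -
    have "f (p i) \<in> g ` carrier M" using lin_closed[OF *(5)] assms(2) that *(4) by (simp add: dual_basis_def)
    then show ?thesis by auto
  qed
  then obtain m where m: "\<And>i. i < n \<Longrightarrow> m i \<in> carrier M \<and> g (m i) = f (p i)" by metis
  interpret M: left_module L M by fact
  have "g (lsum M (\<lambda>i. c i x \<odot>\<^bsub>M\<^esub> m i) n) = f x" if x: "x \<in> carrier P" for x
  proof -
    have c: "c i x \<in> carrier L" if "i < n" for i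
      using assms(2) that x lin_closed[of L P "regular_module L" "c i" x] by (auto simp: dual_basis_def)
    have "g (lsum M (\<lambda>i. c i x \<odot>\<^bsub>M\<^esub> m i) n) = lsum N (\<lambda>i. g (c i x \<odot>\<^bsub>M\<^esub> m i)) n"
      using c m by (intro lin_lsum[OF lm(2,3) *(3)]) auto
    also have "\<dots> = lsum N (\<lambda>i. c i x \<odot>\<^bsub>N\<^esub> f (p i)) n"
      using c m by (intro lsum_cong) (simp add: lin_smult[OF *(3)])
    also have "\<dots> = f x" by (rule dual_basis_expand[OF lm(1,3) assms(2) *(5) x, symmetric])
    finally show ?thesis .
  qed
  then show "\<exists>h. lin L P M h \<and> (\<forall>x\<in>carrier P. g (h x) = f x)"
    using dual_basis_lin[OF lm(1,2) assms(2), of m] m by (intro exI[of _ "\<lambda>x. lsum M (\<lambda>i. c i x \<odot>\<^bsub>M\<^esub> m i) n"]) auto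
qed

section \<open>Existence of projective covers and minimal presentations\<close>

context fdalg begin

lemma regular_module: "left_module L (regular_module L)"
proof -
  have "abelian_group (regular_module L)"
  proof (rule abelian_groupI)
    fix x assume "x \<in> carrier (regular_module L)"
    then show "\<exists>y\<in>carrier (regular_module L). y \<oplus>\<^bsub>regular_module L\<^esub> x = \<zero>\<^bsub>regular_module L\<^esub>"
      by (auto simp: R.l_neg intro!: bexI[of _ "\<ominus>\<^bsub>L\<^esub> x"])
  qed (auto simp: R.a_ac)
  then show ?thesis
    by (intro left_module.intro left_module_axioms.intro R.ring_axioms)
      (auto simp: R.l_distr R.r_distr R.m_assoc)
qed

lemma regular_fgm: "fgm L (regular_module L)"
proof -
  interpret RM: left_module L "regular_module L" by (rule regular_module)
  have "a \<in> mspan L (regular_module L) {\<one>\<^bsub>L\<^esub>}" if "a \<in> carrier L" for a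
    using RM.sub_smult[OF RM.mspan_submodule that, of "{\<one>\<^bsub>L\<^esub>}" "\<one>\<^bsub>L\<^esub>"] RM.mspan_superset[of "{\<one>\<^bsub>L\<^esub>}"] that by auto
  then have "mspan L (regular_module L) {\<one>\<^bsub>L\<^esub>} = carrier (regular_module L)"
    using RM.sub_subset[OF RM.mspan_submodule[of "{\<one>\<^bsub>L\<^esub>}"]] by auto
  then show ?thesis
    using RM.fin_gen_iff regular_module by (auto simp: fgm_def intro!: exI[of _ "{\<one>\<^bsub>L\<^esub>}"])
qed

lemma ex_dual_basis_regular:
  obtains F :: "('k, 'a) fdmod" and \<phi> where "F \<in> fgmod L" "lin L (regular_module L) F \<phi>"
    "bij_betw \<phi> (carrier L) (carrier F)"
  using ex_copy[OF regular_fgm] by (metis regular_simps(1))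

text \<open>One copy \<open>F\<close> of the regular module is added for every generator; the dual
  basis grows by one member each time.\<close>

lemma ex_dual_basis_surj:
  assumes "fgm L M"
  shows "\<exists>(P :: ('k, 'a) fdmod) n p c f. P \<in> fgmod L \<and> dual_basis L P n p c \<and> lin L P M f \<and> f ` carrier P = carrier M"
proof -
  interpret M: left_module L M using assms by (simp add: fgm_def)
  interpret RM: left_module L "regular_module L" by (rule regular_module)
  obtain F :: "('k, 'a) fdmod" and \<phi> where F: "F \<in> fgmod L" "lin L (regular_module L) F \<phi>"
    "bij_betw \<phi> (carrier L) (carrier F)" by (rule ex_dual_basis_regular)
  then interpret F: left_module L F by (simp add: fgmod_def)
  obtain \<psi> where \<psi>: "lin L F (regular_module L) \<psi>" "\<forall>x\<in>carrier L. \<psi> (\<phi> x) = x" "\<forall>y\<in>carrier F. \<phi> (\<psi> y) = y"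
    using lin_inverse[OF regular_module F(2)] F(3) by auto
  note \<psi>c = lin_closed[OF \<psi>(1), simplified] and \<phi>c = lin_closed[OF F(2), simplified]
  have \<phi>\<psi>: "\<psi> y \<odot>\<^bsub>F\<^esub> \<phi> \<one>\<^bsub>L\<^esub> = y" if "y \<in> carrier F" for y
    using lin_smult[OF F(2), of "\<psi> y" "\<one>\<^bsub>L\<^esub>"] that \<psi> \<psi>c by simp
  have "\<exists>(P :: ('k, 'a) fdmod) n p c f. P \<in> fgmod L \<and> dual_basis L P n p c \<and> lin L P M f \<and> S \<subseteq> f ` carrier P"
    if "finite S" "S \<subseteq> carrier M" for S
    using that
  proof (induction S rule: finite_induct)
    case empty
    \<comment> \<open>The induction starts with \<open>F\<close> and the zero map instead of the
      zero module.\<close>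
    have "dual_basis L F 1 (\<lambda>_. \<phi> \<one>\<^bsub>L\<^esub>) (\<lambda>_. \<psi>)"
      using \<phi>\<psi> \<psi> \<phi>c by (simp add: dual_basis_def)
    then show ?case using F(1) lin_const0[OF M.left_module_axioms] by blast
  next
    case (insert s S)
    then obtain P :: "('k, 'a) fdmod" and n p c f where P: "P \<in> fgmod L" "dual_basis L P n p c" "lin L P M f" "S \<subseteq> f ` carrier P"
      by auto
    interpret P: left_module L P using P by (simp add: fgmod_def)
    obtain P' :: "('k, 'a) fdmod" and i1 i2 p1 p2 where P': "P' \<in> fgmod L" "biproduct L P' P F i1 i2 p1 p2"
      by (rule ex_biproduct[of P F]) (use P(1) F(1) in \<open>auto simp: fgmod_iff\<close>)
    interpret P': left_module L P' using P' by (simp add: fgmod_def)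
    have l: "lin L P P' i1" "lin L F P' i2" "lin L P' P p1" "lin L P' F p2"
      and b: "\<And>x. x \<in> carrier P \<Longrightarrow> p1 (i1 x) = x" "\<And>y. y \<in> carrier F \<Longrightarrow> p2 (i2 y) = y"
        "\<And>y. y \<in> carrier F \<Longrightarrow> p1 (i2 y) = \<zero>\<^bsub>P\<^esub>" "\<And>y. y \<in> carrier P \<Longrightarrow> p2 (i1 y) = \<zero>\<^bsub>F\<^esub>"
        "\<And>z. z \<in> carrier P' \<Longrightarrow> i1 (p1 z) \<oplus>\<^bsub>P'\<^esub> i2 (p2 z) = z"
      using P'(2) by (auto simp: biproduct_def)
    note lc = l[THEN lin_closed]
    have pc: "p i \<in> carrier P" "lin L P (regular_module L) (c i)" if "i < n" for i
      using P(2) that by (auto simp: dual_basis_def)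
    \<comment> \<open>Indices below \<open>n\<close> belong to \<open>P\<close>, the last index
      \<open>n\<close> to the new copy \<open>F\<close>.\<close>
    let ?p = "\<lambda>i. if i < n then i1 (p i) else i2 (\<phi> \<one>\<^bsub>L\<^esub>)" and ?c = "\<lambda>i. if i < n then (\<lambda>x. c i (p1 x)) else (\<lambda>x. \<psi> (p2 x))"
    have "lsum P' (\<lambda>i. ?c i x \<odot>\<^bsub>P'\<^esub> ?p i) (Suc n) = x" if x: "x \<in> carrier P'" for x
    proof -
      have "lsum P' (\<lambda>i. ?c i x \<odot>\<^bsub>P'\<^esub> ?p i) n = lsum P' (\<lambda>i. c i (p1 x) \<odot>\<^bsub>P'\<^esub> i1 (p i)) n"
        by (rule lsum_cong) auto
      also have "\<dots> = i1 (p1 x)"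
        by (rule dual_basis_expand[OF P.left_module_axioms P'.left_module_axioms P(2) l(1) lc(3)[OF x], symmetric])
      finally have 1: "lsum P' (\<lambda>i. ?c i x \<odot>\<^bsub>P'\<^esub> ?p i) n = i1 (p1 x)" .
      have "\<psi> (p2 x) \<odot>\<^bsub>P'\<^esub> i2 (\<phi> \<one>\<^bsub>L\<^esub>) = i2 (p2 x)"
        using lin_smult[OF l(2), of "\<psi> (p2 x)" "\<phi> \<one>\<^bsub>L\<^esub>", symmetric] \<phi>\<psi> x \<psi>c \<phi>c lc by simp
      then show ?thesis using 1 b(5)[OF x] by simp
    qed
    moreover have "?p i \<in> carrier P' \<and> lin L P' (regular_module L) (?c i)" for i
      using lc \<phi>c pc lin_comp[OF l(3) pc(2)] lin_comp[OF l(4) \<psi>(1)] by auto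
    ultimately have db: "dual_basis L P' (Suc n) ?p ?c" unfolding dual_basis_def by blast
    have s: "s \<in> carrier M" using insert by auto
    have ls: "lin L F M (\<lambda>y. \<psi> y \<odot>\<^bsub>M\<^esub> s)"
      using s \<psi>c lin_add[OF \<psi>(1)] lin_smult[OF \<psi>(1)]
      by (intro linI) (auto simp: M.smult_l_distr M.smult_assoc1)
    let ?f = "\<lambda>z. f (p1 z) \<oplus>\<^bsub>M\<^esub> \<psi> (p2 z) \<odot>\<^bsub>M\<^esub> s"
    have "lin L P' M ?f"
      using lin_sum[OF M.left_module_axioms lin_comp[OF l(3) P(3)] lin_comp[OF l(4) ls]] .
    moreover have "?f (i1 x) = f x" if "x \<in> carrier P" for x
      using that b lin_zero[OF F.left_module_axioms regular_module \<psi>(1)] s lin_closed[OF P(3)] by simp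
    then have "f x \<in> ?f ` carrier P'" if "x \<in> carrier P" for x
      by (intro image_eqI[of _ ?f "i1 x"]) (use that lc in auto)
    then have "S \<subseteq> ?f ` carrier P'" using P(4) by blast
    moreover have "?f (i2 (\<phi> \<one>\<^bsub>L\<^esub>)) = s"
      using b \<phi>c \<psi> s lin_zero[OF P.left_module_axioms M.left_module_axioms P(3)] by simp
    then have "s \<in> ?f ` carrier P'"
      by (intro image_eqI[of _ ?f "i2 (\<phi> \<one>\<^bsub>L\<^esub>)"]) (use lc \<phi>c in auto)
    ultimately have f: "lin L P' M ?f" "insert s S \<subseteq> ?f ` carrier P'" by simp_all
    show ?case
      by (intro exI[of _ P'] exI[of _ "Suc n"] exI[of _ ?p] exI[of _ ?c] exI[of _ ?f] conjI P'(1) db f)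
  qed
  moreover obtain S where S: "finite S" "S \<subseteq> carrier M" "mspan L M S = carrier M"
    using assms M.fin_gen_iff by (auto simp: fgm_def)
  ultimately obtain P :: "('k, 'a) fdmod" and n p c f where P: "P \<in> fgmod L" "dual_basis L P n p c" "lin L P M f" "S \<subseteq> f ` carrier P"
    by metis
  interpret P: left_module L P using P by (simp add: fgmod_def)
  have im: "submodule (f ` carrier P) L M"
    by (rule image_submodule[OF P.left_module_axioms M.left_module_axioms P(3) P.carrier_submodule])
  have "f ` carrier P = carrier M" using M.mspan_least[OF im P(4)] S(3) M.sub_subset[OF im] by auto
  then show ?thesis using P by blast
qed

text \<open>A surjection from a module with a dual basis splits, and the dual basis is carried over
  along the splitting.\<close>

lemma projective_dual_basis:
  assumes "projective L P" shows "\<exists>n p c. dual_basis L P n p c"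
proof -
  have P: "P \<in> fgmod L" using assms by (simp add: projective_def)
  interpret P: left_module L P using P by (simp add: fgmod_def)
  obtain F :: "('k, 'a) fdmod" and n p c f where F: "F \<in> fgmod L" "dual_basis L F n p c" "lin L F P f" "f ` carrier F = carrier P"
    using ex_dual_basis_surj[of P] P by (auto simp: fgmod_iff)
  interpret F: left_module L F using F by (simp add: fgmod_def)
  obtain s where s: "lin L P F s" "\<forall>x\<in>carrier P. f (s x) = x"
    using projective_lift[OF assms F(1) P F(3,4) lin_id] by blast
  have pc: "p i \<in> carrier F" "lin L F (regular_module L) (c i)" if "i < n" for i
    using F(2) that by (auto simp: dual_basis_def)
  have "lsum P (\<lambda>i. c i (s x) \<odot>\<^bsub>P\<^esub> f (p i)) n = x" if "x \<in> carrier P" for x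
    using dual_basis_expand[OF F.left_module_axioms P.left_module_axioms F(2,3) lin_closed[OF s(1) that]] s(2) that by simp
  then have "dual_basis L P n (\<lambda>i. f (p i)) (\<lambda>i x. c i (s x))"
    unfolding dual_basis_def using pc lin_closed[OF F(3)] lin_comp[OF s(1) pc(2)] by blast
  then show ?thesis by blast
qed

text \<open>Given a projective mapping onto \<open>M\<close>, a direct summand of it that is minimal
  among those still mapping onto \<open>M\<close> is a projective cover. Minimality can only be
  tested on summands, so Fitting's lemma is needed to produce a summand inside an arbitrary
  submodule \<open>U\<close>.\<close>

lemma ex_projective_cover:
  assumes "M \<in> fgmod L" shows "\<exists>P g. projective_cover L P g M"
proof -
  interpret M: left_module L M using assms by (simp add: fgmod_def)
  obtain P :: "('k, 'a) fdmod" and n p c g where P: "P \<in> fgmod L" "dual_basis L P n p c" "lin L P M g" "g ` carrier P = carrier M"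
    using ex_dual_basis_surj[of M] assms by (auto simp: fgmod_iff)
  interpret P: left_module L P using P by (simp add: fgmod_def)
  have proj: "projective L P" using dual_basis_projective[OF P(1,2)] .
  have flP: "fin_len L P" using fgm_fin_len P(1) by (simp add: fgmod_iff)
  let ?Q = "\<lambda>N. (\<exists>N'. complementary L P N N') \<and> g ` N = carrier M"
  have "complementary L P (carrier P) {\<zero>\<^bsub>P\<^esub>}"
    using P.carrier_submodule P.zero_submodule by (auto simp: complementary_iff[OF P.left_module_axioms])
  then have "\<exists>N. submodule N L P \<and> ?Q N \<and> (\<forall>N'. submodule N' L P \<longrightarrow> N' \<subset> N \<longrightarrow> \<not> ?Q N')"
    using P(4) by (intro fin_len_min[OF flP _ P.carrier_submodule]) blast
  then obtain N N' where N: "submodule N L P" "complementary L P N N'" "g ` N = carrier M"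
    and min: "\<And>Y Z. submodule Y L P \<Longrightarrow> Y \<subset> N \<Longrightarrow> complementary L P Y Z \<Longrightarrow> g ` Y = carrier M \<Longrightarrow> False" by metis
  define P1 where "P1 = P\<lparr>carrier := N\<rparr>"
  have P1: "P1 \<in> fgmod L" unfolding P1_def using fgm_sub[of P N] P(1) N(1) by (simp add: fgmod_iff)
  then interpret P1: left_module L P1 by (simp add: fgmod_def)
  have cN: "carrier P1 = N" by (simp add: P1_def)
  obtain \<pi> where \<pi>: "lin L P P \<pi>" "\<And>x. x \<in> carrier P \<Longrightarrow> \<pi> x \<in> N" "\<And>x. x \<in> N \<Longrightarrow> \<pi> x = x"
    using complementary_projection[OF P.left_module_axioms N(2)] by metis
  have proj1: "projective L P1"
    by (rule projective_retract[OF proj P1, of "\<lambda>x. x" \<pi>])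
      (use \<pi> P.sub_subset[OF N(1)] in \<open>auto simp: P1_def intro!: lin_incl lin_corestrict\<close>)
  have g1: "lin L P1 M g" unfolding P1_def using P(3) P.sub_subset[OF N(1)] by (rule lin_restrict)
  have "superfluous L P1 (lker P1 M g)"
    unfolding superfluous_def
  proof (intro conjI allI impI)
    show "submodule (lker P1 M g) L P1" using ker_submodule[OF P1.left_module_axioms M.left_module_axioms g1] .
    fix U assume U: "submodule U L P1 \<and> lker P1 M g <+>\<^bsub>P1\<^esub> U = carrier P1"
    have Us: "submodule U L P" "U \<subseteq> N" using U P.sub_sub[OF N(1)] by (auto simp: P1_def)
    define PU where "PU = P\<lparr>carrier := U\<rparr>"
    have PU: "PU \<in> fgmod L" unfolding PU_def using fgm_sub[of P U] P(1) Us(1) by (simp add: fgmod_iff)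
    have gU: "lin L PU M g" unfolding PU_def using P(3) P.sub_subset[OF Us(1)] by (rule lin_restrict)
    have "carrier M \<subseteq> g ` U"
    proof
      fix y assume "y \<in> carrier M"
      then obtain x where x: "x \<in> N" "y = g x" using N(3) by auto
      then obtain v u where vu: "v \<in> lker P1 M g" "u \<in> U" "x = v \<oplus>\<^bsub>P1\<^esub> u"
      proof -
        have "x \<in> lker P1 M g <+>\<^bsub>P1\<^esub> U" using U x(1) cN by simp
        then show ?thesis using that unfolding set_add_def' by blast
      qed
      then have "g x = g v \<oplus>\<^bsub>M\<^esub> g u" using lin_add[OF g1] Us(2) cN by auto
      then have "g x = g u" using vu lin_closed[OF g1] Us(2) cN by auto
      then show "y \<in> g ` U" using x vu by auto
    qed
    then have gUs: "g ` carrier PU = carrier M" using lin_closed[OF gU] by (auto simp: PU_def)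
    obtain a where a: "lin L P1 PU a" "\<forall>x\<in>carrier P1. g (a x) = g x"
      using projective_lift[OF proj1 PU assms gU gUs g1] by blast
    have aU: "a x \<in> U" if "x \<in> N" for x using lin_closed[OF a(1)] that by (simp add: PU_def cN)
    have "P1\<lparr>carrier := U\<rparr> = PU" by (simp add: P1_def PU_def)
    then have a1: "lin L P1 P1 a" using a(1) Us(2) cN lin_decorestrict[where R=L and M=P1 and N=P1 and H=U and f=a] by simp
    have fl1: "fin_len L P1" using fgm_fin_len P1 by (simp add: fgmod_iff)
    \<comment> \<open>\<open>a\<close> maps into \<open>U\<close> and satisfies
      \<open>g a = g\<close>. Hence the image of its Fitting power is a summand inside
      \<open>U\<close> that still maps onto \<open>M\<close>, and minimality makes it all of
      \<open>N\<close>.\<close>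
    obtain n where n: "n > 0" "complementary L P1 ((a ^^ n) ` carrier P1) (lker P1 P1 (a ^^ n))"
      using fitting[OF P1.left_module_axioms fl1 a1] by blast
    let ?Y = "(a ^^ n) ` N"
    obtain Z where Z: "complementary L P ?Y Z"
      using complementary_trans[OF P.left_module_axioms N(2)] n(2) by (auto simp: P1_def)
    have akN: "(a ^^ k) x \<in> N \<and> g ((a ^^ k) x) = g x" if "x \<in> N" for x k
      using that by (induction k) (use a(2) lin_closed[OF a1] in \<open>auto simp: cN\<close>)
    have "g ` ?Y = g ` N" unfolding image_image using akN by (intro image_cong) auto
    then have "g ` ?Y = carrier M" using N(3) by simp
    moreover have YU: "?Y \<subseteq> U" using n(1) akN aU by (cases n) auto
    moreover have "submodule ?Y L P" using Z by (simp add: complementary_def)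
    ultimately have "\<not> ?Y \<subset> N" using min Z by blast
    then show "U = carrier P1" using YU Us(2) cN by blast
  qed
  moreover have "restrict g (carrier P1) \<in> mod_hom L P1 M" by (rule restrict_mod_hom[OF P1.left_module_axioms g1])
  moreover have "lker P1 M (restrict g (carrier P1)) = lker P1 M g" by auto
  moreover have "restrict g (carrier P1) ` carrier P1 = carrier M" using N(3) by (auto simp: cN)
  ultimately have "projective_cover L P1 (restrict g (carrier P1)) M"
    using proj1 by (simp add: projective_cover_def a_kernel_eq)
  then show ?thesis by blast
qed

lemma ex_min_proj_presentation:
  assumes "M \<in> fgmod L" shows "\<exists>P1 f P0 g. min_proj_presentation L M P1 f P0 g"
proof -
  obtain P0 g where P0: "projective_cover L P0 g M" using ex_projective_cover[OF assms] by blast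
  then have g: "P0 \<in> fgmod L" "lin L P0 M g" by (auto simp: projective_cover_def projective_def mod_hom_lin)
  then have "submodule (lker P0 M g) L P0" using assms ker_submodule[of L P0 M g] by (auto simp: fgmod_def)
  then have "P0\<lparr>carrier := a_kernel P0 M g\<rparr> \<in> fgmod L" using fgm_sub[of P0] g(1) by (simp add: fgmod_iff a_kernel_eq)
  then show ?thesis using ex_projective_cover P0 unfolding min_proj_presentation_def by blast
qed

end

section \<open>Linear functionals and spaces of homomorphisms\<close>

lemma lsum_swap:
  assumes "left_module R M" "\<And>i j. i < n \<Longrightarrow> j < m \<Longrightarrow> f i j \<in> carrier M"
  shows "lsum M (\<lambda>i. lsum M (f i) m) n = lsum M (\<lambda>j. lsum M (\<lambda>i. f i j) n) m"
  using assms(2)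
proof (induction n)
  case 0 show ?case by (simp add: lsum_zero[OF assms(1)])
next
  case (Suc n)
  have "lsum M (\<lambda>i. lsum M (f i) m) (Suc n) = lsum M (\<lambda>j. lsum M (\<lambda>i. f i j) n) m \<oplus>\<^bsub>M\<^esub> lsum M (f n) m"
    using Suc by simp
  also have "\<dots> = lsum M (\<lambda>j. lsum M (\<lambda>i. f i j) n \<oplus>\<^bsub>M\<^esub> f n j) m"
    using Suc.prems by (intro lsum_add[OF assms(1), symmetric] lsum_closed[OF assms(1)]) auto
  finally show ?case by simp
qed

definition self_module :: "'k ring \<Rightarrow> ('k, 'k) module" where
  "self_module K = \<lparr>carrier = carrier K, monoid.mult = monoid.mult K, monoid.one = monoid.one K,
     ring.zero = ring.zero K, ring.add = ring.add K, smult = monoid.mult K\<rparr>"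

lemma self_simps [simp]: "carrier (self_module K) = carrier K" "\<zero>\<^bsub>self_module K\<^esub> = \<zero>\<^bsub>K\<^esub>"
  "ring.add (self_module K) = ring.add K" "a \<odot>\<^bsub>self_module K\<^esub> x = a \<otimes>\<^bsub>K\<^esub> x"
  by (simp_all add: self_module_def)

lemma self_module: assumes "ring K" shows "left_module K (self_module K)"
proof -
  interpret K: ring K by fact
  have "abelian_group (self_module K)"
  proof (rule abelian_groupI)
    fix x assume "x \<in> carrier (self_module K)"
    then show "\<exists>y\<in>carrier (self_module K). y \<oplus>\<^bsub>self_module K\<^esub> x = \<zero>\<^bsub>self_module K\<^esub>"
      by (auto simp: K.l_neg intro!: bexI[of _ "\<ominus>\<^bsub>K\<^esub> x"])
  qed (auto simp: K.a_ac)
  then show ?thesis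
    by (intro left_module.intro left_module_axioms.intro K.ring_axioms)
      (auto simp: K.l_distr K.r_distr K.m_assoc)
qed

text \<open>By Zorn's lemma there is a subspace maximal among those containing \<open>W\<close> and
  missing \<open>u\<close>. It is a complement of the line through \<open>u\<close>, and the
  functional reads off the coordinate along \<open>u\<close>.\<close>

lemma ex_functional:
  assumes "field K" "left_module K V" "submodule W K V" "u \<in> carrier V" "u \<notin> W"
  obtains \<theta> where "lin K V (self_module K) \<theta>" "\<And>w. w \<in> W \<Longrightarrow> \<theta> w = \<zero>\<^bsub>K\<^esub>" "\<theta> u = \<one>\<^bsub>K\<^esub>"
proof -
  interpret K: field K by fact
  interpret V: left_module K V by fact
  let ?A = "{H. submodule H K V \<and> W \<subseteq> H \<and> u \<notin> H}"
  have "\<exists>H\<in>?A. \<forall>U\<in>?A. H \<subseteq> U \<longrightarrow> U = H"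
  proof (rule subset_Zorn_nonempty)
    show "?A \<noteq> {}" using assms by auto
    fix C assume C: "C \<noteq> {}" "subset.chain ?A C"
    then have sub: "submodule H K V" "W \<subseteq> H" "u \<notin> H" if "H \<in> C" for H using that by (auto simp: subset.chain_def)
    have tot: "H \<subseteq> H' \<or> H' \<subseteq> H" if "H \<in> C" "H' \<in> C" for H H' using that C(2) by (auto simp: subset.chain_def)
    obtain H0 where H0: "H0 \<in> C" using C by auto
    have "submodule (\<Union>C) K V"
    proof (rule V.submoduleI)
      show "\<Union>C \<subseteq> carrier V" using sub V.sub_subset by blast
      show "\<zero>\<^bsub>V\<^esub> \<in> \<Union>C" using H0 sub V.sub_zero by blast
      fix x y assume "x \<in> \<Union>C" "y \<in> \<Union>C"
      then obtain H H' where H: "H \<in> C" "H' \<in> C" "x \<in> H" "y \<in> H'" by auto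
      then have "x \<in> H \<union> H'" "y \<in> H \<union> H'" "H \<union> H' \<in> C" using tot[of H H'] by (auto simp: sup_absorb1 sup_absorb2)
      then show "x \<oplus>\<^bsub>V\<^esub> y \<in> \<Union>C" using sub V.sub_add by blast
    next
      fix a x assume "a \<in> carrier K" "x \<in> \<Union>C" then show "a \<odot>\<^bsub>V\<^esub> x \<in> \<Union>C" using sub V.sub_smult by blast
    qed
    then show "\<Union>C \<in> ?A" using sub H0 by blast
  qed
  then obtain H where HA: "H \<in> ?A" and mx: "\<forall>U\<in>?A. H \<subseteq> U \<longrightarrow> U = H" by (elim bexE)
  have H: "submodule H K V" "W \<subseteq> H" "u \<notin> H" using HA by simp_all
  have max: "U = H" if "submodule U K V" "W \<subseteq> U" "u \<notin> U" "H \<subseteq> U" for U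
    using mx that by simp
  note mem = V.sub_mem[OF H(1)]
  have inv: "inv\<^bsub>K\<^esub> c \<in> carrier K" "inv\<^bsub>K\<^esub> c \<otimes>\<^bsub>K\<^esub> c = \<one>\<^bsub>K\<^esub>" if "c \<in> carrier K" "c \<noteq> \<zero>\<^bsub>K\<^esub>" for c
    using that K.field_Units by auto
  have ex: "\<exists>c\<in>carrier K. x \<ominus>\<^bsub>V\<^esub> c \<odot>\<^bsub>V\<^esub> u \<in> H" if x: "x \<in> carrier V" for x
  proof (cases "x \<in> H")
    case True then show ?thesis using assms(4) mem by (intro bexI[of _ "\<zero>\<^bsub>K\<^esub>"]) auto
  next
    case False
    have HV: "insert x H \<subseteq> carrier V" using x mem by auto
    have sup: "insert x H \<subseteq> mspan K V (insert x H)" by (rule V.mspan_superset)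
    have "u \<in> mspan K V (insert x H)"
      using max[OF V.mspan_submodule[OF HV]] sup H(2) False by blast
    then obtain a v where av: "a \<in> carrier K" "v \<in> mspan K V H" "u = a \<odot>\<^bsub>V\<^esub> x \<oplus>\<^bsub>V\<^esub> v"
      using V.mspan_insert[of H x u] x mem by auto
    have v: "v \<in> H" using V.mspan_least[OF H(1), of H] av by auto
    have a: "a \<noteq> \<zero>\<^bsub>K\<^esub>" using av v H(3) x mem by auto
    have "inv\<^bsub>K\<^esub> a \<odot>\<^bsub>V\<^esub> u = x \<oplus>\<^bsub>V\<^esub> inv\<^bsub>K\<^esub> a \<odot>\<^bsub>V\<^esub> v"
      using av v x mem inv[OF av(1) a] by (simp add: V.smult_r_distr V.smult_assoc1[symmetric])
    then have "x \<ominus>\<^bsub>V\<^esub> inv\<^bsub>K\<^esub> a \<odot>\<^bsub>V\<^esub> u = \<ominus>\<^bsub>V\<^esub> (inv\<^bsub>K\<^esub> a \<odot>\<^bsub>V\<^esub> v)"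
      using v x mem inv[OF av(1) a] by (simp add: V.M.minus_eq V.M.minus_add V.M.r_neg V.M.a_assoc[symmetric])
    then show ?thesis using v inv[OF av(1) a] V.sub_smult[OF H(1)] V.sub_neg[OF H(1)] by metis
  qed
  have uniq: "c = d" if "c \<in> carrier K" "d \<in> carrier K" "x \<in> carrier V" "x \<ominus>\<^bsub>V\<^esub> c \<odot>\<^bsub>V\<^esub> u \<in> H" "x \<ominus>\<^bsub>V\<^esub> d \<odot>\<^bsub>V\<^esub> u \<in> H" for c d x
  proof (rule ccontr)
    assume ne: "c \<noteq> d"
    have "(x \<ominus>\<^bsub>V\<^esub> d \<odot>\<^bsub>V\<^esub> u) \<ominus>\<^bsub>V\<^esub> (x \<ominus>\<^bsub>V\<^esub> c \<odot>\<^bsub>V\<^esub> u) \<in> H" using that V.sub_diff[OF H(1)] by blast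
    then have "(c \<ominus>\<^bsub>K\<^esub> d) \<odot>\<^bsub>V\<^esub> u \<in> H" using that assms(4) by (simp add: V.diff_diff_left V.smult_l_diff)
    moreover have cd: "c \<ominus>\<^bsub>K\<^esub> d \<in> carrier K" "c \<ominus>\<^bsub>K\<^esub> d \<noteq> \<zero>\<^bsub>K\<^esub>"
      using that ne by (auto simp: K.r_right_minus_eq)
    ultimately have "inv\<^bsub>K\<^esub> (c \<ominus>\<^bsub>K\<^esub> d) \<odot>\<^bsub>V\<^esub> ((c \<ominus>\<^bsub>K\<^esub> d) \<odot>\<^bsub>V\<^esub> u) \<in> H" using inv V.sub_smult[OF H(1)] by blast
    then have "u \<in> H" using inv[OF cd] cd assms(4) by (simp add: V.smult_assoc1[symmetric])
    then show False using H(3) by simp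
  qed
  obtain \<theta> where \<theta>: "\<And>x. x \<in> carrier V \<Longrightarrow> \<theta> x \<in> carrier K \<and> x \<ominus>\<^bsub>V\<^esub> \<theta> x \<odot>\<^bsub>V\<^esub> u \<in> H" using ex by metis
  have "lin K V (self_module K) \<theta>"
  proof (rule linI)
    fix x assume x: "x \<in> carrier V" then show "\<theta> x \<in> carrier (self_module K)" using \<theta> by simp
    fix y assume y: "y \<in> carrier V"
    have "(x \<oplus>\<^bsub>V\<^esub> y) \<ominus>\<^bsub>V\<^esub> (\<theta> x \<oplus>\<^bsub>K\<^esub> \<theta> y) \<odot>\<^bsub>V\<^esub> u = (x \<ominus>\<^bsub>V\<^esub> \<theta> x \<odot>\<^bsub>V\<^esub> u) \<oplus>\<^bsub>V\<^esub> (y \<ominus>\<^bsub>V\<^esub> \<theta> y \<odot>\<^bsub>V\<^esub> u)"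
      using \<theta> x y assms(4) by (simp add: V.smult_l_distr V.M.minus_eq V.M.minus_add V.M.a_ac)
    also have "\<dots> \<in> H" using \<theta> x y V.sub_add[OF H(1)] by blast
    finally show "\<theta> (x \<oplus>\<^bsub>V\<^esub> y) = \<theta> x \<oplus>\<^bsub>self_module K\<^esub> \<theta> y"
      using \<theta> x y uniq[of "\<theta> (x \<oplus>\<^bsub>V\<^esub> y)" "\<theta> x \<oplus>\<^bsub>K\<^esub> \<theta> y" "x \<oplus>\<^bsub>V\<^esub> y"] by simp
  next
    fix a x assume a: "a \<in> carrier K" and x: "x \<in> carrier V"
    have "a \<odot>\<^bsub>V\<^esub> x \<ominus>\<^bsub>V\<^esub> (a \<otimes>\<^bsub>K\<^esub> \<theta> x) \<odot>\<^bsub>V\<^esub> u = a \<odot>\<^bsub>V\<^esub> (x \<ominus>\<^bsub>V\<^esub> \<theta> x \<odot>\<^bsub>V\<^esub> u)"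
      using \<theta> x a assms(4) by (simp add: V.smult_r_diff V.smult_assoc1)
    also have "\<dots> \<in> H" using \<theta> x a V.sub_smult[OF H(1)] by blast
    finally show "\<theta> (a \<odot>\<^bsub>V\<^esub> x) = a \<odot>\<^bsub>self_module K\<^esub> \<theta> x"
      using \<theta> x a uniq[of "\<theta> (a \<odot>\<^bsub>V\<^esub> x)" "a \<otimes>\<^bsub>K\<^esub> \<theta> x" "a \<odot>\<^bsub>V\<^esub> x"] by simp
  qed
  moreover have "\<theta> w = \<zero>\<^bsub>K\<^esub>" if "w \<in> W" for w
    using that H(2) \<theta> mem assms(4) by (intro uniq[of _ _ w]) auto
  moreover have "\<theta> u = \<one>\<^bsub>K\<^esub>"
    using \<theta> assms(4) V.sub_zero[OF H(1)] by (intro uniq[of _ _ u]) auto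
  ultimately show ?thesis using that by blast
qed

text \<open>The scalar \<open>c\<close> acts through \<open>c \<odot> \<one>\<close>, which commutes
  with all of \<open>L\<close>; multiples of a homomorphism are therefore again
  \<open>L\<close>-linear.\<close>

definition homspace :: "('k, 'a) module \<Rightarrow> ('a, 'm) module \<Rightarrow> ('a, 'n) module \<Rightarrow> ('k, 'm \<Rightarrow> 'n) module" where
  "homspace L P M = \<lparr>carrier = mod_hom L P M, monoid.mult = \<lambda>_ _. undefined, monoid.one = undefined,
     ring.zero = (\<lambda>x\<in>carrier P. \<zero>\<^bsub>M\<^esub>), ring.add = \<lambda>h h'. \<lambda>x\<in>carrier P. h x \<oplus>\<^bsub>M\<^esub> h' x,
     smult = \<lambda>c h. \<lambda>x\<in>carrier P. (c \<odot>\<^bsub>L\<^esub> \<one>\<^bsub>L\<^esub>) \<odot>\<^bsub>M\<^esub> h x\<rparr>"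

lemma homspace_simps [simp]: "carrier (homspace L P M) = mod_hom L P M"
  "\<zero>\<^bsub>homspace L P M\<^esub> = (\<lambda>x\<in>carrier P. \<zero>\<^bsub>M\<^esub>)"
  "h \<oplus>\<^bsub>homspace L P M\<^esub> h' = (\<lambda>x\<in>carrier P. h x \<oplus>\<^bsub>M\<^esub> h' x)"
  "c \<odot>\<^bsub>homspace L P M\<^esub> h = (\<lambda>x\<in>carrier P. (c \<odot>\<^bsub>L\<^esub> \<one>\<^bsub>L\<^esub>) \<odot>\<^bsub>M\<^esub> h x)"
  by (simp_all add: homspace_def)

lemma mod_hom_ext:
  assumes "h \<in> mod_hom L P M" "h' \<in> mod_hom L P M" "\<And>x. x \<in> carrier P \<Longrightarrow> h x = h' x" shows "h = h'"
  using assms by (intro ext) (metis (no_types, lifting) PiE_arb mem_Collect_eq mod_hom_def)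

lemma (in fdalg) homspace_module:
  assumes "left_module L P" "left_module L M" shows "left_module K (homspace L P M)"
proof -
  interpret P: left_module L P by fact
  interpret M: left_module L M by fact
  note res = restrict_mod_hom[OF assms(1)]
  note ml = mod_hom_lin[of _ L P M]
  have cl: "h x \<in> carrier M" if "h \<in> mod_hom L P M" "x \<in> carrier P" for h x
    using that by (blast intro: lin_closed ml)
  have add: "(\<lambda>x\<in>carrier P. h x \<oplus>\<^bsub>M\<^esub> h' x) \<in> mod_hom L P M" if "h \<in> mod_hom L P M" "h' \<in> mod_hom L P M" for h h'
    using that by (intro res lin_sum assms ml)
  have neg: "(\<lambda>x\<in>carrier P. \<ominus>\<^bsub>M\<^esub> h x) \<in> mod_hom L P M" if "h \<in> mod_hom L P M" for h
    using that by (intro res lin_uminus assms ml)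
  have zero: "(\<lambda>x\<in>carrier P. \<zero>\<^bsub>M\<^esub>) \<in> mod_hom L P M" by (intro res lin_const0 assms)
  have sm: "(\<lambda>x\<in>carrier P. sc c \<odot>\<^bsub>M\<^esub> h x) \<in> mod_hom L P M" if "c \<in> carrier K" "h \<in> mod_hom L P M" for c h
    using that by (intro res lin_comp[OF ml lin_sc] assms)
  have "abelian_group (homspace L P M)"
  proof (rule abelian_groupI)
    fix h assume h: "h \<in> carrier (homspace L P M)"
    then have hh: "h \<in> mod_hom L P M" by simp
    then show "\<zero>\<^bsub>homspace L P M\<^esub> \<oplus>\<^bsub>homspace L P M\<^esub> h = h"
      unfolding homspace_simps by (intro mod_hom_ext[of _ L P M] add zero) (auto simp: cl)
    have "(\<lambda>x\<in>carrier P. \<ominus>\<^bsub>M\<^esub> h x) \<oplus>\<^bsub>homspace L P M\<^esub> h = \<zero>\<^bsub>homspace L P M\<^esub>"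
      unfolding homspace_simps using hh by (intro mod_hom_ext[of _ L P M] add zero neg) (auto simp: cl M.M.l_neg)
    then show "\<exists>y\<in>carrier (homspace L P M). y \<oplus>\<^bsub>homspace L P M\<^esub> h = \<zero>\<^bsub>homspace L P M\<^esub>"
      using neg[OF hh] by (metis homspace_simps(1))
    fix h' assume h': "h' \<in> carrier (homspace L P M)"
    then show "h \<oplus>\<^bsub>homspace L P M\<^esub> h' \<in> carrier (homspace L P M)" using h by (auto intro: add)
    show "h \<oplus>\<^bsub>homspace L P M\<^esub> h' = h' \<oplus>\<^bsub>homspace L P M\<^esub> h"
      using h h' unfolding homspace_simps by (intro mod_hom_ext[of _ L P M] add) (auto simp: cl M.M.a_ac)
    fix h'' assume "h'' \<in> carrier (homspace L P M)"
    then show "h \<oplus>\<^bsub>homspace L P M\<^esub> h' \<oplus>\<^bsub>homspace L P M\<^esub> h'' = h \<oplus>\<^bsub>homspace L P M\<^esub> (h' \<oplus>\<^bsub>homspace L P M\<^esub> h'')"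
      using h h' unfolding homspace_simps by (intro mod_hom_ext[of _ L P M] add) (auto simp: cl M.M.a_assoc)
  qed (auto intro: zero)
  moreover have "left_module_axioms K (homspace L P M)"
  proof
    fix h assume h: "h \<in> carrier (homspace L P M)"
    then have h': "h \<in> mod_hom L P M" by simp
    show "\<one>\<^bsub>K\<^esub> \<odot>\<^bsub>homspace L P M\<^esub> h = h" 
      using h unfolding homspace_simps by (intro mod_hom_ext[of _ L P M] sm) (auto simp: cl)
    fix a assume a: "a \<in> carrier K"
    show "a \<odot>\<^bsub>homspace L P M\<^esub> h \<in> carrier (homspace L P M)" using a h by (auto intro: sm)
    { fix b assume b: "b \<in> carrier K"
      show "(a \<oplus>\<^bsub>K\<^esub> b) \<odot>\<^bsub>homspace L P M\<^esub> h = a \<odot>\<^bsub>homspace L P M\<^esub> h \<oplus>\<^bsub>homspace L P M\<^esub> b \<odot>\<^bsub>homspace L P M\<^esub> h"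
        unfolding homspace_simps using a b h' 
        by (intro mod_hom_ext[of _ L P M] add sm) (auto simp: cl KL.smult_l_distr M.smult_l_distr)
      show "(a \<otimes>\<^bsub>K\<^esub> b) \<odot>\<^bsub>homspace L P M\<^esub> h = a \<odot>\<^bsub>homspace L P M\<^esub> (b \<odot>\<^bsub>homspace L P M\<^esub> h)"
        unfolding homspace_simps using a b h' 
        by (intro mod_hom_ext[of _ L P M] add sm) (auto simp: cl KL.smult_assoc1 M.smult_assoc1[symmetric] simp del: mult_sc) }
    fix g assume "g \<in> carrier (homspace L P M)"
    then show "a \<odot>\<^bsub>homspace L P M\<^esub> (h \<oplus>\<^bsub>homspace L P M\<^esub> g) = a \<odot>\<^bsub>homspace L P M\<^esub> h \<oplus>\<^bsub>homspace L P M\<^esub> a \<odot>\<^bsub>homspace L P M\<^esub> g"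
        unfolding homspace_simps using a h' 
        by (intro mod_hom_ext[of _ L P M] add sm) (auto simp: cl M.smult_r_distr)
  qed
  ultimately show ?thesis by (intro left_module.intro K.ring_axioms)
qed

lemma lsum_homspace:
  "lsum (homspace L P M) f n = (\<lambda>x\<in>carrier P. lsum M (\<lambda>i. f i x) n)"
  by (induction n) (auto simp: restrict_def)

lemma lsum_rsc: "lsum (rsc L M) f n = lsum M f n" by (induction n) auto

section \<open>Rigidity without the translate\<close>

lemma abelian_group_cong:
  assumes "abelian_group G" "carrier H = carrier G" "\<zero>\<^bsub>H\<^esub> = \<zero>\<^bsub>G\<^esub>" "ring.add H = ring.add G"
  shows "abelian_group H"
proof -
  interpret G: abelian_group G by fact
  show ?thesis
  proof (rule abelian_groupI)
    fix x assume "x \<in> carrier H"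
    then show "\<exists>y\<in>carrier H. y \<oplus>\<^bsub>H\<^esub> x = \<zero>\<^bsub>H\<^esub>" using assms(2-4) by (auto simp: G.l_neg intro!: bexI[of _ "\<ominus>\<^bsub>G\<^esub> x"])
  qed (auto simp: assms(2-4) G.a_ac)
qed

lemma hom_to_algebra_simps [simp]: "carrier (hom_to_algebra L P) = mod_hom L P (regular_module L)"
  "\<zero>\<^bsub>hom_to_algebra L P\<^esub> = (\<lambda>x\<in>carrier P. \<zero>\<^bsub>L\<^esub>)"
  "h \<oplus>\<^bsub>hom_to_algebra L P\<^esub> h' = (\<lambda>x\<in>carrier P. h x \<oplus>\<^bsub>L\<^esub> h' x)"
  "a \<odot>\<^bsub>hom_to_algebra L P\<^esub> h = (\<lambda>x\<in>carrier P. h x \<otimes>\<^bsub>L\<^esub> a)"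
  by (simp_all add: hom_to_algebra_def)

locale presentation = fdalg K L for K :: "'k ring" and L :: "('k, 'a) module" +
  fixes M P1 P0 :: "('k, 'a) fdmod" and f g
  assumes pres: "min_proj_presentation L M P1 f P0 g" and M: "M \<in> fgmod L"
begin

lemma P0: "projective L P0" "lin L P0 M g" "g ` carrier P0 = carrier M"
  and P1: "projective L P1" "lin L P1 P0 f" "f ` carrier P1 = lker P0 M g"
  and sup: "superfluous L P1 (lker P1 P0 f)"
proof -
  show "projective L P0" "lin L P0 M g" "g ` carrier P0 = carrier M" "projective L P1"
    and f: "f ` carrier P1 = lker P0 M g"
    using pres by (auto simp: min_proj_presentation_def projective_cover_def mod_hom_lin a_kernel_eq)
  have "f \<in> mod_hom L P1 (P0\<lparr>carrier := lker P0 M g\<rparr>)"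
    using pres by (auto simp: min_proj_presentation_def projective_cover_def a_kernel_eq)
  then show "lin L P1 P0 f" using mod_hom_lin lin_decorestrict[where N=P0 and H="lker P0 M g"] by blast
  show "superfluous L P1 (lker P1 P0 f)"
    using pres by (auto simp: min_proj_presentation_def projective_cover_def a_kernel_eq)
qed

lemma fg: "P0 \<in> fgmod L" "P1 \<in> fgmod L" using P0 P1 by (auto simp: projective_def)

sublocale M: left_module L M using M by (simp add: fgmod_def)
sublocale P0: left_module L P0 using fg by (simp add: fgmod_def)
sublocale P1: left_module L P1 using fg by (simp add: fgmod_def)
sublocale RM: left_module L "regular_module L" by (rule regular_module)

lemmas lms = M.left_module_axioms P0.left_module_axioms P1.left_module_axioms RM.left_module_axioms

abbreviation "H1 \<equiv> hom_to_algebra L P1"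
abbreviation "V1 \<equiv> homspace L P1 (regular_module L)"
definition "im = (\<lambda>h. \<lambda>x\<in>carrier P1. h (f x)) ` mod_hom L P0 (regular_module L)"
definition "T = transpose_of L P1 f P0"
definition "cs h = im +>\<^bsub>H1\<^esub> h"

sublocale V1: left_module K V1 by (rule homspace_module[OF lms(3,4)])

text \<open>\<open>H1\<close> and \<open>V1\<close> have the same elements and the same addition;
  they differ in the action, of \<open>L\<close> from the right and of \<open>K\<close>
  respectively.\<close>

sublocale H1: abelian_group H1
  by (rule abelian_group_cong[OF V1.M.abelian_group_axioms]) (auto simp: fun_eq_iff hom_to_algebra_def homspace_def)

lemma act_closed:
  assumes "h \<in> mod_hom L P (regular_module L)" "left_module L P" "a \<in> carrier L"
  shows "(\<lambda>x\<in>carrier P. h x \<otimes>\<^bsub>L\<^esub> a) \<in> mod_hom L P (regular_module L)"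
proof -
  note l = mod_hom_lin[OF assms(1)]
  have "lin L P (regular_module L) (\<lambda>x. h x \<otimes>\<^bsub>L\<^esub> a)"
    using lin_closed[OF l] lin_add[OF l] lin_smult[OF l] assms(3)
    by (intro linI) (auto simp: R.l_distr R.m_assoc)
  then show ?thesis by (rule restrict_mod_hom[OF assms(2)])
qed

lemma im_subset: "im \<subseteq> mod_hom L P1 (regular_module L)"
  using restrict_mod_hom[OF lms(3) lin_comp[OF P1(2) mod_hom_lin]] by (auto simp: im_def)

lemma imI: "lin L P0 (regular_module L) h \<Longrightarrow> (\<lambda>x\<in>carrier P1. h (f x)) \<in> im"
proof -
  assume h: "lin L P0 (regular_module L) h"
  have "(\<lambda>x\<in>carrier P1. restrict h (carrier P0) (f x)) \<in> im"
    using restrict_mod_hom[OF lms(2) h] unfolding im_def by (rule imageI)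
  also have "(\<lambda>x\<in>carrier P1. restrict h (carrier P0) (f x)) = (\<lambda>x\<in>carrier P1. h (f x))"
    using lin_closed[OF P1(2)] by (intro restrict_ext) simp
  finally show ?thesis .
qed

lemma imE: "w \<in> im \<Longrightarrow> \<exists>h. lin L P0 (regular_module L) h \<and> w = (\<lambda>x\<in>carrier P1. h (f x))"
  using mod_hom_lin unfolding im_def by blast

lemma im_act: "w \<in> im \<Longrightarrow> a \<in> carrier L \<Longrightarrow> (\<lambda>x\<in>carrier P1. w x \<otimes>\<^bsub>L\<^esub> a) \<in> im"
proof -
  assume w: "w \<in> im" and a: "a \<in> carrier L"
  obtain h where h: "h \<in> mod_hom L P0 (regular_module L)" "w = (\<lambda>x\<in>carrier P1. h (f x))" using w by (auto simp: im_def)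
  have "(\<lambda>x\<in>carrier P0. h x \<otimes>\<^bsub>L\<^esub> a) \<in> mod_hom L P0 (regular_module L)" using act_closed[OF h(1) lms(2) a] .
  then have "(\<lambda>x\<in>carrier P1. (\<lambda>x\<in>carrier P0. h x \<otimes>\<^bsub>L\<^esub> a) (f x)) \<in> im" unfolding im_def by (rule imageI)
  also have "(\<lambda>x\<in>carrier P1. (\<lambda>x\<in>carrier P0. h x \<otimes>\<^bsub>L\<^esub> a) (f x)) = (\<lambda>x\<in>carrier P1. w x \<otimes>\<^bsub>L\<^esub> a)"
    using lin_closed[OF P1(2)] h(2) by (intro restrict_ext) simp
  finally show ?thesis .
qed

lemma im_submodule: "submodule im K V1"
proof (rule V1.submoduleI)
  show "im \<subseteq> carrier V1" using im_subset by simp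
  show "\<zero>\<^bsub>V1\<^esub> \<in> im" using imI[OF lin_const0[OF lms(4)]] by simp
  fix x y assume "x \<in> im" "y \<in> im"
  then obtain h h' where h: "lin L P0 (regular_module L) h" "lin L P0 (regular_module L) h'"
    "x = (\<lambda>x\<in>carrier P1. h (f x))" "y = (\<lambda>x\<in>carrier P1. h' (f x))" using imE by metis
  have "x \<oplus>\<^bsub>V1\<^esub> y = (\<lambda>x\<in>carrier P1. h (f x) \<oplus>\<^bsub>regular_module L\<^esub> h' (f x))"
    using h(3,4) by (auto simp: fun_eq_iff)
  then show "x \<oplus>\<^bsub>V1\<^esub> y \<in> im" using imI[OF lin_sum[OF lms(4) h(1,2)]] by simp
next
  fix c x assume c: "c \<in> carrier K" and x: "x \<in> im"
  have "c \<odot>\<^bsub>V1\<^esub> x = (\<lambda>y\<in>carrier P1. x y \<otimes>\<^bsub>L\<^esub> sc c)"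
    using c lin_closed[OF mod_hom_lin, of x L P1 "regular_module L"] im_subset x
    by (auto simp: fun_eq_iff subset_iff)
  then show "c \<odot>\<^bsub>V1\<^esub> x \<in> im" using im_act[OF x, of "sc c"] c by simp
qed

sublocale im: abelian_subgroup im H1
proof (rule abelian_subgroupI3)
  show "additive_subgroup im H1"
  proof (intro additive_subgroupI subgroup.intro)
    fix x assume x: "x \<in> im"
    then have c: "x \<in> carrier V1" "\<ominus>\<^bsub>V1\<^esub> x \<in> im" using im_subset V1.sub_neg[OF im_submodule] by auto
    then have c': "\<ominus>\<^bsub>V1\<^esub> x \<in> mod_hom L P1 (regular_module L)" using im_subset by blast
    have "\<ominus>\<^bsub>V1\<^esub> x \<oplus>\<^bsub>H1\<^esub> x = \<zero>\<^bsub>H1\<^esub>" using V1.M.l_neg[OF c(1)] by simp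
    then have "\<ominus>\<^bsub>H1\<^esub> x = \<ominus>\<^bsub>V1\<^esub> x" using c c' by (intro H1.minus_equality) auto
    then show "inv\<^bsub>add_monoid H1\<^esub> x \<in> im" using c by (simp add: a_inv_def)
  qed (use im_subset V1.sub_zero[OF im_submodule] V1.sub_add[OF im_submodule] in auto)
qed unfold_locales

lemma T_carrier: "carrier T = cs ` mod_hom L P1 (regular_module L)"
  unfolding T_def transpose_of_def quot_module_def cs_def
  by (auto simp: A_RCOSETS_def' im_def)

lemma T_add:
  assumes "h \<in> mod_hom L P1 (regular_module L)" "h' \<in> mod_hom L P1 (regular_module L)"
  shows "cs h \<oplus>\<^bsub>T\<^esub> cs h' = cs (h \<oplus>\<^bsub>H1\<^esub> h')"
proof -
  have "cs h \<oplus>\<^bsub>T\<^esub> cs h' = (im +>\<^bsub>H1\<^esub> h) <+>\<^bsub>H1\<^esub> (im +>\<^bsub>H1\<^esub> h')"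
    by (simp add: T_def transpose_of_def quot_module_def cs_def)
  also have "\<dots> = im +>\<^bsub>H1\<^esub> (h \<oplus>\<^bsub>H1\<^esub> h')" using assms by (intro im.a_rcos_sum) auto
  finally show ?thesis by (simp add: cs_def)
qed

lemma cs_memE:
  assumes "h' \<in> cs h" "h \<in> mod_hom L P1 (regular_module L)"
  obtains w where "w \<in> im" "h' = w \<oplus>\<^bsub>H1\<^esub> h"
  using assms unfolding cs_def a_r_coset_def' by blast

lemma cs_self: "h \<in> mod_hom L P1 (regular_module L) \<Longrightarrow> h \<in> cs h"
  unfolding cs_def by (rule im.a_rcos_self) simp

lemma cs_eq: "w \<in> im \<Longrightarrow> h \<in> mod_hom L P1 (regular_module L) \<Longrightarrow> cs (w \<oplus>\<^bsub>H1\<^esub> h) = cs h"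
proof -
  assume w: "w \<in> im" "h \<in> mod_hom L P1 (regular_module L)"
  then have "w \<oplus>\<^bsub>H1\<^esub> h \<in> im +>\<^bsub>H1\<^esub> h" using im_subset by (intro H1.a_rcosI) auto
  then have "im +>\<^bsub>H1\<^esub> h = im +>\<^bsub>H1\<^esub> (w \<oplus>\<^bsub>H1\<^esub> h)"
    using w by (intro H1.a_repr_independence im.a_subgroup) auto
  then show ?thesis by (simp add: cs_def)
qed

text \<open>\<open>quot_module\<close> defines the action as a union over all representatives. The
  union is a single coset because \<open>im\<close> is stable under the right action.\<close>

lemma T_smult:
  assumes h: "h \<in> mod_hom L P1 (regular_module L)" and a: "a \<in> carrier L"
  shows "a \<odot>\<^bsub>T\<^esub> cs h = cs (a \<odot>\<^bsub>H1\<^esub> h)"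
proof -
  have "cs (a \<odot>\<^bsub>H1\<^esub> h') = cs (a \<odot>\<^bsub>H1\<^esub> h)" if hc: "h' \<in> cs h" for h'
  proof -
    obtain w where w: "w \<in> im" "h' = w \<oplus>\<^bsub>H1\<^esub> h" by (rule cs_memE[OF hc h])
    have cl: "w x \<in> carrier L" "h x \<in> carrier L" if "x \<in> carrier P1" for x
      using w h im_subset that lin_closed[OF mod_hom_lin, of _ L P1 "regular_module L"] by auto
    have "a \<odot>\<^bsub>H1\<^esub> h' = (\<lambda>x\<in>carrier P1. w x \<otimes>\<^bsub>L\<^esub> a) \<oplus>\<^bsub>H1\<^esub> (a \<odot>\<^bsub>H1\<^esub> h)"
      using w a cl by (auto simp: fun_eq_iff R.l_distr)
    then show ?thesis using cs_eq[OF im_act[OF w(1) a], of "a \<odot>\<^bsub>H1\<^esub> h"] act_closed[OF h lms(3) a] by simp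
  qed
  then have "(\<Union>h'\<in>cs h. cs (a \<odot>\<^bsub>H1\<^esub> h')) = cs (a \<odot>\<^bsub>H1\<^esub> h)" using cs_self[OF h] by (intro SUP_eq_const) blast+
  moreover have "a \<odot>\<^bsub>T\<^esub> cs h = (\<Union>h'\<in>cs h. cs (a \<odot>\<^bsub>H1\<^esub> h'))"
    by (simp add: T_def transpose_of_def quot_module_def cs_def im_def del: hom_to_algebra_simps(4))
  ultimately show ?thesis by simp
qed

lemma T_zero: "\<zero>\<^bsub>T\<^esub> = cs \<zero>\<^bsub>H1\<^esub>"
  by (simp add: T_def transpose_of_def quot_module_def cs_def im_def[symmetric] H1.a_coset_add_zero[simplified] im_subset del: hom_to_algebra_simps(2))

lemma cs_im: "w \<in> im \<Longrightarrow> cs w = \<zero>\<^bsub>T\<^esub>"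
  using cs_eq[of w "\<zero>\<^bsub>H1\<^esub>"] H1.r_zero[of w] H1.zero_closed im_subset unfolding T_zero by auto

text \<open>Surjectivity of the map Hom(P0, M) to Hom(P1, M) induced by \<open>f\<close>: the
  criterion for \<tau>-rigidity in terms of a minimal projective presentation.\<close>

definition factors where
  "factors \<longleftrightarrow> (\<forall>u. lin L P1 M u \<longrightarrow> (\<exists>v. lin L P0 M v \<and> (\<forall>x\<in>carrier P1. u x = v (f x))))"

text \<open>These are the functionals on the tensor product of the transpose with \<open>M\<close>,
  written as bilinear forms on representatives that vanish on \<open>im\<close>. No tensor product
  has to be formed.\<close>

definition balanced where
  "balanced \<beta> \<longleftrightarrow> (\<forall>m\<in>carrier M. lin K V1 (self_module K) (\<lambda>h. \<beta> h m)) \<and>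
     (\<forall>h\<in>mod_hom L P1 (regular_module L). lin K (rsc L M) (self_module K) (\<beta> h)) \<and>
     (\<forall>h\<in>mod_hom L P1 (regular_module L). \<forall>a\<in>carrier L. \<forall>m\<in>carrier M. \<beta> (a \<odot>\<^bsub>H1\<^esub> h) m = \<beta> h (a \<odot>\<^bsub>M\<^esub> m)) \<and>
     (\<forall>w\<in>im. \<forall>m\<in>carrier M. \<beta> w m = \<zero>\<^bsub>K\<^esub>)"

text \<open>\<open>Hom(M, D Tr M)\<close> is dual to \<open>Tr M \<otimes> M\<close>, i.e. to the cokernel of \<open>Hom(P0, M) \<rightarrow> Hom(P1, M)\<close>.
  The dual bases of the projectives make this explicit.\<close>

lemma balanced_expand:
  assumes db: "dual_basis L P1 n p c" and \<beta>: "balanced \<beta>"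
    and h: "h \<in> mod_hom L P1 (regular_module L)" and m: "m \<in> carrier M"
  shows "\<beta> h m = lsum (self_module K) (\<lambda>i. \<beta> (restrict (c i) (carrier P1)) (h (p i) \<odot>\<^bsub>M\<^esub> m)) n"
proof -
  let ?c = "\<lambda>i. restrict (c i) (carrier P1)"
  have pc: "p i \<in> carrier P1" "?c i \<in> mod_hom L P1 (regular_module L)" if "i < n" for i
    using db that restrict_mod_hom[OF lms(3), of "regular_module L" "c i"] by (auto simp: dual_basis_def)
  have hp: "h (p i) \<in> carrier L" if "i < n" for i
    using lin_closed[OF mod_hom_lin[OF h] pc(1)[OF that]] by simp
  have act: "h (p i) \<odot>\<^bsub>H1\<^esub> ?c i \<in> mod_hom L P1 (regular_module L)" if "i < n" for i
    using act_closed[OF pc(2)[OF that] lms(3) hp[OF that]] by simp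
  have "lsum V1 (\<lambda>i. h (p i) \<odot>\<^bsub>H1\<^esub> ?c i) n = h"
  proof (rule mod_hom_ext[OF _ h])
    have "lsum V1 (\<lambda>i. h (p i) \<odot>\<^bsub>H1\<^esub> ?c i) n \<in> carrier V1"
      by (rule lsum_closed[OF V1.left_module_axioms]) (simp only: homspace_simps(1), rule act)
    then show "lsum V1 (\<lambda>i. h (p i) \<odot>\<^bsub>H1\<^esub> ?c i) n \<in> mod_hom L P1 (regular_module L)"
      by (simp only: homspace_simps(1))
    fix x assume x: "x \<in> carrier P1"
    have "lsum V1 (\<lambda>i. h (p i) \<odot>\<^bsub>H1\<^esub> ?c i) n x = lsum (regular_module L) (\<lambda>i. c i x \<odot>\<^bsub>regular_module L\<^esub> h (p i)) n"
      using x by (simp add: lsum_homspace)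
    also have "\<dots> = h x" by (rule dual_basis_expand[OF lms(3,4) db mod_hom_lin[OF h] x, symmetric])
    finally show "lsum V1 (\<lambda>i. h (p i) \<odot>\<^bsub>H1\<^esub> ?c i) n x = h x" .
  qed
  then have "\<beta> h m = \<beta> (lsum V1 (\<lambda>i. h (p i) \<odot>\<^bsub>H1\<^esub> ?c i) n) m" by simp
  also have "\<dots> = lsum (self_module K) (\<lambda>i. \<beta> (h (p i) \<odot>\<^bsub>H1\<^esub> ?c i) m) n"
  proof -
    have "lin K V1 (self_module K) (\<lambda>h. \<beta> h m)" using \<beta> m by (simp only: balanced_def)
    then show ?thesis
      by (rule lin_lsum[OF V1.left_module_axioms self_module[OF K.ring_axioms]]) (simp only: homspace_simps(1), rule act)
  qed
  also have "\<dots> = lsum (self_module K) (\<lambda>i. \<beta> (?c i) (h (p i) \<odot>\<^bsub>M\<^esub> m)) n"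
  proof (rule lsum_cong)
    have "\<beta> (a \<odot>\<^bsub>H1\<^esub> k) m = \<beta> k (a \<odot>\<^bsub>M\<^esub> m)" if "k \<in> mod_hom L P1 (regular_module L)" "a \<in> carrier L" for a k
      using \<beta> m that unfolding balanced_def by blast
    then show "\<beta> (h (p i) \<odot>\<^bsub>H1\<^esub> ?c i) m = \<beta> (?c i) (h (p i) \<odot>\<^bsub>M\<^esub> m)" if "i < n" for i
      using pc(2)[OF that] hp[OF that] by blast
  qed
  finally show ?thesis .
qed

text \<open>The pair \<open>h\<close>, \<open>m\<close> gives the homomorphism
  \<open>x \<mapsto> h x \<odot> m\<close> from \<open>P1\<close> to \<open>M\<close>, which factors
  as \<open>v\<close> after \<open>f\<close>. Expanding \<open>v\<close> in the dual basis of
  \<open>P0\<close> writes the value of \<open>\<beta>\<close> as a sum of values at the maps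
  \<open>d j\<close> after \<open>f\<close>, which lie in \<open>im\<close>.\<close>

lemma balanced_zero:
  assumes "factors" and \<beta>: "balanced \<beta>"
    and h: "h \<in> mod_hom L P1 (regular_module L)" and m: "m \<in> carrier M"
  shows "\<beta> h m = \<zero>\<^bsub>K\<^esub>"
proof -
  obtain n p c where db: "dual_basis L P1 n p c" using projective_dual_basis[OF P1(1)] by blast
  obtain n' q d where db': "dual_basis L P0 n' q d" using projective_dual_basis[OF P0(1)] by blast
  let ?c = "\<lambda>i. restrict (c i) (carrier P1)"
  have pc: "p i \<in> carrier P1" "?c i \<in> mod_hom L P1 (regular_module L)" if "i < n" for i
    using db that restrict_mod_hom[OF lms(3), of "regular_module L" "c i"] by (auto simp: dual_basis_def)
  have qd: "q i \<in> carrier P0" "lin L P0 (regular_module L) (d i)" if "i < n'" for i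
    using db' that by (auto simp: dual_basis_def)
  note hl = mod_hom_lin[OF h]
  have "lin L P1 M (\<lambda>x. h x \<odot>\<^bsub>M\<^esub> m)"
    using lin_closed[OF hl] lin_add[OF hl] lin_smult[OF hl] m
    by (intro linI) (auto simp: M.smult_l_distr M.smult_assoc1)
  then obtain v where v: "lin L P0 M v" "\<forall>x\<in>carrier P1. h x \<odot>\<^bsub>M\<^esub> m = v (f x)" using assms(1) by (auto simp: factors_def)
  note fp = lin_closed[OF P1(2) pc(1)]
  have dcl: "d j (f (p i)) \<in> carrier L" if "i < n" "j < n'" for i j
    using lin_closed[OF qd(2)[OF that(2)] fp[OF that(1)]] by simp
  have vq: "v (q j) \<in> carrier M" if "j < n'" for j using lin_closed[OF v(1)] qd that by auto
  have \<beta>c: "lin K (rsc L M) (self_module K) (\<beta> (?c i))" if "i < n" for i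
    using \<beta> pc(2)[OF that] by (auto simp: balanced_def)
  note SK = self_module[OF K.ring_axioms]
  have "\<beta> h m = lsum (self_module K) (\<lambda>i. \<beta> (?c i) (v (f (p i)))) n"
    unfolding balanced_expand[OF db \<beta> h m] using v(2) pc by (intro lsum_cong) auto
  also have "\<dots> = lsum (self_module K) (\<lambda>i. lsum (self_module K) (\<lambda>j. \<beta> (?c i) (d j (f (p i)) \<odot>\<^bsub>M\<^esub> v (q j))) n') n"
  proof (rule lsum_cong)
    fix i assume i: "i < n"
    have "v (f (p i)) = lsum (rsc L M) (\<lambda>j. d j (f (p i)) \<odot>\<^bsub>M\<^esub> v (q j)) n'"
      using dual_basis_expand[OF lms(2,1) db' v(1) fp[OF i]] by (simp add: lsum_rsc)
    then show "\<beta> (?c i) (v (f (p i))) = lsum (self_module K) (\<lambda>j. \<beta> (?c i) (d j (f (p i)) \<odot>\<^bsub>M\<^esub> v (q j))) n'"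
      using lin_lsum[OF rsc_module[OF lms(1)] SK \<beta>c[OF i], of n' "\<lambda>j. d j (f (p i)) \<odot>\<^bsub>M\<^esub> v (q j)"] dcl[OF i] vq by simp
  qed
  \<comment> \<open>With the sums exchanged, the inner sum is the expansion of
    \<open>\<beta>\<close> at \<open>d j\<close> after \<open>f\<close>.\<close>
  also have "\<dots> = lsum (self_module K) (\<lambda>j. lsum (self_module K) (\<lambda>i. \<beta> (?c i) (d j (f (p i)) \<odot>\<^bsub>M\<^esub> v (q j))) n) n'"
    using lin_closed[OF \<beta>c] dcl vq by (intro lsum_swap[OF SK]) auto
  also have "\<dots> = \<zero>\<^bsub>self_module K\<^esub>"
  proof (rule lsum_zero[OF SK])
    fix j assume j: "j < n'"
    let ?h = "\<lambda>x\<in>carrier P1. d j (f x)"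
    have him: "?h \<in> im" using imI[OF qd(2)[OF j]] .
    then have "\<beta> ?h (v (q j)) = \<zero>\<^bsub>K\<^esub>" using \<beta> vq[OF j] by (auto simp: balanced_def)
    moreover have "\<beta> ?h (v (q j)) = lsum (self_module K) (\<lambda>i. \<beta> (?c i) (?h (p i) \<odot>\<^bsub>M\<^esub> v (q j))) n"
      using balanced_expand[OF db \<beta> _ vq[OF j]] him im_subset by blast
    moreover have "\<dots> = lsum (self_module K) (\<lambda>i. \<beta> (?c i) (d j (f (p i)) \<odot>\<^bsub>M\<^esub> v (q j))) n"
      using pc by (intro lsum_cong) simp
    ultimately show "lsum (self_module K) (\<lambda>i. \<beta> (?c i) (d j (f (p i)) \<odot>\<^bsub>M\<^esub> v (q j))) n = \<zero>\<^bsub>self_module K\<^esub>" by simp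
  qed
  finally show ?thesis by simp
qed

end

section \<open>Homomorphisms into the translate as balanced forms\<close>

context presentation begin

abbreviation "D \<equiv> k_dual K L T"

lemma D_simps: "\<zero>\<^bsub>D\<^esub> = (\<lambda>x\<in>carrier T. \<zero>\<^bsub>K\<^esub>)"
  "\<phi> \<oplus>\<^bsub>D\<^esub> \<psi> = (\<lambda>x\<in>carrier T. \<phi> x \<oplus>\<^bsub>K\<^esub> \<psi> x)"
  "a \<odot>\<^bsub>D\<^esub> \<phi> = (\<lambda>x\<in>carrier T. \<phi> (a \<odot>\<^bsub>T\<^esub> x))"
  by (simp_all add: k_dual_def)

lemma H1_closed:
  assumes "h \<in> mod_hom L P1 (regular_module L)"
  shows "h' \<in> mod_hom L P1 (regular_module L) \<Longrightarrow> h \<oplus>\<^bsub>H1\<^esub> h' \<in> mod_hom L P1 (regular_module L)"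
    "a \<in> carrier L \<Longrightarrow> a \<odot>\<^bsub>H1\<^esub> h \<in> mod_hom L P1 (regular_module L)"
proof -
  show "h' \<in> mod_hom L P1 (regular_module L) \<Longrightarrow> h \<oplus>\<^bsub>H1\<^esub> h' \<in> mod_hom L P1 (regular_module L)"
    using H1.a_closed[of h h'] assms by (simp only: hom_to_algebra_simps(1))
  show "a \<in> carrier L \<Longrightarrow> a \<odot>\<^bsub>H1\<^esub> h \<in> mod_hom L P1 (regular_module L)"
    using act_closed[OF assms lms(3)] by (simp only: hom_to_algebra_simps(4))
qed

lemma V1_smult: "h \<in> mod_hom L P1 (regular_module L) \<Longrightarrow> c \<in> carrier K \<Longrightarrow> c \<odot>\<^bsub>V1\<^esub> h = sc c \<odot>\<^bsub>H1\<^esub> h"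
  using lin_closed[OF mod_hom_lin, of h L P1 "regular_module L"] by (auto simp: fun_eq_iff)

lemma V1_add: "h \<oplus>\<^bsub>V1\<^esub> h' = h \<oplus>\<^bsub>H1\<^esub> h'" by simp

text \<open>Functionals on the transpose are tested on representatives in \<open>Hom(P1, L)\<close>,
  so that no further computation with cosets is necessary.\<close>

lemma D_mem:
  "\<xi> \<in> carrier D \<longleftrightarrow> \<xi> \<in> carrier T \<rightarrow>\<^sub>E carrier K \<and> lin K V1 (self_module K) (\<lambda>h. \<xi> (cs h))"
proof -
  have "lin K V1 (self_module K) (\<lambda>h. \<xi> (cs h)) \<longleftrightarrow> 
     (\<forall>x\<in>carrier T. \<forall>y\<in>carrier T. \<xi> (x \<oplus>\<^bsub>T\<^esub> y) = \<xi> x \<oplus>\<^bsub>K\<^esub> \<xi> y) \<and>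
     (\<forall>c\<in>carrier K. \<forall>x\<in>carrier T. \<xi> (sc c \<odot>\<^bsub>T\<^esub> x) = c \<otimes>\<^bsub>K\<^esub> \<xi> x)" if "\<xi> \<in> carrier T \<rightarrow>\<^sub>E carrier K"
  proof -
    have "\<forall>h\<in>mod_hom L P1 (regular_module L). \<xi> (cs h) \<in> carrier K" using that by (auto simp: T_carrier)
    then show ?thesis
      by (simp add: lin_def T_carrier T_add T_smult V1_smult V1_add sc_closed Pi_iff
          del: homspace_simps(2-4) hom_to_algebra_simps(2-4))
  qed
  then show ?thesis unfolding k_dual_def by auto
qed

lemma rigid_if_factors:
  assumes factors shows "mod_hom L M D = {\<lambda>x\<in>carrier M. \<zero>\<^bsub>D\<^esub>}"
proof
  note SK = self_module[OF K.ring_axioms]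
  have zD: "\<zero>\<^bsub>D\<^esub> \<in> carrier D"
  proof -
    have "lin K V1 (self_module K) (\<lambda>h. \<zero>\<^bsub>D\<^esub> (cs h))"
      by (rule lin_cong[OF lin_const0[OF SK] _ V1.left_module_axioms]) (simp add: D_simps T_carrier)
    then show ?thesis by (simp add: D_mem D_simps)
  qed
  have "\<zero>\<^bsub>D\<^esub> \<oplus>\<^bsub>D\<^esub> \<zero>\<^bsub>D\<^esub> = \<zero>\<^bsub>D\<^esub>" by (auto simp: D_simps fun_eq_iff)
  moreover have "a \<odot>\<^bsub>D\<^esub> \<zero>\<^bsub>D\<^esub> = \<zero>\<^bsub>D\<^esub>" if "a \<in> carrier L" for a
    using that T_smult H1_closed(2) by (auto simp: D_simps fun_eq_iff T_carrier simp del: hom_to_algebra_simps(4))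
  ultimately show "{\<lambda>x\<in>carrier M. \<zero>\<^bsub>D\<^esub>} \<subseteq> mod_hom L M D" using zD by (auto simp: mod_hom_def)
  show "mod_hom L M D \<subseteq> {\<lambda>x\<in>carrier M. \<zero>\<^bsub>D\<^esub>}"
  proof
    fix \<phi> assume \<phi>: "\<phi> \<in> mod_hom L M D"
    note l\<phi> = mod_hom_lin[OF \<phi>]
    have \<phi>D: "\<phi> m \<in> carrier T \<rightarrow>\<^sub>E carrier K" "lin K V1 (self_module K) (\<lambda>h. \<phi> m (cs h))" if "m \<in> carrier M" for m
      using lin_closed[OF l\<phi> that] D_mem by blast+
    have cT: "cs h \<in> carrier T" if "h \<in> mod_hom L P1 (regular_module L)" for h using that by (simp add: T_carrier)
    have act: "\<phi> (a \<odot>\<^bsub>M\<^esub> m) (cs h) = \<phi> m (cs (a \<odot>\<^bsub>H1\<^esub> h))"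
      if "h \<in> mod_hom L P1 (regular_module L)" "a \<in> carrier L" "m \<in> carrier M" for a h m
      unfolding lin_smult[OF l\<phi> that(2,3)] D_simps using cT[OF that(1)] T_smult[OF that(1,2)] by simp
    have "balanced (\<lambda>h m. \<phi> m (cs h))"
      unfolding balanced_def
    proof (intro conjI ballI)
      fix h assume h: "h \<in> mod_hom L P1 (regular_module L)"
      show "lin K (rsc L M) (self_module K) (\<lambda>m. \<phi> m (cs h))"
      proof (rule linI)
        fix x assume x: "x \<in> carrier (rsc L M)"
        then show "\<phi> x (cs h) \<in> carrier (self_module K)" using lin_closed[OF \<phi>D(2), of x h] h by simp
        fix y assume y: "y \<in> carrier (rsc L M)"
        then have "\<phi> (x \<oplus>\<^bsub>M\<^esub> y) = \<phi> x \<oplus>\<^bsub>D\<^esub> \<phi> y" using x by (intro lin_add[OF l\<phi>]) auto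
        then show "\<phi> (x \<oplus>\<^bsub>rsc L M\<^esub> y) (cs h) = \<phi> x (cs h) \<oplus>\<^bsub>self_module K\<^esub> \<phi> y (cs h)"
          using cT[OF h] by (simp add: D_simps)
      next
        fix c x assume c: "c \<in> carrier K" and x: "x \<in> carrier (rsc L M)"
        then have "\<phi> (sc c \<odot>\<^bsub>M\<^esub> x) (cs h) = \<phi> x (cs (c \<odot>\<^bsub>V1\<^esub> h))" using act[OF h, of "sc c" x] V1_smult[OF h c] by simp
        also have "\<dots> = c \<otimes>\<^bsub>K\<^esub> \<phi> x (cs h)" using lin_smult[OF \<phi>D(2), of x c h] c h x by simp
        finally show "\<phi> (c \<odot>\<^bsub>rsc L M\<^esub> x) (cs h) = c \<odot>\<^bsub>self_module K\<^esub> \<phi> x (cs h)" by simp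
      qed
    next
      fix w m assume w: "w \<in> im" and m: "m \<in> carrier M"
      have "cs w = cs \<zero>\<^bsub>V1\<^esub>" using cs_im[OF w] T_zero by simp
      then show "\<phi> m (cs w) = \<zero>\<^bsub>K\<^esub>" using lin_zero[OF V1.left_module_axioms SK \<phi>D(2)[OF m]] by simp
    qed (use \<phi>D(2) act in auto)
    then have z: "\<phi> m (cs h) = \<zero>\<^bsub>K\<^esub>" if "h \<in> mod_hom L P1 (regular_module L)" "m \<in> carrier M" for h m
      using balanced_zero[OF assms] that by blast
    have "\<phi> m = \<zero>\<^bsub>D\<^esub>" if m: "m \<in> carrier M" for m
      unfolding D_simps
    proof
      fix C show "\<phi> m C = (\<lambda>x\<in>carrier T. \<zero>\<^bsub>K\<^esub>) C"
        using \<phi>D(1)[OF m] z[OF _ m] by (cases "C \<in> carrier T") (auto simp: T_carrier PiE_def extensional_def)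
    qed
    moreover have "\<phi> \<in> extensional (carrier M)" using \<phi> by (auto simp: mod_hom_def PiE_def)
    ultimately show "\<phi> \<in> {\<lambda>x\<in>carrier M. \<zero>\<^bsub>D\<^esub>}" by (auto simp: fun_eq_iff extensional_def)
  qed
qed

text \<open>If \<open>u\<close> does not factor through \<open>f\<close>, some functional on Hom(P1,
  M) kills all maps that do and is 1 at \<open>u\<close>. Composed with elementary tensors it is a
  balanced form, hence a homomorphism from \<open>M\<close> to the translate, hence zero. But
  \<open>u\<close> is a sum of elementary tensors.\<close>

lemma factors_if_rigid:
  assumes rigid: "mod_hom L M D = {\<lambda>x\<in>carrier M. \<zero>\<^bsub>D\<^esub>}" shows factors
proof (rule ccontr)
  assume "\<not> factors"
  then obtain u where u: "lin L P1 M u" and nf: "\<And>v. lin L P0 M v \<Longrightarrow> \<exists>x\<in>carrier P1. u x \<noteq> v (f x)"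
    by (auto simp: factors_def)
  let ?V = "homspace L P1 M"
  interpret V: left_module K ?V by (rule homspace_module[OF lms(3,1)])
  note SK = self_module[OF K.ring_axioms]
  define u0 where "u0 = restrict u (carrier P1)"
  have u0: "u0 \<in> mod_hom L P1 M" unfolding u0_def by (rule restrict_mod_hom[OF lms(3) u])
  define W where "W = {\<lambda>x\<in>carrier P1. v (f x) | v. lin L P0 M v}"
  have WI: "(\<lambda>x\<in>carrier P1. v (f x)) \<in> W" if "lin L P0 M v" for v using that by (auto simp: W_def)
  have Wsub: "submodule W K ?V"
  proof (rule V.submoduleI)
    show "W \<subseteq> carrier ?V" using restrict_mod_hom[OF lms(3) lin_comp[OF P1(2)]] by (auto simp: W_def)
    show "\<zero>\<^bsub>?V\<^esub> \<in> W" using WI[OF lin_const0[OF lms(1)]] by simp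
    fix x y assume "x \<in> W" "y \<in> W"
    then obtain v v' where v: "lin L P0 M v" "lin L P0 M v'" "x = (\<lambda>x\<in>carrier P1. v (f x))" "y = (\<lambda>x\<in>carrier P1. v' (f x))"
      by (auto simp: W_def)
    have "x \<oplus>\<^bsub>?V\<^esub> y = (\<lambda>x\<in>carrier P1. v (f x) \<oplus>\<^bsub>M\<^esub> v' (f x))"
      unfolding v(3,4) homspace_simps by (rule restrict_ext) simp
    then show "x \<oplus>\<^bsub>?V\<^esub> y \<in> W" using WI[OF lin_sum[OF lms(1) v(1,2)]] by simp
  next
    fix c x assume c: "c \<in> carrier K" and "x \<in> W"
    then obtain v where v: "lin L P0 M v" "x = (\<lambda>x\<in>carrier P1. v (f x))" by (auto simp: W_def)
    have "c \<odot>\<^bsub>?V\<^esub> x = (\<lambda>x\<in>carrier P1. sc c \<odot>\<^bsub>M\<^esub> v (f x))"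
      unfolding v(2) homspace_simps by (rule restrict_ext) simp
    then show "c \<odot>\<^bsub>?V\<^esub> x \<in> W" using WI[OF lin_comp[OF v(1) lin_sc[OF lms(1) c]]] by simp
  qed
  have "u0 \<notin> W"
  proof
    assume "u0 \<in> W"
    then obtain v where v: "lin L P0 M v" "u0 = (\<lambda>x\<in>carrier P1. v (f x))" by (auto simp: W_def)
    then have "u x = v (f x)" if "x \<in> carrier P1" for x using that unfolding u0_def by (metis restrict_apply')
    then show False using nf[OF v(1)] by blast
  qed
  then obtain \<theta> where \<theta>: "lin K ?V (self_module K) \<theta>" "\<And>w. w \<in> W \<Longrightarrow> \<theta> w = \<zero>\<^bsub>K\<^esub>" "\<theta> u0 = \<one>\<^bsub>K\<^esub>"
    using ex_functional[OF K.field_axioms V.left_module_axioms Wsub] u0 by (metis homspace_simps(1))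
  \<comment> \<open>The elementary tensor of \<open>h\<close> and \<open>m\<close>, read as a
    homomorphism from \<open>P1\<close> to \<open>M\<close>.\<close>
  define ten where "ten h m = (\<lambda>x\<in>carrier P1. h x \<odot>\<^bsub>M\<^esub> m)" for h m
  note hcl = lin_closed[OF mod_hom_lin, of _ L P1 "regular_module L", simplified]
  have ten: "ten h m \<in> mod_hom L P1 M" if "h \<in> mod_hom L P1 (regular_module L)" "m \<in> carrier M" for h m
    unfolding ten_def using mod_hom_lin[OF that(1)] hcl that
    by (intro restrict_mod_hom[OF lms(3)] linI) (auto simp: M.smult_l_distr M.smult_assoc1 lin_add lin_smult)
  have ten_add: "ten (h \<oplus>\<^bsub>H1\<^esub> h') m = ten h m \<oplus>\<^bsub>?V\<^esub> ten h' m"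
    if "h \<in> mod_hom L P1 (regular_module L)" "h' \<in> mod_hom L P1 (regular_module L)" "m \<in> carrier M" for h h' m
    unfolding ten_def homspace_simps hom_to_algebra_simps using that hcl by (intro restrict_ext) (simp add: M.smult_l_distr)
  have ten_add': "ten h (m \<oplus>\<^bsub>M\<^esub> m') = ten h m \<oplus>\<^bsub>?V\<^esub> ten h m'"
    if "h \<in> mod_hom L P1 (regular_module L)" "m \<in> carrier M" "m' \<in> carrier M" for h m m'
    unfolding ten_def homspace_simps hom_to_algebra_simps using that hcl by (intro restrict_ext) (simp add: M.smult_r_distr)
  have ten_act: "ten h (a \<odot>\<^bsub>M\<^esub> m) = ten (a \<odot>\<^bsub>H1\<^esub> h) m"
    if "h \<in> mod_hom L P1 (regular_module L)" "m \<in> carrier M" "a \<in> carrier L" for h m a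
    unfolding ten_def homspace_simps hom_to_algebra_simps using that hcl by (intro restrict_ext) (simp add: M.smult_assoc1)
  have ten_sc: "ten (c \<odot>\<^bsub>V1\<^esub> h) m = c \<odot>\<^bsub>?V\<^esub> ten h m"
    if "h \<in> mod_hom L P1 (regular_module L)" "m \<in> carrier M" "c \<in> carrier K" for h m c
    unfolding ten_def homspace_simps hom_to_algebra_simps using that hcl by (intro restrict_ext) (simp add: M.smult_assoc1[symmetric])
  define \<beta> where "\<beta> h m = \<theta> (ten h m)" for h m
  have \<beta>lin: "lin K V1 (self_module K) (\<lambda>h. \<beta> h m)" if "m \<in> carrier M" for m
  proof (rule linI)
    fix x y a assume x: "x \<in> carrier V1"
    then have x': "x \<in> mod_hom L P1 (regular_module L)" by simp
    show "\<beta> x m \<in> carrier (self_module K)" using lin_closed[OF \<theta>(1)] ten[OF x' that] by (simp add: \<beta>_def)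
    { assume "y \<in> carrier V1"
      then have y': "y \<in> mod_hom L P1 (regular_module L)" by simp
      show "\<beta> (x \<oplus>\<^bsub>V1\<^esub> y) m = \<beta> x m \<oplus>\<^bsub>self_module K\<^esub> \<beta> y m"
        unfolding \<beta>_def V1_add ten_add[OF x' y' that] using ten[OF x' that] ten[OF y' that] by (intro lin_add[OF \<theta>(1)]) auto }
    assume a: "a \<in> carrier K"
    show "\<beta> (a \<odot>\<^bsub>V1\<^esub> x) m = a \<odot>\<^bsub>self_module K\<^esub> \<beta> x m"
      unfolding \<beta>_def ten_sc[OF x' that a] using ten[OF x' that] a by (intro lin_smult[OF \<theta>(1)]) auto
  qed
  have \<beta>im: "\<beta> w m = \<zero>\<^bsub>K\<^esub>" if wi: "w \<in> im" and m: "m \<in> carrier M" for w m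
  proof -
    obtain h where h: "lin L P0 (regular_module L) h" "w = (\<lambda>x\<in>carrier P1. h (f x))" using imE[OF wi] by blast
    have "lin L P0 M (\<lambda>y. h y \<odot>\<^bsub>M\<^esub> m)"
      using h(1) lin_closed[OF h(1)] m by (intro linI) (auto simp: lin_add lin_smult M.smult_l_distr M.smult_assoc1)
    then have "(\<lambda>x\<in>carrier P1. h (f x) \<odot>\<^bsub>M\<^esub> m) \<in> W" by (rule WI)
    moreover have "ten w m = (\<lambda>x\<in>carrier P1. h (f x) \<odot>\<^bsub>M\<^esub> m)" unfolding ten_def h(2) by (rule restrict_ext) simp
    ultimately show ?thesis using \<theta>(2) by (simp add: \<beta>_def)
  qed
  have \<beta>cs: "\<beta> h' m = \<beta> h m" if hc: "h' \<in> cs h" "h \<in> mod_hom L P1 (regular_module L)" and m: "m \<in> carrier M" for h h' m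
  proof -
    note that = hc m
    obtain w where w: "w \<in> im" "h' = w \<oplus>\<^bsub>H1\<^esub> h" by (rule cs_memE[OF hc])
    have "\<beta> (w \<oplus>\<^bsub>V1\<^esub> h) m = \<beta> w m \<oplus>\<^bsub>K\<^esub> \<beta> h m"
      using lin_add[OF \<beta>lin[OF that(3)], of w h] w(1) im_subset that(2) by auto
    then show ?thesis using \<beta>im[OF w(1) that(3)] w(2) lin_closed[OF \<beta>lin[OF that(3)], of h] that(2) V1_add by simp
  qed
  \<comment> \<open>An arbitrary representative of the coset is used; \<open>\<beta>cs\<close> shows
    that the value does not depend on it.\<close>
  define \<phi> where "\<phi> = (\<lambda>m\<in>carrier M. \<lambda>C\<in>carrier T. \<beta> (SOME h. h \<in> C) m)"
  have \<phi>: "\<phi> m (cs h) = \<beta> h m" if "h \<in> mod_hom L P1 (regular_module L)" "m \<in> carrier M" for h m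
  proof -
    have "(SOME h'. h' \<in> cs h) \<in> cs h" using cs_self[OF that(1)] unfolding some_in_eq by blast
    then show ?thesis using \<beta>cs that by (simp add: \<phi>_def T_carrier)
  qed
  have "\<phi> \<in> mod_hom L M D"
    unfolding mod_hom_iff[OF lms(1)]
  proof
    show "\<phi> \<in> extensional (carrier M)" by (simp add: \<phi>_def)
    have ext: "\<phi> m \<in> extensional (carrier T)" if "m \<in> carrier M" for m using that by (simp add: \<phi>_def)
    have eqI: "\<phi> m = \<xi>" if "m \<in> carrier M" "\<xi> \<in> extensional (carrier T)"
      "\<And>h. h \<in> mod_hom L P1 (regular_module L) \<Longrightarrow> \<beta> h m = \<xi> (cs h)" for m \<xi>
      by (rule extensionalityI[OF ext[OF that(1)] that(2)]) (use \<phi> that in \<open>auto simp: T_carrier\<close>)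
    have \<beta>cl: "\<beta> h m \<in> carrier K" if "h \<in> mod_hom L P1 (regular_module L)" "m \<in> carrier M" for h m
      using lin_closed[OF \<beta>lin[OF that(2)], of h] that(1) by simp
    show "lin L M D \<phi>"
    proof (rule linI)
      fix m assume m: "m \<in> carrier M"
      have "\<phi> m \<in> carrier T \<rightarrow>\<^sub>E carrier K" using ext[OF m] \<phi> m \<beta>cl by (auto simp: PiE_def T_carrier)
      moreover have "lin K V1 (self_module K) (\<lambda>h. \<phi> m (cs h))"
        by (rule lin_cong[OF \<beta>lin[OF m] _ V1.left_module_axioms]) (use \<phi> m in simp)
      ultimately show "\<phi> m \<in> carrier D" using D_mem by blast
      fix m' assume m': "m' \<in> carrier M"
      show "\<phi> (m \<oplus>\<^bsub>M\<^esub> m') = \<phi> m \<oplus>\<^bsub>D\<^esub> \<phi> m'"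
      proof (rule eqI)
        fix h assume h: "h \<in> mod_hom L P1 (regular_module L)"
        have "\<beta> h (m \<oplus>\<^bsub>M\<^esub> m') = \<beta> h m \<oplus>\<^bsub>K\<^esub> \<beta> h m'"
          unfolding \<beta>_def ten_add'[OF h m m'] using lin_add[OF \<theta>(1)] ten[OF h m] ten[OF h m'] by simp
        then show "\<beta> h (m \<oplus>\<^bsub>M\<^esub> m') = (\<phi> m \<oplus>\<^bsub>D\<^esub> \<phi> m') (cs h)" using h m m' \<phi> by (simp add: D_simps T_carrier)
      qed (use m m' in \<open>auto simp: D_simps\<close>)
    next
      fix a m assume a: "a \<in> carrier L" and m: "m \<in> carrier M"
      show "\<phi> (a \<odot>\<^bsub>M\<^esub> m) = a \<odot>\<^bsub>D\<^esub> \<phi> m"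
      proof (rule eqI)
        fix h assume h: "h \<in> mod_hom L P1 (regular_module L)"
        have "\<beta> h (a \<odot>\<^bsub>M\<^esub> m) = \<beta> (a \<odot>\<^bsub>H1\<^esub> h) m" unfolding \<beta>_def ten_act[OF h m a] ..
        also have "\<dots> = \<phi> m (cs (a \<odot>\<^bsub>H1\<^esub> h))" using \<phi>[OF H1_closed(2)[OF h a] m] by simp
        also have "\<dots> = (a \<odot>\<^bsub>D\<^esub> \<phi> m) (cs h)" unfolding D_simps T_smult[OF h a, symmetric] using h by (simp add: T_carrier)
        finally show "\<beta> h (a \<odot>\<^bsub>M\<^esub> m) = (a \<odot>\<^bsub>D\<^esub> \<phi> m) (cs h)" .
      qed (use m a in \<open>auto simp: D_simps\<close>)
    qed
  qed
  then have "\<phi> = (\<lambda>x\<in>carrier M. \<zero>\<^bsub>D\<^esub>)" using rigid by blast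
  then have \<beta>0: "\<beta> h m = \<zero>\<^bsub>K\<^esub>" if "h \<in> mod_hom L P1 (regular_module L)" "m \<in> carrier M" for h m
    using \<phi>[OF that] that by (simp add: D_simps T_carrier)
  obtain n p c where db: "dual_basis L P1 n p c" using projective_dual_basis[OF P1(1)] by blast
  have pc: "p i \<in> carrier P1" "restrict (c i) (carrier P1) \<in> mod_hom L P1 (regular_module L)" if "i < n" for i
    using db that restrict_mod_hom[OF lms(3), of "regular_module L" "c i"] by (auto simp: dual_basis_def)
  note up = lin_closed[OF u pc(1)]
  let ?t = "\<lambda>i. ten (restrict (c i) (carrier P1)) (u (p i))"
  have tc: "?t i \<in> mod_hom L P1 M" if "i < n" for i using ten[OF pc(2) up] that by blast
  \<comment> \<open>The dual basis of \<open>P1\<close> exhibits \<open>u\<close> as a sum of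
    elementary tensors.\<close>
  have "u0 = lsum ?V ?t n"
  proof (rule mod_hom_ext[OF u0])
    have "lsum ?V ?t n \<in> carrier ?V" using tc by (intro lsum_closed[OF V.left_module_axioms]) auto
    then show "lsum ?V ?t n \<in> mod_hom L P1 M" by simp
    fix x assume x: "x \<in> carrier P1"
    have "lsum ?V ?t n x = lsum M (\<lambda>i. c i x \<odot>\<^bsub>M\<^esub> u (p i)) n" using x by (simp add: lsum_homspace ten_def)
    also have "\<dots> = u x" by (rule dual_basis_expand[OF lms(3,1) db u x, symmetric])
    finally show "u0 x = lsum ?V ?t n x" using x by (simp add: u0_def)
  qed
  then have "\<theta> u0 = lsum (self_module K) (\<lambda>i. \<theta> (?t i)) n"
    using lin_lsum[OF V.left_module_axioms SK \<theta>(1), of n ?t] tc by simp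
  also have "\<dots> = \<zero>\<^bsub>self_module K\<^esub>" using \<beta>0[OF pc(2) up] by (intro lsum_zero[OF SK]) (simp add: \<beta>_def)
  finally show False using \<theta>(3) by simp
qed

lemma rigid_iff_factors: "mod_hom L M D = {\<lambda>x\<in>carrier M. \<zero>\<^bsub>D\<^esub>} \<longleftrightarrow> factors"
  using rigid_if_factors factors_if_rigid by blast

end

text \<open>The finite sums of images of elements of \<open>T\<close>. Statements about modules
  generated by \<open>T\<close> are proved by induction over these sums, without forming powers of
  \<open>T\<close>, and \<open>T\<close> and \<open>Q\<close> may have different carrier
  types.\<close>

inductive_set trace :: "('a, 'y) ring_scheme \<Rightarrow> ('a, 'm) module \<Rightarrow> ('a, 'n) module \<Rightarrow> 'n set"
  for R T Q where
  zero: "\<zero>\<^bsub>Q\<^esub> \<in> trace R T Q"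
| step: "lin R T Q h \<Longrightarrow> t \<in> carrier T \<Longrightarrow> y \<in> trace R T Q \<Longrightarrow> h t \<oplus>\<^bsub>Q\<^esub> y \<in> trace R T Q"

lemma trace_closed:
  assumes "left_module R Q" "x \<in> trace R T Q" shows "x \<in> carrier Q"
proof -
  interpret Q: left_module R Q by fact
  show ?thesis using assms(2) by induction (auto intro: lin_closed)
qed

lemma trace_hom: "left_module R Q \<Longrightarrow> lin R T Q h \<Longrightarrow> t \<in> carrier T \<Longrightarrow> h t \<in> trace R T Q"
proof -
  assume a: "left_module R Q" "lin R T Q h" "t \<in> carrier T"
  interpret Q: left_module R Q by fact
  show ?thesis using trace.step[OF a(2,3) trace.zero] lin_closed[OF a(2,3)] by simp
qed

lemma trace_submodule:
  assumes "left_module R T" "left_module R Q" shows "submodule (trace R T Q) R Q"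
proof -
  interpret T: left_module R T by fact
  interpret Q: left_module R Q by fact
  note cl = trace_closed[OF assms(2), of _ T]
  show ?thesis
  proof (rule Q.submoduleI)
    show "trace R T Q \<subseteq> carrier Q" using cl by auto
    show "\<zero>\<^bsub>Q\<^esub> \<in> trace R T Q" by (rule trace.zero)
    fix x y assume "x \<in> trace R T Q" and y: "y \<in> trace R T Q"
    then show "x \<oplus>\<^bsub>Q\<^esub> y \<in> trace R T Q"
    proof induction
      case zero then show ?case using cl by simp
    next
      case (step h t z)
      then have "h t \<oplus>\<^bsub>Q\<^esub> z \<oplus>\<^bsub>Q\<^esub> y = h t \<oplus>\<^bsub>Q\<^esub> (z \<oplus>\<^bsub>Q\<^esub> y)"
        using cl lin_closed[OF step(1,2)] by (simp add: Q.M.a_assoc)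
      then show ?case using trace.step[OF step(1,2) step.IH[OF step.prems]] by simp
    qed
  next
    fix a x assume a: "a \<in> carrier R" and "x \<in> trace R T Q"
    from this(2) show "a \<odot>\<^bsub>Q\<^esub> x \<in> trace R T Q"
    proof induction
      case zero show ?case using a by (simp add: trace.zero)
    next
      case (step h t z)
      then have "a \<odot>\<^bsub>Q\<^esub> (h t \<oplus>\<^bsub>Q\<^esub> z) = h (a \<odot>\<^bsub>T\<^esub> t) \<oplus>\<^bsub>Q\<^esub> a \<odot>\<^bsub>Q\<^esub> z"
        using cl lin_closed[OF step(1,2)] a by (simp add: Q.smult_r_distr lin_smult[OF step(1)])
      then show ?case using trace.step[OF step(1) _ step.IH, of "a \<odot>\<^bsub>T\<^esub> t"] a step by simp
    qed
  qed
qed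

lemma trace_map:
  assumes "left_module R Q" "left_module R Q'" "lin R Q Q' k" "x \<in> trace R T Q"
  shows "k x \<in> trace R T Q'"
  using assms(4)
proof induction
  case zero then show ?case using lin_zero[OF assms(1-3)] trace.zero by metis
next
  case (step h t y)
  have "k (h t \<oplus>\<^bsub>Q\<^esub> y) = k (h t) \<oplus>\<^bsub>Q'\<^esub> k y"
    by (rule lin_add[OF assms(3) lin_closed[OF step(1,2)] trace_closed[OF assms(1) step(3)]])
  then show ?case using trace.step[OF lin_comp[OF step(1) assms(3)] step(2) step.IH] by simp
qed

definition gen :: "('a, 'y) ring_scheme \<Rightarrow> ('a, 'm) module \<Rightarrow> ('a, 'n) module \<Rightarrow> bool" where
  "gen R T Q \<longleftrightarrow> carrier Q \<subseteq> trace R T Q"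

text \<open>With \<open>C\<close> all finitely generated modules and \<open>\<Q> = gen R M\<close> this says that \<open>Ext(M, -)\<close> vanishes on the modules
  generated by \<open>M\<close>, without mentioning projectives, which change with the ring.\<close>

definition lifts where
  "lifts R \<Q> C M \<longleftrightarrow> (\<forall>E\<in>C. \<forall>Z\<in>C. \<forall>p u. lin R E Z p \<longrightarrow> p ` carrier E = carrier Z \<longrightarrow>
     \<Q> (E\<lparr>carrier := lker E Z p\<rparr>) \<longrightarrow> lin R M Z u \<longrightarrow> (\<exists>s. lin R M E s \<and> (\<forall>x\<in>carrier M. p (s x) = u x)))"

lemma liftsI:
  assumes "\<And>E Z p u. E \<in> C \<Longrightarrow> Z \<in> C \<Longrightarrow> lin R E Z p \<Longrightarrow> p ` carrier E = carrier Z \<Longrightarrow>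
     \<Q> (E\<lparr>carrier := lker E Z p\<rparr>) \<Longrightarrow> lin R M Z u \<Longrightarrow> \<exists>s. lin R M E s \<and> (\<forall>x\<in>carrier M. p (s x) = u x)"
  shows "lifts R \<Q> C M"
  using assms unfolding lifts_def by blast

lemma liftsD:
  assumes "lifts R \<Q> C M" "E \<in> C" "Z \<in> C" "lin R E Z p" "p ` carrier E = carrier Z"
     "\<Q> (E\<lparr>carrier := lker E Z p\<rparr>)" "lin R M Z u"
  shows "\<exists>s. lin R M E s \<and> (\<forall>x\<in>carrier M. p (s x) = u x)"
  using assms unfolding lifts_def by blast

section \<open>Factoring through the presentation and lifting against generated kernels\<close>

context presentation begin

text \<open>The map \<open>u\<close> after \<open>g\<close> lifts to \<open>l\<close> on the
  projective \<open>P0\<close>, and \<open>l\<close> after \<open>f\<close> takes values in the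
  kernel \<open>Q\<close> of \<open>p\<close>. As \<open>Q\<close> is generated by \<open>M\<close>,
  this map on \<open>P1\<close> has the form \<open>w\<close> after \<open>f\<close> with
  \<open>w\<close> into \<open>Q\<close>; the difference of \<open>l\<close> and \<open>w\<close>
  descends to \<open>M\<close>.\<close>

lemma lifts_if_factors:
  assumes factors shows "lifts L (gen L M) (fgmod L) M"
proof (rule liftsI)
  fix E Z p u
  assume E: "E \<in> fgmod L" and Z: "Z \<in> fgmod L" and p: "lin L E Z p" "p ` carrier E = carrier Z"
    and gen: "gen L M (E\<lparr>carrier := lker E Z p\<rparr>)" and u: "lin L M Z u"
  interpret E: left_module L E using E by (simp add: fgmod_def)
  interpret Z: left_module L Z using Z by (simp add: fgmod_def)
  note ker = ker_submodule[OF E.left_module_axioms Z.left_module_axioms p(1)]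
  define Q where "Q = E\<lparr>carrier := lker E Z p\<rparr>"
  interpret Q: left_module L Q unfolding Q_def by (rule E.sub_module[OF ker])
  have cQ: "carrier Q = lker E Z p" "\<zero>\<^bsub>Q\<^esub> = \<zero>\<^bsub>E\<^esub>" "ring.add Q = ring.add E" "smult Q = smult E" by (simp_all add: Q_def)
  obtain l where l: "lin L P0 E l" "\<forall>x\<in>carrier P0. p (l x) = u (g x)"
    using projective_lift[OF P0(1) E Z p lin_comp[OF P0(2) u]] by blast
  obtain n pp c where db: "dual_basis L P1 n pp c" using projective_dual_basis[OF P1(1)] by blast
  have pc: "pp i \<in> carrier P1" "lin L P1 (regular_module L) (c i)" if "i < n" for i
    using db that by (auto simp: dual_basis_def)
  have gf: "g (f x) = \<zero>\<^bsub>M\<^esub>" "f x \<in> carrier P0" if "x \<in> carrier P1" for x using P1(3) that by auto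
  have lfQ: "l (f x) \<in> carrier Q" if "x \<in> carrier P1" for x
    using gf[OF that] l lin_closed[OF l(1)] lin_zero[OF lms(1) Z.left_module_axioms u] by (simp add: cQ)
  \<comment> \<open>For a rank one map \<open>x \<mapsto> d x \<odot> y\<close> the extension along
    \<open>f\<close> is found by induction on the sum representing \<open>y\<close>: each term comes
    from a map into \<open>M\<close>, to which \<open>factors\<close> applies. The dual basis of
    \<open>P1\<close> then assembles the general case.\<close>
  have one: "\<exists>w. lin L P0 Q w \<and> (\<forall>x\<in>carrier P1. w (f x) = d x \<odot>\<^bsub>Q\<^esub> y)"
    if d: "lin L P1 (regular_module L) d" and "y \<in> trace L M Q" for d y
    using that(2)
  proof induction
    case zero
    show ?case using lin_const0[OF Q.left_module_axioms] lin_closed[OF d] by (intro exI[of _ "\<lambda>_. \<zero>\<^bsub>Q\<^esub>"]) auto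
  next
    case (step h t y)
    then obtain w where w: "lin L P0 Q w" "\<forall>x\<in>carrier P1. w (f x) = d x \<odot>\<^bsub>Q\<^esub> y" by blast
    have "lin L P1 M (\<lambda>x. d x \<odot>\<^bsub>M\<^esub> t)"
      using lin_closed[OF d] lin_add[OF d] lin_smult[OF d] step(2)
      by (intro linI) (auto simp: M.smult_l_distr M.smult_assoc1)
    then obtain v where v: "lin L P0 M v" "\<forall>x\<in>carrier P1. d x \<odot>\<^bsub>M\<^esub> t = v (f x)" using assms by (auto simp: factors_def)
    have "h (v (f x)) \<oplus>\<^bsub>Q\<^esub> w (f x) = d x \<odot>\<^bsub>Q\<^esub> (h t \<oplus>\<^bsub>Q\<^esub> y)" if x: "x \<in> carrier P1" for x
    proof -
      have "h (v (f x)) = d x \<odot>\<^bsub>Q\<^esub> h t" using v(2) x lin_smult[OF step(1), of "d x" t] step(2) lin_closed[OF d x] by simp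
      then show ?thesis using w(2) x lin_closed[OF d x] lin_closed[OF step(1,2)] trace_closed[OF Q.left_module_axioms step(3)]
        by (simp add: Q.smult_r_distr)
    qed
    then show ?case using lin_sum[OF Q.left_module_axioms lin_comp[OF v(1) step(1)] w(1)] by blast
  qed
  have "\<exists>w. lin L P0 Q w \<and> (\<forall>x\<in>carrier P1. w (f x) = lsum Q (\<lambda>i. c i x \<odot>\<^bsub>Q\<^esub> l (f (pp i))) m)" if "m \<le> n" for m
    using that
  proof (induction m)
    case 0 show ?case using lin_const0[OF Q.left_module_axioms] by (intro exI[of _ "\<lambda>_. \<zero>\<^bsub>Q\<^esub>"]) auto
  next
    case (Suc m)
    then obtain w where w: "lin L P0 Q w" "\<forall>x\<in>carrier P1. w (f x) = lsum Q (\<lambda>i. c i x \<odot>\<^bsub>Q\<^esub> l (f (pp i))) m" by auto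
    have "l (f (pp m)) \<in> trace L M Q" using lfQ[OF pc(1)] gen Suc.prems by (auto simp: gen_def Q_def)
    then obtain w' where w': "lin L P0 Q w'" "\<forall>x\<in>carrier P1. w' (f x) = c m x \<odot>\<^bsub>Q\<^esub> l (f (pp m))"
      using one[OF pc(2)[OF Suc_le_lessD[OF Suc.prems]]] by blast
    then show ?case using w lin_sum[OF Q.left_module_axioms w(1) w'(1)] by (intro exI[of _ "\<lambda>x. w x \<oplus>\<^bsub>Q\<^esub> w' x"]) auto
  qed
  then obtain w where w: "lin L P0 Q w" "\<forall>x\<in>carrier P1. w (f x) = lsum Q (\<lambda>i. c i x \<odot>\<^bsub>Q\<^esub> l (f (pp i))) n" by blast
  have lq: "lin L P1 Q (\<lambda>x. l (f x))"
    unfolding Q_def by (rule lin_corestrict[OF lin_comp[OF P1(2) l(1)]]) (use lfQ cQ in auto)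
  have wf: "w (f x) = l (f x)" if "x \<in> carrier P1" for x
    by (rule trans[OF w(2)[rule_format, OF that] dual_basis_expand[OF lms(3) Q.left_module_axioms db lq that, symmetric]])
  have wE: "lin L P0 E w" using lin_decorestrict[OF w(1)[unfolded Q_def] E.sub_subset[OF ker]] .
  have pw: "p (w x) = \<zero>\<^bsub>Z\<^esub>" if "x \<in> carrier P0" for x using lin_closed[OF w(1) that] by (simp add: cQ)
  have "\<exists>s. lin L M E s \<and> (\<forall>x\<in>carrier P0. s (g x) = l x \<ominus>\<^bsub>E\<^esub> w x)"
  proof (rule lin_factor[OF lms(2,1) E.left_module_axioms P0(2) lin_diff[OF E.left_module_axioms l(1) wE] P0(3)])
    fix x assume "x \<in> carrier P0" "g x = \<zero>\<^bsub>M\<^esub>"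
    then have "x \<in> f ` carrier P1" using P1(3) by simp
    then show "l x \<ominus>\<^bsub>E\<^esub> w x = \<zero>\<^bsub>E\<^esub>" using wf lin_closed[OF l(1)] gf(2) by auto
  qed
  then obtain s where s: "lin L M E s" "\<forall>x\<in>carrier P0. s (g x) = l x \<ominus>\<^bsub>E\<^esub> w x" by blast
  have "p (s y) = u y" if y: "y \<in> carrier M" for y
  proof -
    obtain x where x: "x \<in> carrier P0" "y = g x" using P0(3) y by auto
    have "p (s y) = p (l x \<ominus>\<^bsub>E\<^esub> w x)" using s(2) x by simp
    also have "\<dots> = p (l x) \<ominus>\<^bsub>Z\<^esub> p (w x)"
      by (rule lin_minus[OF E.left_module_axioms Z.left_module_axioms p(1) lin_closed[OF l(1) x(1)] lin_closed[OF wE x(1)]])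
    finally have "p (s y) = p (l x) \<ominus>\<^bsub>Z\<^esub> p (w x)" .
    then show ?thesis using pw l(2) x lin_closed[OF u y] by simp
  qed
  then show "\<exists>s. lin L M E s \<and> (\<forall>x\<in>carrier M. p (s x) = u x)" using s(1) by blast
qed

text \<open>Pushing out along \<open>f\<close> and \<open>u\<close> gives an extension of
  \<open>M\<close> whose kernel is a quotient of \<open>M\<close>, so the lifting property splits
  it. The splitting yields a map \<open>w\<close> on \<open>P0\<close> that agrees with
  \<open>u\<close> along \<open>f\<close> up to \<open>u\<close> of the kernel of \<open>f\<close>,
  and minimality of the presentation removes this error.\<close>

lemma factors_if_lifts:
  assumes lifts: "lifts L (gen L M) (fgmod L) M" shows factors
  unfolding factors_def
proof (intro allI impI)
  fix u assume u: "lin L P1 M u"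
  obtain S :: "('k, 'a) fdmod" and i1 i2 p1 p2 where S: "S \<in> fgmod L" "biproduct L S P0 M i1 i2 p1 p2"
    by (rule ex_biproduct[of P0 M]) (use fg M in \<open>auto simp: fgmod_iff\<close>)
  interpret S: left_module L S using S(1) by (simp add: fgmod_def)
  have b: "lin L P0 S i1" "lin L M S i2" "lin L S P0 p1" "lin L S M p2"
    "\<And>x. x \<in> carrier P0 \<Longrightarrow> p1 (i1 x) = x" "\<And>x. x \<in> carrier P0 \<Longrightarrow> p2 (i1 x) = \<zero>\<^bsub>M\<^esub>"
    "\<And>x. x \<in> carrier M \<Longrightarrow> p2 (i2 x) = x" "\<And>x. x \<in> carrier M \<Longrightarrow> p1 (i2 x) = \<zero>\<^bsub>P0\<^esub>"
    "\<And>z. z \<in> carrier S \<Longrightarrow> i1 (p1 z) \<oplus>\<^bsub>S\<^esub> i2 (p2 z) = z"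
    using S(2) by (auto simp: biproduct_def)
  note bc = b(1-4)[THEN lin_closed]
  define k where "k x = i1 (f x) \<ominus>\<^bsub>S\<^esub> i2 (u x)" for x
  have k: "lin L P1 S k"
    unfolding k_def by (rule lin_diff[OF S.left_module_axioms lin_comp[OF P1(2) b(1)] lin_comp[OF u b(2)]])
  have gf: "g (f x) = \<zero>\<^bsub>M\<^esub>" "f x \<in> carrier P0" if "x \<in> carrier P1" for x using P1(3) that by auto
  note uc = lin_closed[OF u]
  have k1: "p1 (k x) = f x" "p2 (k x) = \<ominus>\<^bsub>M\<^esub> u x" if "x \<in> carrier P1" for x
    unfolding k_def using that gf uc bc b(5-8) lin_minus[OF S.left_module_axioms lms(2) b(3)]
      lin_minus[OF S.left_module_axioms lms(1) b(4)] by (simp_all add: M.M.minus_eq)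
  define W where "W = k ` carrier P1"
  have W: "submodule W L S" unfolding W_def by (rule image_submodule[OF lms(3) S.left_module_axioms k P1.carrier_submodule])
  obtain E :: "('k, 'a) fdmod" and q where E: "E \<in> fgmod L" "lin L S E q" "q ` carrier S = carrier E" "lker S E q = W"
    using ex_quotient[of S W] S(1) W by (auto simp: fgmod_iff)
  interpret E: left_module L E using E(1) by (simp add: fgmod_def)
  note qz = lin_zero[OF S.left_module_axioms E.left_module_axioms E(2)]
  have "\<exists>p. lin L E M p \<and> (\<forall>z\<in>carrier S. p (q z) = g (p1 z))"
  proof (rule lin_factor[OF S.left_module_axioms E.left_module_axioms lms(1) E(2) lin_comp[OF b(3) P0(2)] E(3)])
    fix z assume "z \<in> carrier S" "q z = \<zero>\<^bsub>E\<^esub>"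
    then have "z \<in> W" using E(4) by auto
    then show "g (p1 z) = \<zero>\<^bsub>M\<^esub>" using k1 gf by (auto simp: W_def)
  qed
  then obtain p where p: "lin L E M p" "\<forall>z\<in>carrier S. p (q z) = g (p1 z)" by blast
  have psurj: "p ` carrier E = carrier M"
  proof
    show "p ` carrier E \<subseteq> carrier M" using lin_closed[OF p(1)] by auto
    show "carrier M \<subseteq> p ` carrier E"
    proof
      fix m assume "m \<in> carrier M"
      then obtain x where x: "x \<in> carrier P0" "m = g x" using P0(3) by auto
      then have "m = p (q (i1 x))" "q (i1 x) \<in> carrier E" using p(2) b bc lin_closed[OF E(2)] by auto
      then show "m \<in> p ` carrier E" by blast
    qed
  qed
  have kerp: "submodule (lker E M p) L E" by (rule ker_submodule[OF E.left_module_axioms lms(1) p(1)])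
  define Q where "Q = E\<lparr>carrier := lker E M p\<rparr>"
  have Q: "Q \<in> fgmod L" unfolding Q_def using fgm_sub[of E] E(1) kerp by (simp add: fgmod_iff)
  interpret Q: left_module L Q using Q by (simp add: fgmod_def)
  have cQ: "carrier Q = lker E M p" by (simp add: Q_def)
  have qi2: "lin L M Q (\<lambda>m. q (i2 m))"
    unfolding Q_def
    by (rule lin_corestrict[OF lin_comp[OF b(2) E(2)]])
      (use p(2) b(8) bc lin_closed[OF E(2)] lin_zero[OF lms(2,1) P0(2)] in auto)
  have qsurj: "\<exists>m\<in>carrier M. e = q (i2 m)" if eQ: "e \<in> carrier Q" for e
  proof -
    obtain z where z: "z \<in> carrier S" "e = q z" using eQ E(3) cQ by auto
    then have "p1 z \<in> lker P0 M g" using eQ p(2) bc by (simp add: cQ)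
    then obtain x where x: "x \<in> carrier P1" "p1 z = f x" unfolding P1(3)[symmetric] by blast
    have "z = k x \<oplus>\<^bsub>S\<^esub> i2 (u x \<oplus>\<^bsub>M\<^esub> p2 z)"
    proof -
      have "k x \<oplus>\<^bsub>S\<^esub> i2 (u x \<oplus>\<^bsub>M\<^esub> p2 z) = (i1 (f x) \<ominus>\<^bsub>S\<^esub> i2 (u x)) \<oplus>\<^bsub>S\<^esub> i2 (u x) \<oplus>\<^bsub>S\<^esub> i2 (p2 z)"
        using x z gf uc bc lin_add[OF b(2)] by (simp add: k_def S.M.a_assoc[symmetric])
      also have "\<dots> = i1 (p1 z) \<oplus>\<^bsub>S\<^esub> i2 (p2 z)" using x gf uc bc by simp
      finally show ?thesis using b(9)[OF z(1)] by simp
    qed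
    then have "e = q (k x) \<oplus>\<^bsub>E\<^esub> q (i2 (u x \<oplus>\<^bsub>M\<^esub> p2 z))"
      using z x uc bc lin_add[OF E(2), of "k x" "i2 (u x \<oplus>\<^bsub>M\<^esub> p2 z)"] lin_closed[OF k] by simp
    moreover have "q (k x) = \<zero>\<^bsub>E\<^esub>" using E(4) x by (auto simp: W_def)
    ultimately show ?thesis using z x uc bc lin_closed[OF E(2)] by (intro bexI[of _ "u x \<oplus>\<^bsub>M\<^esub> p2 z"]) auto
  qed
  then have "gen L M Q" using trace_hom[OF Q.left_module_axioms qi2] by (auto simp: gen_def)
  then obtain s where s: "lin L M E s" "\<forall>x\<in>carrier M. p (s x) = x"
    using liftsD[OF lifts E(1) M p(1) psurj _ lin_id] by (auto simp: Q_def)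
  \<comment> \<open>Both terms lie over \<open>g y\<close> in \<open>M\<close>, so their difference
    lies in the kernel \<open>Q\<close>; projectivity of \<open>P0\<close> lifts it through the
    surjection from \<open>M\<close> onto \<open>Q\<close>.\<close>
  define a where "a y = q (i1 y) \<ominus>\<^bsub>E\<^esub> s (g y)" for y
  have aE: "lin L P0 E a"
    unfolding a_def by (rule lin_diff[OF E.left_module_axioms lin_comp[OF b(1) E(2)] lin_comp[OF P0(2) s(1)]])
  have aQ: "lin L P0 Q a"
    unfolding Q_def
  proof (rule lin_corestrict[OF aE])
    fix y assume y: "y \<in> carrier P0"
    note gy = lin_closed[OF P0(2) y]
    have "p (a y) = p (q (i1 y)) \<ominus>\<^bsub>M\<^esub> p (s (g y))"
      unfolding a_def using lin_minus[OF E.left_module_axioms lms(1) p(1) lin_closed[OF E(2)] lin_closed[OF s(1)]] bc y gy by simp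
    also have "\<dots> = \<zero>\<^bsub>M\<^esub>" using p(2) s(2) b bc y gy by simp
    finally show "a y \<in> lker E M p" using lin_closed[OF aE y] by simp
  qed
  have "(\<lambda>m. q (i2 m)) ` carrier M = carrier Q" using qsurj lin_closed[OF qi2] by auto
  then obtain w where w: "lin L P0 M w" "\<forall>y\<in>carrier P0. q (i2 (w y)) = a y"
    using projective_lift[OF P0(1) M Q qi2 _ aQ] by blast
  note wc = lin_closed[OF w(1)]
  have wf: "lin L P1 M (\<lambda>x. u x \<ominus>\<^bsub>M\<^esub> w (f x))" by (rule lin_diff[OF lms(1) u lin_comp[OF P1(2) w(1)]])
  \<comment> \<open>In \<open>E\<close> the images of \<open>u x\<close> and \<open>w (f x)\<close>
    agree, so their difference in \<open>M\<close> is a relation; its component in \<open>P0\<close>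
    vanishes, which puts \<open>x'\<close> into the kernel of \<open>f\<close>.\<close>
  have ex: "\<exists>x'\<in>lker P1 P0 f. u x \<ominus>\<^bsub>M\<^esub> w (f x) = u x'" if x: "x \<in> carrier P1" for x
  proof -
    have "q (i2 (w (f x))) = q (i1 (f x))"
      using w(2) gf[OF x] lin_zero[OF lms(1) E.left_module_axioms s(1)] bc lin_closed[OF E(2)] by (simp add: a_def)
    moreover have "q (k x) = \<zero>\<^bsub>E\<^esub>" using E(4) x by (auto simp: W_def)
    then have "q (i1 (f x)) = q (i2 (u x))"
      unfolding k_def using lin_minus[OF S.left_module_axioms E.left_module_axioms E(2)] bc gf uc x lin_closed[OF E(2)] by simp
    ultimately have "q (i2 (u x \<ominus>\<^bsub>M\<^esub> w (f x))) = \<zero>\<^bsub>E\<^esub>"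
      using lin_minus[OF S.left_module_axioms E.left_module_axioms E(2)] lin_minus[OF lms(1) S.left_module_axioms b(2)]
        bc gf uc wc x lin_closed[OF E(2)] by simp
    then have "i2 (u x \<ominus>\<^bsub>M\<^esub> w (f x)) \<in> W" using E(4) bc uc wc gf x by auto
    then obtain x' where x': "x' \<in> carrier P1" "i2 (u x \<ominus>\<^bsub>M\<^esub> w (f x)) = k x'" by (auto simp: W_def)
    have "f x' = \<zero>\<^bsub>P0\<^esub>" using k1(1)[OF x'(1)] x'(2) b(8)[of "u x \<ominus>\<^bsub>M\<^esub> w (f x)"] uc wc gf x by simp
    moreover have "u x \<ominus>\<^bsub>M\<^esub> w (f x) = \<ominus>\<^bsub>M\<^esub> u x'"
      using k1(2)[OF x'(1)] x'(2) b(7)[of "u x \<ominus>\<^bsub>M\<^esub> w (f x)"] uc wc gf x by simp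
    then have "u x \<ominus>\<^bsub>M\<^esub> w (f x) = u (\<ominus>\<^bsub>P1\<^esub> x')" using lin_neg[OF lms(3,1) u x'(1)] by simp
    moreover have "f (\<ominus>\<^bsub>P1\<^esub> x') = \<zero>\<^bsub>P0\<^esub>" using lin_neg[OF lms(3,2) P1(2) x'(1)] calculation(1) by simp
    ultimately show ?thesis using x'(1) by (intro bexI[of _ "\<ominus>\<^bsub>P1\<^esub> x'"]) auto
  qed
  let ?N = "lker P1 M (\<lambda>x. u x \<ominus>\<^bsub>M\<^esub> w (f x))"
  have N: "submodule ?N L P1" by (rule ker_submodule[OF lms(3,1) wf])
  have kerf: "submodule (lker P1 P0 f) L P1" by (rule ker_submodule[OF lms(3,2) P1(2)])
  have "lker P1 P0 f <+>\<^bsub>P1\<^esub> ?N = carrier P1"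
  proof
    show "lker P1 P0 f <+>\<^bsub>P1\<^esub> ?N \<subseteq> carrier P1" by (auto simp: set_add_def')
    show "carrier P1 \<subseteq> lker P1 P0 f <+>\<^bsub>P1\<^esub> ?N"
    proof
      fix x assume x: "x \<in> carrier P1"
      then obtain x' where x': "x' \<in> carrier P1" "f x' = \<zero>\<^bsub>P0\<^esub>" "u x \<ominus>\<^bsub>M\<^esub> w (f x) = u x'" using ex by auto
      have "u x' \<ominus>\<^bsub>M\<^esub> w (f x') = u x'" using x' lin_zero[OF lms(2,1) w(1)] uc by simp
      then have "x \<ominus>\<^bsub>P1\<^esub> x' \<in> ?N" using lin_minus[OF lms(3,1) wf x x'(1)] x x' uc by simp
      moreover have "x = x' \<oplus>\<^bsub>P1\<^esub> (x \<ominus>\<^bsub>P1\<^esub> x')" using x x' by simp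
      ultimately show "x \<in> lker P1 P0 f <+>\<^bsub>P1\<^esub> ?N" using x' unfolding set_add_def' by blast
    qed
  qed
  then have "?N = carrier P1" using sup N unfolding superfluous_def by blast
  then have "u x \<ominus>\<^bsub>M\<^esub> w (f x) = \<zero>\<^bsub>M\<^esub>" if "x \<in> carrier P1" for x using that by blast
  then have "\<forall>x\<in>carrier P1. u x = w (f x)" using uc wc gf M.diff_zero_iff by blast
  then show "\<exists>v. lin L P0 M v \<and> (\<forall>x\<in>carrier P1. u x = v (f x))" using w(1) by blast
qed

end

text \<open>The criterion holds for every minimal presentation, in particular for the one selected
  by the choice operator in \<open>AR_translate\<close>.\<close>

theorem (in fdalg) tau_rigid_iff_lifts:
  assumes M: "M \<in> fgmod L" shows "tau_rigid K L M \<longleftrightarrow> lifts L (gen L M) (fgmod L) M"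
proof -
  let ?P = "\<lambda>(P1, f, P0). \<exists>g. min_proj_presentation L M P1 f P0 g"
  have "\<exists>t. ?P t" using ex_min_proj_presentation[OF M] by auto
  then have "?P (SOME t. ?P t)" by (rule someI_ex)
  moreover obtain P1 f P0 where *: "(SOME t. ?P t) = (P1, f, P0)" by (cases "SOME t. ?P t")
  ultimately obtain g where g: "min_proj_presentation L M P1 f P0 g" by auto
  have tr: "AR_translate K L M = k_dual K L (transpose_of L P1 f P0)"
    unfolding AR_translate_def * by simp
  interpret presentation K L M P1 P0 f g by unfold_locales (rule g, rule M)
  show ?thesis using rigid_iff_factors lifts_if_factors factors_if_lifts M
    unfolding tau_rigid_def tr T_def by blast
qed

section \<open>Counting indecomposable summands\<close>

lemma card_quot:
  assumes "\<And>x y. x \<in> S \<Longrightarrow> y \<in> S \<Longrightarrow> r x y \<longleftrightarrow> g x = g y"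
  shows "card (S // {(x, y) \<in> S \<times> S. r x y}) = card (g ` S)"
proof -
  let ?h = "\<lambda>z. {y \<in> S. g y = z}"
  have "{(x, y) \<in> S \<times> S. r x y} `` {x} = ?h (g x)" if "x \<in> S" for x
    using assms that by auto
  then have "S // {(x, y) \<in> S \<times> S. r x y} = ?h ` (g ` S)" by (auto simp: quotient_def)
  moreover have "inj_on ?h (g ` S)" by (rule inj_onI) blast
  ultimately show ?thesis by (simp add: card_image)
qed

text \<open>Compares isomorphism classes of modules whose carrier types or rings differ: the map
  need only be onto up to isomorphism. The equivalence properties are asked of \<open>r'\<close>
  alone, and \<open>r\<close> inherits them.\<close>

lemma card_quot_eq:
  assumes f: "f ` S \<subseteq> S'" and r: "\<And>x y. x \<in> S \<Longrightarrow> y \<in> S \<Longrightarrow> r x y \<longleftrightarrow> r' (f x) (f y)"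
    and surj: "\<And>y. y \<in> S' \<Longrightarrow> \<exists>x\<in>S. r' (f x) y"
    and refl: "\<And>y. y \<in> S' \<Longrightarrow> r' y y" and sym: "\<And>x y. x \<in> S' \<Longrightarrow> y \<in> S' \<Longrightarrow> r' x y \<Longrightarrow> r' y x"
    and trans: "\<And>x y z. x \<in> S' \<Longrightarrow> y \<in> S' \<Longrightarrow> z \<in> S' \<Longrightarrow> r' x y \<Longrightarrow> r' y z \<Longrightarrow> r' x z"
  shows "card (S // {(x, y) \<in> S \<times> S. r x y}) = card (S' // {(x, y) \<in> S' \<times> S'. r' x y})"
proof -
  let ?g = "\<lambda>y. {z \<in> S'. r' y z}"
  have g: "r' x y \<longleftrightarrow> ?g x = ?g y" if "x \<in> S'" "y \<in> S'" for x y
  proof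
    assume "r' x y" then show "?g x = ?g y" using that sym[of x y] trans[of x y] trans[of y x] by blast
  next
    assume "?g x = ?g y" then have "y \<in> ?g x" using refl that by blast
    then show "r' x y" by simp
  qed
  have "card (S // {(x, y) \<in> S \<times> S. r x y}) = card ((\<lambda>x. ?g (f x)) ` S)"
  proof (rule card_quot)
    fix x y assume "x \<in> S" "y \<in> S"
    then show "r x y \<longleftrightarrow> ?g (f x) = ?g (f y)" using r g f by blast
  qed
  also have "(\<lambda>x. ?g (f x)) ` S = ?g ` S'"
  proof
    show "(\<lambda>x. ?g (f x)) ` S \<subseteq> ?g ` S'" using f by blast
    show "?g ` S' \<subseteq> (\<lambda>x. ?g (f x)) ` S"
    proof
      fix z assume "z \<in> ?g ` S'"
      then obtain y where y: "y \<in> S'" "z = ?g y" by blast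
      then obtain x where x: "x \<in> S" "r' (f x) y" using surj by blast
      then have "?g (f x) = ?g y" using g y f by blast
      then show "z \<in> (\<lambda>x. ?g (f x)) ` S" using x y by blast
    qed
  qed
  also have "card \<dots> = card (S' // {(x, y) \<in> S' \<times> S'. r' x y})" using g by (intro card_quot[symmetric]) blast
  finally show ?thesis .
qed

definition isum :: "('a, 'y) ring_scheme \<Rightarrow> ('a, 'm) module \<Rightarrow> 'm set set" where
  "isum R M = {N. (\<exists>N'. complementary R M N N') \<and> indecomposable R (M\<lparr>carrier := N\<rparr>)}"

lemma num_summands_isum:
  "num_summands R M = card (iso_classes R ((\<lambda>N. M\<lparr>carrier := N\<rparr>) ` isum R M))"
  unfolding num_summands_def isum_def by (rule arg_cong[where f="\<lambda>S. card (iso_classes R S)"]) auto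

lemma isum_submodule: "N \<in> isum R M \<Longrightarrow> submodule N R M"
  by (auto simp: isum_def complementary_def)

lemma isum_module: "left_module R M \<Longrightarrow> N \<in> isum R M \<Longrightarrow> left_module R (M\<lparr>carrier := N\<rparr>)"
  using isum_submodule left_module.sub_module by blast

lemma complementary_image:
  assumes "left_module R M" "left_module R N" "lin R M N h" "bij_betw h (carrier M) (carrier N)"
    "complementary R M A B"
  shows "complementary R N (h ` A) (h ` B)"
proof -
  interpret M: left_module R M by fact
  interpret N: left_module R N by fact
  have A: "submodule A R M" "submodule B R M" "A \<inter> B = {\<zero>\<^bsub>M\<^esub>}"
    and ex: "\<forall>x\<in>carrier M. \<exists>n\<in>A. \<exists>n'\<in>B. x = n \<oplus>\<^bsub>M\<^esub> n'"
    using assms(5) by (auto simp: complementary_iff[OF assms(1)])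
  have inj: "inj_on h (carrier M)" and surj: "h ` carrier M = carrier N" using assms(4) by (auto simp: bij_betw_def)
  have "h ` A \<inter> h ` B = h ` (A \<inter> B)"
    using inj_on_image_Int[OF inj M.sub_subset[OF A(1)] M.sub_subset[OF A(2)]] by simp
  then have "h ` A \<inter> h ` B = {\<zero>\<^bsub>N\<^esub>}" using A(3) lin_zero[OF assms(1-3)] by simp
  moreover have "\<exists>n\<in>h ` A. \<exists>n'\<in>h ` B. y = n \<oplus>\<^bsub>N\<^esub> n'" if y: "y \<in> carrier N" for y
  proof -
    obtain x where x: "x \<in> carrier M" "y = h x" using surj y by blast
    then obtain a b where ab: "a \<in> A" "b \<in> B" "x = a \<oplus>\<^bsub>M\<^esub> b" using ex by blast
    then have "y = h a \<oplus>\<^bsub>N\<^esub> h b" using x M.sub_mem[OF A(1)] M.sub_mem[OF A(2)] lin_add[OF assms(3)] by simp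
    then show ?thesis using ab by blast
  qed
  ultimately show ?thesis
    using image_submodule[OF assms(1-3)] A by (simp add: complementary_iff[OF assms(2)])
qed

lemma indecomposable_iso:
  assumes "left_module R M" "left_module R N" "mod_iso R M N" "indecomposable R M"
  shows "indecomposable R N"
proof -
  interpret M: left_module R M by fact
  interpret N: left_module R N by fact
  obtain h where h: "lin R M N h" "bij_betw h (carrier M) (carrier N)"
    using assms(3) by (auto simp: mod_iso_iff[OF assms(1)])
  obtain g where g: "lin R N M g" "\<forall>x\<in>carrier M. g (h x) = x" "\<forall>y\<in>carrier N. h (g y) = y"
    "bij_betw g (carrier N) (carrier M)" using lin_inverse[OF assms(1) h] by blast
  have zero: "A = {\<zero>\<^bsub>N\<^esub>}" if "g ` A = {\<zero>\<^bsub>M\<^esub>}" "A \<subseteq> carrier N" for A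
  proof -
    have "A = h ` g ` A" using that(2) g(3) by force
    then show ?thesis using that(1) lin_zero[OF assms(1,2) h(1)] by simp
  qed
  show ?thesis
    unfolding indecomposable_def
  proof (intro conjI allI impI notI)
    assume "carrier N = {\<zero>\<^bsub>N\<^esub>}"
    then have "g ` carrier N = {\<zero>\<^bsub>M\<^esub>}" using lin_zero[OF assms(2,1) g(1)] by simp
    then show False using g(4) assms(4) by (simp add: bij_betw_def indecomposable_def)
  next
    fix A B assume c: "complementary R N A B"
    then have "complementary R M (g ` A) (g ` B)" using complementary_image[OF assms(2,1) g(1,4)] by blast
    then have "g ` A = {\<zero>\<^bsub>M\<^esub>} \<or> g ` B = {\<zero>\<^bsub>M\<^esub>}" using assms(4) by (auto simp: indecomposable_def)
    moreover have "A \<subseteq> carrier N" "B \<subseteq> carrier N" using c N.sub_subset by (auto simp: complementary_def)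
    ultimately show "A = {\<zero>\<^bsub>N\<^esub>} \<or> B = {\<zero>\<^bsub>N\<^esub>}" using zero by blast
  qed
qed

lemma iso_restrict:
  assumes "left_module R M" "left_module R N" "lin R M N h" "bij_betw h (carrier M) (carrier N)" "submodule A R M"
  shows "mod_iso R (M\<lparr>carrier := A\<rparr>) (N\<lparr>carrier := h ` A\<rparr>)"
proof -
  interpret M: left_module R M by fact
  have sub: "A \<subseteq> carrier M" by (rule M.sub_subset[OF assms(5)])
  have "lin R (M\<lparr>carrier := A\<rparr>) (N\<lparr>carrier := h ` A\<rparr>) h"
    using lin_restrict[OF assms(3) sub] by (rule lin_corestrict) auto
  moreover have "inj_on h A" using assms(4) sub by (auto simp: bij_betw_def intro: inj_on_subset)
  ultimately show ?thesis
    by (intro mod_isoI[OF M.sub_module[OF assms(5)]]) (auto simp: bij_betw_def)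
qed

lemma isum_image:
  assumes "left_module R M" "left_module R N" "lin R M N h" "bij_betw h (carrier M) (carrier N)" "A \<in> isum R M"
  shows "h ` A \<in> isum R N"
proof -
  interpret M: left_module R M by fact
  interpret N: left_module R N by fact
  obtain B where B: "complementary R M A B" and ind: "indecomposable R (M\<lparr>carrier := A\<rparr>)"
    using assms(5) by (auto simp: isum_def)
  have c: "complementary R N (h ` A) (h ` B)" by (rule complementary_image[OF assms(1-4) B])
  have s: "submodule A R M" "submodule (h ` A) R N" using B c by (auto simp: complementary_def)
  have "indecomposable R (N\<lparr>carrier := h ` A\<rparr>)"
    by (rule indecomposable_iso[OF M.sub_module[OF s(1)] N.sub_module[OF s(2)] iso_restrict[OF assms(1-4) s(1)] ind])
  then show ?thesis using c by (auto simp: isum_def)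
qed

lemma mod_iso_cong:
  assumes "left_module R A" "left_module R B" "left_module R A'" "left_module R B'"
    "mod_iso R A A'" "mod_iso R B B'"
  shows "mod_iso R A B \<longleftrightarrow> mod_iso R A' B'"
  using mod_iso_trans mod_iso_sym assms by metis

lemma num_summands_iso:
  assumes "left_module R M" "left_module R N" "mod_iso R M N"
  shows "num_summands R M = num_summands R N"
proof -
  interpret M: left_module R M by fact
  interpret N: left_module R N by fact
  obtain h where h: "lin R M N h" "bij_betw h (carrier M) (carrier N)"
    using assms(3) by (auto simp: mod_iso_iff[OF assms(1)])
  obtain g where g: "lin R N M g" "\<forall>x\<in>carrier M. g (h x) = x" "\<forall>y\<in>carrier N. h (g y) = y"
    "bij_betw g (carrier N) (carrier M)" using lin_inverse[OF assms(1) h] by blast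
  let ?S = "(\<lambda>A. M\<lparr>carrier := A\<rparr>) ` isum R M" and ?S' = "(\<lambda>A. N\<lparr>carrier := A\<rparr>) ` isum R N"
  let ?f = "\<lambda>U :: ('a, 'c) module. N\<lparr>carrier := h ` carrier U\<rparr>"
  note img = isum_image[OF assms(1,2) h]
  have lmM: "left_module R U" if "U \<in> ?S" for U using that isum_module[OF assms(1)] by auto
  have lmN: "left_module R U" if "U \<in> ?S'" for U using that isum_module[OF assms(2)] by auto
  have iso: "mod_iso R U (?f U)" "?f U \<in> ?S'" if "U \<in> ?S" for U
  proof -
    obtain A where A: "A \<in> isum R M" "U = M\<lparr>carrier := A\<rparr>" using \<open>U \<in> ?S\<close> by blast
    then show "mod_iso R U (?f U)" "?f U \<in> ?S'"
      using iso_restrict[OF assms(1,2) h isum_submodule[OF A(1)]] img[OF A(1)] by auto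
  qed
  have "card (?S // {(x, y) \<in> ?S \<times> ?S. mod_iso R x y}) = card (?S' // {(x, y) \<in> ?S' \<times> ?S'. mod_iso R x y})"
  proof (rule card_quot_eq[where f = ?f])
    show "?f ` ?S \<subseteq> ?S'" using iso by blast
    fix U V assume U: "U \<in> ?S" and V: "V \<in> ?S"
    show "mod_iso R U V \<longleftrightarrow> mod_iso R (?f U) (?f V)"
      by (rule mod_iso_cong[OF lmM[OF U] lmM[OF V] lmN lmN iso(1)[OF U] iso(1)[OF V]]) (use iso(2) U V in blast)+
  next
    fix V assume "V \<in> ?S'"
    then obtain A where A: "A \<in> isum R N" "V = N\<lparr>carrier := A\<rparr>" by blast
    have gA: "g ` A \<in> isum R M" by (rule isum_image[OF assms(2,1) g(1,4) A(1)])
    have "h ` g ` A = A" using g(3) N.sub_subset[OF isum_submodule[OF A(1)]] by force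
    then have "?f (M\<lparr>carrier := g ` A\<rparr>) = V" using A by simp
    moreover have "mod_iso R V V" using mod_iso_refl lmN[OF \<open>V \<in> ?S'\<close>] by blast
    ultimately show "\<exists>U\<in>?S. mod_iso R (?f U) V" using gA by (metis imageI)
  next
    fix U assume "U \<in> ?S'" then show "mod_iso R U U" by (intro mod_iso_refl lmN)
  next
    fix U V assume "U \<in> ?S'" "V \<in> ?S'" "mod_iso R U V" then show "mod_iso R V U" using mod_iso_sym lmN by blast
  next
    fix U V W assume "U \<in> ?S'" "V \<in> ?S'" "W \<in> ?S'" "mod_iso R U V" "mod_iso R V W"
    then show "mod_iso R U W" using mod_iso_trans lmN by blast
  qed
  then show ?thesis by (simp add: num_summands_isum iso_classes_def)
qed

text \<open>The exchange step of the Krull--Schmidt theorem: if \<open>q\<close> is the projection to \<open>N\<close> and \<open>\<pi>\<close> the one to \<open>Y\<close>,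
  the hypothesis says that \<open>Y \<rightarrow> N \<rightarrow> Y\<close> is invertible.\<close>

lemma exchange_aux:
  assumes "left_module R M" "submodule N R M" "Y \<in> isum R M"
    "lin R M M \<pi>" "\<And>x. x \<in> carrier M \<Longrightarrow> \<pi> x \<in> Y" "lin R M M q" "\<And>x. x \<in> carrier M \<Longrightarrow> q x \<in> N"
    "bij_betw (\<lambda>y. \<pi> (q y)) Y Y"
  shows "\<exists>Y'\<in>isum R (M\<lparr>carrier := N\<rparr>). mod_iso R (M\<lparr>carrier := Y\<rparr>) (M\<lparr>carrier := Y'\<rparr>)"
proof -
  interpret M: left_module R M by fact
  have Y: "submodule Y R M" by (rule isum_submodule[OF assms(3)])
  let ?Y = "M\<lparr>carrier := Y\<rparr>" and ?N = "M\<lparr>carrier := N\<rparr>"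
  interpret Y: left_module R ?Y by (rule M.sub_module[OF Y])
  interpret N: left_module R ?N by (rule M.sub_module[OF assms(2)])
  have s: "lin R ?Y ?N q"
    using lin_corestrict[OF lin_restrict[OF assms(6) M.sub_subset[OF Y]]] assms(7) M.sub_mem[OF Y] by simp
  have r: "lin R ?N ?Y \<pi>"
    using lin_corestrict[OF lin_restrict[OF assms(4) M.sub_subset[OF assms(2)]]] assms(5) M.sub_mem[OF assms(2)] by simp
  have ret: "complementary R ?N (q ` Y) (lker ?N ?Y \<pi>)" "lin R ?Y (M\<lparr>carrier := q ` Y\<rparr>) q" "bij_betw q Y (q ` Y)"
    using complementary_retract[OF Y.left_module_axioms N.left_module_axioms s r] assms(8) by simp_all
  have iso: "mod_iso R ?Y (M\<lparr>carrier := q ` Y\<rparr>)"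
    using mod_isoI[OF Y.left_module_axioms ret(2)] ret(3) by simp
  have "submodule (q ` Y) R ?N" using ret(1) by (simp add: complementary_def)
  then have "left_module R (M\<lparr>carrier := q ` Y\<rparr>)" using N.sub_module by simp
  then have "indecomposable R (M\<lparr>carrier := q ` Y\<rparr>)"
    using indecomposable_iso[OF Y.left_module_axioms _ iso] assms(3) by (simp add: isum_def)
  then have "q ` Y \<in> isum R ?N" using ret(1) by (auto simp: isum_def)
  then show ?thesis using iso by blast
qed

text \<open>On \<open>Y\<close> the identity is the sum of the two endomorphisms that pass through
  \<open>N1\<close> and through \<open>N2\<close>. Since \<open>Y\<close> is indecomposable, one of
  them is invertible.\<close>

lemma krull_schmidt_exchange:
  assumes "left_module R M" "fin_len R M" "complementary R M N1 N2" "Y \<in> isum R M"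
  shows "\<exists>Y'\<in>isum R (M\<lparr>carrier := N1\<rparr>) \<union> isum R (M\<lparr>carrier := N2\<rparr>).
    mod_iso R (M\<lparr>carrier := Y\<rparr>) (M\<lparr>carrier := Y'\<rparr>)"
proof -
  interpret M: left_module R M by fact
  obtain Y0 where Y0: "complementary R M Y Y0" using assms(4) by (auto simp: isum_def)
  have Y: "submodule Y R M" by (rule isum_submodule[OF assms(4)])
  obtain \<pi> where \<pi>: "lin R M M \<pi>" "\<And>x. x \<in> carrier M \<Longrightarrow> \<pi> x \<in> Y" "\<And>x. x \<in> Y \<Longrightarrow> \<pi> x = x"
    using complementary_projection[OF assms(1) Y0] by metis
  obtain q where q: "lin R M M q" "\<And>x. x \<in> carrier M \<Longrightarrow> q x \<in> N1" "\<And>x. x \<in> carrier M \<Longrightarrow> x \<ominus>\<^bsub>M\<^esub> q x \<in> N2"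
    using complementary_projection[OF assms(1,3)] by metis
  define q' where "q' x = x \<ominus>\<^bsub>M\<^esub> q x" for x
  have q': "lin R M M q'" unfolding q'_def by (rule lin_diff[OF assms(1) lin_id q(1)])
  let ?Y = "M\<lparr>carrier := Y\<rparr>"
  interpret Y: left_module R ?Y by (rule M.sub_module[OF Y])
  note mem = M.sub_mem[OF Y]
  have endo: "lin R ?Y ?Y (\<lambda>y. \<pi> (k y))" if "lin R M M k" for k
    using lin_corestrict[OF lin_restrict[OF lin_comp[OF that \<pi>(1)] M.sub_subset[OF Y]]] \<pi>(2) lin_closed[OF that] mem by simp
  have sum: "\<pi> (q y) \<oplus>\<^bsub>M\<^esub> \<pi> (q' y) = y" if "y \<in> Y" for y
  proof -
    have "\<pi> (q y) \<oplus>\<^bsub>M\<^esub> \<pi> (q' y) = \<pi> (q y \<oplus>\<^bsub>M\<^esub> q' y)"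
      using lin_add[OF \<pi>(1)] lin_closed[OF q(1)] lin_closed[OF q'] mem[OF that] by simp
    also have "\<dots> = y" using lin_closed[OF q(1) mem[OF that]] mem[OF that] \<pi>(3)[OF that] by (simp add: q'_def)
    finally show ?thesis .
  qed
  have "bij_betw (\<lambda>y. \<pi> (q y) \<oplus>\<^bsub>?Y\<^esub> \<pi> (q' y)) (carrier ?Y) (carrier ?Y)"
    using sum by (subst bij_betw_cong[of _ _ "\<lambda>x. x"]) (auto simp: bij_betw_def)
  then have "bij_betw (\<lambda>y. \<pi> (q y)) (carrier ?Y) (carrier ?Y) \<or> bij_betw (\<lambda>y. \<pi> (q' y)) (carrier ?Y) (carrier ?Y)"
    using indecomposable_local[OF Y.left_module_axioms fin_len_sub[OF assms(1,2) Y] _ endo[OF q(1)] endo[OF q']] assms(4)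
    by (simp add: isum_def)
  moreover have "submodule N1 R M" "submodule N2 R M" using assms(3) by (auto simp: complementary_def)
  ultimately show ?thesis
    using exchange_aux[OF assms(1) _ assms(4) \<pi>(1,2) q(1,2)] exchange_aux[OF assms(1) _ assms(4) \<pi>(1,2) q'] q(3)
    by (simp add: q'_def) blast
qed

lemma isum_indecomposable:
  assumes "left_module R M" "indecomposable R M" "Y \<in> isum R M" shows "Y = carrier M"
proof -
  interpret M: left_module R M by fact
  obtain Y' where Y': "complementary R M Y Y'" and ind: "indecomposable R (M\<lparr>carrier := Y\<rparr>)" using assms(3) by (auto simp: isum_def)
  have "Y \<noteq> {\<zero>\<^bsub>M\<^esub>}" using ind by (simp add: indecomposable_def)
  then have "Y' = {\<zero>\<^bsub>M\<^esub>}" using Y' assms(2) by (auto simp: indecomposable_def)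
  then have "carrier M \<subseteq> Y" using Y' M.sub_mem by (force simp: complementary_iff[OF assms(1)])
  then show ?thesis using M.sub_subset[OF isum_submodule[OF assms(3)]] by auto
qed

text \<open>\<open>num_summands\<close> is a \<open>card\<close>, which is 0 on infinite sets, so
  finiteness has to be secured before summands can be added. A decomposable module is split, and
  exchange reduces its indecomposable summands to those of the two smaller parts.\<close>

lemma finite_isum_classes:
  fixes M :: "('a, 'm) module"
  assumes "left_module R M" "fin_len R M"
  shows "\<exists>F :: ('a, 'm) module set. finite F \<and> (\<forall>Y\<in>isum R M. \<exists>Z\<in>F. left_module R Z \<and> mod_iso R (M\<lparr>carrier := Y\<rparr>) Z)"
proof -
  interpret M: left_module R M by fact
  obtain len :: "'m set \<Rightarrow> nat" where len: "\<forall>N N'. submodule N R M \<longrightarrow> submodule N' R M \<longrightarrow> N \<subset> N' \<longrightarrow> len N < len N'"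
    using assms(2) unfolding fin_len_def by blast
  have "\<exists>F :: ('a, 'm) module set. finite F \<and> (\<forall>Y\<in>isum R (M\<lparr>carrier := N\<rparr>). \<exists>Z\<in>F. left_module R Z \<and> mod_iso R (M\<lparr>carrier := Y\<rparr>) Z)"
    if "submodule N R M" for N
    using that
  proof (induction "len N" arbitrary: N rule: less_induct)
    case less
    let ?N = "M\<lparr>carrier := N\<rparr>"
    interpret N: left_module R ?N by (rule M.sub_module[OF less.prems])
    note fl = fin_len_sub[OF assms less.prems]
    consider "N = {\<zero>\<^bsub>M\<^esub>}" | "indecomposable R ?N" 
      | A B where "complementary R ?N A B" "A \<noteq> {\<zero>\<^bsub>M\<^esub>}" "B \<noteq> {\<zero>\<^bsub>M\<^esub>}"
      by (auto simp: indecomposable_def)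
    then show ?case
    proof cases
      case 1
      have False if "Y \<in> isum R ?N" for Y
      proof -
        have "Y \<subseteq> {\<zero>\<^bsub>M\<^esub>}" "\<zero>\<^bsub>M\<^esub> \<in> Y" using N.sub_subset[OF isum_submodule[OF that]] N.sub_zero[OF isum_submodule[OF that]] 1 by auto
        then have "Y = {\<zero>\<^bsub>M\<^esub>}" by auto
        then show False using that by (auto simp: isum_def indecomposable_def)
      qed
      then show ?thesis by blast
    next
      case 2
      then have "Y = N" if "Y \<in> isum R ?N" for Y using isum_indecomposable[OF N.left_module_axioms 2 that] by simp
      then have "mod_iso R (M\<lparr>carrier := Y\<rparr>) ?N" if "Y \<in> isum R ?N" for Y
        using that mod_iso_refl[OF N.left_module_axioms] by metis
      then have "\<forall>Y\<in>isum R ?N. \<exists>Z\<in>{?N}. left_module R Z \<and> mod_iso R (M\<lparr>carrier := Y\<rparr>) Z"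
        using N.left_module_axioms by blast
      then show ?thesis by (meson finite.emptyI finite_insert)
    next
      case 3
      have s: "submodule A R M" "submodule B R M" "A \<subseteq> N" "B \<subseteq> N" "A \<inter> B = {\<zero>\<^bsub>M\<^esub>}"
        using 3(1) M.sub_sub[OF less.prems] by (auto simp: complementary_def)
      then have "A \<subset> N" "B \<subset> N" using 3(2,3) by blast+
      then have "len A < len N" "len B < len N" using len s less.prems by blast+
      note IH = less.hyps[OF this(1) s(1)] less.hyps[OF this(2) s(2)]
      obtain FA :: "('a, 'm) module set" where FA: "finite FA"
        "\<forall>Y\<in>isum R (M\<lparr>carrier := A\<rparr>). \<exists>Z\<in>FA. left_module R Z \<and> mod_iso R (M\<lparr>carrier := Y\<rparr>) Z"
        using IH(1) by blast
      obtain FB :: "('a, 'm) module set" where FB: "finite FB"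
        "\<forall>Y\<in>isum R (M\<lparr>carrier := B\<rparr>). \<exists>Z\<in>FB. left_module R Z \<and> mod_iso R (M\<lparr>carrier := Y\<rparr>) Z"
        using IH(2) by blast
      note F = FA(1) FB(1) FA(2) FB(2)
      have "\<exists>Z\<in>FA \<union> FB. left_module R Z \<and> mod_iso R (M\<lparr>carrier := Y\<rparr>) Z" if Y: "Y \<in> isum R ?N" for Y
      proof -
        obtain Y' where Y': "Y' \<in> isum R (M\<lparr>carrier := A\<rparr>) \<union> isum R (M\<lparr>carrier := B\<rparr>)"
          "mod_iso R (M\<lparr>carrier := Y\<rparr>) (M\<lparr>carrier := Y'\<rparr>)"
          using krull_schmidt_exchange[OF N.left_module_axioms fl 3(1) Y] by auto
        then obtain Z where Z: "Z \<in> FA \<union> FB" "left_module R Z" "mod_iso R (M\<lparr>carrier := Y'\<rparr>) Z" using F(3,4) by blast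
        have "left_module R (M\<lparr>carrier := Y\<rparr>)" using isum_module[OF N.left_module_axioms Y] by simp
        moreover have "left_module R (M\<lparr>carrier := Y'\<rparr>)"
          using Y'(1) isum_module[OF M.sub_module[OF s(1)]] isum_module[OF M.sub_module[OF s(2)]] by auto
        ultimately show ?thesis using Z mod_iso_trans Y'(2) by blast
      qed
      then show ?thesis using F(1,2) by (intro exI[of _ "FA \<union> FB"]) blast
    qed
  qed
  from this[OF M.carrier_submodule] show ?thesis by simp
qed

text \<open>By exchange every indecomposable summand is isomorphic to a summand of \<open>N1\<close>
  or to \<open>N2\<close>, and \<open>no\<close> keeps the class of \<open>N2\<close> apart from
  those of \<open>N1\<close>.\<close>

lemma num_summands_add:
  fixes M :: "('a, 'm) module"
  assumes "left_module R M" "fin_len R M" "complementary R M N1 N2" "indecomposable R (M\<lparr>carrier := N2\<rparr>)"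
    and no: "\<And>Y. Y \<in> isum R (M\<lparr>carrier := N1\<rparr>) \<Longrightarrow> \<not> mod_iso R (M\<lparr>carrier := Y\<rparr>) (M\<lparr>carrier := N2\<rparr>)"
  shows "num_summands R M = Suc (num_summands R (M\<lparr>carrier := N1\<rparr>))"
proof -
  interpret M: left_module R M by fact
  have s: "submodule N1 R M" "submodule N2 R M" using assms(3) by (auto simp: complementary_def)
  interpret N1: left_module R "M\<lparr>carrier := N1\<rparr>" by (rule M.sub_module[OF s(1)])
  interpret N2: left_module R "M\<lparr>carrier := N2\<rparr>" by (rule M.sub_module[OF s(2)])
  let ?f = "\<lambda>N. M\<lparr>carrier := N\<rparr>"
  let ?S = "?f ` isum R M" and ?S1 = "?f ` isum R (M\<lparr>carrier := N1\<rparr>)"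
  have sub: "?S1 \<subseteq> ?S" using complementary_trans[OF assms(1,3)] by (auto simp: isum_def)
  have N2: "?f N2 \<in> ?S" using complementary_sym[OF assms(1,3)] assms(4) by (auto simp: isum_def)
  have lm: "left_module R U" if "U \<in> ?S" for U using that isum_module[OF assms(1)] by auto
  \<comment> \<open>Isomorphism classes are replaced by a function so that they can be counted as an
    image. It is defined outside \<open>?S\<close> too, because the finiteness argument evaluates it
    at representatives that need not belong to \<open>?S\<close>.\<close>
  define g where "g U = {V \<in> ?S. mod_iso R U V}" for U :: "('a, 'm) module"
  have g: "mod_iso R U V \<longleftrightarrow> g U = g V" if "U \<in> ?S" "V \<in> ?S" for U V
  proof
    assume i: "mod_iso R U V"
    then have j: "mod_iso R V U" using mod_iso_sym lm that by blast
    show "g U = g V" unfolding g_def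
      using mod_iso_trans[OF lm[OF that(1)] lm[OF that(2)] i] mod_iso_trans[OF lm[OF that(2)] lm[OF that(1)] j] by blast
  next
    assume "g U = g V"
    moreover have "V \<in> g V" using mod_iso_refl[OF lm[OF that(2)]] that by (simp add: g_def)
    ultimately show "mod_iso R U V" by (auto simp: g_def)
  qed
  have "g ` ?S = insert (g (?f N2)) (g ` ?S1)"
  proof
    show "insert (g (?f N2)) (g ` ?S1) \<subseteq> g ` ?S" using sub N2 by blast
    show "g ` ?S \<subseteq> insert (g (?f N2)) (g ` ?S1)"
    proof
      fix z assume "z \<in> g ` ?S"
      then obtain Y where Y: "Y \<in> isum R M" "z = g (?f Y)" by blast
      obtain Y' where Y': "Y' \<in> isum R (?f N1) \<union> isum R (?f N2)" "mod_iso R (?f Y) (?f Y')"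
        using krull_schmidt_exchange[OF assms(1-3) Y(1)] by blast
      from Y'(1) show "z \<in> insert (g (?f N2)) (g ` ?S1)"
      proof
        assume "Y' \<in> isum R (?f N1)"
        then have "?f Y' \<in> ?S1" by blast
        then show ?thesis using g[of "?f Y" "?f Y'"] Y Y'(2) sub by blast
      next
        assume "Y' \<in> isum R (?f N2)"
        then have "Y' = N2" using isum_indecomposable[OF N2.left_module_axioms assms(4)] by simp
        then show ?thesis using g[of "?f Y" "?f N2"] Y Y'(2) N2 by blast
      qed
    qed
  qed
  moreover have "g (?f N2) \<notin> g ` ?S1"
  proof
    assume "g (?f N2) \<in> g ` ?S1"
    then obtain Y where Y: "Y \<in> isum R (?f N1)" "g (?f N2) = g (?f Y)" by blast
    then have "mod_iso R (?f Y) (?f N2)" using g[of "?f Y" "?f N2"] sub N2 by force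
    then show False using no Y by blast
  qed
  moreover have "finite (g ` ?S1)"
  proof -
    obtain F :: "('a, 'm) module set" where F: "finite F" "\<forall>Y\<in>isum R (?f N1). \<exists>Z\<in>F. left_module R Z \<and> mod_iso R (?f Y) Z"
      using finite_isum_classes[OF N1.left_module_axioms fin_len_sub[OF assms(1,2) s(1)]] by auto
    have "g ` ?S1 \<subseteq> g ` F"
    proof
      fix z assume "z \<in> g ` ?S1"
      then obtain Y where Y: "Y \<in> isum R (?f N1)" "z = g (?f Y)" by blast
      then obtain Z where Z: "Z \<in> F" "left_module R Z" "mod_iso R (?f Y) Z" using F by blast
      have lY: "left_module R (?f Y)" using lm sub Y by blast
      have "g (?f Y) = g Z"
        unfolding g_def using mod_iso_trans[OF lY Z(2,3)] mod_iso_trans[OF Z(2) lY mod_iso_sym[OF lY Z(2,3)]] by blast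
      then show "z \<in> g ` F" using Y Z by blast
    qed
    then show ?thesis by (rule finite_subset) (rule finite_imageI[OF F(1)])
  qed
  moreover have "card (iso_classes R ?S) = card (g ` ?S)" unfolding iso_classes_def by (rule card_quot[OF g])
  moreover have "card (iso_classes R ?S1) = card (g ` ?S1)" unfolding iso_classes_def by (rule card_quot[OF g[OF subsetD[OF sub] subsetD[OF sub]]])
  moreover have "num_summands R M = card (iso_classes R ?S)" by (rule num_summands_isum)
  moreover have "num_summands R (?f N1) = card (iso_classes R ?S1)" by (simp add: num_summands_isum)
  ultimately show ?thesis by simp
qed

section \<open>Change of rings\<close>

text \<open>\<open>E\<close> is the restriction of scalars of \<open>E'\<close> along
  \<open>\<pi>\<close>, as a relation that looks at carriers only. It covers passage in both
  directions, by \<open>pull\<close> and by \<open>descend\<close>.\<close>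

definition same :: "('a, 'y) ring_scheme \<Rightarrow> ('a \<Rightarrow> 'b) \<Rightarrow> ('a, 'm) module \<Rightarrow> ('b, 'm) module \<Rightarrow> bool" where
  "same R \<pi> E E' \<longleftrightarrow> carrier E' = carrier E \<and> \<zero>\<^bsub>E'\<^esub> = \<zero>\<^bsub>E\<^esub> \<and> ring.add E' = ring.add E \<and>
     (\<forall>a\<in>carrier R. \<forall>x\<in>carrier E. a \<odot>\<^bsub>E\<^esub> x = \<pi> a \<odot>\<^bsub>E'\<^esub> x)"

definition pull :: "('a \<Rightarrow> 'b) \<Rightarrow> ('b, 'm) module \<Rightarrow> ('a, 'm) module" where
  "pull \<pi> N = \<lparr>carrier = carrier N, monoid.mult = monoid.mult N, monoid.one = monoid.one N,
     ring.zero = ring.zero N, ring.add = ring.add N, smult = \<lambda>a x. \<pi> a \<odot>\<^bsub>N\<^esub> x\<rparr>"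

definition descend :: "('a, 'y) ring_scheme \<Rightarrow> ('a \<Rightarrow> 'b) \<Rightarrow> ('a, 'm) module \<Rightarrow> ('b, 'm) module" where
  "descend R \<pi> N = \<lparr>carrier = carrier N, monoid.mult = monoid.mult N, monoid.one = monoid.one N,
     ring.zero = ring.zero N, ring.add = ring.add N, smult = \<lambda>s x. inv_into (carrier R) \<pi> s \<odot>\<^bsub>N\<^esub> x\<rparr>"

lemma inflate_pull: "inflate L I N = pull (\<lambda>a. I +>\<^bsub>L\<^esub> a) N"
  by (simp add: inflate_def pull_def)

lemma same_pull: "same R \<pi> (pull \<pi> N) N"
  by (simp add: same_def pull_def)

lemma pull_simps [simp]: "carrier (pull \<pi> N) = carrier N" "\<zero>\<^bsub>pull \<pi> N\<^esub> = \<zero>\<^bsub>N\<^esub>"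
  "ring.add (pull \<pi> N) = ring.add N" "a \<odot>\<^bsub>pull \<pi> N\<^esub> x = \<pi> a \<odot>\<^bsub>N\<^esub> x"
  by (simp_all add: pull_def)

lemma finsum_cong_struct:
  "carrier E' = carrier E \<Longrightarrow> \<zero>\<^bsub>E'\<^esub> = \<zero>\<^bsub>E\<^esub> \<Longrightarrow> ring.add E' = ring.add E \<Longrightarrow> finsum E' f A = finsum E f A"
  by (simp add: finsum_def finprod_def)

locale ring_surj =
  fixes R :: "('a, 'y) ring_scheme" and S :: "('b, 'z) ring_scheme" and \<pi> :: "'a \<Rightarrow> 'b"
  assumes ringR: "ring R" and ringS: "ring S" and surj: "\<pi> ` carrier R = carrier S"
    and hadd: "\<And>a b. a \<in> carrier R \<Longrightarrow> b \<in> carrier R \<Longrightarrow> \<pi> (a \<oplus>\<^bsub>R\<^esub> b) = \<pi> a \<oplus>\<^bsub>S\<^esub> \<pi> b"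
    and hmult: "\<And>a b. a \<in> carrier R \<Longrightarrow> b \<in> carrier R \<Longrightarrow> \<pi> (a \<otimes>\<^bsub>R\<^esub> b) = \<pi> a \<otimes>\<^bsub>S\<^esub> \<pi> b"
    and hone: "\<pi> \<one>\<^bsub>R\<^esub> = \<one>\<^bsub>S\<^esub>"
begin

sublocale R: ring R by (rule ringR)
sublocale S: ring S by (rule ringS)

lemma sameD:
  assumes "same R \<pi> E E'"
  shows "carrier E' = carrier E" "\<zero>\<^bsub>E'\<^esub> = \<zero>\<^bsub>E\<^esub>" "ring.add E' = ring.add E"
    "a \<in> carrier R \<Longrightarrow> x \<in> carrier E \<Longrightarrow> \<pi> a \<odot>\<^bsub>E'\<^esub> x = a \<odot>\<^bsub>E\<^esub> x"
  using assms by (auto simp: same_def)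

lemma ex_pre: "s \<in> carrier S \<Longrightarrow> \<exists>a\<in>carrier R. s = \<pi> a" using surj by blast

lemma \<pi>c: "a \<in> carrier R \<Longrightarrow> \<pi> a \<in> carrier S" using surj by blast

lemma hdiff: "a \<in> carrier R \<Longrightarrow> b \<in> carrier R \<Longrightarrow> \<pi> a = \<pi> b \<Longrightarrow> \<pi> (a \<ominus>\<^bsub>R\<^esub> b) = \<zero>\<^bsub>S\<^esub>"
proof -
  assume a: "a \<in> carrier R" "b \<in> carrier R" "\<pi> a = \<pi> b"
  have "\<pi> (a \<ominus>\<^bsub>R\<^esub> b) \<oplus>\<^bsub>S\<^esub> \<pi> b = \<pi> (a \<ominus>\<^bsub>R\<^esub> b \<oplus>\<^bsub>R\<^esub> b)" using a by (simp add: hadd)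
  also have "a \<ominus>\<^bsub>R\<^esub> b \<oplus>\<^bsub>R\<^esub> b = a" using a by (simp add: R.minus_eq R.a_assoc R.l_neg)
  finally have "\<pi> (a \<ominus>\<^bsub>R\<^esub> b) \<oplus>\<^bsub>S\<^esub> \<pi> b = \<pi> b" using a by simp
  then show ?thesis using a \<pi>c S.add.r_cancel_one[of "\<pi> b" "\<pi> (a \<ominus>\<^bsub>R\<^esub> b)"] by simp
qed

lemma same_left_module:
  assumes sm: "same R \<pi> E E'"
  shows "left_module R E \<longleftrightarrow> left_module S E'"
proof
  note D = sameD[OF sm]
  assume "left_module R E"
  then interpret E: left_module R E .
  have ag: "abelian_group E'" by (rule abelian_group_cong[OF E.M.abelian_group_axioms]) (simp_all add: D)
  have "left_module_axioms S E'"
  proof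
    fix s x assume s: "s \<in> carrier S" and x: "x \<in> carrier E'"
    from s obtain a where a: "a \<in> carrier R" "s = \<pi> a" using ex_pre by blast
    show "s \<odot>\<^bsub>E'\<^esub> x \<in> carrier E'" using a x by (simp add: D)
    { fix t assume "t \<in> carrier S"
      then obtain b where b: "b \<in> carrier R" "t = \<pi> b" using ex_pre by blast
      show "(s \<oplus>\<^bsub>S\<^esub> t) \<odot>\<^bsub>E'\<^esub> x = s \<odot>\<^bsub>E'\<^esub> x \<oplus>\<^bsub>E'\<^esub> t \<odot>\<^bsub>E'\<^esub> x" using a b x by (simp add: D hadd[symmetric] E.smult_l_distr)
      show "(s \<otimes>\<^bsub>S\<^esub> t) \<odot>\<^bsub>E'\<^esub> x = s \<odot>\<^bsub>E'\<^esub> (t \<odot>\<^bsub>E'\<^esub> x)" using a b x by (simp add: D hmult[symmetric] E.smult_assoc1) }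
    fix y assume "y \<in> carrier E'"
    then show "s \<odot>\<^bsub>E'\<^esub> (x \<oplus>\<^bsub>E'\<^esub> y) = s \<odot>\<^bsub>E'\<^esub> x \<oplus>\<^bsub>E'\<^esub> s \<odot>\<^bsub>E'\<^esub> y" using a x by (simp add: D E.smult_r_distr)
  next
    fix x assume "x \<in> carrier E'" then show "\<one>\<^bsub>S\<^esub> \<odot>\<^bsub>E'\<^esub> x = x" by (simp add: D hone[symmetric])
  qed
  then show "left_module S E'" by (intro left_module.intro ringS ag)
next
  note D = sameD[OF sm]
  assume "left_module S E'"
  then interpret E': left_module S E' .
  have ag: "abelian_group E" by (rule abelian_group_cong[OF E'.M.abelian_group_axioms]) (simp_all add: D)
  have D4: "a \<odot>\<^bsub>E\<^esub> x = \<pi> a \<odot>\<^bsub>E'\<^esub> x" if "a \<in> carrier R" "x \<in> carrier E'" for a x using that D by simp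
  have c: "carrier E = carrier E'" "ring.add E = ring.add E'" using D by simp_all
  have "left_module_axioms R E"
    by unfold_locales
      (use \<pi>c in \<open>auto simp: c D4 hadd hmult hone E'.smult_l_distr E'.smult_r_distr E'.smult_assoc1\<close>)
  then show "left_module R E" by (intro left_module.intro ringR ag)
qed

lemma same_lin:
  assumes "same R \<pi> E E'" "same R \<pi> F F'"
  shows "lin R E F f \<longleftrightarrow> lin S E' F' f"
proof -
  note D = sameD[OF assms(1)] sameD[OF assms(2)]
  show ?thesis unfolding lin_def surj[symmetric] by (auto simp: D Pi_iff)
qed

lemma same_iso:
  assumes "same R \<pi> E E'" "same R \<pi> F F'" "left_module R E"
  shows "mod_iso R E F \<longleftrightarrow> mod_iso S E' F'"
proof -
  have m: "left_module S E'" using same_left_module[OF assms(1)] assms(3) by blast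
  show ?thesis
    unfolding mod_iso_iff[OF assms(3)] mod_iso_iff[OF m] same_lin[OF assms(1,2)]
    by (simp add: sameD(1)[OF assms(1)] sameD(1)[OF assms(2)])
qed

lemma same_submodule:
  assumes "same R \<pi> E E'" "left_module R E"
  shows "submodule N R E \<longleftrightarrow> submodule N S E'"
proof -
  interpret E: left_module R E by fact
  interpret E': left_module S E' using same_left_module[OF assms(1)] assms(2) by blast
  note D = sameD[OF assms(1)]
  show ?thesis
  proof
    assume N: "submodule N R E"
    show "submodule N S E'"
    proof (rule E'.submoduleI)
      fix s x assume s: "s \<in> carrier S" and x: "x \<in> N"
      obtain a where a: "a \<in> carrier R" "s = \<pi> a" using s ex_pre by blast
      then show "s \<odot>\<^bsub>E'\<^esub> x \<in> N" using E.sub_smult[OF N a(1) x] E.sub_mem[OF N x] D by simp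
    qed (use E.sub_subset[OF N] E.sub_zero[OF N] E.sub_add[OF N] D in auto)
  next
    assume N: "submodule N S E'"
    show "submodule N R E"
    proof (rule E.submoduleI)
      fix a x assume a: "a \<in> carrier R" and x: "x \<in> N"
      then show "a \<odot>\<^bsub>E\<^esub> x \<in> N" using E'.sub_smult[OF N \<pi>c[OF a] x] E'.sub_mem[OF N x] D by simp
    qed (use E'.sub_subset[OF N] E'.sub_zero[OF N] E'.sub_add[OF N] D in auto)
  qed
qed

lemma same_sub: "same R \<pi> E E' \<Longrightarrow> N \<subseteq> carrier E \<Longrightarrow> same R \<pi> (E\<lparr>carrier := N\<rparr>) (E'\<lparr>carrier := N\<rparr>)"
  by (auto simp: same_def subset_iff)

lemma same_complementary:
  assumes "same R \<pi> E E'" "left_module R E"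
  shows "complementary R E A B \<longleftrightarrow> complementary S E' A B"
proof -
  have m: "left_module S E'" using same_left_module[OF assms(1)] assms(2) by blast
  note D = sameD[OF assms(1)]
  show ?thesis
    unfolding complementary_iff[OF assms(2)] complementary_iff[OF m] same_submodule[OF assms] by (simp add: D)
qed

lemma same_indecomposable:
  assumes "same R \<pi> E E'" "left_module R E"
  shows "indecomposable R E \<longleftrightarrow> indecomposable S E'"
  unfolding indecomposable_def same_complementary[OF assms] by (simp add: sameD[OF assms(1)])

lemma same_isum:
  assumes "same R \<pi> E E'" "left_module R E"
  shows "isum R E = isum S E'"
proof -
  interpret E: left_module R E by fact
  have "indecomposable R (E\<lparr>carrier := N\<rparr>) \<longleftrightarrow> indecomposable S (E'\<lparr>carrier := N\<rparr>)" if "complementary R E N N'" for N N'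
  proof -
    have "submodule N R E" using that by (simp add: complementary_def)
    then show ?thesis using same_indecomposable[OF same_sub[OF assms(1)]] E.sub_module E.sub_subset by blast
  qed
  then show ?thesis unfolding isum_def same_complementary[OF assms] by blast
qed

lemma same_num:
  assumes "same R \<pi> E E'" "left_module R E"
  shows "num_summands R E = num_summands S E'"
proof -
  interpret E: left_module R E by fact
  have m: "left_module S E'" using same_left_module[OF assms(1)] assms(2) by blast
  let ?S = "(\<lambda>N. E\<lparr>carrier := N\<rparr>) ` isum R E" and ?S' = "(\<lambda>N. E'\<lparr>carrier := N\<rparr>) ` isum S E'"
  have lm: "left_module S U" if "U \<in> ?S'" for U using that isum_module[OF m] by auto
  note eq = same_isum[OF assms]
  have sm: "same R \<pi> (E\<lparr>carrier := N\<rparr>) (E'\<lparr>carrier := N\<rparr>)" "left_module R (E\<lparr>carrier := N\<rparr>)" if "N \<in> isum R E" for N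
    using same_sub[OF assms(1) E.sub_subset] isum_submodule[OF that] isum_module[OF assms(2) that] by auto
  have "card (?S // {(x, y) \<in> ?S \<times> ?S. mod_iso R x y}) = card (?S' // {(x, y) \<in> ?S' \<times> ?S'. mod_iso S x y})"
  proof (rule card_quot_eq[where f = "\<lambda>U. E'\<lparr>carrier := carrier U\<rparr>"])
    show "(\<lambda>U. E'\<lparr>carrier := carrier U\<rparr>) ` ?S \<subseteq> ?S'" using eq by auto
    fix U V assume "U \<in> ?S" "V \<in> ?S"
    then show "mod_iso R U V \<longleftrightarrow> mod_iso S (E'\<lparr>carrier := carrier U\<rparr>) (E'\<lparr>carrier := carrier V\<rparr>)"
      using same_iso[OF sm(1) sm(1) sm(2)] by auto
  next
    fix U assume U: "U \<in> ?S'"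
    then obtain N where N: "N \<in> isum R E" "U = E'\<lparr>carrier := N\<rparr>" using eq by blast
    then show "\<exists>V\<in>?S. mod_iso S (E'\<lparr>carrier := carrier V\<rparr>) U"
      using mod_iso_refl[OF lm[OF U]] by (intro bexI[of _ "E\<lparr>carrier := N\<rparr>"]) auto
  next
    fix U assume "U \<in> ?S'" then show "mod_iso S U U" by (intro mod_iso_refl lm)
  next
    fix U V assume "U \<in> ?S'" "V \<in> ?S'" "mod_iso S U V" then show "mod_iso S V U" using mod_iso_sym lm by blast
  next
    fix U V W assume "U \<in> ?S'" "V \<in> ?S'" "W \<in> ?S'" "mod_iso S U V" "mod_iso S V W"
    then show "mod_iso S U W" using mod_iso_trans lm by blast
  qed
  then show ?thesis by (simp add: num_summands_isum iso_classes_def)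
qed

lemma same_fgm:
  assumes "same R \<pi> E E'" shows "fgm R E \<longleftrightarrow> fgm S E'"
proof (cases "left_module R E")
  case True
  interpret E: left_module R E by fact
  interpret E': left_module S E' using same_left_module[OF assms(1)] True by blast
  have "mspan R E U = mspan S E' U" for U unfolding mspan_def same_submodule[OF assms True] ..
  then show ?thesis
    unfolding fgm_def E.fin_gen_iff E'.fin_gen_iff using sameD[OF assms] E.left_module_axioms E'.left_module_axioms by simp
qed (use same_left_module[OF assms] in \<open>simp add: fgm_def\<close>)

lemma same_trace:
  assumes "same R \<pi> T T'" "same R \<pi> Q Q'"
  shows "trace R T Q = trace S T' Q'"
proof
  note D = sameD[OF assms(1)] sameD[OF assms(2)]
  note l = same_lin[OF assms]
  show "trace R T Q \<subseteq> trace S T' Q'"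
  proof
    fix x assume "x \<in> trace R T Q" then show "x \<in> trace S T' Q'"
    proof induction
      case zero show ?case using trace.zero[of Q' S T'] D by simp
    next
      case (step h t y) then show ?case using trace.step[of S T' Q' h t y] D l by simp
    qed
  qed
  show "trace S T' Q' \<subseteq> trace R T Q"
  proof
    fix x assume "x \<in> trace S T' Q'" then show "x \<in> trace R T Q"
    proof induction
      case zero show ?case using trace.zero[of Q R T] D by simp
    next
      case (step h t y) then show ?case using trace.step[of R T Q h t y] D l by simp
    qed
  qed
qed

lemma same_basic:
  assumes "same R \<pi> E E'" "left_module R E"
  shows "basic_module R E \<longleftrightarrow> basic_module S E'"
proof -
  interpret E: left_module R E by fact
  note D = sameD[OF assms(1)]
  have fs: "finsum E' f A = finsum E f A" for f :: "'c set \<Rightarrow> 'c" and A using D by (intro finsum_cong_struct) simp_all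
  have ids: "internal_direct_sum R E U \<longleftrightarrow> internal_direct_sum S E' U" for U
    unfolding internal_direct_sum_def same_submodule[OF assms] by (simp add: D fs)
  have ind: "indecomposable R (E\<lparr>carrier := N\<rparr>) \<longleftrightarrow> indecomposable S (E'\<lparr>carrier := N\<rparr>)"
    and iso: "submodule N' R E \<Longrightarrow> mod_iso R (E\<lparr>carrier := N\<rparr>) (E\<lparr>carrier := N'\<rparr>) \<longleftrightarrow> mod_iso S (E'\<lparr>carrier := N\<rparr>) (E'\<lparr>carrier := N'\<rparr>)"
    if "submodule N R E" for N N'
    using same_indecomposable[OF same_sub[OF assms(1)]] same_iso[OF same_sub[OF assms(1)] same_sub[OF assms(1)]]
      E.sub_module[OF that] E.sub_subset that by blast+
  have sub: "submodule N R E" if "internal_direct_sum R E U" "N \<in> U" for N U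
    using that by (auto simp: internal_direct_sum_def)
  have "(internal_direct_sum R E U \<and> (\<forall>N\<in>U. indecomposable R (E\<lparr>carrier := N\<rparr>)) \<and>
      (\<forall>N\<in>U. \<forall>N'\<in>U. mod_iso R (E\<lparr>carrier := N\<rparr>) (E\<lparr>carrier := N'\<rparr>) \<longrightarrow> N = N')) \<longleftrightarrow>
    (internal_direct_sum S E' U \<and> (\<forall>N\<in>U. indecomposable S (E'\<lparr>carrier := N\<rparr>)) \<and>
      (\<forall>N\<in>U. \<forall>N'\<in>U. mod_iso S (E'\<lparr>carrier := N\<rparr>) (E'\<lparr>carrier := N'\<rparr>) \<longrightarrow> N = N'))" for U
  proof (cases "internal_direct_sum R E U")
    case True
    then show ?thesis using ids[of U] ind[OF sub[OF True]] iso[OF sub[OF True] sub[OF True]] by simp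
  next
    case False then show ?thesis using ids[of U] by simp
  qed
  then show ?thesis unfolding basic_module_def by (rule iff_exI)
qed

text \<open>The preimages chosen in \<open>descend\<close> are determined up to the kernel of
  \<open>\<pi>\<close>, which acts on \<open>E\<close> as zero.\<close>

lemma same_descend:
  assumes "left_module R E" and kill: "\<And>a x. a \<in> carrier R \<Longrightarrow> \<pi> a = \<zero>\<^bsub>S\<^esub> \<Longrightarrow> x \<in> carrier E \<Longrightarrow> a \<odot>\<^bsub>E\<^esub> x = \<zero>\<^bsub>E\<^esub>"
  shows "same R \<pi> E (descend R \<pi> E)"
proof -
  interpret E: left_module R E by fact
  have "inv_into (carrier R) \<pi> (\<pi> a) \<odot>\<^bsub>E\<^esub> x = a \<odot>\<^bsub>E\<^esub> x" if "a \<in> carrier R" "x \<in> carrier E" for a x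
  proof -
    let ?b = "inv_into (carrier R) \<pi> (\<pi> a)"
    have b: "?b \<in> carrier R" "\<pi> ?b = \<pi> a" using that by (auto intro: inv_into_into f_inv_into_f)
    then have "(?b \<ominus>\<^bsub>R\<^esub> a) \<odot>\<^bsub>E\<^esub> x = \<zero>\<^bsub>E\<^esub>" using that hdiff by (intro kill) auto
    then show ?thesis using b that by (simp add: E.smult_l_diff)
  qed
  then show ?thesis by (simp add: same_def descend_def)
qed

end

section \<open>Rigidity relative to an idempotent and its invariance under change of rings\<close>

definition kmod :: "('k, 'a) module \<Rightarrow> 'a \<Rightarrow> ('k, 'a) fdmod set" where
  "kmod L e = {M \<in> fgmod L. \<forall>x\<in>carrier M. e \<odot>\<^bsub>M\<^esub> x = \<zero>\<^bsub>M\<^esub>}"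

text \<open>Modules killed by \<open>e\<close> are the modules over \<open>L/\<langle>e\<rangle>\<close>. By \<open>tau_rigid_iff_lifts\<close>, \<open>rig\<close> singles out the \<open>\<tau>\<close>-rigid ones.\<close>

definition rig :: "('k, 'a) module \<Rightarrow> 'a \<Rightarrow> ('k, 'a) fdmod \<Rightarrow> bool" where
  "rig L e M \<longleftrightarrow> M \<in> kmod L e \<and> lifts L (gen L M) (kmod L e) M"

text \<open>A lifting problem over \<open>S\<close> is translated to one over \<open>R\<close> on
  modules with the same carriers and solved there. The correspondence \<open>P\<close> is left
  abstract because the lemma is applied twice, with the two rings interchanged.\<close>

lemma lifts_half:
  assumes lift: "lifts R \<Q> C M"
    and C: "\<And>E'. E' \<in> C' \<Longrightarrow> \<exists>E\<in>C. carrier E = carrier E' \<and> \<zero>\<^bsub>E\<^esub> = \<zero>\<^bsub>E'\<^esub> \<and>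
        (\<forall>U. \<Q>' (E'\<lparr>carrier := U\<rparr>) \<longrightarrow> U \<subseteq> carrier E \<longrightarrow> \<Q> (E\<lparr>carrier := U\<rparr>)) \<and> P E E'"
    and lin: "\<And>E E' F F' f. P E E' \<Longrightarrow> P F F' \<Longrightarrow> lin R E F f \<longleftrightarrow> lin S E' F' f" and M: "P M M'" "carrier M' = carrier M"
  shows "lifts S \<Q>' C' M'"
proof (rule liftsI)
  fix E' Z' p u
  assume E': "E' \<in> C'" and Z': "Z' \<in> C'" and p: "lin S E' Z' p" "p ` carrier E' = carrier Z'"
    and Q': "\<Q>' (E'\<lparr>carrier := lker E' Z' p\<rparr>)" and u: "lin S M' Z' u"
  obtain E where E: "E \<in> C" "carrier E = carrier E'" "\<Q>' (E'\<lparr>carrier := lker E' Z' p\<rparr>) \<longrightarrow> lker E' Z' p \<subseteq> carrier E \<longrightarrow> \<Q> (E\<lparr>carrier := lker E' Z' p\<rparr>)" "P E E'"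
    using C[OF E'] by blast
  obtain Z where Z: "Z \<in> C" "carrier Z = carrier Z'" "\<zero>\<^bsub>Z\<^esub> = \<zero>\<^bsub>Z'\<^esub>" "P Z Z'" using C[OF Z'] by blast
  have "\<exists>s. lin R M E s \<and> (\<forall>x\<in>carrier M. p (s x) = u x)"
  proof (rule liftsD[OF lift E(1) Z(1)])
    show "lin R E Z p" using p(1) lin[OF E(4) Z(4)] by blast
    show "lin R M Z u" using u lin[OF M(1) Z(4)] by blast
    show "p ` carrier E = carrier Z" using p(2) E(2) Z(2) by simp
    show "\<Q> (E\<lparr>carrier := lker E Z p\<rparr>)" using E Q' Z by simp
  qed
  then show "\<exists>s. lin S M' E' s \<and> (\<forall>x\<in>carrier M'. p (s x) = u x)" using lin[OF M(1) E(4)] M(2) by auto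
qed

text \<open>The annihilator of a module is a two-sided ideal.\<close>

lemma kill_ideal:
  assumes "left_module L M" "e \<in> carrier L" "\<forall>x\<in>carrier M. e \<odot>\<^bsub>M\<^esub> x = \<zero>\<^bsub>M\<^esub>" "a \<in> Idl\<^bsub>L\<^esub> {e}" "x \<in> carrier M"
  shows "a \<odot>\<^bsub>M\<^esub> x = \<zero>\<^bsub>M\<^esub>"
proof -
  interpret M: left_module L M by fact
  let ?J = "{a \<in> carrier L. \<forall>x\<in>carrier M. a \<odot>\<^bsub>M\<^esub> x = \<zero>\<^bsub>M\<^esub>}"
  have "subgroup ?J (add_monoid L)"
  proof (rule M.R.add.subgroupI)
    fix a b assume "a \<in> ?J" "b \<in> ?J"
    then show "a \<oplus>\<^bsub>L\<^esub> b \<in> ?J" by (auto simp: M.smult_l_distr)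
  next
    fix a assume "a \<in> ?J" then show "\<ominus>\<^bsub>L\<^esub> a \<in> ?J" by (auto simp: M.smult_l_minus)
  qed (auto intro!: exI[of _ "\<zero>\<^bsub>L\<^esub>"])
  then have "ideal ?J L"
    by (intro idealI M.R.ring_axioms) (auto simp: M.smult_assoc1)
  then have "Idl\<^bsub>L\<^esub> {e} \<subseteq> ?J" using assms(2,3) by (intro M.R.genideal_minimal) auto
  then show ?thesis using assms(4,5) by auto
qed

text \<open>Both algebras have scalars of the type \<open>'k\<close>, so their modules in
  \<open>fdmod\<close> share the carrier type \<open>nat \<Rightarrow> 'k\<close> and can be matched
  by \<open>same\<close>.\<close>

locale alg_surj = fixes L :: "('k, 'a) module" and L' :: "('k, 'b) module" and \<pi> :: "'a \<Rightarrow> 'b"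
  assumes rs: "ring_surj L L' \<pi>"

sublocale alg_surj \<subseteq> ring_surj L L' \<pi> by (rule rs)

context alg_surj begin

text \<open>Linear maps, kernels and traces are the same for corresponding modules. The test modules
  correspond by \<open>pull\<close> and \<open>descend\<close>; for the latter the kernel of
  \<open>\<pi>\<close> must act as zero on everything killed by \<open>e\<close>.\<close>

lemma rig_change:
  fixes M :: "('k, 'a) fdmod" and M' :: "('k, 'b) fdmod"
  assumes sm: "same L \<pi> M M'" and e: "e \<in> carrier L"
    and ker: "\<And>(E :: ('k, 'a) fdmod) a x. E \<in> kmod L e \<Longrightarrow> a \<in> carrier L \<Longrightarrow> \<pi> a = \<zero>\<^bsub>L'\<^esub> \<Longrightarrow> x \<in> carrier E \<Longrightarrow> a \<odot>\<^bsub>E\<^esub> x = \<zero>\<^bsub>E\<^esub>"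
  shows "rig L e M \<longleftrightarrow> rig L' (\<pi> e) M'"
proof -
  have k: "E \<in> kmod L e \<longleftrightarrow> E' \<in> kmod L' (\<pi> e)" if "same L \<pi> E E'" for E :: "('k, 'a) fdmod" and E' :: "('k, 'b) fdmod"
    using same_fgm[OF that] sameD[OF that] e by (simp add: kmod_def fgmod_iff)
  have g: "gen L' M' (E'\<lparr>carrier := U\<rparr>) \<longleftrightarrow> gen L M (E\<lparr>carrier := U\<rparr>)" if "same L \<pi> E E'" "U \<subseteq> carrier E"
    for E :: "('k, 'a) fdmod" and E' :: "('k, 'b) fdmod" and U
    using same_trace[OF sm same_sub[OF that]] by (simp add: gen_def)
  have l: "lin L E F f \<longleftrightarrow> lin L' E' F' f" if "same L \<pi> E E'" "same L \<pi> F F'"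
    for E F :: "('k, 'a) fdmod" and E' F' :: "('k, 'b) fdmod" and f using same_lin[OF that] .
  have 1: "\<exists>E\<in>kmod L e. carrier E = carrier E' \<and> \<zero>\<^bsub>E\<^esub> = \<zero>\<^bsub>E'\<^esub> \<and>
      (\<forall>U. gen L' M' (E'\<lparr>carrier := U\<rparr>) \<longrightarrow> U \<subseteq> carrier E \<longrightarrow> gen L M (E\<lparr>carrier := U\<rparr>)) \<and> same L \<pi> E E'"
    if "E' \<in> kmod L' (\<pi> e)" for E' :: "('k, 'b) fdmod"
  proof -
    have s: "same L \<pi> (pull \<pi> E') E'" by (rule same_pull)
    show ?thesis
      by (rule bexI[of _ "pull \<pi> E'"]) (use s that k[OF s] g[OF s] in auto)
  qed
  have 2: "\<exists>E'\<in>kmod L' (\<pi> e). carrier E' = carrier E \<and> \<zero>\<^bsub>E'\<^esub> = \<zero>\<^bsub>E\<^esub> \<and>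
      (\<forall>U. gen L M (E\<lparr>carrier := U\<rparr>) \<longrightarrow> U \<subseteq> carrier E' \<longrightarrow> gen L' M' (E'\<lparr>carrier := U\<rparr>)) \<and> same L \<pi> E E'"
    if E: "E \<in> kmod L e" for E :: "('k, 'a) fdmod"
  proof -
    have s: "same L \<pi> E (descend L \<pi> E)"
      using E ker[OF E] by (intro same_descend) (auto simp: kmod_def fgmod_def)
    show ?thesis
      by (rule bexI[of _ "descend L \<pi> E"]) (use s E k[OF s] g[OF s] sameD[OF s] in auto)
  qed
  have "lifts L (gen L M) (kmod L e) M \<longleftrightarrow> lifts L' (gen L' M') (kmod L' (\<pi> e)) M'"
  proof
    assume "lifts L (gen L M) (kmod L e) M"
    then show "lifts L' (gen L' M') (kmod L' (\<pi> e)) M'"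
      by (rule lifts_half[OF _ 1 l sm sameD(1)[OF sm]])
  next
    assume "lifts L' (gen L' M') (kmod L' (\<pi> e)) M'"
    then show "lifts L (gen L M) (kmod L e) M"
      by (rule lifts_half[where P="\<lambda>E' E. same L \<pi> E E'", OF _ 2 l[symmetric] sm sameD(1)[OF sm, symmetric]])
  qed
  then show ?thesis unfolding rig_def using k[OF sm] by blast
qed

end

lemma rig_iso:
  assumes "rig L e M" "M' \<in> fgmod L" "mod_iso L M M'" "e \<in> carrier L"
  shows "rig L e M'"
proof -
  have M: "left_module L M" "left_module L M'" using assms by (auto simp: rig_def kmod_def fgmod_def)
  obtain h where h: "lin L M M' h" "bij_betw h (carrier M) (carrier M')"
    using assms(3) by (auto simp: mod_iso_iff[OF M(1)])
  obtain g where g: "lin L M' M g" "\<forall>x\<in>carrier M. g (h x) = x" "\<forall>y\<in>carrier M'. h (g y) = y"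
    using lin_inverse[OF M(1) h] by blast
  have "e \<odot>\<^bsub>M'\<^esub> y = \<zero>\<^bsub>M'\<^esub>" if y: "y \<in> carrier M'" for y
  proof -
    have "e \<odot>\<^bsub>M'\<^esub> y = h (e \<odot>\<^bsub>M\<^esub> g y)" using lin_smult[OF h(1) assms(4) lin_closed[OF g(1) y]] g(3) y by simp
    also have "e \<odot>\<^bsub>M\<^esub> g y = \<zero>\<^bsub>M\<^esub>" using assms(1) lin_closed[OF g(1) y] by (simp add: rig_def kmod_def)
    finally show ?thesis using lin_zero[OF M h(1)] by simp
  qed
  then have "M' \<in> kmod L e" using assms(2) by (simp add: kmod_def)
  moreover have "lifts L (gen L M') (kmod L e) M'"
  proof (rule liftsI)
    fix E Z p u
    assume E: "E \<in> kmod L e" "Z \<in> kmod L e" "lin L E Z p" "p ` carrier E = carrier Z"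
      "gen L M' (E\<lparr>carrier := lker E Z p\<rparr>)" "lin L M' Z u"
    have lE: "left_module L E" "left_module L Z" using E by (auto simp: kmod_def fgmod_def)
    let ?Q = "E\<lparr>carrier := lker E Z p\<rparr>"
    have lQ: "left_module L ?Q" by (rule left_module.sub_module[OF lE(1) ker_submodule[OF lE E(3)]])
    have "trace L M' ?Q \<subseteq> trace L M ?Q"
    proof
      fix x assume "x \<in> trace L M' ?Q" then show "x \<in> trace L M ?Q"
      proof induction
        case zero show ?case by (rule trace.zero)
      next
        case (step k t y)
        have "k (h (g t)) \<oplus>\<^bsub>?Q\<^esub> y \<in> trace L M ?Q"
          by (rule trace.step[OF lin_comp[OF h(1) step(1)] lin_closed[OF g(1) step(2)] step.IH])
        then show ?case using g(3) step(2) by simp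
      qed
    qed
    then have "gen L M ?Q" using E(5) by (auto simp: gen_def)
    then obtain s where s: "lin L M E s" "\<forall>x\<in>carrier M. p (s x) = u (h x)"
      using liftsD[of L "gen L M" "kmod L e" M E Z p, OF _ E(1-4) _ lin_comp[OF h(1) E(6)]] assms(1) by (auto simp: rig_def)
    then show "\<exists>s. lin L M' E s \<and> (\<forall>x\<in>carrier M'. p (s x) = u x)"
      using lin_comp[OF g(1) s(1)] g(3) lin_closed[OF g(1)] by (intro exI[of _ "\<lambda>x. s (g x)"]) auto
  qed
  ultimately show ?thesis by (simp add: rig_def)
qed

section \<open>Quotient algebras\<close>

lemma quot_simps [simp]: "carrier (quot_algebra L I) = a_rcosets\<^bsub>L\<^esub> I" 
  "monoid.mult (quot_algebra L I) = rcoset_mult L I" "\<one>\<^bsub>quot_algebra L I\<^esub> = I +>\<^bsub>L\<^esub> \<one>\<^bsub>L\<^esub>"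
  "\<zero>\<^bsub>quot_algebra L I\<^esub> = I" "ring.add (quot_algebra L I) = set_add L"
  "c \<odot>\<^bsub>quot_algebra L I\<^esub> C = (\<Union>x\<in>C. I +>\<^bsub>L\<^esub> (c \<odot>\<^bsub>L\<^esub> x))"
  by (simp_all add: quot_algebra_def ring.extend_def module.fields_def FactRing_def)

lemma iso_of_surj:
  assumes "left_module R M" "left_module R Q" "left_module R Q'" "lin R M Q p" "lin R M Q' p'"
    "p ` carrier M = carrier Q" "p' ` carrier M = carrier Q'"
    "\<And>x. x \<in> carrier M \<Longrightarrow> p x = \<zero>\<^bsub>Q\<^esub> \<longleftrightarrow> p' x = \<zero>\<^bsub>Q'\<^esub>"
  shows "mod_iso R Q Q'"
proof -
  obtain g where g: "lin R Q Q' g" "\<forall>x\<in>carrier M. g (p x) = p' x"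
    using lin_factor[OF assms(1,2,3,4,5,6)] assms(8) by blast
  obtain g' where g': "lin R Q' Q g'" "\<forall>x\<in>carrier M. g' (p' x) = p x"
    using lin_factor[OF assms(1,3,2,5,4,7)] assms(8) by blast
  have "bij_betw g (carrier Q) (carrier Q')"
  proof (rule bij_of_inverse[OF g(1) g'(1)])
    fix y assume "y \<in> carrier Q"
    then obtain x where "x \<in> carrier M" "y = p x" unfolding assms(6)[symmetric] by blast
    then show "g' (g y) = y" using g(2) g'(2) by simp
  next
    fix y assume "y \<in> carrier Q'"
    then obtain x where "x \<in> carrier M" "y = p' x" unfolding assms(7)[symmetric] by blast
    then show "g (g' y) = y" using g(2) g'(2) by simp
  qed
  then show ?thesis using mod_isoI[OF assms(2) g(1)] by blast
qed

section \<open>Support tau-tilting modules described without passing to a quotient algebra\<close>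

context fdalg begin

lemma ideal_regular_submodule: assumes "ideal I L" shows "submodule I L (regular_module L)"
proof -
  interpret RM: left_module L "regular_module L" by (rule regular_module)
  interpret I: ideal I L by fact
  show ?thesis by (rule RM.submoduleI) (auto simp: I.I_l_closed)
qed

lemma ideal_smult: "ideal I L \<Longrightarrow> c \<in> carrier K \<Longrightarrow> x \<in> I \<Longrightarrow> c \<odot>\<^bsub>L\<^esub> x \<in> I"
proof -
  assume I: "ideal I L" and c: "c \<in> carrier K" and x: "x \<in> I"
  interpret I: ideal I L by fact
  have "sc c \<otimes>\<^bsub>L\<^esub> x \<in> I" using c x by (intro I.I_l_closed) auto
  then show ?thesis using c x by simp
qed

lemma
  assumes I: "ideal I L"
  shows quot_ring_surj: "ring_surj L (quot_algebra L I) (\<lambda>a. I +>\<^bsub>L\<^esub> a)"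
    and quot_zero_iff: "a \<in> carrier L \<Longrightarrow> I +>\<^bsub>L\<^esub> a = I \<longleftrightarrow> a \<in> I"
    and quot_fd: "fd_algebra K (quot_algebra L I)"
proof -
  interpret I: ideal I L by fact
  let ?Q = "quot_algebra L I" and ?\<pi> = "\<lambda>a. I +>\<^bsub>L\<^esub> a"
  have surj: "?\<pi> ` carrier L = carrier ?Q" by (auto simp: A_RCOSETS_def')
  have ag: "abelian_group (L Quot I)" using I.quotient_is_ring by (simp add: ring_def)
  interpret LQ: ring "L Quot I" by (rule I.quotient_is_ring)
  have agQ: "abelian_group ?Q" by (rule abelian_group_cong[OF ag]) (simp_all add: FactRing_def)
  have "Group.monoid ?Q"
    using LQ.monoid_axioms unfolding Group.monoid_def by (simp add: FactRing_def)
  then have ringQ: "ring ?Q"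
    using LQ.ring_axioms agQ unfolding ring_def ring_axioms_def by (simp add: FactRing_def)
  have hom: "\<And>a b. a \<in> carrier L \<Longrightarrow> b \<in> carrier L \<Longrightarrow> ?\<pi> (a \<oplus>\<^bsub>L\<^esub> b) = ?\<pi> a \<oplus>\<^bsub>?Q\<^esub> ?\<pi> b"
    "\<And>a b. a \<in> carrier L \<Longrightarrow> b \<in> carrier L \<Longrightarrow> ?\<pi> (a \<otimes>\<^bsub>L\<^esub> b) = ?\<pi> a \<otimes>\<^bsub>?Q\<^esub> ?\<pi> b"
    using I.a_rcos_sum I.rcoset_mult_add by simp_all
  show rs: "ring_surj L ?Q ?\<pi>"
    by (rule ring_surj.intro[OF R.ring_axioms ringQ surj hom]) simp_all
  show z: "I +>\<^bsub>L\<^esub> a = I \<longleftrightarrow> a \<in> I" if "a \<in> carrier L" for a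
    using R.a_coset_join1[OF _ that I.a_subgroup] R.a_coset_join2[OF that I.a_subgroup] by blast
  \<comment> \<open>The action on a coset is a union over its representatives, and this union is
    constant because ideals are stable under scalars.\<close>
  have sm: "?\<pi> (c \<odot>\<^bsub>L\<^esub> x) = c \<odot>\<^bsub>?Q\<^esub> ?\<pi> x" if c: "c \<in> carrier K" and x: "x \<in> carrier L" for c x
  proof -
    have "I +>\<^bsub>L\<^esub> (c \<odot>\<^bsub>L\<^esub> y) = I +>\<^bsub>L\<^esub> (c \<odot>\<^bsub>L\<^esub> x)" if yI: "y \<in> I +>\<^bsub>L\<^esub> x" for y
    proof -
      obtain w where w: "w \<in> I" "y = w \<oplus>\<^bsub>L\<^esub> x" using yI unfolding a_r_coset_def' by blast
      then have "c \<odot>\<^bsub>L\<^esub> y = c \<odot>\<^bsub>L\<^esub> w \<oplus>\<^bsub>L\<^esub> c \<odot>\<^bsub>L\<^esub> x" using c x by (simp add: KL.smult_r_distr)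
      moreover have "c \<odot>\<^bsub>L\<^esub> w \<in> I" using w c by (intro ideal_smult[OF I])
      ultimately have "c \<odot>\<^bsub>L\<^esub> y \<in> I +>\<^bsub>L\<^esub> (c \<odot>\<^bsub>L\<^esub> x)"
        using c x R.a_rcosI[OF _ I.a_subset, of "c \<odot>\<^bsub>L\<^esub> w" "c \<odot>\<^bsub>L\<^esub> x"] by simp
      then show ?thesis using c x by (intro R.a_repr_independence[symmetric] I.a_subgroup) auto
    qed
    moreover have "x \<in> I +>\<^bsub>L\<^esub> x" using x by (rule I.a_rcos_self)
    ultimately have "(\<Union>y\<in>I +>\<^bsub>L\<^esub> x. I +>\<^bsub>L\<^esub> (c \<odot>\<^bsub>L\<^esub> y)) = I +>\<^bsub>L\<^esub> (c \<odot>\<^bsub>L\<^esub> x)"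
      by (intro SUP_eq_const) blast+
    then show ?thesis by simp
  qed
  have zz: "?\<pi> \<zero>\<^bsub>L\<^esub> = \<zero>\<^bsub>?Q\<^esub>" using z[of "\<zero>\<^bsub>L\<^esub>"] by simp
  have KQ: "left_module K ?Q" by (rule left_module_surj[OF KL.left_module_axioms surj zz hom(1) sm])
  interpret KQ: left_module K ?Q by fact
  have "lin K L ?Q ?\<pi>" using surj by (intro linI hom(1) sm) auto
  moreover have "fgm K L" using fd KL.left_module_axioms by (simp add: fgm_def fd_algebra_def)
  ultimately have "fgm K ?Q" using fgm_surj KQ surj by blast
  then have fg: "fin_gen K ?Q" by (simp add: fgm_def)
  have "module K ?Q"
    by (rule moduleI[OF K.cring_axioms agQ])
      (simp_all only: KQ.smult_closed KQ.smult_l_distr KQ.smult_r_distr KQ.smult_assoc1 KQ.smult_one)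
  moreover have "(c \<odot>\<^bsub>?Q\<^esub> C) \<otimes>\<^bsub>?Q\<^esub> D = c \<odot>\<^bsub>?Q\<^esub> (C \<otimes>\<^bsub>?Q\<^esub> D) \<and> C \<otimes>\<^bsub>?Q\<^esub> (c \<odot>\<^bsub>?Q\<^esub> D) = c \<odot>\<^bsub>?Q\<^esub> (C \<otimes>\<^bsub>?Q\<^esub> D)"
    if "c \<in> carrier K" "C \<in> carrier ?Q" "D \<in> carrier ?Q" for c C D
  proof -
    obtain a b where ab: "a \<in> carrier L" "C = ?\<pi> a" "b \<in> carrier L" "D = ?\<pi> b"
      using \<open>C \<in> carrier ?Q\<close> \<open>D \<in> carrier ?Q\<close> unfolding surj[symmetric] by blast
    have c: "c \<in> carrier K" by fact
    show ?thesis
      unfolding ab(2,4) using ab(1,3) c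
      by (simp only: sm[symmetric] hom(2)[symmetric] KL.smult_closed R.m_closed smult_mult mult_smult simp_thms)
  qed
  ultimately show "fd_algebra K ?Q"
    unfolding fd_algebra_def using K.field_axioms ringQ fg by blast
qed

text \<open>The quotient algebra as a module over \<open>L\<close> itself, so that the required
  numbers of summands for different idempotents can be compared over one ring.\<close>

definition regular_quot :: "'a \<Rightarrow> ('a, 'a set) module" where
  "regular_quot e = inflate L (Idl\<^bsub>L\<^esub> {e}) (regular_module (quot_algebra L (Idl\<^bsub>L\<^esub> {e})))"

context
  fixes e assumes e: "e \<in> carrier L"
begin

abbreviation (input) "I \<equiv> Idl\<^bsub>L\<^esub> {e}"
abbreviation (input) "LQ \<equiv> quot_algebra L I"
abbreviation (input) "\<rho> \<equiv> (\<lambda>a. I +>\<^bsub>L\<^esub> a)"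

lemma ideal_I: "ideal I L" using e by (intro R.genideal_ideal) simp

lemma quot_alg_surj: "ring_surj L LQ \<rho>" "alg_surj L LQ \<rho>" and quot_fdalg: "fdalg K LQ"
  using quot_ring_surj[OF ideal_I] quot_fd[OF ideal_I] by (simp_all only: alg_surj_def fdalg_def)

lemma regular_quot_module: "left_module L (regular_quot e)"
  unfolding regular_quot_def inflate_pull using ring_surj.same_left_module[OF quot_alg_surj(1) same_pull] fdalg.regular_module[OF quot_fdalg] by blast

lemma regular_quot_proj:
  "lin L (regular_module L) (regular_quot e) \<rho>" "\<rho> ` carrier L = carrier (regular_quot e)"
  "a \<in> carrier L \<Longrightarrow> \<rho> a = \<zero>\<^bsub>regular_quot e\<^esub> \<longleftrightarrow> a \<in> I"
  unfolding regular_quot_def inflate_pull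
proof -
  show "lin L (regular_module L) (pull \<rho> (regular_module LQ)) \<rho>"
    by (rule linI) (simp_all only: regular_simps pull_simps ring_surj.hadd[OF quot_alg_surj(1)] ring_surj.hmult[OF quot_alg_surj(1)] ring_surj.\<pi>c[OF quot_alg_surj(1)])
  show "\<rho> ` carrier L = carrier (pull \<rho> (regular_module LQ))"
    by (simp only: regular_simps pull_simps ring_surj.surj[OF quot_alg_surj(1)])
  show "a \<in> carrier L \<Longrightarrow> \<rho> a = \<zero>\<^bsub>pull \<rho> (regular_module LQ)\<^esub> \<longleftrightarrow> a \<in> I"
    using quot_zero_iff[OF ideal_I] by simp
qed

text \<open>A cyclic module whose generator has annihilator \<open>I\<close> is a copy of
  \<open>regular_quot e\<close>; in this way quotients that arise differently are
  recognised.\<close>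

lemma num_regular_quot:
  assumes "left_module L U" "lin L (regular_module L) U q" "q ` carrier L = carrier U"
    "\<And>a. a \<in> carrier L \<Longrightarrow> q a = \<zero>\<^bsub>U\<^esub> \<longleftrightarrow> a \<in> I"
  shows "num_summands L U = num_summands L (regular_quot e)"
proof (rule num_summands_iso[OF assms(1) regular_quot_module])
  show "mod_iso L U (regular_quot e)"
    by (rule iso_of_surj[OF regular_module assms(1) regular_quot_module assms(2) regular_quot_proj(1)])
      (use assms(3,4) regular_quot_proj(2,3) in auto)
qed

lemma kmod_ideal: "E \<in> kmod L e \<Longrightarrow> a \<in> carrier L \<Longrightarrow> \<rho> a = \<zero>\<^bsub>LQ\<^esub> \<Longrightarrow> x \<in> carrier E \<Longrightarrow> a \<odot>\<^bsub>E\<^esub> x = \<zero>\<^bsub>E\<^esub>"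
  using kill_ideal[of L E e a x] e quot_zero_iff[OF ideal_I] by (auto simp: kmod_def fgmod_def)

lemma \<rho>e: "\<rho> e = \<zero>\<^bsub>LQ\<^esub>" using quot_zero_iff[OF ideal_I e] R.genideal_self'[OF e] by simp

lemma tau_tilting_quot_iff:
  fixes N :: "('k, 'a set) fdmod"
  shows "tau_tilting K LQ N \<longleftrightarrow> rig L e (inflate L I N) \<and>
    num_summands L (inflate L I N) = num_summands L (regular_quot e)"
proof -
  have sm: "same L \<rho> (inflate L I N) N" unfolding inflate_pull by (rule same_pull)
  \<comment> \<open>Over the quotient the image of \<open>e\<close> is zero and imposes no
    condition, so relative rigidity becomes the criterion for \<tau>-rigidity.\<close>
  have "kmod LQ (\<zero>\<^bsub>LQ\<^esub>) = fgmod LQ"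
    using left_module.smult_l_null[of LQ] by (auto simp: kmod_def fgmod_def)
  then have rig: "rig L e (inflate L I N) \<longleftrightarrow> N \<in> fgmod LQ \<and> lifts LQ (gen LQ N) (fgmod LQ) N"
    using alg_surj.rig_change[OF quot_alg_surj(2) sm e] kmod_ideal unfolding \<rho>e by (simp add: rig_def)
  have "tau_rigid K LQ N \<longleftrightarrow> rig L e (inflate L I N)"
    unfolding rig using fdalg.tau_rigid_iff_lifts[OF quot_fdalg] by (auto simp: tau_rigid_def)
  moreover have "num_summands L (inflate L I N) = num_summands LQ N" if "rig L e (inflate L I N)"
    using that ring_surj.same_num[OF quot_alg_surj(1) sm] by (simp add: rig_def kmod_def fgmod_def)
  moreover have "num_summands L (regular_quot e) = num_summands LQ (regular_module LQ)"
    using ring_surj.same_num[OF quot_alg_surj(1) same_pull] regular_quot_module unfolding regular_quot_def inflate_pull by blast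
  ultimately show ?thesis unfolding tau_tilting_def by auto
qed

text \<open>\<open>descend\<close> turns a module killed by \<open>e\<close> into a witness
  \<open>N\<close> with the same elements.\<close>

lemma stt_iff:
  fixes M :: "('k, 'a) fdmod"
  assumes M: "M \<in> fgmod L"
  shows "(\<exists>N. tau_tilting K LQ N \<and> mod_iso L M (inflate L I N)) \<longleftrightarrow>
    rig L e M \<and> num_summands L M = num_summands L (regular_quot e)"
proof
  assume "\<exists>N. tau_tilting K LQ N \<and> mod_iso L M (inflate L I N)"
  then obtain N where N: "rig L e (inflate L I N)" "num_summands L (inflate L I N) = num_summands L (regular_quot e)"
    "mod_iso L M (inflate L I N)" unfolding tau_tilting_quot_iff by blast
  have lm: "left_module L M" "left_module L (inflate L I N)" using M N by (auto simp: rig_def kmod_def fgmod_def)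
  show "rig L e M \<and> num_summands L M = num_summands L (regular_quot e)"
    using rig_iso[OF N(1) M mod_iso_sym[OF lm N(3)] e] num_summands_iso[OF lm N(3)] N(2) by simp
next
  assume r: "rig L e M \<and> num_summands L M = num_summands L (regular_quot e)"
  then have Mk: "M \<in> kmod L e" by (simp add: rig_def)
  have lm: "left_module L M" using M by (simp add: fgmod_def)
  let ?N = "descend L \<rho> M"
  have sm: "same L \<rho> M ?N" using kmod_ideal[OF Mk] by (intro ring_surj.same_descend[OF quot_alg_surj(1)] lm) auto
  have sm': "same L \<rho> (inflate L I ?N) ?N" unfolding inflate_pull by (rule same_pull)
  have lm': "left_module L (inflate L I ?N)" using ring_surj.same_left_module[OF quot_alg_surj(1) sm] ring_surj.same_left_module[OF quot_alg_surj(1) sm'] lm by blast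
  have iso: "mod_iso L M (inflate L I ?N)"
    using ring_surj.same_iso[OF quot_alg_surj(1) sm sm' lm] mod_iso_refl[of LQ ?N] ring_surj.same_left_module[OF quot_alg_surj(1) sm] lm by blast
  have "inflate L I ?N \<in> fgmod L" using M ring_surj.same_fgm[OF quot_alg_surj(1) sm] ring_surj.same_fgm[OF quot_alg_surj(1) sm'] by (simp add: fgmod_iff)
  then have "tau_tilting K LQ ?N"
    unfolding tau_tilting_quot_iff using rig_iso[OF _ _ iso e] r num_summands_iso[OF lm lm' iso] by simp
  then show "\<exists>N. tau_tilting K LQ N \<and> mod_iso L M (inflate L I N)" using iso by blast
qed

end

text \<open>All conditions are now over \<open>L\<close>, and only the idempotent varies. The
  comparison of A with B thus needs the single surjection from B to A.\<close>

theorem support_tau_tilting_iff: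
  "support_tau_tilting K L M \<longleftrightarrow> M \<in> fgmod L \<and> (\<exists>e\<in>carrier L. e \<otimes>\<^bsub>L\<^esub> e = e \<and> rig L e M \<and>
     num_summands L M = num_summands L (regular_quot e))"
  unfolding support_tau_tilting_def using stt_iff by blast

end

section \<open>Extending a rigid module by a new vertex\<close>

lemma kmod_module: "E \<in> kmod L e \<Longrightarrow> left_module L E"
  by (simp add: kmod_def fgmod_def)

lemma biproductD:
  assumes "biproduct R S M N i1 i2 p1 p2"
  shows "lin R M S i1" "lin R N S i2" "lin R S M p1" "lin R S N p2"
    "\<And>x. x \<in> carrier M \<Longrightarrow> p1 (i1 x) = x" "\<And>x. x \<in> carrier M \<Longrightarrow> p2 (i1 x) = \<zero>\<^bsub>N\<^esub>"
    "\<And>y. y \<in> carrier N \<Longrightarrow> p2 (i2 y) = y" "\<And>y. y \<in> carrier N \<Longrightarrow> p1 (i2 y) = \<zero>\<^bsub>M\<^esub>"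
    "\<And>z. z \<in> carrier S \<Longrightarrow> i1 (p1 z) \<oplus>\<^bsub>S\<^esub> i2 (p2 z) = z"
  using assms by (auto simp: biproduct_def)

lemma biproduct_kill:
  assumes "left_module L M" "left_module L N" "left_module L S" "biproduct L S M N i1 i2 p1 p2" "e \<in> carrier L"
    "\<And>x. x \<in> carrier M \<Longrightarrow> e \<odot>\<^bsub>M\<^esub> x = \<zero>\<^bsub>M\<^esub>" "\<And>x. x \<in> carrier N \<Longrightarrow> e \<odot>\<^bsub>N\<^esub> x = \<zero>\<^bsub>N\<^esub>" "z \<in> carrier S"
  shows "e \<odot>\<^bsub>S\<^esub> z = \<zero>\<^bsub>S\<^esub>"
proof -
  note b = biproductD[OF assms(4)]
  note bc = b(1-4)[THEN lin_closed]
  interpret S: left_module L S by fact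
  have "e \<odot>\<^bsub>S\<^esub> z = i1 (e \<odot>\<^bsub>M\<^esub> p1 z) \<oplus>\<^bsub>S\<^esub> i2 (e \<odot>\<^bsub>N\<^esub> p2 z)"
    using b(9)[OF assms(8)] bc assms(5,8) S.smult_r_distr[of e "i1 (p1 z)" "i2 (p2 z)"]
    by (simp add: lin_smult[OF b(1)] lin_smult[OF b(2)])
  then show ?thesis
    using assms(6,7) bc assms(8) lin_zero[OF assms(1,3) b(1)] lin_zero[OF assms(2,3) b(2)] by simp
qed

lemma biproduct_kmod:
  assumes "M \<in> kmod L e" "N \<in> kmod L e" "S \<in> fgmod L" "biproduct L S M N i1 i2 p1 p2" "e \<in> carrier L"
  shows "S \<in> kmod L e"
  using biproduct_kill[OF _ _ _ assms(4,5)] assms(1-3) by (simp add: kmod_def fgmod_def)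

lemma lifts_biproduct:
  assumes "left_module R M" "left_module R N" "biproduct R S M N i1 i2 p1 p2" "lifts R \<Q> C M" "lifts R \<Q> C N"
    and C: "\<And>E. E \<in> C \<Longrightarrow> left_module R E"
  shows "lifts R \<Q> C S"
proof (rule liftsI)
  fix E Z p u
  assume *: "E \<in> C" "Z \<in> C" "lin R E Z p" "p ` carrier E = carrier Z" "\<Q> (E\<lparr>carrier := lker E Z p\<rparr>)" and u: "lin R S Z u"
  note b = biproductD[OF assms(3)]
  note bc = b(1-4)[THEN lin_closed]
  obtain s where s: "lin R M E s" "\<forall>x\<in>carrier M. p (s x) = u (i1 x)"
    using liftsD[OF assms(4) * lin_comp[OF b(1) u]] by blast
  obtain t where t: "lin R N E t" "\<forall>x\<in>carrier N. p (t x) = u (i2 x)"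
    using liftsD[OF assms(5) * lin_comp[OF b(2) u]] by blast
  have "lin R S E (\<lambda>z. s (p1 z) \<oplus>\<^bsub>E\<^esub> t (p2 z))"
    by (rule lin_sum[OF C[OF *(1)] lin_comp[OF b(3) s(1)] lin_comp[OF b(4) t(1)]])
  moreover have "p (s (p1 z) \<oplus>\<^bsub>E\<^esub> t (p2 z)) = u z" if z: "z \<in> carrier S" for z
  proof -
    have "p (s (p1 z) \<oplus>\<^bsub>E\<^esub> t (p2 z)) = u (i1 (p1 z)) \<oplus>\<^bsub>Z\<^esub> u (i2 (p2 z))"
      using lin_add[OF *(3) lin_closed[OF s(1) bc(3)[OF z]] lin_closed[OF t(1) bc(4)[OF z]]] s(2) t(2) bc z by simp
    also have "\<dots> = u (i1 (p1 z) \<oplus>\<^bsub>S\<^esub> i2 (p2 z))" using lin_add[OF u] bc z by simp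
    finally show ?thesis using b(9)[OF z] by simp
  qed
  ultimately show "\<exists>s. lin R S E s \<and> (\<forall>x\<in>carrier S. p (s x) = u x)" by blast
qed

lemma lifts_retract:
  assumes "lifts R \<Q> C M" "lin R Y M s" "lin R M Y r" "\<And>y. y \<in> carrier Y \<Longrightarrow> r (s y) = y"
  shows "lifts R \<Q> C Y"
proof (rule liftsI)
  fix E Z p u
  assume *: "E \<in> C" "Z \<in> C" "lin R E Z p" "p ` carrier E = carrier Z" "\<Q> (E\<lparr>carrier := lker E Z p\<rparr>)" and u: "lin R Y Z u"
  obtain l where l: "lin R M E l" "\<forall>x\<in>carrier M. p (l x) = u (r x)"
    using liftsD[OF assms(1) * lin_comp[OF assms(3) u]] by blast
  then show "\<exists>s. lin R Y E s \<and> (\<forall>x\<in>carrier Y. p (s x) = u x)"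
    using lin_comp[OF assms(2) l(1)] lin_closed[OF assms(2)] assms(4) by (intro exI[of _ "\<lambda>y. l (s y)"]) auto
qed

text \<open>One-point extensions in terms of idempotents: \<open>\<epsilon>\<close> is the new vertex, \<open>T\<close> a \<open>\<tau>\<close>-rigid \<open>L/\<langle>e0 + \<epsilon>\<rangle>\<close>-module.\<close>

locale new_vertex = fdalg K L for K :: "'k ring" and L :: "('k, 'a) module" +
  fixes \<epsilon> e0 :: 'a and T :: "('k, 'a) fdmod"
  assumes \<epsilon>L: "\<epsilon> \<in> carrier L" and e0L: "e0 \<in> carrier L"
    and \<epsilon>\<epsilon>: "\<epsilon> \<otimes>\<^bsub>L\<^esub> \<epsilon> = \<epsilon>" and \<epsilon>e0: "\<epsilon> \<otimes>\<^bsub>L\<^esub> e0 = \<zero>\<^bsub>L\<^esub>" and e0\<epsilon>: "e0 \<otimes>\<^bsub>L\<^esub> \<epsilon> = \<zero>\<^bsub>L\<^esub>"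
    and \<epsilon>b: "b \<in> carrier L \<Longrightarrow> \<epsilon> \<otimes>\<^bsub>L\<^esub> b = \<epsilon> \<otimes>\<^bsub>L\<^esub> b \<otimes>\<^bsub>L\<^esub> \<epsilon>"
    and \<epsilon>b\<epsilon>: "b \<in> carrier L \<Longrightarrow> \<exists>c\<in>carrier K. \<epsilon> \<otimes>\<^bsub>L\<^esub> b \<otimes>\<^bsub>L\<^esub> \<epsilon> = c \<odot>\<^bsub>L\<^esub> \<epsilon>"
    and \<epsilon>I0: "\<epsilon> \<notin> Idl\<^bsub>L\<^esub> {e0}"
    and rigT: "rig L (e0 \<oplus>\<^bsub>L\<^esub> \<epsilon>) T"
begin

abbreviation "e' \<equiv> e0 \<oplus>\<^bsub>L\<^esub> \<epsilon>"
abbreviation "I0 \<equiv> Idl\<^bsub>L\<^esub> {e0}"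

lemma e'L: "e' \<in> carrier L" using \<epsilon>L e0L by simp

text \<open>\<open>\<epsilon>\<close> equals \<open>\<epsilon>\<close> times \<open>e'\<close>, so a
  module killed by \<open>e'\<close> is killed by \<open>\<epsilon>\<close> and then also by
  \<open>e0\<close>.\<close>

lemma kmod_e'_iff: "E \<in> kmod L e' \<longleftrightarrow> E \<in> kmod L e0 \<and> (\<forall>x\<in>carrier E. \<epsilon> \<odot>\<^bsub>E\<^esub> x = \<zero>\<^bsub>E\<^esub>)"
proof -
  have "(\<forall>x\<in>carrier E. e' \<odot>\<^bsub>E\<^esub> x = \<zero>\<^bsub>E\<^esub>) \<longleftrightarrow> (\<forall>x\<in>carrier E. e0 \<odot>\<^bsub>E\<^esub> x = \<zero>\<^bsub>E\<^esub> \<and> \<epsilon> \<odot>\<^bsub>E\<^esub> x = \<zero>\<^bsub>E\<^esub>)"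
    if "left_module L E"
  proof -
    interpret E: left_module L E by fact
    have 1: "\<epsilon> \<otimes>\<^bsub>L\<^esub> e' = \<epsilon>" using \<epsilon>L e0L by (simp add: R.r_distr \<epsilon>\<epsilon> \<epsilon>e0)
    have "e0 \<odot>\<^bsub>E\<^esub> x = \<zero>\<^bsub>E\<^esub> \<and> \<epsilon> \<odot>\<^bsub>E\<^esub> x = \<zero>\<^bsub>E\<^esub>" if x: "x \<in> carrier E" and z: "e' \<odot>\<^bsub>E\<^esub> x = \<zero>\<^bsub>E\<^esub>" for x
    proof -
      have "\<epsilon> \<odot>\<^bsub>E\<^esub> x = \<epsilon> \<odot>\<^bsub>E\<^esub> (e' \<odot>\<^bsub>E\<^esub> x)" using E.smult_assoc1[OF \<epsilon>L e'L x] by (simp add: 1)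
      then have e: "\<epsilon> \<odot>\<^bsub>E\<^esub> x = \<zero>\<^bsub>E\<^esub>" using z \<epsilon>L by simp
      then show ?thesis using z x E.smult_l_distr[OF e0L \<epsilon>L x] \<epsilon>L e0L by simp
    qed
    moreover have "e' \<odot>\<^bsub>E\<^esub> x = \<zero>\<^bsub>E\<^esub>" if "x \<in> carrier E" "e0 \<odot>\<^bsub>E\<^esub> x = \<zero>\<^bsub>E\<^esub> \<and> \<epsilon> \<odot>\<^bsub>E\<^esub> x = \<zero>\<^bsub>E\<^esub>" for x
      using that E.smult_l_distr[OF e0L \<epsilon>L that(1)] by simp
    ultimately show ?thesis by blast
  qed
  then show ?thesis by (auto simp: kmod_def fgmod_def)
qed

lemma T: "T \<in> kmod L e'" "lifts L (gen L T) (kmod L e') T" "left_module L T"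
  using rigT by (auto simp: rig_def kmod_def fgmod_def)

lemma \<epsilon>T: "x \<in> carrier T \<Longrightarrow> \<epsilon> \<odot>\<^bsub>T\<^esub> x = \<zero>\<^bsub>T\<^esub>" using T(1) kmod_e'_iff by blast

sublocale T: left_module L T by (rule T(3))

definition "old E = {x \<in> carrier E. \<epsilon> \<odot>\<^bsub>E\<^esub> x = \<zero>\<^bsub>E\<^esub>}"

text \<open>The torsion class in question. The trace may be formed in \<open>Q\<close> instead of in
  its old part, because images of \<open>T\<close> are killed by \<open>\<epsilon>\<close>, as
  \<open>trace_old\<close> records.\<close>

definition "tors Q \<longleftrightarrow> old Q \<subseteq> trace L T Q"

text \<open>Multiplication by \<open>a\<close> preserves the old part because
  \<open>\<epsilon> a = \<epsilon> a \<epsilon>\<close>.\<close>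

lemma old_submodule: assumes "left_module L E" shows "submodule (old E) L E"
proof -
  interpret E: left_module L E by fact
  show ?thesis
  proof (rule E.submoduleI)
    fix a x assume a: "a \<in> carrier L" and x: "x \<in> old E"
    then have x': "x \<in> carrier E" "\<epsilon> \<odot>\<^bsub>E\<^esub> x = \<zero>\<^bsub>E\<^esub>" by (auto simp: old_def)
    have "\<epsilon> \<odot>\<^bsub>E\<^esub> (a \<odot>\<^bsub>E\<^esub> x) = (\<epsilon> \<otimes>\<^bsub>L\<^esub> a \<otimes>\<^bsub>L\<^esub> \<epsilon>) \<odot>\<^bsub>E\<^esub> x"
      using E.smult_assoc1[OF \<epsilon>L a x'(1)] \<epsilon>b[OF a] by simp
    also have "\<dots> = (\<epsilon> \<otimes>\<^bsub>L\<^esub> a) \<odot>\<^bsub>E\<^esub> (\<epsilon> \<odot>\<^bsub>E\<^esub> x)" using a \<epsilon>L x' by (simp add: E.smult_assoc1)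
    finally show "a \<odot>\<^bsub>E\<^esub> x \<in> old E" using a x' \<epsilon>L by (simp add: old_def)
  qed (use \<epsilon>L in \<open>auto simp: old_def E.smult_r_distr\<close>)
qed

lemma old_kmod: assumes "E \<in> kmod L e0" shows "E\<lparr>carrier := old E\<rparr> \<in> kmod L e'"
proof -
  have "fgm L (E\<lparr>carrier := old E\<rparr>)"
    using fgm_sub[OF _ old_submodule] assms by (auto simp: kmod_def fgmod_iff fgm_def)
  then show ?thesis unfolding kmod_e'_iff using assms by (auto simp: kmod_def fgmod_iff old_def)
qed

lemma old_map: "lin L E Z f \<Longrightarrow> left_module L E \<Longrightarrow> left_module L Z \<Longrightarrow> x \<in> old E \<Longrightarrow> f x \<in> old Z"
  using lin_smult[of L E Z f \<epsilon> x, symmetric] lin_closed[of L E Z f x] lin_zero[of L E Z f] \<epsilon>L by (auto simp: old_def)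

lemma trace_old: "left_module L Q \<Longrightarrow> x \<in> trace L T Q \<Longrightarrow> x \<in> old Q"
proof -
  assume Q: "left_module L Q" and x: "x \<in> trace L T Q"
  interpret Q: left_module L Q by fact
  from x show "x \<in> old Q"
  proof induction
    case zero show ?case using \<epsilon>L by (simp add: old_def)
  next
    case (step h t y)
    have "t \<in> old T" using step(2) \<epsilon>T by (simp add: old_def)
    then have "h t \<in> old Q" by (rule old_map[OF step(1) T(3) Q])
    then show ?case by (rule Q.sub_add[OF old_submodule[OF Q] _ step.IH])
  qed
qed

text \<open>As \<open>T\<close> is killed by \<open>\<epsilon>\<close>, the lifting problem takes
  place in the old parts, where rigidity of \<open>T\<close> applies. Passing to old parts is exact
  since \<open>\<epsilon>\<close> is idempotent.\<close>

lemma lifts_T: "lifts L tors (kmod L e0) T"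
proof (rule liftsI)
  fix E Z p u
  assume E: "E \<in> kmod L e0" and Z: "Z \<in> kmod L e0" and p: "lin L E Z p" "p ` carrier E = carrier Z"
    and Q: "tors (E\<lparr>carrier := lker E Z p\<rparr>)" and u: "lin L T Z u"
  interpret E: left_module L E by (rule kmod_module[OF E])
  interpret Z: left_module L Z by (rule kmod_module[OF Z])
  note lE = E.left_module_axioms and lZ = Z.left_module_axioms
  let ?E = "E\<lparr>carrier := old E\<rparr>" and ?Z = "Z\<lparr>carrier := old Z\<rparr>" and ?Q = "E\<lparr>carrier := lker E Z p\<rparr>"
  have oE: "old E \<subseteq> carrier E" and oZ: "old Z \<subseteq> carrier Z" by (auto simp: old_def)
  have ker: "submodule (lker E Z p) L E" by (rule ker_submodule[OF lE lZ p(1)])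
  have lQ: "left_module L ?Q" by (rule E.sub_module[OF ker])
  have pA: "lin L ?E ?Z p"
    by (rule lin_corestrict[OF lin_restrict[OF p(1) oE]]) (use old_map[OF p(1) lE lZ] in simp)
  have surjA: "p ` carrier ?E = carrier ?Z"
  proof
    show "p ` carrier ?E \<subseteq> carrier ?Z" using old_map[OF p(1) lE lZ] by auto
    show "carrier ?Z \<subseteq> p ` carrier ?E"
    proof
      fix z assume "z \<in> carrier ?Z"
      then have z: "z \<in> carrier Z" "\<epsilon> \<odot>\<^bsub>Z\<^esub> z = \<zero>\<^bsub>Z\<^esub>" by (auto simp: old_def)
      then obtain x where x: "x \<in> carrier E" "z = p x" unfolding p(2)[symmetric] by blast
      \<comment> \<open>Subtracting \<open>\<epsilon> x\<close> makes the preimage old and does not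
        change its image, which is old already.\<close>
      have "p (x \<ominus>\<^bsub>E\<^esub> \<epsilon> \<odot>\<^bsub>E\<^esub> x) = z"
        using lin_minus[OF lE lZ p(1)] lin_smult[OF p(1) \<epsilon>L] x z \<epsilon>L by simp
      moreover have "\<epsilon> \<odot>\<^bsub>E\<^esub> (x \<ominus>\<^bsub>E\<^esub> \<epsilon> \<odot>\<^bsub>E\<^esub> x) = \<zero>\<^bsub>E\<^esub>"
        using x \<epsilon>L by (simp add: E.smult_r_diff E.smult_assoc1[symmetric] \<epsilon>\<epsilon>)
      ultimately show "z \<in> p ` carrier ?E" using x \<epsilon>L by (intro image_eqI[of _ p "x \<ominus>\<^bsub>E\<^esub> \<epsilon> \<odot>\<^bsub>E\<^esub> x"]) (auto simp: old_def)
    qed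
  qed
  \<comment> \<open>Homomorphisms from \<open>T\<close> into the kernel land in its old part, so the
    trace is not diminished by restricting to that part.\<close>
  have tr: "x \<in> trace L T (?E\<lparr>carrier := lker ?E ?Z p\<rparr>)" if "x \<in> trace L T ?Q" for x
    using that
  proof induction
    case zero show ?case using trace.zero[of "?E\<lparr>carrier := lker ?E ?Z p\<rparr>" L T] by simp
  next
    case (step h t y)
    have "h z \<in> lker ?E ?Z p" if "z \<in> carrier T" for z
    proof -
      have "h z \<in> old ?Q" using trace_old[OF lQ trace_hom[OF lQ step(1) that]] .
      then show ?thesis by (auto simp: old_def)
    qed
    then have "lin L T (?E\<lparr>carrier := lker ?E ?Z p\<rparr>) h"
      using step(1) by (auto simp: lin_def)
    then show ?case using trace.step[OF _ step(2) step.IH] by simp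
  qed
  have "gen L T (?E\<lparr>carrier := lker ?E ?Z p\<rparr>)"
    unfolding gen_def
  proof
    fix x assume "x \<in> carrier (?E\<lparr>carrier := lker ?E ?Z p\<rparr>)"
    then have "x \<in> old ?Q" by (auto simp: old_def)
    then show "x \<in> trace L T (?E\<lparr>carrier := lker ?E ?Z p\<rparr>)" using Q tr unfolding tors_def by blast
  qed
  moreover have "lin L T ?Z u"
    by (rule lin_corestrict[OF u]) (use old_map[OF u T(3) lZ] \<epsilon>T in \<open>auto simp: old_def\<close>)
  ultimately obtain s where s: "lin L T ?E s" "\<forall>x\<in>carrier T. p (s x) = u x"
    using liftsD[OF T(2) old_kmod[OF E] old_kmod[OF Z] pA surjA] by blast
  have "lin L T E s" using lin_decorestrict[OF s(1) oE] .
  then show "\<exists>s. lin L T E s \<and> (\<forall>x\<in>carrier T. p (s x) = u x)" using s(2) by blast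
qed

text \<open>\<open>S\<close> is a finite sum of copies of \<open>T\<close>, and \<open>t\<close> has
  a spanning set of \<open>T\<close> over \<open>K\<close> among its components; combinations of the
  projections carry \<open>t\<close> to any given element. The map from \<open>L\<close> to
  \<open>S\<close> with \<open>1 \<mapsto> t\<close> is thus a left approximation of the regular
  module by sums of copies of \<open>T\<close>.\<close>

lemma ex_universal:
  obtains S t where "S \<in> kmod L e'" "lifts L tors (kmod L e0) S" "gen L T S" "t \<in> carrier S"
    "\<And>s. s \<in> carrier T \<Longrightarrow> \<exists>h. lin L S T h \<and> h t = s"
proof -
  have fgT: "fgm L T" using T(1) by (simp add: kmod_def fgmod_iff)
  let ?V = "rsc L T"
  interpret V: left_module K ?V by (rule rsc_module[OF T(3)])
  have genT: "gen L T T" unfolding gen_def using trace_hom[OF T(3) lin_id] by blast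
  have "\<exists>S t. S \<in> kmod L e' \<and> lifts L tors (kmod L e0) S \<and> gen L T S \<and> t \<in> carrier S \<and>
      (\<forall>s\<in>mspan K ?V G. \<exists>h. lin L S T h \<and> h t = s)" if "finite G" "G \<subseteq> carrier T" for G
    using that
  proof (induction G rule: finite_induct)
    case empty
    \<comment> \<open>The induction starts with one copy of \<open>T\<close> and the component 0,
      which serves the zero subspace.\<close>
    have "mspan K ?V {} \<subseteq> {\<zero>\<^bsub>T\<^esub>}" using V.mspan_least[OF V.zero_submodule, of "{}"] by simp
    then have "\<forall>s\<in>mspan K ?V {}. \<exists>h. lin L T T h \<and> h \<zero>\<^bsub>T\<^esub> = s" using lin_const0[OF T(3)] by blast
    then show ?case using T(1) lifts_T genT T.M.zero_closed by blast
  next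
    case (insert \<tau> G)
    then obtain S t where S: "S \<in> kmod L e'" "lifts L tors (kmod L e0) S" "gen L T S" "t \<in> carrier S"
      "\<forall>s\<in>mspan K ?V G. \<exists>h. lin L S T h \<and> h t = s" by auto
    have \<tau>: "\<tau> \<in> carrier T" "G \<subseteq> carrier T" using insert by auto
    have fgS: "fgm L S" using S(1) by (simp add: kmod_def fgmod_iff)
    obtain S' :: "('k, 'a) fdmod" and i1 i2 p1 p2 where S': "S' \<in> fgmod L" "biproduct L S' S T i1 i2 p1 p2"
      by (rule ex_biproduct[OF fgS fgT])
    interpret S: left_module L S by (rule kmod_module[OF S(1)])
    interpret S': left_module L S' using S'(1) by (simp add: fgmod_def)
    note b = biproductD[OF S'(2)]
    note bc = b(1-4)[THEN lin_closed]
    let ?t = "i1 t \<oplus>\<^bsub>S'\<^esub> i2 \<tau>"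
    have pt: "p1 ?t = t" "p2 ?t = \<tau>"
      using lin_add[OF b(3)] lin_add[OF b(4)] bc b(5-8) S(4) \<tau>(1) by simp_all
    have "\<exists>h. lin L S' T h \<and> h ?t = s" if sG: "s \<in> mspan K ?V (insert \<tau> G)" for s
    proof -
      obtain c v where cv: "c \<in> carrier K" "v \<in> mspan K ?V G" "s = sc c \<odot>\<^bsub>T\<^esub> \<tau> \<oplus>\<^bsub>T\<^esub> v"
        using V.mspan_insert[OF _ _ sG] \<tau> by auto
      obtain h where h: "lin L S T h" "h t = v" using S(5) cv(2) by blast
      have "lin L S' T (\<lambda>z. sc c \<odot>\<^bsub>T\<^esub> p2 z \<oplus>\<^bsub>T\<^esub> h (p1 z))"
        by (rule lin_sum[OF T(3) lin_comp[OF b(4) lin_sc[OF T(3) cv(1)]] lin_comp[OF b(3) h(1)]])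
      then show ?thesis using pt cv(3) h(2) by (intro exI[of _ "\<lambda>z. sc c \<odot>\<^bsub>T\<^esub> p2 z \<oplus>\<^bsub>T\<^esub> h (p1 z)"]) simp
    qed
    moreover have "S' \<in> kmod L e'" by (rule biproduct_kmod[OF S(1) T(1) S' e'L])
    moreover have "lifts L tors (kmod L e0) S'"
      by (rule lifts_biproduct[OF S.left_module_axioms T(3) S'(2) S(2) lifts_T kmod_module])
    moreover have "gen L T S'"
      unfolding gen_def
    proof
      fix z assume z: "z \<in> carrier S'"
      have "i1 (p1 z) \<in> trace L T S'"
        using trace_map[OF S.left_module_axioms S'.left_module_axioms b(1)] S(3) bc(3)[OF z] by (auto simp: gen_def)
      moreover have "i2 (p2 z) \<in> trace L T S'" using trace_hom[OF S'.left_module_axioms b(2) bc(4)[OF z]] .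
      ultimately show "z \<in> trace L T S'"
        using S'.sub_add[OF trace_submodule[OF T(3) S'.left_module_axioms]] b(9)[OF z] by metis
    qed
    moreover have "?t \<in> carrier S'" using bc S(4) \<tau>(1) by simp
    ultimately show ?case by blast
  qed
  moreover obtain G where "finite G" "G \<subseteq> carrier ?V" "mspan K ?V G = carrier ?V"
    using fgm_rsc[OF fgT] V.fin_gen_iff by (auto simp: fgm_def)
  ultimately show ?thesis using that by (metis rsc_simps(1))
qed

text \<open>An element of the trace is a sum of values \<open>h \<tau>\<close>, and each
  \<open>\<tau>\<close> is an image of \<open>t\<close>; the resulting maps from \<open>S\<close>
  are added up.\<close>

lemma universal_trace:
  assumes "left_module L Q" and S: "\<And>s. s \<in> carrier T \<Longrightarrow> \<exists>h. lin L S T h \<and> h t = s" and "y \<in> trace L T Q"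
  shows "\<exists>h. lin L S Q h \<and> h t = y"
  using assms(3)
proof induction
  case zero show ?case using lin_const0[OF assms(1)] by blast
next
  case (step h \<tau> y)
  then obtain k where k: "lin L S Q k" "k t = y" by blast
  obtain g where g: "lin L S T g" "g t = \<tau>" using S[OF step(2)] by blast
  then show ?case using lin_sum[OF assms(1) lin_comp[OF g(1) step(1)] k(1)] k(2) by blast
qed

section \<open>The projective at the new vertex and the pushouts\<close>

lemma ideal_I0: "ideal I0 L" using e0L by (intro R.genideal_ideal) simp

text \<open>Maps from \<open>P\<close> correspond to elements fixed by \<open>\<epsilon>\<close> in
  modules killed by \<open>e0\<close>. A preimage of such an element becomes fixed after
  multiplication by \<open>\<epsilon>\<close>, so \<open>P\<close> lifts against all surjections of
  such modules, whatever their kernels.\<close>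

lemma ex_P:
  obtains P n where "P \<in> kmod L e0" "n \<in> carrier P" "\<epsilon> \<odot>\<^bsub>P\<^esub> n = n" "n \<noteq> \<zero>\<^bsub>P\<^esub>"
    "\<And>x. x \<in> carrier P \<Longrightarrow> \<exists>b\<in>carrier L. x = b \<odot>\<^bsub>P\<^esub> n"
    "\<And>\<Q>. lifts L \<Q> (kmod L e0) P"
proof -
  interpret RM: left_module L "regular_module L" by (rule regular_module)
  interpret I0: ideal I0 L by (rule ideal_I0)
  \<comment> \<open>The kernel of the map from \<open>L\<close> to \<open>L/I0\<close> that
    multiplies by \<open>\<epsilon>\<close> on the right; \<open>P\<close> is a copy of its
    image.\<close>
  let ?J = "{b \<in> carrier L. b \<otimes>\<^bsub>L\<^esub> \<epsilon> \<in> I0}"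
  have "lin L (regular_module L) (regular_module L) (\<lambda>b. b \<otimes>\<^bsub>L\<^esub> \<epsilon>)"
    using \<epsilon>L by (intro linI) (auto simp: R.l_distr R.m_assoc)
  then have J: "submodule ?J L (regular_module L)"
    using vimage_submodule[OF regular_module regular_module _ ideal_regular_submodule[OF ideal_I0]] by simp
  obtain P :: "('k, 'a) fdmod" and q where P: "P \<in> fgmod L" "lin L (regular_module L) P q"
    "q ` carrier (regular_module L) = carrier P" "lker (regular_module L) P q = ?J"
    by (rule ex_quotient[OF regular_fgm J])
  interpret P: left_module L P using P(1) by (simp add: fgmod_def)
  note lP = P.left_module_axioms
  define n where "n = q \<one>\<^bsub>L\<^esub>"
  have nP: "n \<in> carrier P" using lin_closed[OF P(2)] by (simp add: n_def)
  have qn: "q b = b \<odot>\<^bsub>P\<^esub> n" if "b \<in> carrier L" for b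
    using lin_smult[OF P(2) that, of "\<one>\<^bsub>L\<^esub>"] that by (simp add: n_def)
  have gP: "\<exists>b\<in>carrier L. x = b \<odot>\<^bsub>P\<^esub> n" if "x \<in> carrier P" for x
    using that qn unfolding P(3)[symmetric] by auto
  have qz: "q b = \<zero>\<^bsub>P\<^esub> \<longleftrightarrow> b \<otimes>\<^bsub>L\<^esub> \<epsilon> \<in> I0" if "b \<in> carrier L" for b
    using P(4) that by auto
  have \<epsilon>n: "\<epsilon> \<odot>\<^bsub>P\<^esub> n = n"
  proof -
    have "(\<epsilon> \<ominus>\<^bsub>L\<^esub> \<one>\<^bsub>L\<^esub>) \<otimes>\<^bsub>L\<^esub> \<epsilon> = \<zero>\<^bsub>L\<^esub>" using \<epsilon>L by (simp add: R.minus_eq R.l_distr R.l_minus \<epsilon>\<epsilon> R.r_neg)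
    then have "q (\<epsilon> \<ominus>\<^bsub>L\<^esub> \<one>\<^bsub>L\<^esub>) = \<zero>\<^bsub>P\<^esub>" using qz \<epsilon>L by simp
    moreover have "q (\<epsilon> \<ominus>\<^bsub>L\<^esub> \<one>\<^bsub>L\<^esub>) = \<epsilon> \<odot>\<^bsub>P\<^esub> n \<ominus>\<^bsub>P\<^esub> n" using qn nP \<epsilon>L by (simp add: P.smult_l_diff)
    ultimately show ?thesis using nP \<epsilon>L by simp
  qed
  have n0: "n \<noteq> \<zero>\<^bsub>P\<^esub>" using qz[of "\<one>\<^bsub>L\<^esub>"] \<epsilon>L \<epsilon>I0 by (simp add: n_def)
  have "e0 \<odot>\<^bsub>P\<^esub> x = \<zero>\<^bsub>P\<^esub>" if x: "x \<in> carrier P" for x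
  proof -
    obtain b where b: "b \<in> carrier L" "x = b \<odot>\<^bsub>P\<^esub> n" using gP[OF x] by blast
    have "(e0 \<otimes>\<^bsub>L\<^esub> b) \<otimes>\<^bsub>L\<^esub> \<epsilon> \<in> I0"
      using b e0L \<epsilon>L R.genideal_self'[OF e0L] by (intro I0.I_r_closed) auto
    then show ?thesis using qz[of "e0 \<otimes>\<^bsub>L\<^esub> b"] qn b e0L nP by (simp add: P.smult_assoc1)
  qed
  then have Pk: "P \<in> kmod L e0" using P(1) by (simp add: kmod_def)
  have "lifts L \<Q> (kmod L e0) P" for \<Q>
  proof (rule liftsI)
    fix E Z p u
    assume E: "E \<in> kmod L e0" and Z: "Z \<in> kmod L e0" and p: "lin L E Z p" "p ` carrier E = carrier Z" and u: "lin L P Z u"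
    interpret E: left_module L E by (rule kmod_module[OF E])
    interpret Z: left_module L Z by (rule kmod_module[OF Z])
    note lE = E.left_module_axioms and lZ = Z.left_module_axioms
    have "u n \<in> carrier Z" using lin_closed[OF u nP] .
    then obtain x0 where x0: "x0 \<in> carrier E" "u n = p x0" unfolding p(2)[symmetric] by blast
    \<comment> \<open>An arbitrary preimage of \<open>u n\<close> is made fixed by
      \<open>\<epsilon>\<close>; it still maps to \<open>u n\<close> because \<open>n\<close> is
      fixed.\<close>
    define x where "x = \<epsilon> \<odot>\<^bsub>E\<^esub> x0"
    have x: "x \<in> carrier E" "\<epsilon> \<odot>\<^bsub>E\<^esub> x = x" using x0 \<epsilon>L by (simp_all add: x_def E.smult_assoc1[symmetric] \<epsilon>\<epsilon>)
    have px: "p x = u n" using lin_smult[OF p(1) \<epsilon>L x0(1)] lin_smult[OF u \<epsilon>L nP] x0(2) \<epsilon>n by (simp add: x_def)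
    have l0: "lin L (regular_module L) E (\<lambda>b. b \<odot>\<^bsub>E\<^esub> x)"
      using x by (intro linI) (auto simp: E.smult_l_distr E.smult_assoc1)
    have kz: "b \<odot>\<^bsub>E\<^esub> x = \<zero>\<^bsub>E\<^esub>" if b: "b \<in> carrier L" "q b = \<zero>\<^bsub>P\<^esub>" for b
    proof -
      have "b \<otimes>\<^bsub>L\<^esub> \<epsilon> \<in> I0" using qz b by blast
      then have "(b \<otimes>\<^bsub>L\<^esub> \<epsilon>) \<odot>\<^bsub>E\<^esub> x = \<zero>\<^bsub>E\<^esub>" using kill_ideal[OF lE e0L _ _ x(1)] E by (simp add: kmod_def)
      then show ?thesis using x b \<epsilon>L by (simp add: E.smult_assoc1)
    qed
    have "\<exists>s. lin L P E s \<and> (\<forall>b\<in>carrier (regular_module L). s (q b) = b \<odot>\<^bsub>E\<^esub> x)"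
      by (rule lin_factor[OF regular_module lP lE P(2) l0 P(3)]) (use kz in simp)
    then obtain s where s: "lin L P E s" "\<forall>b\<in>carrier L. s (q b) = b \<odot>\<^bsub>E\<^esub> x" by auto
    have "p (s y) = u y" if yP: "y \<in> carrier P" for y
    proof -
      obtain b where b: "b \<in> carrier L" "y = b \<odot>\<^bsub>P\<^esub> n" using gP[OF yP] by blast
      have "p (s y) = p (b \<odot>\<^bsub>E\<^esub> x)" using s(2) b qn by simp
      also have "\<dots> = b \<odot>\<^bsub>Z\<^esub> u n" using lin_smult[OF p(1) b(1) x(1)] px by simp
      also have "\<dots> = u y" using lin_smult[OF u b(1) nP] b by simp
      finally show ?thesis .
    qed
    then show "\<exists>s. lin L P E s \<and> (\<forall>x\<in>carrier P. p (s x) = u x)" using s(1) by blast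
  qed
  then show ?thesis using that[OF Pk nP \<epsilon>n n0 gP] by blast
qed

text \<open>\<open>P\<close> is the projective \<open>L/\<langle>e0\<rangle>\<close>-module at the new vertex, with generator \<open>n\<close>. A stage with \<open>f x\<close> in the trace of \<open>T\<close>
  for all \<open>x \<in> old P\<close> has \<open>tors N\<close>.\<close>

definition stage where
  "stage P n N f \<longleftrightarrow> N \<in> kmod L e0 \<and> lifts L tors (kmod L e0) N \<and> lin L P N f \<and> f n \<noteq> \<zero>\<^bsub>N\<^esub> \<and>
     (\<forall>y\<in>carrier N. \<exists>x\<in>carrier P. \<exists>w\<in>trace L T N. y = f x \<oplus>\<^bsub>N\<^esub> w)"

text \<open>The pushout of \<open>N \<leftarrow> L \<rightarrow> S\<close> along \<open>1 \<mapsto> f x\<close> and \<open>1 \<mapsto> t\<close>, where \<open>t\<close> is a universal element,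
  moves the image of \<open>x\<close> into the trace of \<open>T\<close>.\<close>

lemma stage_step:
  assumes st: "stage P n N f" and P: "P \<in> kmod L e0" and n: "n \<in> carrier P" "\<epsilon> \<odot>\<^bsub>P\<^esub> n = n" and x: "x \<in> old P"
  shows "\<exists>N' f'. stage P n N' f' \<and> f' x \<in> trace L T N' \<and> (\<forall>y\<in>carrier P. f y \<in> trace L T N \<longrightarrow> f' y \<in> trace L T N')"
proof -
  have N: "N \<in> kmod L e0" "lifts L tors (kmod L e0) N" and f: "lin L P N f" "f n \<noteq> \<zero>\<^bsub>N\<^esub>"
    and dec: "\<forall>y\<in>carrier N. \<exists>x\<in>carrier P. \<exists>w\<in>trace L T N. y = f x \<oplus>\<^bsub>N\<^esub> w" using st by (auto simp: stage_def)
  obtain S t where S: "S \<in> kmod L e'" "lifts L tors (kmod L e0) S" "gen L T S" "t \<in> carrier S"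
    "\<And>s. s \<in> carrier T \<Longrightarrow> \<exists>h. lin L S T h \<and> h t = s" using ex_universal by blast
  interpret P: left_module L P by (rule kmod_module[OF P])
  interpret N: left_module L N by (rule kmod_module[OF N(1)])
  interpret S: left_module L S by (rule kmod_module[OF S(1)])
  note lP = P.left_module_axioms and lN = N.left_module_axioms and lS = S.left_module_axioms
  have fg: "fgm L N" "fgm L S" using N(1) S(1) by (auto simp: kmod_def fgmod_iff)
  obtain D :: "('k, 'a) fdmod" and i1 i2 p1 p2 where D: "D \<in> fgmod L" "biproduct L D N S i1 i2 p1 p2"
    by (rule ex_biproduct[OF fg])
  interpret D: left_module L D using D(1) by (simp add: fgmod_def)
  note lD = D.left_module_axioms
  note b = biproductD[OF D(2)]
  note bc = b(1-4)[THEN lin_closed]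
  have S0: "S \<in> kmod L e0" "\<And>s. s \<in> carrier S \<Longrightarrow> \<epsilon> \<odot>\<^bsub>S\<^esub> s = \<zero>\<^bsub>S\<^esub>" using S(1) kmod_e'_iff by blast+
  have Dk: "D \<in> kmod L e0" by (rule biproduct_kmod[OF N(1) S0(1) D e0L])
  note fc = lin_closed[OF f(1)]
  have xP: "x \<in> carrier P" "\<epsilon> \<odot>\<^bsub>P\<^esub> x = \<zero>\<^bsub>P\<^esub>" using x by (auto simp: old_def)
  \<comment> \<open>The relation that glues \<open>f x\<close> to \<open>t\<close>. It is killed by
    \<open>\<epsilon>\<close>, since \<open>x\<close> is old and \<open>S\<close> is killed by
    \<open>\<epsilon>\<close>.\<close>
  define z0 where "z0 = i1 (f x) \<ominus>\<^bsub>D\<^esub> i2 t"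
  have z0: "z0 \<in> carrier D" using bc fc xP S(4) by (simp add: z0_def)
  have \<epsilon>z0: "\<epsilon> \<odot>\<^bsub>D\<^esub> z0 = \<zero>\<^bsub>D\<^esub>"
  proof -
    have "\<epsilon> \<odot>\<^bsub>D\<^esub> z0 = i1 (f (\<epsilon> \<odot>\<^bsub>P\<^esub> x)) \<ominus>\<^bsub>D\<^esub> i2 (\<epsilon> \<odot>\<^bsub>S\<^esub> t)"
      using bc fc xP(1) S(4) \<epsilon>L by (simp add: z0_def D.smult_r_diff lin_smult[OF b(1)] lin_smult[OF b(2)] lin_smult[OF f(1)])
    also have "\<dots> = \<zero>\<^bsub>D\<^esub>"
      using xP S0(2)[OF S(4)] lin_zero[OF lP lN f(1)] lin_zero[OF lN lD b(1)] lin_zero[OF lS lD b(2)] by simp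
    finally show ?thesis .
  qed
  define W where "W = (\<lambda>a. a \<odot>\<^bsub>D\<^esub> z0) ` carrier L"
  have "lin L (regular_module L) D (\<lambda>a. a \<odot>\<^bsub>D\<^esub> z0)"
    using z0 by (intro linI) (auto simp: D.smult_l_distr D.smult_assoc1)
  then have W: "submodule W L D"
    unfolding W_def using image_submodule[OF regular_module lD _ left_module.carrier_submodule[OF regular_module]] by simp
  have fgD: "fgm L D" using D(1) by (simp add: fgmod_iff)
  obtain N' :: "('k, 'a) fdmod" and r where N': "N' \<in> fgmod L" "lin L D N' r" "r ` carrier D = carrier N'" "lker D N' r = W"
    by (rule ex_quotient[OF fgD W])
  interpret N': left_module L N' using N'(1) by (simp add: fgmod_def)
  note lN' = N'.left_module_axioms
  note rc = lin_closed[OF N'(2)]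
  have rz0: "r z0 = \<zero>\<^bsub>N'\<^esub>" 
  proof -
    have "\<one>\<^bsub>L\<^esub> \<odot>\<^bsub>D\<^esub> z0 \<in> W" unfolding W_def by (rule imageI) simp
    then have "z0 \<in> lker D N' r" using z0 N'(4) by simp
    then show ?thesis by simp
  qed
  have "e0 \<odot>\<^bsub>N'\<^esub> y = \<zero>\<^bsub>N'\<^esub>" if "y \<in> carrier N'" for y
  proof -
    obtain z where z: "z \<in> carrier D" "y = r z" using \<open>y \<in> carrier N'\<close> unfolding N'(3)[symmetric] by blast
    have "e0 \<odot>\<^bsub>N'\<^esub> y = r (e0 \<odot>\<^bsub>D\<^esub> z)" using lin_smult[OF N'(2) e0L z(1)] z(2) by simp
    also have "e0 \<odot>\<^bsub>D\<^esub> z = \<zero>\<^bsub>D\<^esub>" using Dk z(1) by (simp add: kmod_def)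
    finally show ?thesis using lin_zero[OF lD lN' N'(2)] by simp
  qed
  then have N'k: "N' \<in> kmod L e0" using N'(1) by (simp add: kmod_def)
  define f' where "f' y = r (i1 (f y))" for y
  have f': "lin L P N' f'" unfolding f'_def by (rule lin_comp[OF lin_comp[OF f(1) b(1)] N'(2)])
  \<comment> \<open>\<open>\<epsilon>\<close> kills \<open>W\<close>, because
    \<open>\<epsilon> a z0 = \<epsilon> a \<epsilon> z0\<close>. The element \<open>f n\<close> is
    fixed by \<open>\<epsilon>\<close> and nonzero, so it does not become a relation.\<close>
  have f'n: "f' n \<noteq> \<zero>\<^bsub>N'\<^esub>"
  proof
    assume "f' n = \<zero>\<^bsub>N'\<^esub>"
    then have "i1 (f n) \<in> W" using N'(4) bc fc n(1) by (auto simp: f'_def)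
    then obtain a where a: "a \<in> carrier L" "i1 (f n) = a \<odot>\<^bsub>D\<^esub> z0" by (auto simp: W_def)
    have "i1 (f n) = \<epsilon> \<odot>\<^bsub>D\<^esub> i1 (f n)"
      using lin_smult[OF b(1) \<epsilon>L, of "f n"] lin_smult[OF f(1) \<epsilon>L n(1)] n fc by simp
    also have "\<dots> = (\<epsilon> \<otimes>\<^bsub>L\<^esub> a \<otimes>\<^bsub>L\<^esub> \<epsilon>) \<odot>\<^bsub>D\<^esub> z0" unfolding a(2) using D.smult_assoc1[OF \<epsilon>L a(1) z0] \<epsilon>b[OF a(1)] by simp
    also have "\<dots> = \<zero>\<^bsub>D\<^esub>" using a(1) \<epsilon>L z0 \<epsilon>z0 by (simp add: D.smult_assoc1)
    finally have "p1 (i1 (f n)) = p1 \<zero>\<^bsub>D\<^esub>" by simp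
    then show False using b(5)[OF fc[OF n(1)]] lin_zero[OF lD lN b(3)] f(2) by simp
  qed
  have tr1: "r (i1 w) \<in> trace L T N'" if "w \<in> trace L T N" for w
    by (rule trace_map[OF lN lN' lin_comp[OF b(1) N'(2)] that])
  have tr2: "r (i2 s) \<in> trace L T N'" if "s \<in> carrier S" for s
    by (rule trace_map[OF lS lN' lin_comp[OF b(2) N'(2)]]) (use S(3) that in \<open>auto simp: gen_def\<close>)
  have "r (i1 (f x)) = r (i2 t)"
  proof -
    have "r (i1 (f x)) \<ominus>\<^bsub>N'\<^esub> r (i2 t) = \<zero>\<^bsub>N'\<^esub>"
      using rz0 lin_minus[OF lD lN' N'(2)] bc fc xP(1) S(4) by (simp add: z0_def)
    then show ?thesis using bc fc xP(1) S(4) rc by simp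
  qed
  then have f'x: "f' x \<in> trace L T N'" using tr2[OF S(4)] by (simp add: f'_def)
  have dec': "\<exists>x\<in>carrier P. \<exists>w\<in>trace L T N'. y = f' x \<oplus>\<^bsub>N'\<^esub> w" if "y \<in> carrier N'" for y
  proof -
    obtain z where z: "z \<in> carrier D" "y = r z" using \<open>y \<in> carrier N'\<close> unfolding N'(3)[symmetric] by blast
    obtain x1 w where xw: "x1 \<in> carrier P" "w \<in> trace L T N" "p1 z = f x1 \<oplus>\<^bsub>N\<^esub> w" using dec bc(3)[OF z(1)] by blast
    have wN: "w \<in> carrier N" by (rule trace_closed[OF lN xw(2)])
    have "y = r (i1 (p1 z)) \<oplus>\<^bsub>N'\<^esub> r (i2 (p2 z))"
      using z b(9)[OF z(1)] lin_add[OF N'(2) bc(1)[OF bc(3)[OF z(1)]] bc(2)[OF bc(4)[OF z(1)]]] by simp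
    also have "r (i1 (p1 z)) = f' x1 \<oplus>\<^bsub>N'\<^esub> r (i1 w)"
      unfolding xw(3) f'_def using xw(1) wN fc bc by (simp add: lin_add[OF b(1)] lin_add[OF N'(2)])
    finally have "y = f' x1 \<oplus>\<^bsub>N'\<^esub> (r (i1 w) \<oplus>\<^bsub>N'\<^esub> r (i2 (p2 z)))"
      using xw(1) wN bc rc z(1) lin_closed[OF f'] by (simp add: N'.M.a_assoc)
    moreover have "r (i1 w) \<oplus>\<^bsub>N'\<^esub> r (i2 (p2 z)) \<in> trace L T N'"
      by (rule N'.sub_add[OF trace_submodule[OF T(3) lN'] tr1[OF xw(2)] tr2[OF bc(4)[OF z(1)]]])
    ultimately show ?thesis using xw(1) by blast
  qed
  have "lifts L tors (kmod L e0) N'"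
  proof (rule liftsI)
    fix E Z p u
    assume E: "E \<in> kmod L e0" and Z: "Z \<in> kmod L e0" and p: "lin L E Z p" "p ` carrier E = carrier Z"
      and Q: "tors (E\<lparr>carrier := lker E Z p\<rparr>)" and u: "lin L N' Z u"
    interpret E: left_module L E by (rule kmod_module[OF E])
    interpret Z: left_module L Z by (rule kmod_module[OF Z])
    note lE = E.left_module_axioms and lZ = Z.left_module_axioms
    let ?Q = "E\<lparr>carrier := lker E Z p\<rparr>"
    have ker: "submodule (lker E Z p) L E" by (rule ker_submodule[OF lE lZ p(1)])
    have lQ: "left_module L ?Q" by (rule E.sub_module[OF ker])
    obtain s1 where s1: "lin L N E s1" "\<forall>y\<in>carrier N. p (s1 y) = u (r (i1 y))"
      using liftsD[OF N(2) E Z p Q lin_comp[OF lin_comp[OF b(1) N'(2)] u]] by blast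
    obtain s2 where s2: "lin L S E s2" "\<forall>y\<in>carrier S. p (s2 y) = u (r (i2 y))"
      using liftsD[OF S(2) E Z p Q lin_comp[OF lin_comp[OF b(2) N'(2)] u]] by blast
    \<comment> \<open>The lifts on the two summands may disagree on the glued elements. Their
      difference is old and lies in the kernel of \<open>p\<close>, hence in the trace of
      \<open>T\<close>, so it equals \<open>h t\<close> for a map \<open>h\<close> from
      \<open>S\<close> into the kernel. Adding \<open>h\<close> to the second lift repairs the
      disagreement without changing the composite with \<open>p\<close>.\<close>
    define \<delta> where "\<delta> = s1 (f x) \<ominus>\<^bsub>E\<^esub> s2 t"
    have s12: "s1 (f x) \<in> carrier E" "s2 t \<in> carrier E" using lin_closed[OF s1(1)] lin_closed[OF s2(1)] fc xP(1) S(4) by auto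
    have "p \<delta> = u (r (i1 (f x))) \<ominus>\<^bsub>Z\<^esub> u (r (i2 t))"
      using lin_minus[OF lE lZ p(1) s12] s1(2) s2(2) fc xP(1) S(4) by (simp add: \<delta>_def)
    also have "\<dots> = \<zero>\<^bsub>Z\<^esub>" using \<open>r (i1 (f x)) = r (i2 t)\<close> lin_closed[OF u] rc bc S(4) by simp
    finally have "\<delta> \<in> lker E Z p" using s12 by (simp add: \<delta>_def)
    moreover have "\<epsilon> \<odot>\<^bsub>E\<^esub> \<delta> = \<zero>\<^bsub>E\<^esub>"
    proof -
      have "f x \<in> old N" by (rule old_map[OF f(1) lP lN x])
      then have "s1 (f x) \<in> old E" by (rule old_map[OF s1(1) lN lE])
      moreover have "t \<in> old S" using S(4) S0(2) by (simp add: old_def)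
      then have "s2 t \<in> old E" by (rule old_map[OF s2(1) lS lE])
      ultimately have "\<delta> \<in> old E" unfolding \<delta>_def by (rule E.sub_diff[OF old_submodule[OF lE]])
      then show ?thesis by (simp add: old_def)
    qed
    ultimately have "\<delta> \<in> trace L T ?Q" using Q by (auto simp: tors_def old_def)
    then obtain h where h: "lin L S ?Q h" "h t = \<delta>" using universal_trace[OF lQ S(5)] by blast
    have hE: "lin L S E h" using lin_decorestrict[OF h(1) E.sub_subset[OF ker]] .
    have ph: "p (h y) = \<zero>\<^bsub>Z\<^esub>" if "y \<in> carrier S" for y using lin_closed[OF h(1) that] by simp
    define s where "s z = s1 (p1 z) \<oplus>\<^bsub>E\<^esub> (s2 (p2 z) \<oplus>\<^bsub>E\<^esub> h (p2 z))" for z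
    have s: "lin L D E s"
      unfolding s_def
      by (rule lin_sum[OF lE lin_comp[OF b(3) s1(1)] lin_sum[OF lE lin_comp[OF b(4) s2(1)] lin_comp[OF b(4) hE]]])
    have p12: "p1 z0 = f x" "p2 z0 = \<ominus>\<^bsub>S\<^esub> t"
      unfolding z0_def using lin_minus[OF lD lN b(3)] lin_minus[OF lD lS b(4)] bc b(5-8) fc xP(1) S(4)
      by (simp_all add: S.M.minus_eq)
    have "s z0 = s1 (f x) \<oplus>\<^bsub>E\<^esub> (\<ominus>\<^bsub>E\<^esub> s2 t \<oplus>\<^bsub>E\<^esub> \<ominus>\<^bsub>E\<^esub> h t)"
      unfolding s_def p12 using lin_neg[OF lS lE s2(1) S(4)] lin_neg[OF lS lE hE S(4)] by simp
    also have "\<dots> = \<delta> \<ominus>\<^bsub>E\<^esub> h t"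
      using s12 lin_closed[OF hE S(4)] by (simp add: \<delta>_def E.M.minus_eq E.M.a_assoc)
    also have "\<dots> = \<zero>\<^bsub>E\<^esub>" using h(2) s12 by (simp add: \<delta>_def)
    finally have sz0: "s z0 = \<zero>\<^bsub>E\<^esub>" .
    have "\<exists>g. lin L N' E g \<and> (\<forall>z\<in>carrier D. g (r z) = s z)"
    proof (rule lin_factor[OF lD lN' lE N'(2) s N'(3)])
      fix z assume "z \<in> carrier D" "r z = \<zero>\<^bsub>N'\<^esub>"
      then have "z \<in> W" using N'(4) by auto
      then obtain a where "a \<in> carrier L" "z = a \<odot>\<^bsub>D\<^esub> z0" by (auto simp: W_def)
      then show "s z = \<zero>\<^bsub>E\<^esub>" using lin_smult[OF s _ z0] sz0 by simp
    qed
    then obtain g where g: "lin L N' E g" "\<forall>z\<in>carrier D. g (r z) = s z" by blast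
    have "p (g y) = u y" if "y \<in> carrier N'" for y
    proof -
      obtain z where z: "z \<in> carrier D" "y = r z" using \<open>y \<in> carrier N'\<close> unfolding N'(3)[symmetric] by blast
      note pz = bc(3)[OF z(1)] bc(4)[OF z(1)]
      note sz = lin_closed[OF s1(1) pz(1)] lin_closed[OF s2(1) pz(2)] lin_closed[OF hE pz(2)]
      have "p (g y) = p (s1 (p1 z)) \<oplus>\<^bsub>Z\<^esub> (p (s2 (p2 z)) \<oplus>\<^bsub>Z\<^esub> p (h (p2 z)))"
        using g(2) z sz lin_add[OF p(1)] by (simp add: s_def)
      also have "\<dots> = u (r (i1 (p1 z))) \<oplus>\<^bsub>Z\<^esub> u (r (i2 (p2 z)))"
        using s1(2) s2(2) ph pz lin_closed[OF u] rc bc by simp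
      also have "\<dots> = u (r (i1 (p1 z) \<oplus>\<^bsub>D\<^esub> i2 (p2 z)))"
        using pz rc bc by (simp add: lin_add[OF u] lin_add[OF N'(2)])
      finally show ?thesis using b(9)[OF z(1)] z(2) by simp
    qed
    then show "\<exists>s. lin L N' E s \<and> (\<forall>x\<in>carrier N'. p (s x) = u x)" using g(1) by blast
  qed
  then have "stage P n N' f'" unfolding stage_def using N'k f' f'n dec' by blast
  moreover have "\<forall>y\<in>carrier P. f y \<in> trace L T N \<longrightarrow> f' y \<in> trace L T N'" using tr1 by (simp add: f'_def)
  ultimately show ?thesis using f'x by blast
qed

end

section \<open>The Ext-projective object and its summand at the new vertex\<close>

context new_vertex begin

text \<open>One pushout for each member of a finite generating set of \<open>old P\<close> suffices,
  because the trace is a submodule and each step preserves what has been achieved.\<close>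

lemma ex_stage:
  obtains N where "N \<in> kmod L e0" "lifts L tors (kmod L e0) N" "tors N" "\<exists>y\<in>carrier N. \<epsilon> \<odot>\<^bsub>N\<^esub> y \<noteq> \<zero>\<^bsub>N\<^esub>"
proof -
  obtain P n where P: "P \<in> kmod L e0" and n: "n \<in> carrier P" "\<epsilon> \<odot>\<^bsub>P\<^esub> n = n" "n \<noteq> \<zero>\<^bsub>P\<^esub>"
    and gP: "\<And>x. x \<in> carrier P \<Longrightarrow> \<exists>b\<in>carrier L. x = b \<odot>\<^bsub>P\<^esub> n" and liP: "\<And>\<Q>. lifts L \<Q> (kmod L e0) P"
    using ex_P by blast
  interpret P: left_module L P by (rule kmod_module[OF P])
  note lP = P.left_module_axioms
  have oP: "submodule (old P) L P" by (rule old_submodule[OF lP])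
  let ?O = "P\<lparr>carrier := old P\<rparr>"
  interpret O: left_module L ?O by (rule P.sub_module[OF oP])
  have "fgm L ?O" using fgm_sub[OF _ oP] P by (simp add: kmod_def fgmod_iff)
  then obtain G where G: "finite G" "G \<subseteq> old P" "mspan L ?O G = old P"
    using O.fin_gen_iff by (auto simp: fgm_def)
  have "\<exists>N f. stage P n N f \<and> (\<forall>x\<in>G. f x \<in> trace L T N)"
    using G(1,2)
  proof (induction G rule: finite_induct)
    case empty
    have "stage P n P (\<lambda>x. x)"
      unfolding stage_def
    proof (intro conjI P liP lin_id n(3) ballI)
      fix y assume "y \<in> carrier P"
      then show "\<exists>x\<in>carrier P. \<exists>w\<in>trace L T P. y = x \<oplus>\<^bsub>P\<^esub> w"
        by (intro bexI[of _ y] bexI[of _ "\<zero>\<^bsub>P\<^esub>"]) (auto intro: trace.zero)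
    qed
    then show ?case by blast
  next
    case (insert x G)
    then obtain N f where N: "stage P n N f" "\<forall>x\<in>G. f x \<in> trace L T N" by blast
    have x: "x \<in> old P" using insert by simp
    obtain N' f' where N': "stage P n N' f'" "f' x \<in> trace L T N'" "\<forall>y\<in>carrier P. f y \<in> trace L T N \<longrightarrow> f' y \<in> trace L T N'"
      using stage_step[OF N(1) P n(1,2) x] by blast
    have "G \<subseteq> carrier P" using insert P.sub_subset[OF oP] by blast
    then have "\<forall>x\<in>insert x G. f' x \<in> trace L T N'" using N' N(2) by blast
    then show ?case using N'(1) by blast
  qed
  then obtain N f where st: "stage P n N f" and fG: "\<forall>x\<in>G. f x \<in> trace L T N" by blast
  have N: "N \<in> kmod L e0" "lifts L tors (kmod L e0) N" and f: "lin L P N f" "f n \<noteq> \<zero>\<^bsub>N\<^esub>"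
    and dec: "\<forall>y\<in>carrier N. \<exists>x\<in>carrier P. \<exists>w\<in>trace L T N. y = f x \<oplus>\<^bsub>N\<^esub> w" using st by (auto simp: stage_def)
  interpret N: left_module L N by (rule kmod_module[OF N(1)])
  note lN = N.left_module_axioms
  have tr: "submodule (trace L T N) L N" by (rule trace_submodule[OF T(3) lN])
  have fold: "f x \<in> trace L T N" if "x \<in> old P" for x
  proof -
    have fO: "lin L ?O N f" by (rule lin_restrict[OF f(1) P.sub_subset[OF oP]])
    have "mspan L ?O G \<subseteq> {x \<in> carrier ?O. f x \<in> trace L T N}"
      by (rule O.mspan_least[OF vimage_submodule[OF O.left_module_axioms lN fO tr]]) (use G(2) fG in auto)
    then show ?thesis using G(3) that by auto
  qed
  have "tors N"
    unfolding tors_def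
  proof
    fix y assume "y \<in> old N"
    then have y: "y \<in> carrier N" "\<epsilon> \<odot>\<^bsub>N\<^esub> y = \<zero>\<^bsub>N\<^esub>" by (auto simp: old_def)
    obtain x w where x: "x \<in> carrier P" and w: "w \<in> trace L T N" and yy: "y = f x \<oplus>\<^bsub>N\<^esub> w" using dec y(1) by blast
    note fx = lin_closed[OF f(1) x]
    have wN: "w \<in> carrier N" "\<epsilon> \<odot>\<^bsub>N\<^esub> w = \<zero>\<^bsub>N\<^esub>" using trace_old[OF lN w] by (auto simp: old_def)
    have "\<epsilon> \<odot>\<^bsub>N\<^esub> f x = \<zero>\<^bsub>N\<^esub>"
      using y(2) N.smult_r_distr[OF \<epsilon>L fx wN(1)] wN(2) fx \<epsilon>L by (simp add: yy)
    then have f0: "f (\<epsilon> \<odot>\<^bsub>P\<^esub> x) = \<zero>\<^bsub>N\<^esub>" using lin_smult[OF f(1) \<epsilon>L x] by simp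
    obtain b where b: "b \<in> carrier L" "x = b \<odot>\<^bsub>P\<^esub> n" using gP[OF x] by blast
    \<comment> \<open>\<open>\<epsilon> x\<close> is a scalar multiple \<open>c n\<close> of the
      generator, and its image \<open>c (f n)\<close> vanishes. As \<open>f n\<close> is nonzero,
      \<open>c\<close> is zero and \<open>x\<close> is old.\<close>
    obtain c where c: "c \<in> carrier K" "\<epsilon> \<otimes>\<^bsub>L\<^esub> b \<otimes>\<^bsub>L\<^esub> \<epsilon> = c \<odot>\<^bsub>L\<^esub> \<epsilon>" using \<epsilon>b\<epsilon>[OF b(1)] by blast
    have "\<epsilon> \<odot>\<^bsub>P\<^esub> x = (\<epsilon> \<otimes>\<^bsub>L\<^esub> b \<otimes>\<^bsub>L\<^esub> \<epsilon>) \<odot>\<^bsub>P\<^esub> n"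
      using b n \<epsilon>L P.smult_assoc1[of "\<epsilon> \<otimes>\<^bsub>L\<^esub> b" \<epsilon> n] P.smult_assoc1[of \<epsilon> b n] by simp
    also have "\<dots> = sc c \<odot>\<^bsub>P\<^esub> n"
      unfolding c(2) using P.smult_assoc1[of "sc c" \<epsilon> n] c(1) \<epsilon>L n by simp
    finally have \<epsilon>x: "\<epsilon> \<odot>\<^bsub>P\<^esub> x = sc c \<odot>\<^bsub>P\<^esub> n" .
    have fn: "f n \<in> carrier N" by (rule lin_closed[OF f(1) n(1)])
    have "sc c \<odot>\<^bsub>N\<^esub> f n = \<zero>\<^bsub>N\<^esub>" using f0 lin_smult[OF f(1) sc_closed[OF c(1)] n(1)] by (simp add: \<epsilon>x)
    have "c = \<zero>\<^bsub>K\<^esub>"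
    proof (rule ccontr)
      assume "c \<noteq> \<zero>\<^bsub>K\<^esub>"
      then have i: "inv\<^bsub>K\<^esub> c \<in> carrier K" "inv\<^bsub>K\<^esub> c \<otimes>\<^bsub>K\<^esub> c = \<one>\<^bsub>K\<^esub>" using c(1) K.field_Units by auto
      have "f n = sc (inv\<^bsub>K\<^esub> c \<otimes>\<^bsub>K\<^esub> c) \<odot>\<^bsub>N\<^esub> f n" using i fn by simp
      also have "\<dots> = sc (inv\<^bsub>K\<^esub> c) \<odot>\<^bsub>N\<^esub> (sc c \<odot>\<^bsub>N\<^esub> f n)"
        using i(1) c(1) fn N.smult_assoc1[of "sc (inv\<^bsub>K\<^esub> c)" "sc c" "f n"] KL.smult_assoc1[of "inv\<^bsub>K\<^esub> c" c "\<one>\<^bsub>L\<^esub>"]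
        by (simp del: mult_sc add: i(2))
      also have "\<dots> = \<zero>\<^bsub>N\<^esub>" using \<open>sc c \<odot>\<^bsub>N\<^esub> f n = \<zero>\<^bsub>N\<^esub>\<close> i(1) by simp
      finally show False using f(2) by simp
    qed
    then have "x \<in> old P" using \<epsilon>x n x by (simp add: old_def)
    then show "y \<in> trace L T N" unfolding yy by (intro N.sub_add[OF tr] fold w)
  qed
  moreover have "\<epsilon> \<odot>\<^bsub>N\<^esub> f n \<noteq> \<zero>\<^bsub>N\<^esub>" using lin_smult[OF f(1) \<epsilon>L n(1)] n(2) f(2) by simp
  ultimately show ?thesis using that N lin_closed[OF f(1) n(1)] by blast
qed

text \<open>A direct summand minimal among those not killed by \<open>\<epsilon>\<close> is
  indecomposable, because one part of any splitting is again not killed. The lifting property and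
  \<open>tors\<close> pass to summands along the projection.\<close>

lemma ex_new_summand:
  obtains N where "N \<in> kmod L e0" "lifts L tors (kmod L e0) N" "tors N" "\<exists>y\<in>carrier N. \<epsilon> \<odot>\<^bsub>N\<^esub> y \<noteq> \<zero>\<^bsub>N\<^esub>"
    "indecomposable L N"
proof -
  obtain N where N: "N \<in> kmod L e0" "lifts L tors (kmod L e0) N" "tors N" "\<exists>y\<in>carrier N. \<epsilon> \<odot>\<^bsub>N\<^esub> y \<noteq> \<zero>\<^bsub>N\<^esub>"
    using ex_stage by blast
  interpret N: left_module L N by (rule kmod_module[OF N(1)])
  note lN = N.left_module_axioms
  have fgN: "fgm L N" using N(1) by (simp add: kmod_def fgmod_iff)
  let ?Q = "\<lambda>Y. (\<exists>Z. complementary L N Y Z) \<and> (\<exists>y\<in>Y. \<epsilon> \<odot>\<^bsub>N\<^esub> y \<noteq> \<zero>\<^bsub>N\<^esub>)"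
  have "complementary L N (carrier N) {\<zero>\<^bsub>N\<^esub>}"
    using N.carrier_submodule N.zero_submodule by (auto simp: complementary_iff[OF lN])
  then have "\<exists>Y. submodule Y L N \<and> ?Q Y \<and> (\<forall>Y'. submodule Y' L N \<longrightarrow> Y' \<subset> Y \<longrightarrow> \<not> ?Q Y')"
    using N(4) by (intro fin_len_min[OF fgm_fin_len[OF fgN] _ N.carrier_submodule]) blast
  then obtain Y Z where Y: "submodule Y L N" and c: "complementary L N Y Z" and ne: "\<exists>y\<in>Y. \<epsilon> \<odot>\<^bsub>N\<^esub> y \<noteq> \<zero>\<^bsub>N\<^esub>"
    and min: "\<forall>Y'. submodule Y' L N \<longrightarrow> Y' \<subset> Y \<longrightarrow> \<not> ?Q Y'" by blast
  let ?Y = "N\<lparr>carrier := Y\<rparr>"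
  interpret Y: left_module L ?Y by (rule N.sub_module[OF Y])
  have sub: "Y \<subseteq> carrier N" by (rule N.sub_subset[OF Y])
  obtain \<pi> where \<pi>: "lin L N N \<pi>" "\<And>x. x \<in> carrier N \<Longrightarrow> \<pi> x \<in> Y" "\<And>x. x \<in> Y \<Longrightarrow> \<pi> x = x"
    using complementary_projection[OF lN c] by metis
  have \<pi>Y: "lin L N ?Y \<pi>" using \<pi> by (intro lin_corestrict)
  have "?Y \<in> kmod L e0" using fgm_sub[OF fgN Y] N(1) sub by (auto simp: kmod_def fgmod_iff)
  moreover have "lifts L tors (kmod L e0) ?Y"
    by (rule lifts_retract[OF N(2) lin_incl[OF sub] \<pi>Y]) (use \<pi> in simp)
  moreover have "tors ?Y"
    unfolding tors_def
  proof
    fix y assume "y \<in> old ?Y"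
    then have y: "y \<in> Y" "y \<in> old N" using sub by (auto simp: old_def)
    then have "y \<in> trace L T N" using N(3) by (auto simp: tors_def)
    then have "\<pi> y \<in> trace L T ?Y" by (rule trace_map[OF lN Y.left_module_axioms \<pi>Y])
    then show "y \<in> trace L T ?Y" using \<pi>(3) y(1) by simp
  qed
  moreover have "indecomposable L ?Y"
    unfolding indecomposable_def
  proof (intro conjI allI impI)
    show "carrier ?Y \<noteq> {\<zero>\<^bsub>?Y\<^esub>}" using ne \<epsilon>L by auto
    fix A B assume AB: "complementary L ?Y A B"
    then have s: "submodule A L ?Y" "submodule B L ?Y" by (auto simp: complementary_def)
    then have s': "submodule A L N" "submodule B L N" "A \<subseteq> Y" "B \<subseteq> Y" using N.sub_sub[OF Y] by auto
    have sAB: "\<exists>Z. complementary L N A Z" "\<exists>Z. complementary L N B Z"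
      using complementary_trans[OF lN c AB] complementary_trans[OF lN c complementary_sym[OF Y.left_module_axioms AB]] by auto
    have "(\<exists>y\<in>A. \<epsilon> \<odot>\<^bsub>N\<^esub> y \<noteq> \<zero>\<^bsub>N\<^esub>) \<or> (\<exists>y\<in>B. \<epsilon> \<odot>\<^bsub>N\<^esub> y \<noteq> \<zero>\<^bsub>N\<^esub>)"
    proof (rule ccontr)
      assume a: "\<not> ?thesis"
      have "\<epsilon> \<odot>\<^bsub>N\<^esub> y = \<zero>\<^bsub>N\<^esub>" if yY: "y \<in> Y" for y
      proof -
        obtain a b where ab: "a \<in> A" "b \<in> B" "y = a \<oplus>\<^bsub>N\<^esub> b" using AB yY by (auto simp: complementary_iff[OF Y.left_module_axioms])
        then show ?thesis using a N.sub_mem[OF s'(1)] N.sub_mem[OF s'(2)] \<epsilon>L by (simp add: N.smult_r_distr)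
      qed
      then show False using ne by blast
    qed
    then have "A = Y \<or> B = Y" using min s' sAB by blast
    moreover have i: "A \<inter> B = {\<zero>\<^bsub>N\<^esub>}" using AB by (simp add: complementary_def)
    ultimately show "A = {\<zero>\<^bsub>?Y\<^esub>} \<or> B = {\<zero>\<^bsub>?Y\<^esub>}" using s'(3,4) by auto
  qed
  ultimately show ?thesis using that[of ?Y] ne by simp
qed

text \<open>The sum lifts against kernels satisfying \<open>tors\<close>, as both summands do. It
  remains to see that kernels generated by \<open>S\<close> satisfy \<open>tors\<close>: the part of
  \<open>N\<close> killed by \<open>\<epsilon>\<close> lies in the trace of
  \<open>T\<close>.\<close>

lemma extend_rigid:
  assumes N: "N \<in> kmod L e0" "lifts L tors (kmod L e0) N" "tors N"
    and S: "S \<in> fgmod L" "biproduct L S T N i1 i2 p1 p2"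
  shows "rig L e0 S"
proof -
  have T0: "T \<in> kmod L e0" using T(1) kmod_e'_iff by blast
  interpret N: left_module L N by (rule kmod_module[OF N(1)])
  interpret S: left_module L S using S(1) by (simp add: fgmod_def)
  note lN = N.left_module_axioms and lS = S.left_module_axioms
  note b = biproductD[OF S(2)]
  note bc = b(1-4)[THEN lin_closed]
  have li: "lifts L tors (kmod L e0) S"
    by (rule lifts_biproduct[OF T(3) lN S(2) lifts_T N(2) kmod_module])
  have genS: "q \<in> trace L T Q" if Q: "left_module L Q" and q: "q \<in> trace L S Q" "q \<in> old Q" for Q :: "('k, 'a) fdmod" and q
  proof -
    interpret Q: left_module L Q by fact
    have tr: "submodule (trace L T Q) L Q" by (rule trace_submodule[OF T(3) Q])
    \<comment> \<open>The partial sums of an old element need not be old. Therefore the induction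
      follows \<open>q - \<epsilon> q\<close>, which is additive in \<open>q\<close> and equals
      \<open>q\<close> for old \<open>q\<close>.\<close>
    have "q \<ominus>\<^bsub>Q\<^esub> \<epsilon> \<odot>\<^bsub>Q\<^esub> q \<in> trace L T Q" if "q \<in> trace L S Q" for q
      using that
    proof induction
      case zero then show ?case using trace.zero[of Q L T] \<epsilon>L by simp
    next
      case (step h s y)
      note ps = bc(3)[OF step(2)] bc(4)[OF step(2)]
      have yQ: "y \<in> carrier Q" by (rule trace_closed[OF Q step(3)])
      have h1: "lin L T Q (\<lambda>x. h (i1 x))" "lin L N Q (\<lambda>x. h (i2 x))" using lin_comp b(1,2) step(1) by blast+
      let ?u = "h (i1 (p1 s))" and ?v = "h (i2 (p2 s))"
      have hs: "h s = ?u \<oplus>\<^bsub>Q\<^esub> ?v" using b(9)[OF step(2)] lin_add[OF step(1) bc(1)[OF ps(1)] bc(2)[OF ps(2)]] by simp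
      have u: "?u \<in> trace L T Q" by (rule trace_hom[OF Q h1(1) ps(1)])
      let ?m = "p2 s \<ominus>\<^bsub>N\<^esub> \<epsilon> \<odot>\<^bsub>N\<^esub> p2 s"
      have "?m \<in> old N" using ps(2) \<epsilon>L by (simp add: old_def N.smult_r_diff N.smult_assoc1[symmetric] \<epsilon>\<epsilon>)
      then have "?m \<in> trace L T N" using N(3) by (auto simp: tors_def)
      then have "h (i2 ?m) \<in> trace L T Q" by (rule trace_map[OF lN Q h1(2)])
      also have "h (i2 ?m) = ?v \<ominus>\<^bsub>Q\<^esub> \<epsilon> \<odot>\<^bsub>Q\<^esub> ?v"
        using lin_minus[OF lN Q h1(2) ps(2)] lin_smult[OF h1(2) \<epsilon>L ps(2)] ps(2) \<epsilon>L by simp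
      finally have v: "?v \<ominus>\<^bsub>Q\<^esub> \<epsilon> \<odot>\<^bsub>Q\<^esub> ?v \<in> trace L T Q" .
      have c: "?u \<in> carrier Q" "?v \<in> carrier Q" using lin_closed[OF h1(1) ps(1)] lin_closed[OF h1(2) ps(2)] by auto
      have u': "\<epsilon> \<odot>\<^bsub>Q\<^esub> ?u = \<zero>\<^bsub>Q\<^esub>" using trace_old[OF Q u] by (simp add: old_def)
      have "(h s \<oplus>\<^bsub>Q\<^esub> y) \<ominus>\<^bsub>Q\<^esub> \<epsilon> \<odot>\<^bsub>Q\<^esub> (h s \<oplus>\<^bsub>Q\<^esub> y) = ?u \<oplus>\<^bsub>Q\<^esub> ((?v \<ominus>\<^bsub>Q\<^esub> \<epsilon> \<odot>\<^bsub>Q\<^esub> ?v) \<oplus>\<^bsub>Q\<^esub> (y \<ominus>\<^bsub>Q\<^esub> \<epsilon> \<odot>\<^bsub>Q\<^esub> y))"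
        unfolding hs using c yQ \<epsilon>L u' by (simp add: Q.smult_r_distr Q.M.minus_eq Q.M.minus_add Q.M.a_ac)
      then show ?case using Q.sub_add[OF tr u Q.sub_add[OF tr v step.IH]] by simp
    qed
    from this[OF q(1)] show ?thesis using q(2) trace_closed[OF Q q(1)] by (simp add: old_def)
  qed
  have "lifts L (gen L S) (kmod L e0) S"
  proof (rule liftsI)
    fix E Z p u
    assume E: "E \<in> kmod L e0" "Z \<in> kmod L e0" "lin L E Z p" "p ` carrier E = carrier Z"
      and g: "gen L S (E\<lparr>carrier := lker E Z p\<rparr>)" and u: "lin L S Z u"
    let ?Q = "E\<lparr>carrier := lker E Z p\<rparr>"
    have lQ: "left_module L ?Q"
      by (rule left_module.sub_module[OF kmod_module[OF E(1)] ker_submodule[OF kmod_module[OF E(1)] kmod_module[OF E(2)] E(3)]])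
    have "tors ?Q" unfolding tors_def
    proof
      fix q assume q: "q \<in> old ?Q"
      then have "q \<in> trace L S ?Q" using g by (auto simp: gen_def old_def)
      then show "q \<in> trace L T ?Q" using genS[OF lQ _ q] by blast
    qed
    then show "\<exists>s. lin L S E s \<and> (\<forall>x\<in>carrier S. p (s x) = u x)" using liftsD[OF li E _ u] by blast
  qed
  then show ?thesis unfolding rig_def using biproduct_kmod[OF T0 N(1) S e0L] by blast
qed

lemma \<epsilon>_iso:
  assumes "left_module L M" "left_module L M'" "mod_iso L M M'" "\<And>x. x \<in> carrier M \<Longrightarrow> \<epsilon> \<odot>\<^bsub>M\<^esub> x = \<zero>\<^bsub>M\<^esub>" "y \<in> carrier M'"
  shows "\<epsilon> \<odot>\<^bsub>M'\<^esub> y = \<zero>\<^bsub>M'\<^esub>"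
proof -
  obtain h where h: "lin L M M' h" "bij_betw h (carrier M) (carrier M')" using assms(3) by (auto simp: mod_iso_iff[OF assms(1)])
  then obtain x where x: "x \<in> carrier M" "y = h x" using assms(5) by (auto simp: bij_betw_def)
  then show ?thesis using lin_smult[OF h(1) \<epsilon>L x(1)] assms(4)[OF x(1)] lin_zero[OF assms(1,2) h(1)] by simp
qed

lemma biproduct_complementary:
  assumes "left_module L M" "left_module L N" "left_module L S" "biproduct L S M N i1 i2 p1 p2"
  shows "complementary L S (i1 ` carrier M) (i2 ` carrier N)"
    "mod_iso L M (S\<lparr>carrier := i1 ` carrier M\<rparr>)" "mod_iso L N (S\<lparr>carrier := i2 ` carrier N\<rparr>)"
proof -
  note b = biproductD[OF assms(4)]
  note bc = b(1-4)[THEN lin_closed]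
  interpret N: left_module L N by fact
  have bij: "bij_betw (\<lambda>y. p1 (i1 y)) (carrier M) (carrier M)" "bij_betw (\<lambda>y. p2 (i2 y)) (carrier N) (carrier N)"
    using b(5,7) by (auto simp: bij_betw_def inj_on_def)
  note r1 = complementary_retract[OF assms(1,3) b(1,3) bij(1)]
  note r2 = complementary_retract[OF assms(2,3) b(2,4) bij(2)]
  have "lker S M p1 = i2 ` carrier N"
  proof
    show "i2 ` carrier N \<subseteq> lker S M p1" using bc b(8) by auto
    show "lker S M p1 \<subseteq> i2 ` carrier N"
    proof
      fix z assume z: "z \<in> lker S M p1"
      then have "i2 (p2 z) = z" using b(9)[of z] lin_zero[OF assms(1,3) b(1)] bc left_module.axioms(2)[OF assms(3)]
        by (simp add: abelian_group.r_neg abelian_monoid.l_zero abelian_group_def)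
      then show "z \<in> i2 ` carrier N" using z bc(4)[of z] by (metis (no_types, lifting) imageI mem_Collect_eq)
    qed
  qed
  then show "complementary L S (i1 ` carrier M) (i2 ` carrier N)" using r1(1) by simp
  show "mod_iso L M (S\<lparr>carrier := i1 ` carrier M\<rparr>)" using mod_isoI[OF assms(1) r1(2)] r1(3) by simp
  show "mod_iso L N (S\<lparr>carrier := i2 ` carrier N\<rparr>)" using mod_isoI[OF assms(2) r2(2)] r2(3) by simp
qed

text \<open>No summand of \<open>M\<close> is isomorphic to \<open>N\<close>, because
  \<open>\<epsilon>\<close> acts as zero on the former and not on the latter.\<close>

lemma num_biproduct:
  assumes M: "fgm L M" "\<And>x. x \<in> carrier M \<Longrightarrow> \<epsilon> \<odot>\<^bsub>M\<^esub> x = \<zero>\<^bsub>M\<^esub>"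
    and N: "fgm L N" "indecomposable L N" "\<exists>y\<in>carrier N. \<epsilon> \<odot>\<^bsub>N\<^esub> y \<noteq> \<zero>\<^bsub>N\<^esub>"
    and S: "fgm L S" "biproduct L S M N i1 i2 p1 p2"
  shows "num_summands L S = Suc (num_summands L M)"
proof -
  note lm = fgm_module[OF M(1)] fgm_module[OF N(1)] fgm_module[OF S(1)]
  note c = biproduct_complementary[OF lm S(2)]
  interpret S: left_module L S by (rule lm)
  have s: "submodule (i1 ` carrier M) L S" "submodule (i2 ` carrier N) L S" using c(1) by (auto simp: complementary_def)
  note l1 = S.sub_module[OF s(1)] and l2 = S.sub_module[OF s(2)]
  have "indecomposable L (S\<lparr>carrier := i2 ` carrier N\<rparr>)" by (rule indecomposable_iso[OF lm(2) l2 c(3) N(2)])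
  moreover have "\<not> mod_iso L (S\<lparr>carrier := i1 ` carrier M\<rparr>\<lparr>carrier := Y\<rparr>) (S\<lparr>carrier := i2 ` carrier N\<rparr>)"
    if Y: "Y \<in> isum L (S\<lparr>carrier := i1 ` carrier M\<rparr>)" for Y
  proof
    assume iso: "mod_iso L (S\<lparr>carrier := i1 ` carrier M\<rparr>\<lparr>carrier := Y\<rparr>) (S\<lparr>carrier := i2 ` carrier N\<rparr>)"
    have lY: "left_module L (S\<lparr>carrier := i1 ` carrier M\<rparr>\<lparr>carrier := Y\<rparr>)" by (rule isum_module[OF l1 Y])
    have YM: "Y \<subseteq> i1 ` carrier M" using left_module.sub_subset[OF l1 isum_submodule[OF Y]] by simp
    have "\<epsilon> \<odot>\<^bsub>S\<^esub> y = \<zero>\<^bsub>S\<^esub>" if "y \<in> Y" for y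
      using \<epsilon>_iso[OF lm(1) l1 c(2) M(2), of y] that YM by auto
    then have "\<epsilon> \<odot>\<^bsub>S\<^esub> y = \<zero>\<^bsub>S\<^esub>" if "y \<in> i2 ` carrier N" for y
      using \<epsilon>_iso[OF lY l2 iso, of y] that by simp
    then have "\<epsilon> \<odot>\<^bsub>N\<^esub> y = \<zero>\<^bsub>N\<^esub>" if "y \<in> carrier N" for y
      using \<epsilon>_iso[OF l2 lm(2) mod_iso_sym[OF lm(2) l2 c(3)], of y] that by simp
    then show False using N(3) by blast
  qed
  ultimately have "num_summands L S = Suc (num_summands L (S\<lparr>carrier := i1 ` carrier M\<rparr>))"
    by (intro num_summands_add[OF lm(3) fgm_fin_len[OF S(1)] c(1)]) simp_all
  then show ?thesis using num_summands_iso[OF lm(1) l1 c(2)] by simp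
qed

end

section \<open>Internal direct sums and basic modules\<close>

lemma lin_finsum:
  assumes "left_module R M" "left_module R N" "lin R M N h" "finite A" "f \<in> A \<rightarrow> carrier M"
  shows "h (finsum M f A) = finsum N (\<lambda>x. h (f x)) A"
proof -
  interpret M: left_module R M by fact
  interpret N: left_module R N by fact
  show ?thesis using assms(4,5)
  proof (induction A rule: finite_induct)
    case empty then show ?case using lin_zero[OF assms(1-3)] by simp
  next
    case (insert a A)
    then have f: "f \<in> A \<rightarrow> carrier M" "f a \<in> carrier M" by auto
    have hf: "(\<lambda>x. h (f x)) \<in> A \<rightarrow> carrier N" "h (f a) \<in> carrier N" using f lin_closed[OF assms(3)] by auto
    have "finsum M f A \<in> carrier M" using f by (intro M.M.finsum_closed)
    then show ?case using insert f hf lin_add[OF assms(3)] by simp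
  qed
qed

text \<open>The summands form a set, so the image of \<open>N\<close> must differ from the images of
  the members of \<open>D\<close>. An equality would force \<open>N\<close> to be zero, which
  \<open>ne\<close> excludes.\<close>

lemma internal_direct_sum_biproduct:
  assumes M: "left_module R M" and N: "left_module R N" and S: "left_module R S" "biproduct R S M N i1 i2 p1 p2"
    and D: "internal_direct_sum R M D" and ne: "carrier N \<noteq> {\<zero>\<^bsub>N\<^esub>}"
  shows "internal_direct_sum R S (insert (i2 ` carrier N) ((`) i1 ` D))"
proof -
  interpret M: left_module R M by fact
  interpret N: left_module R N by fact
  interpret S: left_module R S by fact
  note b = biproductD[OF S(2)]
  note bc = b(1-4)[THEN lin_closed]
  let ?N = "i2 ` carrier N" and ?D = "(`) i1 ` D"
  have fin: "finite D" and sub: "\<And>A. A \<in> D \<Longrightarrow> submodule A R M"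
    and uni: "\<And>x. x \<in> carrier M \<Longrightarrow> \<exists>!c. c \<in> (\<Pi>\<^sub>E A\<in>D. A) \<and> x = (\<Oplus>\<^bsub>M\<^esub>A\<in>D. c A)"
    using D by (auto simp: internal_direct_sum_def)
  have subc: "A \<subseteq> carrier M" if "A \<in> D" for A using M.sub_subset[OF sub[OF that]] .
  have p1i1: "p1 ` i1 ` A = A" if "A \<in> D" for A using b(5) subc[OF that] by force
  have inj: "inj_on ((`) i1) D" by (rule inj_on_inverseI[of _ "(`) p1"]) (rule p1i1)
  have notin: "?N \<notin> ?D"
  proof
    assume "?N \<in> ?D"
    then obtain A where A: "A \<in> D" "?N = i1 ` A" by blast
    have "y = \<zero>\<^bsub>N\<^esub>" if "y \<in> carrier N" for y
    proof -
      have "i2 y \<in> i1 ` A" using that A(2) by blast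
      then obtain x where "x \<in> A" "i2 y = i1 x" by blast
      then show ?thesis using b(6)[of x] b(7)[OF that] subc[OF A(1)] by auto
    qed
    then show False using ne N.M.zero_closed by blast
  qed
  have sum: "(\<Oplus>\<^bsub>S\<^esub>A\<in>insert ?N ?D. d A) = d ?N \<oplus>\<^bsub>S\<^esub> (\<Oplus>\<^bsub>S\<^esub>A\<in>D. d (i1 ` A))"
    if d: "d \<in> (\<Pi> A\<in>insert ?N ?D. A)" for d
  proof -
    have "?N \<subseteq> carrier S" using bc(2) by blast
    then have cl1: "d ?N \<in> carrier S" using Pi_mem[OF d insertI1] by blast
    have "d \<in> ?D \<rightarrow> carrier S"
    proof
      fix B assume B: "B \<in> ?D"
      then have "B \<subseteq> carrier S" using bc(1) subc by blast
      then show "d B \<in> carrier S" using Pi_mem[OF d insertI2[OF B]] by blast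
    qed
    note cl = cl1 this
    have "(\<Oplus>\<^bsub>S\<^esub>A\<in>insert ?N ?D. d A) = d ?N \<oplus>\<^bsub>S\<^esub> (\<Oplus>\<^bsub>S\<^esub>A\<in>?D. d A)" using fin notin cl by simp
    also have "(\<Oplus>\<^bsub>S\<^esub>A\<in>?D. d A) = (\<Oplus>\<^bsub>S\<^esub>A\<in>D. d (i1 ` A))" using inj cl by (intro S.M.finsum_reindex)
    finally show ?thesis .
  qed
  show ?thesis
    unfolding internal_direct_sum_def
  proof (intro conjI ballI)
    show "finite (insert ?N ?D)" using fin by simp
    fix A assume "A \<in> insert ?N ?D"
    then show "submodule A R S"
      using image_submodule[OF N S(1) b(2) N.carrier_submodule] image_submodule[OF M S(1) b(1) sub] by blast
  next
    fix x assume x: "x \<in> carrier S"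
    obtain c where c: "c \<in> (\<Pi>\<^sub>E A\<in>D. A)" "p1 x = (\<Oplus>\<^bsub>M\<^esub>A\<in>D. c A)" using uni[OF bc(3)[OF x]] by blast
    have cA: "c A \<in> A" "c A \<in> carrier M" if "A \<in> D" for A using c(1) that subc by auto
    \<comment> \<open>A member \<open>A\<close> of \<open>D\<close> is recovered from its image
      under \<open>i1\<close> by applying \<open>p1\<close>.\<close>
    let ?d = "\<lambda>B\<in>insert ?N ?D. if B = ?N then i2 (p2 x) else i1 (c (p1 ` B))"
    have d1: "?d \<in> (\<Pi>\<^sub>E A\<in>insert ?N ?D. A)" using bc(4)[OF x] p1i1 cA by auto
    have dA: "?d (i1 ` A) = i1 (c A)" if "A \<in> D" for A
    proof -
      have "i1 ` A \<noteq> ?N" using notin that by blast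
      then show ?thesis using p1i1[OF that] that by simp
    qed
    have e1: "?d ?N = i2 (p2 x)" by simp
    have "(\<Oplus>\<^bsub>S\<^esub>A\<in>D. ?d (i1 ` A)) = (\<Oplus>\<^bsub>S\<^esub>A\<in>D. i1 (c A))"
      by (rule S.M.add.finprod_cong') (use dA cA bc in auto)
    also have "\<dots> = i1 (p1 x)"
      unfolding c(2) by (rule lin_finsum[OF M S(1) b(1) fin, symmetric]) (use cA in auto)
    finally have e2: "(\<Oplus>\<^bsub>S\<^esub>A\<in>D. ?d (i1 ` A)) = i1 (p1 x)" .
    have "?d \<in> (\<Pi> A\<in>insert ?N ?D. A)" using d1 by (simp only: PiE_def Int_iff)
    note sum[OF this, unfolded e1 e2]
    also have "i2 (p2 x) \<oplus>\<^bsub>S\<^esub> i1 (p1 x) = i1 (p1 x) \<oplus>\<^bsub>S\<^esub> i2 (p2 x)" using bc x by (intro S.M.a_comm) auto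
    also have "\<dots> = x" by (rule b(9)[OF x])
    finally have d2: "(\<Oplus>\<^bsub>S\<^esub>A\<in>insert ?N ?D. ?d A) = x" .
    show "\<exists>!d. d \<in> (\<Pi>\<^sub>E A\<in>insert ?N ?D. A) \<and> x = (\<Oplus>\<^bsub>S\<^esub>A\<in>insert ?N ?D. d A)"
    proof (rule ex1I[of _ ?d])
      show "?d \<in> (\<Pi>\<^sub>E A\<in>insert ?N ?D. A) \<and> x = (\<Oplus>\<^bsub>S\<^esub>A\<in>insert ?N ?D. ?d A)" using d1 d2 by simp
      fix d assume d: "d \<in> (\<Pi>\<^sub>E A\<in>insert ?N ?D. A) \<and> x = (\<Oplus>\<^bsub>S\<^esub>A\<in>insert ?N ?D. d A)"
      then have dP: "d \<in> (\<Pi> A\<in>insert ?N ?D. A)" by (auto simp: PiE_def)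
      obtain y where y: "y \<in> carrier N" "d ?N = i2 y" using dP by (auto simp: Pi_iff)
      have dA: "d (i1 ` A) \<in> i1 ` A" if "A \<in> D" for A using dP that by (auto simp: Pi_iff)
      have dAc: "d (i1 ` A) \<in> carrier S" "p1 (d (i1 ` A)) \<in> A" "i1 (p1 (d (i1 ` A))) = d (i1 ` A)" "p2 (d (i1 ` A)) = \<zero>\<^bsub>N\<^esub>" if A: "A \<in> D" for A
      proof -
        obtain z where z: "z \<in> A" "d (i1 ` A) = i1 z" using dA[OF A] by blast
        then show "d (i1 ` A) \<in> carrier S" "p1 (d (i1 ` A)) \<in> A" "i1 (p1 (d (i1 ` A))) = d (i1 ` A)" "p2 (d (i1 ` A)) = \<zero>\<^bsub>N\<^esub>"
          using b(5,6) bc subc[OF A] by auto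
      qed
      have sS: "(\<Oplus>\<^bsub>S\<^esub>A\<in>D. d (i1 ` A)) \<in> carrier S" using dAc(1) by (intro S.M.finsum_closed) auto
      have xd: "x = i2 y \<oplus>\<^bsub>S\<^esub> (\<Oplus>\<^bsub>S\<^esub>A\<in>D. d (i1 ` A))" using d sum[OF dP] y(2) by simp
      have s1: "p1 (\<Oplus>\<^bsub>S\<^esub>A\<in>D. d (i1 ` A)) = (\<Oplus>\<^bsub>M\<^esub>A\<in>D. p1 (d (i1 ` A)))"
        by (rule lin_finsum[OF S(1) M b(3) fin]) (use dAc in auto)
      have "(\<Oplus>\<^bsub>N\<^esub>A\<in>D. p2 (d (i1 ` A))) = \<zero>\<^bsub>N\<^esub>"
        by (rule N.M.add.finprod_one_eqI) (use dAc in auto)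
      then have s2: "p2 (\<Oplus>\<^bsub>S\<^esub>A\<in>D. d (i1 ` A)) = \<zero>\<^bsub>N\<^esub>"
        using lin_finsum[OF S(1) N b(4) fin, of "\<lambda>A. d (i1 ` A)"] dAc by simp
      have "p1 x = (\<Oplus>\<^bsub>M\<^esub>A\<in>D. p1 (d (i1 ` A)))"
        unfolding xd using lin_add[OF b(3) bc(2)[OF y(1)] sS] b(8)[OF y(1)] s1 bc(3)[OF sS] by simp
      also have "\<dots> = (\<Oplus>\<^bsub>M\<^esub>A\<in>D. (\<lambda>A\<in>D. p1 (d (i1 ` A))) A)"
        by (rule M.M.add.finprod_cong') (use dAc bc in auto)
      finally have "p1 x = (\<Oplus>\<^bsub>M\<^esub>A\<in>D. (\<lambda>A\<in>D. p1 (d (i1 ` A))) A)" .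
      moreover have "(\<lambda>A\<in>D. p1 (d (i1 ` A))) \<in> (\<Pi>\<^sub>E A\<in>D. A)" using dAc by auto
      ultimately have cd: "(\<lambda>A\<in>D. p1 (d (i1 ` A))) = c" using uni[OF bc(3)[OF x]] c by blast
      have px: "p2 x = y"
        unfolding xd using lin_add[OF b(4) bc(2)[OF y(1)] sS] b(7)[OF y(1)] s2 y(1) by simp
      show "d = ?d"
      proof (rule extensionalityI[of _ "insert ?N ?D"])
        show "d \<in> extensional (insert ?N ?D)" using d by (auto simp: PiE_def)
        fix B assume "B \<in> insert ?N ?D"
        then show "d B = ?d B"
        proof
          assume "B = ?N" then show ?thesis using y(2) px by simp
        next
          assume "B \<in> ?D"
          then obtain A where A: "A \<in> D" "B = i1 ` A" by blast
          have "B \<noteq> ?N" using \<open>B \<in> ?D\<close> notin by blast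
          then have "?d B = i1 (c (p1 ` B))" using \<open>B \<in> ?D\<close> by simp
          also have "c (p1 ` B) = p1 (d (i1 ` A))" unfolding A(2) p1i1[OF A(1)] using A(1) by (simp add: cd[symmetric])
          also have "i1 (p1 (d (i1 ` A))) = d B" using dAc(3)[OF A(1)] A(2) by simp
          finally show ?thesis by simp
        qed
      qed simp
    qed
  qed
qed

context new_vertex begin

text \<open>The action of \<open>\<epsilon>\<close> separates the new summand from all the old ones,
  which are pairwise non-isomorphic already.\<close>

lemma basic_biproduct:
  assumes M: "left_module L M" "\<And>x. x \<in> carrier M \<Longrightarrow> \<epsilon> \<odot>\<^bsub>M\<^esub> x = \<zero>\<^bsub>M\<^esub>" "basic_module L M"
    and N: "left_module L N" "indecomposable L N" "\<exists>y\<in>carrier N. \<epsilon> \<odot>\<^bsub>N\<^esub> y \<noteq> \<zero>\<^bsub>N\<^esub>"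
    and S: "left_module L S" "biproduct L S M N i1 i2 p1 p2"
  shows "basic_module L S"
proof -
  obtain D where D: "internal_direct_sum L M D" "\<forall>A\<in>D. indecomposable L (M\<lparr>carrier := A\<rparr>)"
    "\<forall>A\<in>D. \<forall>B\<in>D. mod_iso L (M\<lparr>carrier := A\<rparr>) (M\<lparr>carrier := B\<rparr>) \<longrightarrow> A = B"
    using M(3) by (auto simp: basic_module_def)
  interpret M: left_module L M by fact
  interpret N: left_module L N by fact
  interpret S: left_module L S by fact
  note b = biproductD[OF S(2)]
  let ?N = "i2 ` carrier N"
  have sub: "submodule A L M" if "A \<in> D" for A using D(1) that by (auto simp: internal_direct_sum_def)
  have c: "submodule ?N L S" "mod_iso L N (S\<lparr>carrier := ?N\<rparr>)"
    using biproduct_complementary[OF M(1) N(1) S] by (auto simp: complementary_def)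
  note lN' = S.sub_module[OF c(1)]
  have A: "left_module L (M\<lparr>carrier := A\<rparr>)" "left_module L (S\<lparr>carrier := i1 ` A\<rparr>)"
      "mod_iso L (M\<lparr>carrier := A\<rparr>) (S\<lparr>carrier := i1 ` A\<rparr>)" if "A \<in> D" for A
  proof -
    have s: "submodule A L M" by (rule sub[OF that])
    have A: "A \<subseteq> carrier M" by (rule M.sub_subset[OF s])
    show l: "left_module L (M\<lparr>carrier := A\<rparr>)" by (rule M.sub_module[OF s])
    show "left_module L (S\<lparr>carrier := i1 ` A\<rparr>)" by (rule S.sub_module[OF image_submodule[OF M(1) S(1) b(1) s]])
    have li: "lin L (M\<lparr>carrier := A\<rparr>) (S\<lparr>carrier := i1 ` A\<rparr>) i1"
      by (rule lin_corestrict[OF lin_restrict[OF b(1) A]]) auto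
    have "inj_on i1 A" by (rule inj_on_inverseI[of _ p1]) (use b(5) A in auto)
    then show "mod_iso L (M\<lparr>carrier := A\<rparr>) (S\<lparr>carrier := i1 ` A\<rparr>)"
      using mod_isoI[OF l li] by (simp add: bij_betw_def)
  qed
  have sep: "\<not> mod_iso L (S\<lparr>carrier := i1 ` A\<rparr>) (S\<lparr>carrier := ?N\<rparr>)" if "A \<in> D" for A
  proof
    assume iso: "mod_iso L (S\<lparr>carrier := i1 ` A\<rparr>) (S\<lparr>carrier := ?N\<rparr>)"
    have "\<epsilon> \<odot>\<^bsub>S\<^esub> y = \<zero>\<^bsub>S\<^esub>" if "y \<in> i1 ` A" for y
      using \<epsilon>_iso[OF A[OF \<open>A \<in> D\<close>], of y] M(2) M.sub_mem[OF sub[OF \<open>A \<in> D\<close>]] that by simp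
    then have "\<epsilon> \<odot>\<^bsub>S\<^esub> y = \<zero>\<^bsub>S\<^esub>" if "y \<in> ?N" for y using \<epsilon>_iso[OF A(2)[OF \<open>A \<in> D\<close>] lN' iso, of y] that by simp
    then have "\<epsilon> \<odot>\<^bsub>N\<^esub> y = \<zero>\<^bsub>N\<^esub>" if "y \<in> carrier N" for y
      using \<epsilon>_iso[OF lN' N(1) mod_iso_sym[OF N(1) lN' c(2)], of y] that by simp
    then show False using N(3) by blast
  qed
  have ne: "carrier N \<noteq> {\<zero>\<^bsub>N\<^esub>}" using N(2) by (simp add: indecomposable_def)
  have ids: "internal_direct_sum L S (insert ?N ((`) i1 ` D))"
    by (rule internal_direct_sum_biproduct[OF M(1) N(1) S D(1) ne])
  have ind: "indecomposable L (S\<lparr>carrier := B\<rparr>)" if "B \<in> insert ?N ((`) i1 ` D)" for B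
    using that
  proof
    assume "B = ?N" then show ?thesis using indecomposable_iso[OF N(1) lN' c(2) N(2)] by simp
  next
    assume "B \<in> (`) i1 ` D"
    then obtain A0 where "A0 \<in> D" "B = i1 ` A0" by blast
    then show ?thesis using indecomposable_iso[OF A] D(2) by blast
  qed
  have sepB: "B = B'"
    if B: "B \<in> insert ?N ((`) i1 ` D)" "B' \<in> insert ?N ((`) i1 ` D)" and iso: "mod_iso L (S\<lparr>carrier := B\<rparr>) (S\<lparr>carrier := B'\<rparr>)" for B B'
  proof -
    have lm: "left_module L (S\<lparr>carrier := B\<rparr>)" "left_module L (S\<lparr>carrier := B'\<rparr>)" using B lN' A(2) by auto
    note iso' = mod_iso_sym[OF lm iso]
    consider "B = ?N" "B' = ?N" | A0 where "A0 \<in> D" "B = i1 ` A0" "B' = ?N" | A0 where "A0 \<in> D" "B' = i1 ` A0" "B = ?N"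
      | A0 A1 where "A0 \<in> D" "A1 \<in> D" "B = i1 ` A0" "B' = i1 ` A1" using B by blast
    then show ?thesis
    proof cases
      case 2 then show ?thesis using sep iso by blast
    next
      case 3 then show ?thesis using sep iso' by blast
    next
      case 4
      have "mod_iso L (M\<lparr>carrier := A0\<rparr>) (M\<lparr>carrier := A1\<rparr>)"
        using mod_iso_cong[OF A(1)[OF 4(1)] A(1)[OF 4(2)] A(2)[OF 4(1)] A(2)[OF 4(2)] A(3)[OF 4(1)] A(3)[OF 4(2)]] iso 4 by simp
      then show ?thesis using D(3) 4 by blast
    qed simp
  qed
  show ?thesis
    unfolding basic_module_def
    by (intro exI[of _ "insert ?N ((`) i1 ` D)"] conjI ballI impI ids ind sepB) assumption+
qed

text \<open>Right multiplication by \<open>\<epsilon>\<close> splits the quotient by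
  \<open>e0\<close> into two left modules. The kernel is a copy of the quotient by
  \<open>e'\<close>; the image is the projective at the new vertex, indecomposable and not killed by
  \<open>\<epsilon>\<close>.\<close>

lemma num_regular_quot_new:
  "num_summands L (regular_quot e0) = Suc (num_summands L (regular_quot e'))"
proof -
  let ?U = "regular_quot e0"
  define q where "q = (\<lambda>a. I0 +>\<^bsub>L\<^esub> a)"
  have lU: "left_module L ?U" by (rule regular_quot_module[OF e0L])
  interpret U: left_module L ?U by (rule lU)
  interpret I0: ideal I0 L by (rule ideal_I0)
  have q: "lin L (regular_module L) ?U q" "q ` carrier L = carrier ?U"
    and qz: "\<And>a. a \<in> carrier L \<Longrightarrow> q a = \<zero>\<^bsub>?U\<^esub> \<longleftrightarrow> a \<in> I0"
    unfolding q_def using regular_quot_proj[OF e0L] by auto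
  note qc = lin_closed[OF q(1), simplified] and qadd = lin_add[OF q(1), simplified] and qs = lin_smult[OF q(1), simplified]
  have qm: "q (a \<ominus>\<^bsub>L\<^esub> b) = q a \<ominus>\<^bsub>?U\<^esub> q b" if "a \<in> carrier L" "b \<in> carrier L" for a b
  proof -
    have "q (a \<ominus>\<^bsub>L\<^esub> b) \<oplus>\<^bsub>?U\<^esub> q b = q ((a \<ominus>\<^bsub>L\<^esub> b) \<oplus>\<^bsub>L\<^esub> b)" by (rule qadd[symmetric]) (use that in auto)
    also have "(a \<ominus>\<^bsub>L\<^esub> b) \<oplus>\<^bsub>L\<^esub> b = a" using that by (simp add: R.minus_eq R.a_assoc R.l_neg)
    finally show ?thesis using that qc by (metis R.minus_closed U.add_diff_cancel)
  qed
  have ex: "\<exists>a\<in>carrier L. x = q a" if "x \<in> carrier ?U" for x using that unfolding q(2)[symmetric] by blast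
  \<comment> \<open>Right multiplication by \<open>\<epsilon>\<close> descends to the quotient
    because \<open>I0\<close> is two-sided.\<close>
  have "lin L (regular_module L) ?U (\<lambda>b. q (b \<otimes>\<^bsub>L\<^esub> \<epsilon>))"
    using \<epsilon>L qc qadd qs by (intro linI) (auto simp: R.l_distr R.m_assoc)
  then have "\<exists>r. lin L ?U ?U r \<and> (\<forall>b\<in>carrier (regular_module L). r (q b) = q (b \<otimes>\<^bsub>L\<^esub> \<epsilon>))"
    by (rule lin_factor[OF regular_module lU lU q(1)]) (use q(2) qz \<epsilon>L I0.I_r_closed in auto)
  then obtain r where r: "lin L ?U ?U r" "\<And>b. b \<in> carrier L \<Longrightarrow> r (q b) = q (b \<otimes>\<^bsub>L\<^esub> \<epsilon>)" by auto
  note rc = lin_closed[OF r(1)]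
  have rr: "r (r x) = r x" if xU: "x \<in> carrier ?U" for x
  proof -
    obtain a where a: "a \<in> carrier L" "x = q a" using ex[OF xU] by blast
    then show ?thesis using r(2) \<epsilon>L by (simp add: R.m_assoc \<epsilon>\<epsilon>)
  qed
  define p where "p x = x \<ominus>\<^bsub>?U\<^esub> r x" for x
  have p: "lin L ?U ?U p" unfolding p_def by (rule lin_diff[OF lU lin_id r(1)])
  have rp: "r (p x) = \<zero>\<^bsub>?U\<^esub>" if "x \<in> carrier ?U" for x
    unfolding p_def using lin_minus[OF lU lU r(1) that rc[OF that]] rr[OF that] rc[OF that] by simp
  let ?M = "?U\<lparr>carrier := lker ?U ?U r\<rparr>" and ?N = "?U\<lparr>carrier := r ` carrier ?U\<rparr>"
  have sM: "submodule (lker ?U ?U r) L ?U" by (rule ker_submodule[OF lU lU r(1)])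
  have sN: "submodule (r ` carrier ?U) L ?U" by (rule image_submodule[OF lU lU r(1) U.carrier_submodule])
  interpret M: left_module L ?M by (rule U.sub_module[OF sM])
  interpret N: left_module L ?N by (rule U.sub_module[OF sN])
  have fgU: "fgm L ?U" by (rule fgm_surj[OF regular_fgm lU q(1)]) (simp add: q(2))
  have pM: "lin L ?U ?M p" by (rule lin_corestrict[OF p]) (use rp lin_closed[OF p] in auto)
  have rN: "lin L ?U ?N r" by (rule lin_corestrict[OF r(1)]) auto
  have bi: "biproduct L ?U ?M ?N (\<lambda>x. x) (\<lambda>x. x) p r"
    unfolding biproduct_def
  proof (intro conjI ballI lin_incl U.sub_subset[OF sM] U.sub_subset[OF sN] pM rN)
    fix x assume "x \<in> carrier ?M" then show "p x = x" "r x = \<zero>\<^bsub>?N\<^esub>" by (simp_all add: p_def)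
  next
    fix x assume "x \<in> carrier ?N"
    then obtain y where "y \<in> carrier ?U" "x = r y" by auto
    then show "r x = x" "p x = \<zero>\<^bsub>?M\<^esub>" using rr rc by (simp_all add: p_def)
  next
    fix x assume "x \<in> carrier ?U" then show "p x \<oplus>\<^bsub>?U\<^esub> r x = x" using rc by (simp add: p_def)
  qed
  have qp: "p (q b) = q (b \<ominus>\<^bsub>L\<^esub> b \<otimes>\<^bsub>L\<^esub> \<epsilon>)" if "b \<in> carrier L" for b
    using r(2) qm that \<epsilon>L by (simp add: p_def)
  have \<epsilon>p: "\<epsilon> \<odot>\<^bsub>?U\<^esub> p (q b) = \<zero>\<^bsub>?U\<^esub>" if b: "b \<in> carrier L" for b
  proof -
    have "\<epsilon> \<otimes>\<^bsub>L\<^esub> (b \<ominus>\<^bsub>L\<^esub> b \<otimes>\<^bsub>L\<^esub> \<epsilon>) = \<epsilon> \<otimes>\<^bsub>L\<^esub> b \<ominus>\<^bsub>L\<^esub> \<epsilon> \<otimes>\<^bsub>L\<^esub> b \<otimes>\<^bsub>L\<^esub> \<epsilon>"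
      using b \<epsilon>L by (simp add: R.minus_eq R.r_distr R.r_minus R.m_assoc)
    also have "\<dots> = \<zero>\<^bsub>L\<^esub>" using \<epsilon>b[OF b] b \<epsilon>L by (simp add: R.minus_eq R.r_neg)
    finally have "q (\<epsilon> \<otimes>\<^bsub>L\<^esub> (b \<ominus>\<^bsub>L\<^esub> b \<otimes>\<^bsub>L\<^esub> \<epsilon>)) = \<zero>\<^bsub>?U\<^esub>" using qz[of "\<zero>\<^bsub>L\<^esub>"] by simp
    then show ?thesis using qp[OF b] qs[of \<epsilon> "b \<ominus>\<^bsub>L\<^esub> b \<otimes>\<^bsub>L\<^esub> \<epsilon>"] b \<epsilon>L by simp
  qed
  have pM_eq: "p x = x" if "x \<in> carrier ?M" for x using that by (simp add: p_def)
  have \<epsilon>M: "\<epsilon> \<odot>\<^bsub>?M\<^esub> x = \<zero>\<^bsub>?M\<^esub>" if xM: "x \<in> carrier ?M" for x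
  proof -
    obtain a where a: "a \<in> carrier L" "x = q a" using ex xM by auto
    then have "x = p (q a)" using pM_eq[OF xM] by simp
    then show ?thesis using \<epsilon>p[OF a(1)] by simp
  qed
  define n where "n = q \<epsilon>"
  have nU: "n \<in> carrier ?U" and n0: "n \<noteq> \<zero>\<^bsub>?U\<^esub>" and \<epsilon>n: "\<epsilon> \<odot>\<^bsub>?U\<^esub> n = n"
    using qc qz \<epsilon>L \<epsilon>I0 qs[of \<epsilon> \<epsilon>] by (auto simp: n_def \<epsilon>\<epsilon>)
  have "r n = n" using r(2)[OF \<epsilon>L] by (simp add: n_def \<epsilon>\<epsilon>)
  then have nN: "n \<in> carrier ?N" using imageI[OF nU, of r] by simp
  have gN: "\<exists>b\<in>carrier L. x = b \<odot>\<^bsub>?U\<^esub> n" if xN: "x \<in> carrier ?N" for x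
  proof -
    obtain y where y: "y \<in> carrier ?U" "x = r y" using xN by auto
    obtain b where b: "b \<in> carrier L" "y = q b" using ex[OF y(1)] by blast
    then show ?thesis using r(2) qs[of b \<epsilon>] \<epsilon>L y by (intro bexI[of _ b]) (simp_all add: n_def)
  qed
  \<comment> \<open>In a decomposition the generator is a sum \<open>n = a + b\<close>, and
    \<open>\<epsilon> a\<close> is a scalar multiple \<open>c n\<close>. If \<open>c\<close> is zero
    then \<open>n = \<epsilon> b\<close>, otherwise \<open>n\<close> is a multiple of
    \<open>\<epsilon> a\<close>; so one part contains the generator.\<close>
  have "indecomposable L ?N"
    unfolding indecomposable_def
  proof (intro conjI allI impI)
    show "carrier ?N \<noteq> {\<zero>\<^bsub>?N\<^esub>}" using nN n0 by auto
    fix A B assume AB: "complementary L ?N A B"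
    then have s: "submodule A L ?N" "submodule B L ?N" and i: "A \<inter> B = {\<zero>\<^bsub>?U\<^esub>}"
      and dec: "\<forall>x\<in>carrier ?N. \<exists>a\<in>A. \<exists>b\<in>B. x = a \<oplus>\<^bsub>?U\<^esub> b" by (simp_all add: complementary_iff[OF N.left_module_axioms])
    obtain a b where ab: "a \<in> A" "b \<in> B" "n = a \<oplus>\<^bsub>?U\<^esub> b" using bspec[OF dec nN] by blast
    have mem: "a \<in> carrier ?N" "b \<in> carrier ?N" using N.sub_mem[OF s(1) ab(1)] N.sub_mem[OF s(2) ab(2)] by auto
    have all: "A = carrier ?N" if "n \<in> A" "submodule A L ?N" for A
    proof -
      have "carrier ?N \<subseteq> A"
      proof
        fix x assume "x \<in> carrier ?N"
        then obtain b where "b \<in> carrier L" "x = b \<odot>\<^bsub>?U\<^esub> n" using gN by blast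
        then show "x \<in> A" using N.sub_smult[OF that(2) _ that(1)] by simp
      qed
      then show ?thesis using N.sub_subset[OF that(2)] by blast
    qed
    obtain b0 where b0: "b0 \<in> carrier L" "a = b0 \<odot>\<^bsub>?U\<^esub> n" using gN[OF mem(1)] by blast
    obtain c where c: "c \<in> carrier K" "\<epsilon> \<otimes>\<^bsub>L\<^esub> b0 \<otimes>\<^bsub>L\<^esub> \<epsilon> = c \<odot>\<^bsub>L\<^esub> \<epsilon>" using \<epsilon>b\<epsilon>[OF b0(1)] by blast
    have "\<epsilon> \<odot>\<^bsub>?U\<^esub> a = (\<epsilon> \<otimes>\<^bsub>L\<^esub> b0 \<otimes>\<^bsub>L\<^esub> \<epsilon>) \<odot>\<^bsub>?U\<^esub> n"
      unfolding b0(2) using b0(1) nU \<epsilon>n \<epsilon>L U.smult_assoc1[of "\<epsilon> \<otimes>\<^bsub>L\<^esub> b0" \<epsilon> n] U.smult_assoc1[of \<epsilon> b0 n] by simp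
    also have "\<dots> = sc c \<odot>\<^bsub>?U\<^esub> n"
      unfolding c(2) using U.smult_assoc1[of "sc c" \<epsilon> n] c(1) \<epsilon>L nU \<epsilon>n by simp
    finally have \<epsilon>a: "\<epsilon> \<odot>\<^bsub>?U\<^esub> a = sc c \<odot>\<^bsub>?U\<^esub> n" .
    have \<epsilon>aA: "\<epsilon> \<odot>\<^bsub>?U\<^esub> a \<in> A" "\<epsilon> \<odot>\<^bsub>?U\<^esub> b \<in> B" using N.sub_smult[OF s(1) \<epsilon>L ab(1)] N.sub_smult[OF s(2) \<epsilon>L ab(2)] by auto
    have "n \<in> A \<or> n \<in> B"
    proof (cases "c = \<zero>\<^bsub>K\<^esub>")
      case True
      then have "\<epsilon> \<odot>\<^bsub>?U\<^esub> a = \<zero>\<^bsub>?U\<^esub>" using \<epsilon>a nU by simp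
      moreover have mU: "a \<in> carrier ?U" "b \<in> carrier ?U" using mem U.sub_mem[OF sN] by auto
      ultimately have "n = \<epsilon> \<odot>\<^bsub>?U\<^esub> b" using \<epsilon>n ab(3) U.smult_r_distr[OF \<epsilon>L mU] \<epsilon>L by simp
      then show ?thesis using \<epsilon>aA(2) by simp
    next
      case False
      then have i: "inv\<^bsub>K\<^esub> c \<in> carrier K" "inv\<^bsub>K\<^esub> c \<otimes>\<^bsub>K\<^esub> c = \<one>\<^bsub>K\<^esub>" using c(1) K.field_Units by auto
      have "sc (inv\<^bsub>K\<^esub> c) \<odot>\<^bsub>?U\<^esub> (\<epsilon> \<odot>\<^bsub>?U\<^esub> a) = sc (inv\<^bsub>K\<^esub> c \<otimes>\<^bsub>K\<^esub> c) \<odot>\<^bsub>?U\<^esub> n"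
        unfolding \<epsilon>a using i(1) c(1) nU U.smult_assoc1[of "sc (inv\<^bsub>K\<^esub> c)" "sc c" n] KL.smult_assoc1[of "inv\<^bsub>K\<^esub> c" c "\<one>\<^bsub>L\<^esub>"]
        by (simp del: mult_sc)
      also have "\<dots> = n" using i nU by simp
      finally have "sc (inv\<^bsub>K\<^esub> c) \<odot>\<^bsub>?U\<^esub> (\<epsilon> \<odot>\<^bsub>?U\<^esub> a) = n" .
      then show ?thesis using N.sub_smult[OF s(1) sc_closed[OF i(1)] \<epsilon>aA(1)] by simp
    qed
    then have "A = carrier ?N \<or> B = carrier ?N" using all s by blast
    then show "A = {\<zero>\<^bsub>?N\<^esub>} \<or> B = {\<zero>\<^bsub>?N\<^esub>}" using i N.sub_subset[OF s(1)] N.sub_subset[OF s(2)] by auto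
  qed
  moreover have "\<exists>y\<in>carrier ?N. \<epsilon> \<odot>\<^bsub>?N\<^esub> y \<noteq> \<zero>\<^bsub>?N\<^esub>" using nN \<epsilon>n n0 by (intro bexI[of _ n]) simp_all
  ultimately have "num_summands L ?U = Suc (num_summands L ?M)"
    using num_biproduct[OF fgm_sub[OF fgU sM] \<epsilon>M fgm_sub[OF fgU sN] _ _ fgU bi] by blast
  moreover have "num_summands L ?M = num_summands L (regular_quot e')"
  proof (rule num_regular_quot[OF e'L M.left_module_axioms lin_comp[OF q(1) pM]])
    show "(\<lambda>x. p (q x)) ` carrier L = carrier ?M"
    proof
      show "(\<lambda>x. p (q x)) ` carrier L \<subseteq> carrier ?M" using lin_closed[OF pM] qc by auto
      show "carrier ?M \<subseteq> (\<lambda>x. p (q x)) ` carrier L"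
      proof
        fix x assume x: "x \<in> carrier ?M"
        then obtain a where "a \<in> carrier L" "x = q a" using ex by auto
        then show "x \<in> (\<lambda>x. p (q x)) ` carrier L" using pM_eq[OF x] by (intro image_eqI[of _ _ a]) auto
      qed
    qed
    interpret I': ideal "Idl\<^bsub>L\<^esub> {e'}" L by (rule ideal_I[OF e'L])
    have e'I: "e' \<in> Idl\<^bsub>L\<^esub> {e'}" by (rule R.genideal_self'[OF e'L])
    have "\<epsilon> \<otimes>\<^bsub>L\<^esub> e' = \<epsilon>" using \<epsilon>L e0L by (simp add: R.r_distr \<epsilon>\<epsilon> \<epsilon>e0)
    then have \<epsilon>I: "\<epsilon> \<in> Idl\<^bsub>L\<^esub> {e'}" using I'.I_l_closed[OF e'I \<epsilon>L] by simp
    have "e' \<oplus>\<^bsub>L\<^esub> \<ominus>\<^bsub>L\<^esub> \<epsilon> = e0" using \<epsilon>L e0L by (simp add: R.a_assoc R.r_neg)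
    then have "e0 \<in> Idl\<^bsub>L\<^esub> {e'}" using e'I \<epsilon>I I'.a_closed I'.a_inv_closed by metis
    then have I0I: "I0 \<subseteq> Idl\<^bsub>L\<^esub> {e'}" by (intro R.genideal_minimal[OF ideal_I[OF e'L]]) simp
    \<comment> \<open>This is the kernel of the projection of \<open>L\<close> onto
      \<open>?M\<close>; that it is an ideal containing \<open>e'\<close> gives one of the two
      inclusions identifying it with the ideal generated by \<open>e'\<close>.\<close>
    let ?J = "{b \<in> carrier L. b \<ominus>\<^bsub>L\<^esub> b \<otimes>\<^bsub>L\<^esub> \<epsilon> \<in> I0}"
    have J1: "b \<oplus>\<^bsub>L\<^esub> b' \<in> ?J" if "b \<in> ?J" "b' \<in> ?J" for b b'
    proof -
      have "(b \<oplus>\<^bsub>L\<^esub> b') \<ominus>\<^bsub>L\<^esub> (b \<oplus>\<^bsub>L\<^esub> b') \<otimes>\<^bsub>L\<^esub> \<epsilon> = (b \<ominus>\<^bsub>L\<^esub> b \<otimes>\<^bsub>L\<^esub> \<epsilon>) \<oplus>\<^bsub>L\<^esub> (b' \<ominus>\<^bsub>L\<^esub> b' \<otimes>\<^bsub>L\<^esub> \<epsilon>)"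
        using that \<epsilon>L by (simp add: R.minus_eq R.l_distr R.minus_add R.a_ac)
      also have "\<dots> \<in> I0" using that by simp
      finally show ?thesis using that by simp
    qed
    have J2: "a \<otimes>\<^bsub>L\<^esub> b \<in> ?J" if "b \<in> ?J" "a \<in> carrier L" for a b
    proof -
      have "(a \<otimes>\<^bsub>L\<^esub> b) \<ominus>\<^bsub>L\<^esub> (a \<otimes>\<^bsub>L\<^esub> b) \<otimes>\<^bsub>L\<^esub> \<epsilon> = a \<otimes>\<^bsub>L\<^esub> (b \<ominus>\<^bsub>L\<^esub> b \<otimes>\<^bsub>L\<^esub> \<epsilon>)"
        using that \<epsilon>L by (simp add: R.minus_eq R.r_distr R.r_minus R.m_assoc)
      also have "\<dots> \<in> I0" using that by (intro I0.I_l_closed) auto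
      finally show ?thesis using that by simp
    qed
    \<comment> \<open>Closure on this side rests on
      \<open>\<epsilon> a = \<epsilon> a \<epsilon>\<close>, which makes the map
      \<open>b \<mapsto> b - b \<epsilon>\<close> multiplicative.\<close>
    have J3: "b \<otimes>\<^bsub>L\<^esub> a \<in> ?J" if "b \<in> ?J" "a \<in> carrier L" for a b
    proof -
      have b: "b \<in> carrier L" "b \<ominus>\<^bsub>L\<^esub> b \<otimes>\<^bsub>L\<^esub> \<epsilon> \<in> I0" using that by auto
      have "(b \<otimes>\<^bsub>L\<^esub> \<epsilon>) \<otimes>\<^bsub>L\<^esub> a = (b \<otimes>\<^bsub>L\<^esub> \<epsilon>) \<otimes>\<^bsub>L\<^esub> (a \<otimes>\<^bsub>L\<^esub> \<epsilon>)"
        using \<epsilon>b[OF that(2)] b that(2) \<epsilon>L by (simp add: R.m_assoc)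
      then have eq: "(b \<ominus>\<^bsub>L\<^esub> b \<otimes>\<^bsub>L\<^esub> \<epsilon>) \<otimes>\<^bsub>L\<^esub> (a \<ominus>\<^bsub>L\<^esub> a \<otimes>\<^bsub>L\<^esub> \<epsilon>) = (b \<otimes>\<^bsub>L\<^esub> a) \<ominus>\<^bsub>L\<^esub> (b \<otimes>\<^bsub>L\<^esub> a) \<otimes>\<^bsub>L\<^esub> \<epsilon>"
        using b that(2) \<epsilon>L KL.diff_diff_right[of "b \<otimes>\<^bsub>L\<^esub> a" "b \<otimes>\<^bsub>L\<^esub> (a \<otimes>\<^bsub>L\<^esub> \<epsilon>)" "b \<otimes>\<^bsub>L\<^esub> (\<epsilon> \<otimes>\<^bsub>L\<^esub> (a \<otimes>\<^bsub>L\<^esub> \<epsilon>))", unfolded a_minus_def]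
        by (simp add: R.minus_eq R.l_distr R.r_distr R.l_minus R.r_minus R.m_assoc)
      have "(b \<ominus>\<^bsub>L\<^esub> b \<otimes>\<^bsub>L\<^esub> \<epsilon>) \<otimes>\<^bsub>L\<^esub> (a \<ominus>\<^bsub>L\<^esub> a \<otimes>\<^bsub>L\<^esub> \<epsilon>) \<in> I0" using b that(2) \<epsilon>L by (intro I0.I_r_closed) auto
      then show ?thesis using eq b(1) that(2) by simp
    qed
    have J: "ideal ?J L"
    proof (rule idealI[OF R.ring_axioms R.add.subgroupI])
      fix a assume a: "a \<in> ?J"
      have "(\<ominus>\<^bsub>L\<^esub> \<one>\<^bsub>L\<^esub>) \<otimes>\<^bsub>L\<^esub> a \<in> ?J" by (rule J2[OF a]) simp
      then show "\<ominus>\<^bsub>L\<^esub> a \<in> ?J" using a by (simp add: R.l_minus)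
    qed (use J1 J2 J3 \<epsilon>L in \<open>auto simp: R.minus_eq intro!: exI[of _ "\<zero>\<^bsub>L\<^esub>"]\<close>)
    have "e' \<ominus>\<^bsub>L\<^esub> e' \<otimes>\<^bsub>L\<^esub> \<epsilon> = e0" using \<epsilon>L e0L by (simp add: R.l_distr R.minus_eq \<epsilon>\<epsilon> e0\<epsilon> R.a_assoc R.r_neg)
    then have "e' \<in> ?J" using e'L R.genideal_self'[OF e0L] by simp
    then have IJ: "Idl\<^bsub>L\<^esub> {e'} \<subseteq> ?J" by (intro R.genideal_minimal[OF J]) simp
    fix b assume b: "b \<in> carrier L"
    have "p (q b) = \<zero>\<^bsub>?M\<^esub> \<longleftrightarrow> b \<ominus>\<^bsub>L\<^esub> b \<otimes>\<^bsub>L\<^esub> \<epsilon> \<in> I0" using qp[OF b] qz b \<epsilon>L by simp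
    also have "\<dots> \<longleftrightarrow> b \<in> Idl\<^bsub>L\<^esub> {e'}"
    proof
      assume "b \<ominus>\<^bsub>L\<^esub> b \<otimes>\<^bsub>L\<^esub> \<epsilon> \<in> I0"
      then have "(b \<ominus>\<^bsub>L\<^esub> b \<otimes>\<^bsub>L\<^esub> \<epsilon>) \<oplus>\<^bsub>L\<^esub> b \<otimes>\<^bsub>L\<^esub> \<epsilon> \<in> Idl\<^bsub>L\<^esub> {e'}" using I0I I'.I_l_closed[OF \<epsilon>I b] by (intro I'.a_closed) auto
      then show "b \<in> Idl\<^bsub>L\<^esub> {e'}" using b \<epsilon>L by (simp add: R.minus_eq R.a_assoc R.l_neg)
    next
      assume "b \<in> Idl\<^bsub>L\<^esub> {e'}" then show "b \<ominus>\<^bsub>L\<^esub> b \<otimes>\<^bsub>L\<^esub> \<epsilon> \<in> I0" using IJ by blast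
    qed
    finally show "p (q b) = \<zero>\<^bsub>?M\<^esub> \<longleftrightarrow> b \<in> Idl\<^bsub>L\<^esub> {e'}" .
  qed
  ultimately show ?thesis by simp
qed

theorem extension:
  assumes num: "num_summands L T = num_summands L (regular_quot e')" and basic: "basic_module L T"
  obtains S N i1 i2 p1 p2 where "S \<in> fgmod L" "rig L e0 S" "num_summands L S = num_summands L (regular_quot e0)"
    "basic_module L S" "N \<in> fgmod L" "indecomposable L N" "\<exists>y\<in>carrier N. \<epsilon> \<odot>\<^bsub>N\<^esub> y \<noteq> \<zero>\<^bsub>N\<^esub>" "biproduct L S T N i1 i2 p1 p2"
proof -
  obtain N where N: "N \<in> kmod L e0" "lifts L tors (kmod L e0) N" "tors N" "\<exists>y\<in>carrier N. \<epsilon> \<odot>\<^bsub>N\<^esub> y \<noteq> \<zero>\<^bsub>N\<^esub>"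
    "indecomposable L N" using ex_new_summand by blast
  have fg: "fgm L T" "fgm L N" using T(1) N(1) by (auto simp: kmod_def fgmod_iff)
  obtain S :: "('k, 'a) fdmod" and i1 i2 p1 p2 where S: "S \<in> fgmod L" "biproduct L S T N i1 i2 p1 p2"
    by (rule ex_biproduct[OF fg])
  have fgS: "fgm L S" using S(1) by (simp add: fgmod_iff)
  have "num_summands L S = Suc (num_summands L T)" by (rule num_biproduct[OF fg(1) \<epsilon>T fg(2) N(5,4) fgS S(2)])
  moreover have "basic_module L S"
    by (rule basic_biproduct[OF T(3) \<epsilon>T basic fgm_module[OF fg(2)] N(5,4) fgm_module[OF fgS] S(2)])
  moreover have "rig L e0 S" by (rule extend_rigid[OF N(1-3) S])
  ultimately show ?thesis using that[OF S(1) _ _ _ _ N(5,4) S(2)] num num_regular_quot_new fg(2) by (simp add: fgmod_iff)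
qed

end

section \<open>Cancellation\<close>

text \<open>The component \<open>u\<close> from \<open>N\<close> to \<open>N'\<close> of the
  isomorphism is invertible: the other contribution to the identity of \<open>N\<close> passes
  through \<open>T'\<close>, on which \<open>\<epsilon>\<close> is zero. Eliminating with an
  invertible entry leaves an isomorphism between the complements.\<close>

lemma cancel_new_vertex:
  fixes T T' N N' S S' :: "('a, 'm) module"
  assumes T: "left_module L T" "left_module L T'" and N: "left_module L N" "left_module L N'"
    and S: "left_module L S" "left_module L S'"
    and b: "biproduct L S T N i1 i2 p1 p2" and b': "biproduct L S' T' N' j1 j2 q1 q2"
    and fl: "fin_len L N" "fin_len L N'" and ind: "indecomposable L N" "indecomposable L N'"
    and \<epsilon>: "\<epsilon> \<in> carrier L" and \<epsilon>T: "\<And>x. x \<in> carrier T \<Longrightarrow> \<epsilon> \<odot>\<^bsub>T\<^esub> x = \<zero>\<^bsub>T\<^esub>" "\<And>x. x \<in> carrier T' \<Longrightarrow> \<epsilon> \<odot>\<^bsub>T'\<^esub> x = \<zero>\<^bsub>T'\<^esub>"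
    and \<epsilon>N: "\<exists>y\<in>carrier N. \<epsilon> \<odot>\<^bsub>N\<^esub> y \<noteq> \<zero>\<^bsub>N\<^esub>" "\<exists>y\<in>carrier N'. \<epsilon> \<odot>\<^bsub>N'\<^esub> y \<noteq> \<zero>\<^bsub>N'\<^esub>"
    and iso: "mod_iso L S S'"
  shows "mod_iso L T T'"
proof -
  interpret N: left_module L N by (rule N(1))
  interpret N': left_module L N' by (rule N(2))
  interpret S: left_module L S by (rule S(1))
  interpret S': left_module L S' by (rule S(2))
  interpret T': left_module L T' by (rule T(2))
  obtain \<phi> where \<phi>: "lin L S S' \<phi>" "bij_betw \<phi> (carrier S) (carrier S')"
    using iso by (auto simp: mod_iso_iff[OF S(1)])
  obtain \<psi> where \<psi>: "lin L S' S \<psi>" "\<forall>x\<in>carrier S. \<psi> (\<phi> x) = x" "\<forall>y\<in>carrier S'. \<phi> (\<psi> y) = y"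
    using lin_inverse[OF S(1) \<phi>] by blast
  note B = biproductD[OF b] and B' = biproductD[OF b']
  note Bc = B(1-4)[THEN lin_closed] and Bc' = B'(1-4)[THEN lin_closed]
  note \<phi>c = lin_closed[OF \<phi>(1)] and \<psi>c = lin_closed[OF \<psi>(1)]
  \<comment> \<open>The endomorphism through \<open>U\<close> kills a nonzero element
    \<open>\<epsilon> y\<close> and is not injective. By locality the other summand of the identity
    is bijective.\<close>
  have bij: "bij_betw (\<lambda>x. v (u x)) (carrier A) (carrier A)"
    if lm: "left_module L A" "left_module L C" "left_module L U" and fA: "fin_len L A" "indecomposable L A"
      and eA: "\<exists>y\<in>carrier A. \<epsilon> \<odot>\<^bsub>A\<^esub> y \<noteq> \<zero>\<^bsub>A\<^esub>" and eU: "\<And>x. x \<in> carrier U \<Longrightarrow> \<epsilon> \<odot>\<^bsub>U\<^esub> x = \<zero>\<^bsub>U\<^esub>"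
      and l: "lin L A C u" "lin L C A v" "lin L A U w" "lin L U A z"
      and id: "\<And>x. x \<in> carrier A \<Longrightarrow> z (w x) \<oplus>\<^bsub>A\<^esub> v (u x) = x"
    for A C U :: "('a, 'm) module" and u v w z
  proof -
    have 1: "bij_betw (\<lambda>x. z (w x) \<oplus>\<^bsub>A\<^esub> v (u x)) (carrier A) (carrier A)"
      using id by (auto simp: bij_betw_def inj_on_def)
    obtain y where y: "y \<in> carrier A" "\<epsilon> \<odot>\<^bsub>A\<^esub> y \<noteq> \<zero>\<^bsub>A\<^esub>" using eA by blast
    interpret A: left_module L A by (rule lm(1))
    have \<epsilon>y: "\<epsilon> \<odot>\<^bsub>A\<^esub> y \<in> carrier A" using y \<epsilon> by simp
    have "w (\<epsilon> \<odot>\<^bsub>A\<^esub> y) = \<zero>\<^bsub>U\<^esub>" using lin_smult[OF l(3) \<epsilon> y(1)] eU[OF lin_closed[OF l(3) y(1)]] by simp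
    then have "z (w (\<epsilon> \<odot>\<^bsub>A\<^esub> y)) = \<zero>\<^bsub>A\<^esub>" using lin_zero[OF lm(3,1) l(4)] by simp
    then have "\<not> inj_on (\<lambda>x. z (w x)) (carrier A)"
      using lin_inj_iff[OF lm(1,1) lin_comp[OF l(3,4)]] \<epsilon>y y(2) by auto
    then show ?thesis
      using indecomposable_local[OF lm(1) fA lin_comp[OF l(3,4)] lin_comp[OF l(1,2)] 1] by (auto simp: bij_betw_def)
  qed
  define u where "u x = q2 (\<phi> (i2 x))" for x
  define v where "v y = p2 (\<psi> (j2 y))" for y
  have u: "lin L N N' u" unfolding u_def by (rule lin_comp[OF lin_comp[OF B(2) \<phi>(1)] B'(4)])
  have v: "lin L N' N v" unfolding v_def by (rule lin_comp[OF lin_comp[OF B'(2) \<psi>(1)] B(4)])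
  have vu: "bij_betw (\<lambda>x. v (u x)) (carrier N) (carrier N)"
  proof (rule bij[OF N(1,2) T(2) fl(1) ind(1) \<epsilon>N(1) \<epsilon>T(2) u v])
    show "lin L N T' (\<lambda>x. q1 (\<phi> (i2 x)))" by (rule lin_comp[OF lin_comp[OF B(2) \<phi>(1)] B'(3)])
    show "lin L T' N (\<lambda>x. p2 (\<psi> (j1 x)))" by (rule lin_comp[OF lin_comp[OF B'(1) \<psi>(1)] B(4)])
    fix x assume x: "x \<in> carrier N"
    note fx = \<phi>c[OF Bc(2)[OF x]]
    have "p2 (\<psi> (j1 (q1 (\<phi> (i2 x))))) \<oplus>\<^bsub>N\<^esub> v (u x) = p2 (\<psi> (j1 (q1 (\<phi> (i2 x))) \<oplus>\<^bsub>S'\<^esub> j2 (q2 (\<phi> (i2 x)))))"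
      unfolding v_def u_def using fx Bc' \<psi>c by (simp add: lin_add[OF \<psi>(1)] lin_add[OF B(4)])
    also have "\<dots> = x" using B'(9)[OF fx] \<psi>(2) Bc(2)[OF x] B(7)[OF x] by simp
    finally show "p2 (\<psi> (j1 (q1 (\<phi> (i2 x))))) \<oplus>\<^bsub>N\<^esub> v (u x) = x" .
  qed
  have uv: "bij_betw (\<lambda>x. u (v x)) (carrier N') (carrier N')"
  proof (rule bij[OF N(2,1) T(1) fl(2) ind(2) \<epsilon>N(2) \<epsilon>T(1) v u])
    show "lin L N' T (\<lambda>x. p1 (\<psi> (j2 x)))" by (rule lin_comp[OF lin_comp[OF B'(2) \<psi>(1)] B(3)])
    show "lin L T N' (\<lambda>x. q2 (\<phi> (i1 x)))" by (rule lin_comp[OF lin_comp[OF B(1) \<phi>(1)] B'(4)])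
    fix x assume x: "x \<in> carrier N'"
    note fx = \<psi>c[OF Bc'(2)[OF x]]
    have "q2 (\<phi> (i1 (p1 (\<psi> (j2 x))))) \<oplus>\<^bsub>N'\<^esub> u (v x) = q2 (\<phi> (i1 (p1 (\<psi> (j2 x))) \<oplus>\<^bsub>S\<^esub> i2 (p2 (\<psi> (j2 x)))))"
      unfolding v_def u_def using fx Bc \<phi>c by (simp add: lin_add[OF \<phi>(1)] lin_add[OF B'(4)])
    also have "\<dots> = x" using B(9)[OF fx] \<psi>(3) Bc'(2)[OF x] B'(7)[OF x] by simp
    finally show "q2 (\<phi> (i1 (p1 (\<psi> (j2 x))))) \<oplus>\<^bsub>N'\<^esub> u (v x) = x" .
  qed
  have "inj_on u (carrier N)" using vu by (auto simp: bij_betw_def inj_on_def)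
  moreover have "u ` carrier N = carrier N'"
  proof
    show "u ` carrier N \<subseteq> carrier N'" using lin_closed[OF u] by blast
    show "carrier N' \<subseteq> u ` carrier N"
    proof
      fix y assume "y \<in> carrier N'"
      then have "y \<in> (\<lambda>x. u (v x)) ` carrier N'" using uv by (simp add: bij_betw_def)
      then show "y \<in> u ` carrier N" using lin_closed[OF v] by blast
    qed
  qed
  ultimately have ubij: "bij_betw u (carrier N) (carrier N')" by (simp add: bij_betw_def)
  obtain w where w: "lin L N' N w" "\<forall>x\<in>carrier N. w (u x) = x" "\<forall>y\<in>carrier N'. u (w y) = y"
    using lin_inverse[OF N(1) u ubij] by blast
  \<comment> \<open>Gaussian elimination: subtracting the correction by the inverse \<open>w\<close>
    of \<open>u\<close> moves \<open>T\<close> into the kernel of \<open>q2\<close> after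
    \<open>\<phi>\<close>, that is, into the part of \<open>S\<close> that corresponds to
    \<open>T'\<close>.\<close>
  define \<kappa> where "\<kappa> t = i1 t \<ominus>\<^bsub>S\<^esub> i2 (w (q2 (\<phi> (i1 t))))" for t
  have l1: "lin L T N' (\<lambda>t. q2 (\<phi> (i1 t)))" by (rule lin_comp[OF lin_comp[OF B(1) \<phi>(1)] B'(4)])
  have \<kappa>: "lin L T S \<kappa>"
    unfolding \<kappa>_def by (rule lin_diff[OF S(1) B(1) lin_comp[OF lin_comp[OF l1 w(1)] B(2)]])
  note \<kappa>c = lin_closed[OF \<kappa>] and wc = lin_closed[OF w(1)]
  have q2\<phi>: "q2 (\<phi> (\<kappa> t)) = \<zero>\<^bsub>N'\<^esub>" if t: "t \<in> carrier T" for t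
  proof -
    note g = lin_closed[OF l1 t]
    have "q2 (\<phi> (\<kappa> t)) = q2 (\<phi> (i1 t)) \<ominus>\<^bsub>N'\<^esub> u (w (q2 (\<phi> (i1 t))))"
      unfolding \<kappa>_def u_def using Bc \<phi>c t wc[OF g] g
      by (simp add: lin_minus[OF S \<phi>(1)] lin_minus[OF S(2) N(2) B'(4)])
    then show ?thesis using w(3) g by simp
  qed
  define s where "s t = q1 (\<phi> (\<kappa> t))" for t
  have s: "lin L T T' s" unfolding s_def by (rule lin_comp[OF lin_comp[OF \<kappa> \<phi>(1)] B'(3)])
  have \<phi>\<kappa>: "\<phi> (\<kappa> t) = j1 (s t)" if t: "t \<in> carrier T" for t
    using B'(9)[OF \<phi>c[OF \<kappa>c[OF t]]] q2\<phi>[OF t] lin_zero[OF N(2) S(2) B'(2)] Bc' \<phi>c \<kappa>c[OF t] by (simp add: s_def)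
  have p1\<kappa>: "p1 (\<kappa> t) = t" if t: "t \<in> carrier T" for t
    unfolding \<kappa>_def using Bc t wc lin_closed[OF l1 t] B(5)[OF t] B(8) left_module.diff_zero[OF T(1)]
    by (simp add: lin_minus[OF S(1) T(1) B(3)])
  have "inj_on s (carrier T)"
  proof (subst lin_inj_iff[OF T s], intro ballI impI)
    fix t assume t: "t \<in> carrier T" "s t = \<zero>\<^bsub>T'\<^esub>"
    then have "\<phi> (\<kappa> t) = \<zero>\<^bsub>S'\<^esub>" using \<phi>\<kappa> lin_zero[OF T(2) S(2) B'(1)] by simp
    then have "\<kappa> t = \<zero>\<^bsub>S\<^esub>" using \<psi>(2) \<kappa>c[OF t(1)] lin_zero[OF S(2,1) \<psi>(1)] by metis
    then show "t = \<zero>\<^bsub>T\<^esub>" using p1\<kappa>[OF t(1)] lin_zero[OF S(1) T(1) B(3)] by simp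
  qed
  moreover have "t' \<in> s ` carrier T" if t': "t' \<in> carrier T'" for t'
  proof -
    \<comment> \<open>Its component in \<open>N'\<close> vanishes, which determines
      \<open>p2 z\<close> from \<open>p1 z\<close> and shows that \<open>z\<close> is in the image
      of \<open>\<kappa>\<close>.\<close>
    define z where "z = \<psi> (j1 t')"
    have z: "z \<in> carrier S" "\<phi> z = j1 t'" using \<psi>c Bc' t' \<psi>(3) by (auto simp: z_def)
    note pz = Bc(3)[OF z(1)] Bc(4)[OF z(1)]
    have "\<zero>\<^bsub>N'\<^esub> = q2 (\<phi> (i1 (p1 z) \<oplus>\<^bsub>S\<^esub> i2 (p2 z)))" using B(9)[OF z(1)] z(2) B'(6)[OF t'] by simp
    also have "\<dots> = q2 (\<phi> (i1 (p1 z))) \<oplus>\<^bsub>N'\<^esub> u (p2 z)"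
      unfolding u_def using Bc \<phi>c pz by (simp add: lin_add[OF \<phi>(1)] lin_add[OF B'(4)])
    finally have "w (q2 (\<phi> (i1 (p1 z))) \<oplus>\<^bsub>N'\<^esub> u (p2 z)) = \<zero>\<^bsub>N\<^esub>" using lin_zero[OF N(2,1) w(1)] by simp
    then have 0: "w (q2 (\<phi> (i1 (p1 z)))) \<oplus>\<^bsub>N\<^esub> p2 z = \<zero>\<^bsub>N\<^esub>"
      using lin_add[OF w(1) lin_closed[OF l1 pz(1)] lin_closed[OF u pz(2)]] w(2) pz by simp
    then have "p2 z = \<ominus>\<^bsub>N\<^esub> w (q2 (\<phi> (i1 (p1 z))))"
      using N.M.minus_equality[OF 0] pz(2) wc[OF lin_closed[OF l1 pz(1)]] N.M.minus_minus by metis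
    then have "z = i1 (p1 z) \<oplus>\<^bsub>S\<^esub> i2 (\<ominus>\<^bsub>N\<^esub> w (q2 (\<phi> (i1 (p1 z)))))" using B(9)[OF z(1)] by simp
    also have "\<dots> = \<kappa> (p1 z)"
      unfolding \<kappa>_def using lin_neg[OF N(1) S(1) B(2) wc[OF lin_closed[OF l1 pz(1)]]] by (simp add: S.M.minus_eq)
    finally have "z = \<kappa> (p1 z)" .
    then have "j1 t' = j1 (s (p1 z))" using \<phi>\<kappa>[OF pz(1)] z(2) by simp
    then have "t' = s (p1 z)" using B'(5)[OF t'] B'(5)[OF lin_closed[OF s pz(1)]] by metis
    then show ?thesis using pz(1) by blast
  qed
  ultimately have "bij_betw s (carrier T) (carrier T')" using lin_closed[OF s] by (auto simp: bij_betw_def)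
  then show ?thesis by (rule mod_isoI[OF T(1) s])
qed

section \<open>The one-point extension\<close>

locale one_point = fdalg K A for K :: "'k ring" and A :: "('k, 'a) module" +
  fixes M :: "('a, 'm) module"
  assumes M: "left_module A M" "fin_gen A M"
begin

definition "B = one_point_extension K A M"

sublocale M: left_module A M by (rule M)

lemma B_simps [simp]: "carrier B = carrier A \<times> carrier M \<times> carrier K"
  "(a, x, c) \<otimes>\<^bsub>B\<^esub> (a', x', c') = (a \<otimes>\<^bsub>A\<^esub> a', a \<odot>\<^bsub>M\<^esub> x' \<oplus>\<^bsub>M\<^esub> sc c' \<odot>\<^bsub>M\<^esub> x, c \<otimes>\<^bsub>K\<^esub> c')"
  "\<one>\<^bsub>B\<^esub> = (\<one>\<^bsub>A\<^esub>, \<zero>\<^bsub>M\<^esub>, \<one>\<^bsub>K\<^esub>)" "\<zero>\<^bsub>B\<^esub> = (\<zero>\<^bsub>A\<^esub>, \<zero>\<^bsub>M\<^esub>, \<zero>\<^bsub>K\<^esub>)"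
  "(a, x, c) \<oplus>\<^bsub>B\<^esub> (a', x', c') = (a \<oplus>\<^bsub>A\<^esub> a', x \<oplus>\<^bsub>M\<^esub> x', c \<oplus>\<^bsub>K\<^esub> c')"
  "t \<odot>\<^bsub>B\<^esub> (a, x, c) = (t \<odot>\<^bsub>A\<^esub> a, sc t \<odot>\<^bsub>M\<^esub> x, t \<otimes>\<^bsub>K\<^esub> c)"
  by (simp_all add: B_def one_point_extension_def)

lemma sc_sc: "c \<in> carrier K \<Longrightarrow> d \<in> carrier K \<Longrightarrow> x \<in> carrier M \<Longrightarrow> sc c \<odot>\<^bsub>M\<^esub> (sc d \<odot>\<^bsub>M\<^esub> x) = sc (c \<otimes>\<^bsub>K\<^esub> d) \<odot>\<^bsub>M\<^esub> x"
  using M.smult_assoc1[of "sc c" "sc d" x] KL.smult_assoc1[of c d "\<one>\<^bsub>A\<^esub>"] by (simp del: mult_sc)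

lemma sc_comm: "a \<in> carrier A \<Longrightarrow> c \<in> carrier K \<Longrightarrow> x \<in> carrier M \<Longrightarrow> a \<odot>\<^bsub>M\<^esub> (sc c \<odot>\<^bsub>M\<^esub> x) = sc c \<odot>\<^bsub>M\<^esub> (a \<odot>\<^bsub>M\<^esub> x)"
  by (simp add: M.smult_assoc1[symmetric])

lemma fd_B: "fd_algebra K B"
proof -
  \<comment> \<open>As a vector space \<open>B\<close> is this direct sum, so its linear structure
    and its finite generation are transported along the identity.\<close>
  let ?D = "dsum A (dsum (rsc A M) (self_module K))"
  have fg: "fgm K A" "fgm K (rsc A M)" "fgm K (self_module K)"
  proof -
    show "fgm K A" using fd KL.left_module_axioms by (simp add: fgm_def fd_algebra_def)
    show "fgm K (rsc A M)" using M by (intro fgm_rsc) (simp add: fgm_def)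
    have SK: "left_module K (self_module K)" by (rule self_module[OF K.ring_axioms])
    interpret S: left_module K "self_module K" by (rule SK)
    have "c \<in> mspan K (self_module K) {\<one>\<^bsub>K\<^esub>}" if "c \<in> carrier K" for c
      using S.sub_smult[OF S.mspan_submodule that, of "{\<one>\<^bsub>K\<^esub>}" "\<one>\<^bsub>K\<^esub>"] S.mspan_superset[of "{\<one>\<^bsub>K\<^esub>}"] that by auto
    then have "mspan K (self_module K) {\<one>\<^bsub>K\<^esub>} = carrier (self_module K)"
      using S.sub_subset[OF S.mspan_submodule[of "{\<one>\<^bsub>K\<^esub>}"]] by auto
    then show "fgm K (self_module K)"
      using S.fin_gen_iff SK by (auto simp: fgm_def intro!: exI[of _ "{\<one>\<^bsub>K\<^esub>}"])
  qed
  have fgD: "fgm K ?D" by (intro fgm_dsum fg)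
  have lD: "left_module K ?D" by (rule fgm_module[OF fgD])
  have c: "(\<lambda>x. x) ` carrier ?D = carrier B" by (auto simp: dsum_def)
  have add: "(\<lambda>x. x) (x \<oplus>\<^bsub>?D\<^esub> y) = (\<lambda>x. x) x \<oplus>\<^bsub>B\<^esub> (\<lambda>x. x) y" for x y
    by (cases x; cases y) (auto simp: dsum_def)
  have sm: "(\<lambda>x. x) (t \<odot>\<^bsub>?D\<^esub> x) = t \<odot>\<^bsub>B\<^esub> (\<lambda>x. x) x" for t x
    by (cases x) (auto simp: dsum_def)
  have KB: "left_module K B"
    by (rule left_module_surj[OF lD c _ add sm]) (simp add: dsum_def)
  interpret KB: left_module K B by (rule KB)
  have "lin K ?D B (\<lambda>x. x)" using c by (intro linI add sm) auto
  then have fgB: "fin_gen K B" using fgm_surj[OF fgD KB _ c] by (simp add: fgm_def)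
  have "Group.monoid B"
  proof (rule monoidI)
    fix x y z assume "x \<in> carrier B" "y \<in> carrier B" "z \<in> carrier B"
    then obtain a m c a' m' c' a'' m'' c'' where xyz: "x = (a, m, c)" "y = (a', m', c')" "z = (a'', m'', c'')"
      and cl: "a \<in> carrier A" "m \<in> carrier M" "c \<in> carrier K" "a' \<in> carrier A" "m' \<in> carrier M" "c' \<in> carrier K"
        "a'' \<in> carrier A" "m'' \<in> carrier M" "c'' \<in> carrier K" by (cases x; cases y; cases z) auto
    have "a \<odot>\<^bsub>M\<^esub> (a' \<odot>\<^bsub>M\<^esub> m'' \<oplus>\<^bsub>M\<^esub> sc c'' \<odot>\<^bsub>M\<^esub> m') \<oplus>\<^bsub>M\<^esub> sc (c' \<otimes>\<^bsub>K\<^esub> c'') \<odot>\<^bsub>M\<^esub> m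
        = (a \<otimes>\<^bsub>A\<^esub> a') \<odot>\<^bsub>M\<^esub> m'' \<oplus>\<^bsub>M\<^esub> (sc c'' \<odot>\<^bsub>M\<^esub> (a \<odot>\<^bsub>M\<^esub> m') \<oplus>\<^bsub>M\<^esub> sc (c'' \<otimes>\<^bsub>K\<^esub> c') \<odot>\<^bsub>M\<^esub> m)"
      using cl by (simp add: M.smult_r_distr M.smult_assoc1[of a a'] sc_comm[of a c'' m'] M.M.a_assoc K.m_comm[of c' c''])
    also have "\<dots> = (a \<otimes>\<^bsub>A\<^esub> a') \<odot>\<^bsub>M\<^esub> m'' \<oplus>\<^bsub>M\<^esub> sc c'' \<odot>\<^bsub>M\<^esub> (a \<odot>\<^bsub>M\<^esub> m' \<oplus>\<^bsub>M\<^esub> sc c' \<odot>\<^bsub>M\<^esub> m)"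
      using cl by (simp add: M.smult_r_distr sc_sc[symmetric])
    finally show "x \<otimes>\<^bsub>B\<^esub> y \<otimes>\<^bsub>B\<^esub> z = x \<otimes>\<^bsub>B\<^esub> (y \<otimes>\<^bsub>B\<^esub> z)"
      using cl unfolding xyz by (simp add: R.m_assoc K.m_assoc)
  qed auto
  moreover have "ring_axioms B"
    by unfold_locales
      (auto simp: R.l_distr R.r_distr K.l_distr K.r_distr M.smult_l_distr M.smult_r_distr KL.smult_l_distr M.M.a_ac)
  ultimately have ringB: "ring B" using KB.M.abelian_group_axioms by (simp add: ring_def)
  have "module K B"
    by (rule moduleI[OF K.cring_axioms KB.M.abelian_group_axioms])
      (simp_all only: KB.smult_closed KB.smult_l_distr KB.smult_r_distr KB.smult_assoc1 KB.smult_one)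
  moreover have "(t \<odot>\<^bsub>B\<^esub> x) \<otimes>\<^bsub>B\<^esub> y = t \<odot>\<^bsub>B\<^esub> (x \<otimes>\<^bsub>B\<^esub> y) \<and> x \<otimes>\<^bsub>B\<^esub> (t \<odot>\<^bsub>B\<^esub> y) = t \<odot>\<^bsub>B\<^esub> (x \<otimes>\<^bsub>B\<^esub> y)"
    if "t \<in> carrier K" "x \<in> carrier B" "y \<in> carrier B" for t x y
  proof -
    obtain a m d a' m' d' where xy: "x = (a, m, d)" "y = (a', m', d')" "a \<in> carrier A" "m \<in> carrier M" "d \<in> carrier K"
      "a' \<in> carrier A" "m' \<in> carrier M" "d' \<in> carrier K" using \<open>x \<in> carrier B\<close> \<open>y \<in> carrier B\<close> by auto
    have "(t \<odot>\<^bsub>A\<^esub> a) \<odot>\<^bsub>M\<^esub> m' = sc t \<odot>\<^bsub>M\<^esub> (a \<odot>\<^bsub>M\<^esub> m')"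
      using that(1) xy by (simp add: M.smult_assoc1[symmetric])
    moreover have "sc d' \<odot>\<^bsub>M\<^esub> (sc t \<odot>\<^bsub>M\<^esub> m) = sc t \<odot>\<^bsub>M\<^esub> (sc d' \<odot>\<^bsub>M\<^esub> m)" "sc (t \<otimes>\<^bsub>K\<^esub> d') \<odot>\<^bsub>M\<^esub> m = sc t \<odot>\<^bsub>M\<^esub> (sc d' \<odot>\<^bsub>M\<^esub> m)"
      using sc_sc[of d' t m] sc_sc[of t d' m] K.m_comm[of d' t] that(1) xy by simp_all
    ultimately show ?thesis
      using that(1) xy by (simp add: smult_mult mult_smult M.smult_r_distr sc_comm[of a t m'] K.m_assoc K.m_lcomm del: sc_mult mult_sc)
  qed
  ultimately show ?thesis using K.field_axioms ringB fgB unfolding fd_algebra_def by blast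
qed

lemma proj_surj: "ring_surj B A fst"
proof (rule ring_surj.intro)
  show "ring B" using fd_B by (simp add: fd_algebra_def)
  have "a \<in> fst ` carrier B" if "a \<in> carrier A" for a
    by (rule image_eqI[of _ _ "(a, \<zero>\<^bsub>M\<^esub>, \<zero>\<^bsub>K\<^esub>)"]) (use that in auto)
  then show "fst ` carrier B = carrier A" by auto
qed (auto intro: R.ring_axioms)

end

section \<open>Idempotents and ideals of the one-point extension\<close>

context one_point begin

definition "E11 e = (e, \<zero>\<^bsub>M\<^esub>, \<zero>\<^bsub>K\<^esub>)"
definition "\<epsilon> = (\<zero>\<^bsub>A\<^esub>, \<zero>\<^bsub>M\<^esub>, \<one>\<^bsub>K\<^esub>)"

lemma ring_B: "ring B"
  using fd_B by (simp add: fd_algebra_def)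

lemma E11_closed [simp]: "e \<in> carrier A \<Longrightarrow> E11 e \<in> carrier B" and \<epsilon>_closed [simp]: "\<epsilon> \<in> carrier B"
  by (simp_all add: E11_def \<epsilon>_def)

lemma sum_closed: "e \<in> carrier A \<Longrightarrow> E11 e \<oplus>\<^bsub>B\<^esub> \<epsilon> \<in> carrier B"
  by (simp add: E11_def \<epsilon>_def)

lemma E11_idem: "e \<in> carrier A \<Longrightarrow> e \<otimes>\<^bsub>A\<^esub> e = e \<Longrightarrow> E11 e \<otimes>\<^bsub>B\<^esub> E11 e = E11 e"
  by (simp add: E11_def)

lemma sum_idem: "e \<in> carrier A \<Longrightarrow> e \<otimes>\<^bsub>A\<^esub> e = e \<Longrightarrow> (E11 e \<oplus>\<^bsub>B\<^esub> \<epsilon>) \<otimes>\<^bsub>B\<^esub> (E11 e \<oplus>\<^bsub>B\<^esub> \<epsilon>) = E11 e \<oplus>\<^bsub>B\<^esub> \<epsilon>"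
  by (simp add: E11_def \<epsilon>_def)

lemma \<epsilon>_absorb: "e \<in> carrier A \<Longrightarrow> \<epsilon> \<otimes>\<^bsub>B\<^esub> (E11 e \<oplus>\<^bsub>B\<^esub> \<epsilon>) = \<epsilon>"
  by (simp add: E11_def \<epsilon>_def)

text \<open>The kernel of the projection to \<open>A\<close> thus acts as zero on every module
  killed by \<open>\<epsilon>\<close>, which allows such modules to descend to
  \<open>A\<close>.\<close>

lemma fst_kernel: "b \<in> carrier B \<Longrightarrow> fst b = \<zero>\<^bsub>A\<^esub> \<Longrightarrow> b = b \<otimes>\<^bsub>B\<^esub> \<epsilon>"
  by (auto simp: \<epsilon>_def)

text \<open>The elements with last component zero form an ideal that contains \<open>E11 e\<close>
  but not \<open>\<epsilon>\<close>.\<close>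

lemma \<epsilon>_notin: assumes e: "e \<in> carrier A" shows "\<epsilon> \<notin> Idl\<^bsub>B\<^esub> {E11 e}"
proof -
  interpret B: ring B by (rule ring_B)
  let ?J = "{b \<in> carrier B. snd (snd b) = \<zero>\<^bsub>K\<^esub>}"
  have "snd (snd (\<ominus>\<^bsub>B\<^esub> b)) = \<zero>\<^bsub>K\<^esub>" if b: "b \<in> ?J" for b
  proof -
    have "\<ominus>\<^bsub>B\<^esub> b = (\<ominus>\<^bsub>B\<^esub> \<one>\<^bsub>B\<^esub>) \<otimes>\<^bsub>B\<^esub> b" using b by (simp add: B.l_minus del: B_simps)
    moreover obtain a x c where "\<ominus>\<^bsub>B\<^esub> \<one>\<^bsub>B\<^esub> = (a, x, c)" "c \<in> carrier K"
      using B.a_inv_closed[OF B.one_closed] by (auto simp del: B_simps(3))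
    ultimately show ?thesis using b by auto
  qed
  then have "subgroup ?J (add_monoid B)"
    by (intro B.add.subgroupI) (use B.a_inv_closed in \<open>auto intro!: exI[of _ "\<zero>\<^bsub>B\<^esub>"] simp del: B.add.inv_closed\<close>)
  then have "ideal ?J B"
    by (intro idealI ring_B) auto
  then have "Idl\<^bsub>B\<^esub> {E11 e} \<subseteq> ?J" using e by (intro B.genideal_minimal) (auto simp: E11_def)
  then show ?thesis by (auto simp: \<epsilon>_def)
qed

text \<open>The ideal on the right contains \<open>\<epsilon>\<close>, and \<open>b\<close> is the
  sum of \<open>E11 (fst b)\<close> and \<open>b \<epsilon>\<close>; membership therefore depends on
  the component in \<open>A\<close> only.\<close>

lemma fst_in_ideal_iff:
  assumes e: "e \<in> carrier A" and b: "b \<in> carrier B"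
  shows "fst b \<in> Idl\<^bsub>A\<^esub> {e} \<longleftrightarrow> b \<in> Idl\<^bsub>B\<^esub> {E11 e \<oplus>\<^bsub>B\<^esub> \<epsilon>}"
proof -
  interpret B: ring B by (rule ring_B)
  interpret P: ring_surj B A fst by (rule proj_surj)
  define e' where "e' = E11 e \<oplus>\<^bsub>B\<^esub> \<epsilon>"
  have e': "e' \<in> carrier B" using e by (simp add: e'_def del: B_simps)
  interpret I: ideal "Idl\<^bsub>A\<^esub> {e}" A using e by (intro R.genideal_ideal) simp
  interpret I': ideal "Idl\<^bsub>B\<^esub> {e'}" B using e' by (intro B.genideal_ideal) simp
  have mem: "e \<in> Idl\<^bsub>A\<^esub> {e}" "e' \<in> Idl\<^bsub>B\<^esub> {e'}" using R.genideal_self'[OF e] B.genideal_self'[OF e'] by simp_all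
  have "\<epsilon> \<otimes>\<^bsub>B\<^esub> e' \<in> Idl\<^bsub>B\<^esub> {e'}" by (rule I'.I_l_closed[OF mem(2) \<epsilon>_closed])
  then have \<epsilon>I: "\<epsilon> \<in> Idl\<^bsub>B\<^esub> {e'}" using \<epsilon>_absorb[OF e] by (simp add: e'_def)
  have "b \<in> Idl\<^bsub>B\<^esub> {e'}" if "fst b \<in> Idl\<^bsub>A\<^esub> {e}"
  proof -
    \<comment> \<open>\<open>E11\<close> preserves sums and products but not the unit, so the ideal
      property of this preimage is checked by hand.\<close>
    let ?J = "{a \<in> carrier A. E11 a \<in> Idl\<^bsub>B\<^esub> {e'}}"
    have sub: "?J \<subseteq> carrier A" by blast
    have mult: "E11 (a \<otimes>\<^bsub>A\<^esub> a') = E11 a \<otimes>\<^bsub>B\<^esub> E11 a'" "E11 (a \<oplus>\<^bsub>A\<^esub> a') = E11 a \<oplus>\<^bsub>B\<^esub> E11 a'"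
      if "a \<in> carrier A" "a' \<in> carrier A" for a a' using that by (simp_all add: E11_def)
    have J: "a \<otimes>\<^bsub>A\<^esub> a' \<in> ?J" "a' \<otimes>\<^bsub>A\<^esub> a \<in> ?J" if "a \<in> ?J" "a' \<in> carrier A" for a a'
      using that I'.I_l_closed[of "E11 a" "E11 a'"] I'.I_r_closed[of "E11 a" "E11 a'"] by (simp_all add: mult del: B_simps)
    have neg: "\<ominus>\<^bsub>A\<^esub> a \<in> ?J" if "a \<in> ?J" for a using J(2)[OF that, of "\<ominus>\<^bsub>A\<^esub> \<one>\<^bsub>A\<^esub>"] that by (simp add: R.l_minus)
    have "E11 \<zero>\<^bsub>A\<^esub> = \<zero>\<^bsub>B\<^esub>" by (simp add: E11_def)
    then have zero: "\<zero>\<^bsub>A\<^esub> \<in> ?J" using I'.zero_closed by simp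
    have "subgroup ?J (add_monoid A)"
      by (rule R.add.subgroupI) (use zero neg I'.a_closed in \<open>auto simp: mult\<close>)
    then have "ideal ?J A" using J by (intro idealI R.ring_axioms) blast+
    moreover have "e \<in> ?J"
    proof -
      have "E11 \<one>\<^bsub>A\<^esub> \<otimes>\<^bsub>B\<^esub> e' \<in> Idl\<^bsub>B\<^esub> {e'}" by (rule I'.I_l_closed[OF mem(2) E11_closed]) simp
      moreover have "E11 \<one>\<^bsub>A\<^esub> \<otimes>\<^bsub>B\<^esub> e' = E11 e" using e by (simp add: E11_def e'_def \<epsilon>_def)
      ultimately show ?thesis using e by simp
    qed
    ultimately have "E11 (fst b) \<in> Idl\<^bsub>B\<^esub> {e'}" using R.genideal_minimal[of ?J "{e}"] that by blast
    moreover have "b \<otimes>\<^bsub>B\<^esub> \<epsilon> \<in> Idl\<^bsub>B\<^esub> {e'}" using \<epsilon>I b by (intro I'.I_l_closed)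
    ultimately have "E11 (fst b) \<oplus>\<^bsub>B\<^esub> b \<otimes>\<^bsub>B\<^esub> \<epsilon> \<in> Idl\<^bsub>B\<^esub> {e'}" by (intro I'.a_closed)
    moreover have "E11 (fst b) \<oplus>\<^bsub>B\<^esub> b \<otimes>\<^bsub>B\<^esub> \<epsilon> = b" using b by (auto simp: E11_def \<epsilon>_def)
    ultimately show ?thesis by simp
  qed
  moreover have "fst b \<in> Idl\<^bsub>A\<^esub> {e}" if "b \<in> Idl\<^bsub>B\<^esub> {e'}"
  proof -
    let ?J = "{b \<in> carrier B. fst b \<in> Idl\<^bsub>A\<^esub> {e}}"
    have J: "b \<otimes>\<^bsub>B\<^esub> b' \<in> ?J" "b' \<otimes>\<^bsub>B\<^esub> b \<in> ?J" if "b \<in> ?J" "b' \<in> carrier B" for b b'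
      using that I.I_l_closed I.I_r_closed P.\<pi>c[of b'] by (simp_all add: P.hmult del: B_simps)
    have neg: "\<ominus>\<^bsub>B\<^esub> b \<in> ?J" if "b \<in> ?J" for b
      using J(2)[OF that, of "\<ominus>\<^bsub>B\<^esub> \<one>\<^bsub>B\<^esub>"] that by (simp add: B.l_minus del: B_simps)
    have "fst \<zero>\<^bsub>B\<^esub> = \<zero>\<^bsub>A\<^esub>" by simp
    then have zero: "\<zero>\<^bsub>B\<^esub> \<in> ?J" using I.zero_closed B.zero_closed by simp
    have add: "b \<oplus>\<^bsub>B\<^esub> b' \<in> ?J" if "b \<in> ?J" "b' \<in> ?J" for b b'
      using that I.a_closed by (simp add: P.hadd del: B_simps)
    have "subgroup ?J (add_monoid B)"
      by (rule B.add.subgroupI) (use zero in blast, use zero in blast, use neg in blast, use add in blast)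
    then have "ideal ?J B" using J by (intro idealI ring_B) blast+
    moreover have "e' \<in> ?J" using e e' mem(1) by (simp add: e'_def E11_def \<epsilon>_def)
    ultimately show ?thesis using B.genideal_minimal[of ?J "{e'}"] that by blast
  qed
  ultimately show ?thesis unfolding e'_def by blast
qed

lemma fdalg_B: "fdalg K B"
  using fd_B by (rule fdalg.intro)

lemma num_quot:
  assumes e: "e \<in> carrier A"
  shows "num_summands B (fdalg.regular_quot B (E11 e \<oplus>\<^bsub>B\<^esub> \<epsilon>)) = num_summands A (regular_quot e)"
proof -
  let ?U = "pull fst (regular_quot e)" and ?e = "E11 e \<oplus>\<^bsub>B\<^esub> \<epsilon>"
  have sm: "same B fst ?U (regular_quot e)" by (rule same_pull)
  have U: "left_module B ?U" using ring_surj.same_left_module[OF proj_surj sm] regular_quot_module[OF e] by blast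
  have e': "?e \<in> carrier B" by (rule sum_closed[OF e])
  note l = regular_quot_proj[OF e]
  let ?q = "\<lambda>b. Idl\<^bsub>A\<^esub> {e} +>\<^bsub>A\<^esub> fst b"
  have q: "lin B (regular_module B) ?U ?q"
  proof (rule linI)
    fix b c assume "b \<in> carrier (regular_module B)" "c \<in> carrier (regular_module B)"
    then show "?q (b \<oplus>\<^bsub>regular_module B\<^esub> c) = ?q b \<oplus>\<^bsub>?U\<^esub> ?q c"
      using lin_add[OF l(1)] ring_surj.hadd[OF proj_surj] ring_surj.\<pi>c[OF proj_surj] by (simp del: B_simps)
  next
    fix a b assume "a \<in> carrier B" "b \<in> carrier (regular_module B)"
    then show "?q (a \<odot>\<^bsub>regular_module B\<^esub> b) = a \<odot>\<^bsub>?U\<^esub> ?q b"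
      using lin_smult[OF l(1)] ring_surj.hmult[OF proj_surj] ring_surj.\<pi>c[OF proj_surj] by (simp del: B_simps)
  qed (use lin_closed[OF l(1)] ring_surj.\<pi>c[OF proj_surj] in \<open>simp del: B_simps\<close>)
  have "num_summands B ?U = num_summands B (fdalg.regular_quot B ?e)"
  proof (rule fdalg.num_regular_quot[OF fdalg_B e' U q])
    show "?q ` carrier B = carrier ?U"
      using l(2) ring_surj.surj[OF proj_surj] by (simp add: image_image[symmetric, of _ fst] del: B_simps)
    show "?q b = \<zero>\<^bsub>?U\<^esub> \<longleftrightarrow> b \<in> Idl\<^bsub>B\<^esub> {?e}" if "b \<in> carrier B" for b
      using l(3)[OF ring_surj.\<pi>c[OF proj_surj that]] fst_in_ideal_iff[OF e that] by simp
  qed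
  then show ?thesis using ring_surj.same_num[OF proj_surj sm U] by simp
qed

text \<open>The product of \<open>\<epsilon>\<close> with \<open>(a, x, c)\<close> is
  \<open>(0, 0, c)\<close>, from which the conditions on \<open>\<epsilon>\<close> follow. Rigidity
  is carried from \<open>A\<close> to \<open>B\<close> by \<open>rig_change\<close>.\<close>

lemma new_vertex_B:
  assumes e: "e \<in> carrier A" and T: "rig A e T"
  shows "new_vertex K B \<epsilon> (E11 e) (pull fst T)"
proof (intro new_vertex.intro new_vertex_axioms.intro fdalg_B)
  let ?e = "E11 e \<oplus>\<^bsub>B\<^esub> \<epsilon>"
  have e': "?e \<in> carrier B" by (rule sum_closed[OF e])
  have f: "fst ?e = e" using e by (simp add: E11_def \<epsilon>_def)
  have "rig B ?e (pull fst T) \<longleftrightarrow> rig A (fst ?e) T"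
  proof (rule alg_surj.rig_change[OF alg_surj.intro[OF proj_surj] same_pull e'])
    fix E :: "('k, 'a \<times> 'm \<times> 'k) fdmod" and b x
    assume E: "E \<in> kmod B ?e" and b: "b \<in> carrier B" "fst b = \<zero>\<^bsub>A\<^esub>" and x: "x \<in> carrier E"
    interpret E: left_module B E using E by (rule kmod_module)
    have "?e \<odot>\<^bsub>E\<^esub> x = \<zero>\<^bsub>E\<^esub>" using E x by (simp add: kmod_def)
    then have "\<epsilon> \<odot>\<^bsub>E\<^esub> x = \<zero>\<^bsub>E\<^esub>" using E.smult_assoc1[OF \<epsilon>_closed e' x] \<epsilon>_absorb[OF e] E.smult_r_null[OF \<epsilon>_closed] by simp
    then show "b \<odot>\<^bsub>E\<^esub> x = \<zero>\<^bsub>E\<^esub>" using E.smult_assoc1[OF b(1) \<epsilon>_closed x] fst_kernel[OF b] E.smult_r_null[OF b(1)] by simp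
  qed
  then show "rig B ?e (pull fst T)" using T f by simp
  show "\<epsilon> \<otimes>\<^bsub>B\<^esub> b = \<epsilon> \<otimes>\<^bsub>B\<^esub> b \<otimes>\<^bsub>B\<^esub> \<epsilon>" "\<exists>c\<in>carrier K. \<epsilon> \<otimes>\<^bsub>B\<^esub> b \<otimes>\<^bsub>B\<^esub> \<epsilon> = c \<odot>\<^bsub>B\<^esub> \<epsilon>" if "b \<in> carrier B" for b
    using that by (auto simp: \<epsilon>_def)
  show "\<epsilon> \<notin> Idl\<^bsub>B\<^esub> {E11 e}" by (rule \<epsilon>_notin[OF e])
qed (use e in \<open>simp_all add: \<epsilon>_def E11_def\<close>)

lemma two_modules:
  assumes T: "support_tau_tilting K A T" "basic_module A T"
  obtains S N i1 i2 p1 p2 where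
    "support_tau_tilting K B (pull fst T)" "basic_module B (pull fst T)"
    "\<And>x. x \<in> carrier T \<Longrightarrow> \<epsilon> \<odot>\<^bsub>pull fst T\<^esub> x = \<zero>\<^bsub>T\<^esub>"
    "support_tau_tilting K B S" "basic_module B S"
    "N \<in> fgmod B" "indecomposable B N" "\<exists>y\<in>carrier N. \<epsilon> \<odot>\<^bsub>N\<^esub> y \<noteq> \<zero>\<^bsub>N\<^esub>"
    "biproduct B S (pull fst T) N i1 i2 p1 p2"
proof -
  obtain e where e: "e \<in> carrier A" "e \<otimes>\<^bsub>A\<^esub> e = e" "rig A e T" "num_summands A T = num_summands A (regular_quot e)"
    and Tf: "T \<in> fgmod A" using T(1) support_tau_tilting_iff by blast
  interpret V: new_vertex K B \<epsilon> "E11 e" "pull fst T" by (rule new_vertex_B[OF e(1,3)])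
  have sm: "same B fst (pull fst T) T" by (rule same_pull)
  have num: "num_summands B (pull fst T) = num_summands B (V.regular_quot V.e')"
    using num_quot[OF e(1)] e(4) ring_surj.same_num[OF proj_surj sm V.T(3)] by simp
  have basic: "basic_module B (pull fst T)" using ring_surj.same_basic[OF proj_surj sm V.T(3)] T(2) by simp
  have stt: "support_tau_tilting K B (pull fst T)"
    using V.support_tau_tilting_iff V.rigT V.T(1) num V.e'L sum_idem[OF e(1,2)] unfolding kmod_def by blast
  obtain S N i1 i2 p1 p2 where S: "S \<in> fgmod B" "rig B (E11 e) S"
    "num_summands B S = num_summands B (V.regular_quot (E11 e))" "basic_module B S"
    and N: "N \<in> fgmod B" "indecomposable B N" "\<exists>y\<in>carrier N. \<epsilon> \<odot>\<^bsub>N\<^esub> y \<noteq> \<zero>\<^bsub>N\<^esub>"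
    and b: "biproduct B S (pull fst T) N i1 i2 p1 p2"
    by (rule V.extension[OF num basic])
  have "support_tau_tilting K B S"
    using V.support_tau_tilting_iff S V.e0L E11_idem[OF e(1,2)] by blast
  moreover have "\<epsilon> \<odot>\<^bsub>pull fst T\<^esub> x = \<zero>\<^bsub>T\<^esub>" if "x \<in> carrier T" for x using V.\<epsilon>T[of x] that unfolding pull_simps .
  ultimately show ?thesis using that[OF stt basic _ _ S(4) N b] by blast
qed

end

section \<open>The injection between sets of isomorphism classes\<close>

lemma stau_tilt_classes:
  "stau_tilt K L = {M. support_tau_tilting K L M \<and> basic_module L M} //
     {(M, N). (support_tau_tilting K L M \<and> basic_module L M) \<and> (support_tau_tilting K L N \<and> basic_module L N) \<and> mod_iso L M N}"
  unfolding stau_tilt_def iso_classes_def by (rule arg_cong2[where f="(//)"]) auto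

text \<open>Pairs of a truth value and a class over \<open>A\<close> are sent injectively to classes
  over \<open>B\<close>; this proves the bound for infinite sets of classes as well.\<close>

theorem (in one_point) double_stau_tilt:
  "ctwo *c |stau_tilt K A| \<le>o |stau_tilt K B|"
proof -
  let ?SA = "{T. support_tau_tilting K A T \<and> basic_module A T}"
  let ?SB = "{T. support_tau_tilting K B T \<and> basic_module B T}"
  let ?rA = "{(M, N). M \<in> ?SA \<and> N \<in> ?SA \<and> mod_iso A M N}"
  let ?rB = "{(M, N). M \<in> ?SB \<and> N \<in> ?SB \<and> mod_iso B M N}"
  have cls: "stau_tilt K A = ?SA // ?rA" "stau_tilt K B = ?SB // ?rB"
    by (simp_all add: stau_tilt_classes)
  have mA: "left_module A T" if "T \<in> ?SA" for T
    using that by (auto simp: support_tau_tilting_def fgmod_def)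
  have mB: "left_module B T" if "T \<in> ?SB" for T
    using that by (auto simp: support_tau_tilting_def fgmod_def)
  \<comment> \<open>The decomposition of \<open>S\<close> is recorded along with it, since
    cancelling the new summand needs it.\<close>
  define good where "good T S \<longleftrightarrow> S \<in> ?SB \<and> (\<exists>N i1 i2 p1 p2. N \<in> fgmod B \<and> indecomposable B N \<and>
      (\<exists>y\<in>carrier N. \<epsilon> \<odot>\<^bsub>N\<^esub> y \<noteq> \<zero>\<^bsub>N\<^esub>) \<and> biproduct B S (pull fst T) N i1 i2 p1 p2)" for T S :: "('k, _) fdmod"
  have two: "pull fst T \<in> ?SB \<and> (\<forall>x\<in>carrier T. \<epsilon> \<odot>\<^bsub>pull fst T\<^esub> x = \<zero>\<^bsub>T\<^esub>) \<and> (\<exists>S. good T S)" if "T \<in> ?SA" for T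
  proof -
    have "support_tau_tilting K A T" "basic_module A T" using that by auto
    then show ?thesis
    proof (rule two_modules)
      fix S N i1 i2 p1 p2
      assume *: "support_tau_tilting K B (pull fst T)" "basic_module B (pull fst T)"
        "\<And>x. x \<in> carrier T \<Longrightarrow> \<epsilon> \<odot>\<^bsub>pull fst T\<^esub> x = \<zero>\<^bsub>T\<^esub>" "support_tau_tilting K B S" "basic_module B S"
        "N \<in> fgmod B" "indecomposable B N" "\<exists>y\<in>carrier N. \<epsilon> \<odot>\<^bsub>N\<^esub> y \<noteq> \<zero>\<^bsub>N\<^esub>" "biproduct B S (pull fst T) N i1 i2 p1 p2"
      have "\<exists>N i1 i2 p1 p2. N \<in> fgmod B \<and> indecomposable B N \<and>
          (\<exists>y\<in>carrier N. \<epsilon> \<odot>\<^bsub>N\<^esub> y \<noteq> \<zero>\<^bsub>N\<^esub>) \<and> biproduct B S (pull fst T) N i1 i2 p1 p2"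
        by (intro exI[of _ N] exI[of _ i1] exI[of _ i2] exI[of _ p1] exI[of _ p2] conjI *(6-9))
      then have "good T S" unfolding good_def using *(4,5) by blast
      then show ?thesis using *(1-3) by blast
    qed
  qed
  define ext where "ext T = (SOME S. good T S)" for T
  have ext: "good T (ext T)" if "T \<in> ?SA" for T
    unfolding ext_def using two[OF that] by (auto intro: someI_ex)
  define rep where "rep C = (SOME T. T \<in> C)" for C :: "('k, 'a) fdmod set"
  have cls_eq: "?rA `` {T} = ?rA `` {T'}" if T: "T \<in> ?SA" "T' \<in> ?SA" and i: "mod_iso A T T'" for T T'
  proof -
    have "mod_iso A T U \<longleftrightarrow> mod_iso A T' U" for U :: "('k, 'a) fdmod"
      using mod_iso_trans[OF mA[OF T(1)] mA[OF T(2)] i]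
        mod_iso_trans[OF mA[OF T(2)] mA[OF T(1)] mod_iso_sym[OF mA[OF T(1)] mA[OF T(2)] i]] by blast
    then show ?thesis using T by simp
  qed
  have refl: "(T, T) \<in> ?rA" if "T \<in> ?SA" for T using mod_iso_refl[OF mA[OF that]] that by simp
  have rep: "rep C \<in> ?SA" "C = ?rA `` {rep C}" if C: "C \<in> ?SA // ?rA" for C
  proof -
    obtain T where T: "T \<in> ?SA" "C = ?rA `` {T}" using C by (rule quotientE)
    have "T \<in> C" unfolding T(2) using refl[OF T(1)] by (rule ImageI) simp
    then have "rep C \<in> C" unfolding rep_def by (rule someI)
    then have R: "rep C \<in> ?SA" "mod_iso A T (rep C)" using T by auto
    then show "rep C \<in> ?SA" by simp
    show "C = ?rA `` {rep C}" unfolding T(2)[symmetric] using cls_eq[OF T(1) R] T(2) by simp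
  qed
  \<comment> \<open>The truth value selects between the module itself over \<open>B\<close> and its
    extension by a summand at the new vertex.\<close>
  define g where "g x = (if fst x then ext (rep (snd x)) else pull fst (rep (snd x)))" for x
  define f where "f x = ?rB `` {g x}" for x
  have gB: "g (b, C) \<in> ?SB" if "C \<in> ?SA // ?rA" for b C
    using two[OF rep(1)[OF that]] ext[OF rep(1)[OF that]] by (auto simp: g_def good_def)
  have eps: "\<exists>s\<in>carrier S. \<epsilon> \<odot>\<^bsub>S\<^esub> s \<noteq> \<zero>\<^bsub>S\<^esub>" if S: "good T S" and T: "T \<in> ?SA" for T S
  proof -
    obtain N i1 i2 p1 p2 y where N: "N \<in> fgmod B" "biproduct B S (pull fst T) N i1 i2 p1 p2"
      "y \<in> carrier N" "\<epsilon> \<odot>\<^bsub>N\<^esub> y \<noteq> \<zero>\<^bsub>N\<^esub>" using S by (auto simp: good_def)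
    note bp = biproductD[OF N(2)]
    have m: "left_module B S" "left_module B N" using S mB N(1) by (auto simp: good_def fgmod_def)
    have "\<epsilon> \<odot>\<^bsub>S\<^esub> i2 y \<noteq> \<zero>\<^bsub>S\<^esub>"
    proof
      assume "\<epsilon> \<odot>\<^bsub>S\<^esub> i2 y = \<zero>\<^bsub>S\<^esub>"
      then have "p2 (i2 (\<epsilon> \<odot>\<^bsub>N\<^esub> y)) = p2 \<zero>\<^bsub>S\<^esub>" using lin_smult[OF bp(2) \<epsilon>_closed N(3)] by simp
      then show False
        using bp(7)[OF left_module.smult_closed[OF m(2) \<epsilon>_closed N(3)]] lin_zero[OF m bp(4)] N(4) by simp
    qed
    then show ?thesis using lin_closed[OF bp(2) N(3)] by blast
  qed
  have diff: "\<not> mod_iso B (pull fst T) S" if T: "T \<in> ?SA" and T': "T' \<in> ?SA" and S: "good T' S" for T T' S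
  proof
    assume "mod_iso B (pull fst T) S"
    have m: "left_module B (pull fst T)" "left_module B S" using two[OF T] S mB by (auto simp: good_def)
    obtain h where h: "lin B (pull fst T) S h" "bij_betw h (carrier (pull fst T)) (carrier S)"
      using \<open>mod_iso B (pull fst T) S\<close> by (auto simp: mod_iso_iff[OF m(1)])
    obtain s where s: "s \<in> carrier S" "\<epsilon> \<odot>\<^bsub>S\<^esub> s \<noteq> \<zero>\<^bsub>S\<^esub>" using eps[OF S T'] by blast
    then obtain x where x: "x \<in> carrier T" "s = h x" using h(2) by (auto simp: bij_betw_def)
    have "\<epsilon> \<odot>\<^bsub>S\<^esub> s = h (\<epsilon> \<odot>\<^bsub>pull fst T\<^esub> x)" using lin_smult[OF h(1) \<epsilon>_closed, of x] x by simp
    also have "\<epsilon> \<odot>\<^bsub>pull fst T\<^esub> x = \<zero>\<^bsub>T\<^esub>" using two[OF T] x(1) by blast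
    finally show False using s(2) lin_zero[OF m h(1)] by simp
  qed
  have pull_inj: "mod_iso A T T'" if "mod_iso B (pull fst T) (pull fst T')" "T \<in> ?SA" for T T' :: "('k, 'a) fdmod"
    using that ring_surj.same_iso[OF proj_surj same_pull same_pull, of T T'] mB two[OF that(2)] by blast
  have good_inj: "mod_iso A T T'" if S: "good T S" "good T' S'" and i: "mod_iso B S S'" and T: "T \<in> ?SA" "T' \<in> ?SA" for T T' S S'
  proof (rule pull_inj[OF _ T(1)])
    obtain N i1 i2 p1 p2 where N: "N \<in> fgmod B" "indecomposable B N" "\<exists>y\<in>carrier N. \<epsilon> \<odot>\<^bsub>N\<^esub> y \<noteq> \<zero>\<^bsub>N\<^esub>"
      "biproduct B S (pull fst T) N i1 i2 p1 p2" using S(1) unfolding good_def by blast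
    obtain N' j1 j2 q1 q2 where N': "N' \<in> fgmod B" "indecomposable B N'" "\<exists>y\<in>carrier N'. \<epsilon> \<odot>\<^bsub>N'\<^esub> y \<noteq> \<zero>\<^bsub>N'\<^esub>"
      "biproduct B S' (pull fst T') N' j1 j2 q1 q2" using S(2) unfolding good_def by blast
    have m: "left_module B S" "left_module B S'" using S mB by (auto simp: good_def)
    show "mod_iso B (pull fst T) (pull fst T')"
    proof (rule cancel_new_vertex[OF _ _ _ _ m N(4) N'(4) _ _ N(2) N'(2) \<epsilon>_closed _ _ N(3) N'(3) i])
      show "left_module B (pull fst T)" "left_module B (pull fst T')" using two[OF T(1)] two[OF T(2)] mB by auto
      show "left_module B N" "left_module B N'" using N(1) N'(1) by (simp_all add: fgmod_def)
      show "fin_len B N" "fin_len B N'" using fdalg.fgm_fin_len[OF fdalg_B] N(1) N'(1) by (auto simp: fgmod_iff)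
    qed (use two[OF T(1)] two[OF T(2)] in auto)
  qed
  \<comment> \<open>The truth value is recovered from whether \<open>\<epsilon>\<close> acts as
    zero. The class is recovered by change of rings in one case and by cancellation in the
    other.\<close>
  have "inj_on f (UNIV \<times> ?SA // ?rA)"
  proof (rule inj_onI, clarify)
    fix b C b' C' assume C: "C \<in> ?SA // ?rA" "C' \<in> ?SA // ?rA" and eq: "f (b, C) = f (b', C')"
    note r = rep[OF C(1)] rep[OF C(2)]
    have "g (b', C') \<in> f (b', C')" using gB[OF C(2), of b'] mod_iso_refl[OF mB[OF gB[OF C(2), of b']]] by (simp add: f_def)
    then have iso: "mod_iso B (g (b, C)) (g (b', C'))" unfolding eq[symmetric] by (simp add: f_def)
    then have iso': "mod_iso B (g (b', C')) (g (b, C))" by (rule mod_iso_sym[OF mB[OF gB[OF C(1)]] mB[OF gB[OF C(2)]]])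
    have "b = b' \<and> mod_iso A (rep C) (rep C')"
      using iso iso' diff[OF r(1,3) ext[OF r(3)]] diff[OF r(3,1) ext[OF r(1)]] pull_inj[OF _ r(1)]
        good_inj[OF ext[OF r(1)] ext[OF r(3)] _ r(1,3)]
      by (cases b; cases b') (auto simp: g_def)
    moreover from this have "?rA `` {rep C} = ?rA `` {rep C'}"
      by (intro cls_eq[OF r(1,3)]) simp
    ultimately show "b = b' \<and> C = C'" using r by simp
  qed
  moreover have "f ` (UNIV \<times> ?SA // ?rA) \<subseteq> ?SB // ?rB"
  proof clarify
    fix b C assume "C \<in> ?SA // ?rA"
    then show "f (b, C) \<in> ?SB // ?rB" unfolding f_def by (intro quotientI gB)
  qed
  ultimately have "|(UNIV :: bool set) \<times> stau_tilt K A| \<le>o |stau_tilt K B|"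
    unfolding cls using card_of_ordLeq by blast
  then show ?thesis by (simp add: ctwo_def cprod_def Field_card_of)
qed

theorem corollary1p3:
  fixes K :: "'k ring" and A :: "('k, 'a) module" and M :: "('a, 'm) module"
  assumes "algebraically_closed K"
    and "fd_algebra K A" and "basic_algebra A" and "connected_algebra A"
    and "left_module A M" and "fin_gen A M"
    and "basic_algebra (one_point_extension K A M)"
    and "connected_algebra (one_point_extension K A M)"
  shows "ctwo *c |stau_tilt K A| \<le>o |stau_tilt K (one_point_extension K A M)|"
proof -
  interpret one_point K A M
    using assms(2,5,6) by (intro one_point.intro fdalg.intro one_point_axioms.intro)
  show ?thesis using double_stau_tilt by (simp only: B_def)
qed

end
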